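(* Let $f$ be the planar Bargmann-Fock field and, for $p\in\mathbb{R}$, let $\mathcal{D}_p=f^{-1}([-p,+\infty[)$. Then the probability that $\mathcal{D}_p$ has an unbounded connected component is $1$ if $p>0$, and $0$ otherwise. Moreover, if it exists, such a component is a.s. unique.
   Context: The planar Bargmann-Fock field is the random real-analytic function on $\mathbb{R}^2$ defined by $f(x)=e^{-\frac12|x|^2}\sum_{i,j\in\mathbb{N}}a_{i,j}\frac{x_1^i x_2^j}{\sqrt{i!\,j!}}$ for $x=(x_1,x_2)\in\mathbb{R}^2$, where $(a_{i,j})_{i,j\in\mathbb{N}}$ are independent centered Gaussian random variables of variance $1$ (the series converges a.s. in $C^\infty(\mathbb{R}^2)$). Equivalently, it is the a.s. continuous centered Gaussian field on $\mathbb{R}^2$ with covariance $\mathbb{E}[f(x)f(y)]=\exp(-\frac12|x-y|^2)$. Here $|\cdot|$ is the Euclidean norm. *)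

theory Defs
  imports "HOL-Probability.Probability"
begin

text \<open>The double series is taken as an unconditional sum over all pairs \<open>(i, j)\<close>. Almost surely it
  converges (absolutely) at every point of the plane; where it does not converge, \<^term>\<open>infsum\<close>
  has the value 0, which affects only a null set of \<open>\<omega>\<close>.\<close>

definition bargmann_fock :: "(nat \<Rightarrow> nat \<Rightarrow> 'w \<Rightarrow> real) \<Rightarrow> 'w \<Rightarrow> real ^ 2 \<Rightarrow> real" where
  "bargmann_fock a \<omega> x =
     exp (- (1 / 2) * (norm x)\<^sup>2) *
     (\<Sum>\<^sub>\<infinity>(i, j)\<in>UNIV. a i j \<omega> * ((x $ 1) ^ i * (x $ 2) ^ j / sqrt (fact i * fact j)))"

definition excursion_set :: "(real ^ 2 \<Rightarrow> real) \<Rightarrow> real \<Rightarrow> (real ^ 2) set" where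
  "excursion_set g p = g -` {- p..}"

definition unbounded_components :: "(real ^ 2) set \<Rightarrow> (real ^ 2) set set" where
  "unbounded_components D = {C \<in> components D. \<not> bounded C}"

end

theory Submission
  imports Defs
begin

text \<open>The field is a function \<open>fld z\<close> of independent standard normal coefficients \<open>z\<close>, and every
  percolation event is a level event \<open>l < \<Phi> (fld z)\<close> of a functional \<open>\<Phi>\<close> that is increasing and
  1-Lipschitz for the supremum norm. Far from a point the field is carried by other coefficients than
  near it, which gives quasi-independence at the cost of a small change of level, and hence a 0-1 law.

  At level 0 squares are self-dual, so they are crossed with probability at least \<open>1 / 2\<close>; by
  Tassion's form of the Russo-Seymour-Welsh theory there are infinitely many scales at which an
  annulus is not traversed with probability bounded below, and \<open>{f \<ge> 0}\<close> does not percolate.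

  Suppose that \<open>{f \<ge> - p}\<close> does not percolate for some \<open>p > 0\<close>. The largest level at which a big
  square is crossed is attained at a point from which a long arm starts, and long arms are unlikely.
  A Gaussian superconcentration inequality (hypercontractivity on the discrete cube and the central
  limit theorem) then shows that the variance of this level tends to 0. Its median is non-negative,
  so the square is crossed at any negative level above \<open>- p\<close> with probability close to 1. A
  renormalization with sprinkling makes the probabilities of dual arms summable over scales; this
  excludes the dual circuits that surround the origin when \<open>{f \<ge> - p}\<close> does not percolate.

  For \<open>p > 0\<close>, \<open>{f \<le> - p / 2}\<close> does not percolate either, so a connected subset of
  \<open>{f > - p / 2}\<close> surrounds any given disc; it meets, hence joins, any two unbounded components.\<close>

section \<open>Plane topology\<close>

text \<open>Every approximation used, be it truncation of the series, rounding to a grid or removal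
  of modes, moves the field by little in the supremum norm of a bounded set, so the functionals
  absorb it as a small shift of level. They have no atoms, hence strict and weak levels have equal
  probability and limits in the level are harmless. Such shifts make up for the infinite range of
  dependence. The assumption that \<open>{f \<ge> - p}\<close> does not percolate yields decay of
  arm probabilities without any rate. The variance bound is therefore arranged so that its
  parameters can be fixed one after the other, the arm probability last. In the same way the
  Russo-Seymour-Welsh argument gives no control on where the good scales lie; one of them suffices,
  since the renormalization can start from any large enough scale. The final contradiction only
  needs a total probability of dual arms below 1: it contradicts a percolation probability equal to
  0, and the zero-one law leaves nothing else.\<close>

definition pt :: "real => real => real ^ 2" where
 "pt x y = vector [x, y]"

lemma pt_nth [simp]: "pt x y $ 1 = x" "pt x y $ 2 = y"
 by (simp_all add: pt_def)

lemma vec2_eq_iff: "(x :: real ^ 2) = y \<longleftrightarrow> x $ 1 = y $ 1 \<and> x $ 2 = y $ 2"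
 by (simp add: vec_eq_iff forall_2)

lemma pt_collapse [simp]: "pt (x $ 1) (x $ 2) = x"
 by (simp add: vec2_eq_iff)

definition rect :: "real => real => real => real => (real ^ 2) set" where
 "rect a b c d = {x. a <= x $ 1 \<and> x $ 1 <= b \<and> c <= x $ 2 \<and> x $ 2 <= d}"

lemma rect_cbox: "rect a b c d = cbox (pt a c) (pt b d)"
 by (auto simp: rect_def mem_box_cart forall_2)

lemma compact_rect [simp, intro]: "compact (rect a b c d)"
 by (simp add: rect_cbox)

lemma closed_rect [simp, intro]: "closed (rect a b c d)"
 by (simp add: compact_imp_closed)

lemma bounded_rect [simp, intro]: "bounded (rect a b c d)"
 by (simp add: compact_imp_bounded)

lemma continuous_on_pt [continuous_intros]:
 assumes "continuous_on S f" "continuous_on S g"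
 shows "continuous_on S (%x. pt (f x) (g x))"
proof -
 have eq: "(%x. pt (f x) (g x)) = (%x. \<chi> i. if i = 1 then f x else g x)"
  by (auto simp: fun_eq_iff vec2_eq_iff)
 have "continuous_on S (%x. if i = (1::2) then f x else g x)" for i
  using assms by (cases "i = 1") auto
 then show ?thesis unfolding eq by (rule continuous_on_vec_lambda)
qed

section \<open>Crossings by connected sets\<close>

text \<open>Crossings are connected compact sets, whereas the Fashoda theorem is about paths. The
  \<open>e\<close>-neighbourhood of \<open>S\<close> is open and connected, hence path connected;
  the closest-point map onto the box is 1-Lipschitz and fixes \<open>S\<close>, so it brings the
  path into the box without leaving the neighbourhood.\<close>

lemma path_in_thickening:
 fixes S :: "'a::euclidean_space set"
 assumes "connected S" "x \<in> S" "y \<in> S" "S \<subseteq> cbox a b" "e > 0"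
 obtains p where "path p" "path_image p \<subseteq> cbox a b" "pathstart p = x" "pathfinish p = y"
  "!!z. z \<in> path_image p ==> \<exists>s\<in>S. dist s z < e"
proof -
 define U where "U = (%(s, v). s + v) ` (S \<times> ball 0 e)"
 have U: "z \<in> U \<longleftrightarrow> (\<exists>s\<in>S. dist s z < e)" for z
 proof -
  have "z \<in> U" if "s \<in> S" "dist s z < e" for s
   unfolding U_def using that by (intro image_eqI[of _ _ "(s, z - s)"]) (auto simp: dist_norm norm_minus_commute)
  moreover have "\<exists>s\<in>S. dist s z < e" if z: "z \<in> U"
  proof -
   obtain s v where "s \<in> S" "norm v < e" "z = s + v" using z by (auto simp: U_def)
   then show ?thesis by (intro bexI[of _ s]) (simp_all add: dist_norm)
  qed
  ultimately show ?thesis by blast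
 qed
 have "connected U"
  unfolding U_def using assms(1) convex_connected[OF convex_ball, of 0 e]
  by (intro connected_continuous_image connected_Times)
    (auto intro!: continuous_intros simp: case_prod_unfold)
 moreover have "U = (\<Union>s\<in>S. ball s e)"
  using U by auto
 hence "open U" by auto
 ultimately have "path_connected U"
  by (simp add: connected_open_path_connected)
 moreover have "x \<in> U" "y \<in> U" using assms U by force+
 ultimately obtain p where p: "path p" "path_image p \<subseteq> U" "pathstart p = x" "pathfinish p = y"
  unfolding path_connected_def by blast
 have ne: "cbox a b ~= {}" using assms by auto
 let ?q = "closest_point (cbox a b) \<circ> p"
 have q: "path ?q"
  using p(1) continuous_on_closest_point[of "cbox a b"] ne
  by (intro path_continuous_image) (auto intro: continuous_on_subset)
 have fixp: "closest_point (cbox a b) z = z" if "z \<in> S" for z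
  using that assms(4) by (intro closest_point_self) auto
 show ?thesis
 proof (rule that[OF q])
  show "path_image ?q \<subseteq> cbox a b"
   using ne by (auto simp: path_image_def intro!: closest_point_in_set)
  show "pathstart ?q = x" "pathfinish ?q = y"
   using p assms fixp by (auto simp: pathstart_compose pathfinish_compose)
  fix z assume "z \<in> path_image ?q"
  then obtain w where w: "w \<in> path_image p" "z = closest_point (cbox a b) w"
   by (auto simp: path_image_def)
  then obtain s where s: "s \<in> S" "dist s w < e" using p U by blast
  have "dist s z <= dist s w"
   using closest_point_lipschitz[of "cbox a b" s w] ne fixp[OF s(1)] w by (simp add: closed_cbox)
  then show "\<exists>s\<in>S. dist s z < e" using s by force
 qed
qed

text \<open>Disjoint compact sets have a positive distance \<open>e\<close>. Paths that stay within
  \<open>e/2\<close> of \<open>S\<close> and of \<open>T\<close> still cross by the Fashoda theorem,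
  and their common point contradicts this distance.\<close>

lemma rect_crossing:
 assumes S: "compact S" "connected S" "S \<subseteq> rect a b c d"
  and T: "compact T" "connected T" "T \<subseteq> rect a b c d"
  and s: "s1 \<in> S" "s1 $ 1 = a" "s2 \<in> S" "s2 $ 1 = b"
  and t: "t1 \<in> T" "t1 $ 2 = c" "t2 \<in> T" "t2 $ 2 = d"
 shows "S \<inter> T ~= {}"
proof
 assume "S \<inter> T = {}"
 then obtain e where e: "e > 0" "!!x y. x \<in> S ==> y \<in> T ==> e <= dist x y"
  using separate_compact_closed[of S T] S T by (auto simp: compact_imp_closed)
 obtain p where p: "path p" "path_image p \<subseteq> rect a b c d" "pathstart p = s1" "pathfinish p = s2"
  "!!z. z \<in> path_image p ==> \<exists>s\<in>S. dist s z < e/2"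
  using path_in_thickening[OF S(2) s(1) s(3), of "pt a c" "pt b d" "e/2"] S e by (auto simp: rect_cbox)
 obtain q where q: "path q" "path_image q \<subseteq> rect a b c d" "pathstart q = t1" "pathfinish q = t2"
  "!!z. z \<in> path_image q ==> \<exists>s\<in>T. dist s z < e/2"
  using path_in_thickening[OF T(2) t(1) t(3), of "pt a c" "pt b d" "e/2"] T e by (auto simp: rect_cbox)
 obtain z where "z \<in> path_image p" "z \<in> path_image q"
  using fashoda[OF p(1) q(1), of "pt a c" "pt b d"] p q s t by (auto simp: rect_cbox)
 then obtain x y where "x \<in> S" "y \<in> T" "dist x z < e/2" "dist y z < e/2"
  using p q by blast
 then show False
  using e(2)[of x y] dist_triangle_half_r[of z x e y] by (simp add: dist_commute)
qed

text \<open>\<open>S\<close> may leave the rectangle above and below, so vertical segments are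
  attached to its two ends and heights are clamped to \<open>[c - 1, d + 1]\<close>. Clamping fixes
  the rectangle of \<open>P\<close>, and the added segments lie outside it except for their end in
  \<open>S\<close>; hence a meeting point belongs to \<open>S\<close> itself.\<close>

lemma strip_crossing:
 assumes P: "compact P" "connected P" "P \<subseteq> rect a b c d"
  and p: "p1 \<in> P" "p1 $ 1 = a" "p2 \<in> P" "p2 $ 1 = b"
  and S: "compact S" "connected S" "!!x. x \<in> S ==> a <= x $ 1 \<and> x $ 1 <= b"
  and s: "s1 \<in> S" "s1 $ 2 <= c" "s2 \<in> S" "s2 $ 2 >= d"
 shows "P \<inter> S ~= {}"
proof -
 define L1 where "L1 = closed_segment s1 (pt (s1 $ 1) (c - 1))"
 define L2 where "L2 = closed_segment s2 (pt (s2 $ 1) (d + 1))"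
 define S' where "S' = L1 \<union> S \<union> L2"
 define k where "k = (%x::real^2. pt (x $ 1) (max (c - 1) (min (d + 1) (x $ 2))))"
 have cd: "c <= d" using P(3) p(1) by (auto simp: rect_def)
 have L1: "x $ 1 = s1 $ 1 \<and> (x = s1 \<or> x $ 2 < c)" if x: "x \<in> L1" for x
 proof -
  obtain u where u: "0 <= u" "u <= 1" "x = (1 - u) *\<^sub>R s1 + u *\<^sub>R pt (s1 $ 1) (c - 1)"
   using x by (auto simp: L1_def closed_segment_def)
  have "x $ 2 = (1 - u) * s1 $ 2 + u * (c - 1)" using u by simp
  moreover have "(1 - u) * s1 $ 2 <= (1 - u) * c" using u s by (intro mult_left_mono) auto
  ultimately have "x $ 2 <= c - u" by (simp add: algebra_simps)
  moreover have "x $ 1 = s1 $ 1" unfolding u(3) by (simp add: algebra_simps)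
  ultimately show ?thesis using u by (cases "u = 0") auto
 qed
 have L2: "x $ 1 = s2 $ 1 \<and> (x = s2 \<or> x $ 2 > d)" if x: "x \<in> L2" for x
 proof -
  obtain u where u: "0 <= u" "u <= 1" "x = (1 - u) *\<^sub>R s2 + u *\<^sub>R pt (s2 $ 1) (d + 1)"
   using x by (auto simp: L2_def closed_segment_def)
  have "x $ 2 = (1 - u) * s2 $ 2 + u * (d + 1)" using u by simp
  moreover have "(1 - u) * s2 $ 2 >= (1 - u) * d" using u s by (intro mult_left_mono) auto
  ultimately have "x $ 2 >= d + u" by (simp add: algebra_simps)
  moreover have "x $ 1 = s2 $ 1" unfolding u(3) by (simp add: algebra_simps)
  ultimately show ?thesis using u by (cases "u = 0") auto
 qed
 have con: "connected S'"
  unfolding S'_def L1_def L2_def using S s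
  by (intro connected_Un connected_segment) auto
 have com: "compact S'"
  unfolding S'_def L1_def L2_def using S by (intro compact_Un) auto
 have ck: "continuous_on X k" for X
  unfolding k_def by (intro continuous_intros)
 have "P \<inter> k ` S' ~= {}"
 proof (rule rect_crossing[of P a b "c - 1" "d + 1"])
  show "P \<subseteq> rect a b (c - 1) (d + 1)" using P(3) by (auto simp: rect_def)
  show "k ` S' \<subseteq> rect a b (c - 1) (d + 1)"
   using S(3) s cd by (auto simp: S'_def k_def rect_def dest!: L1 L2)
  show "k (pt (s1 $ 1) (c - 1)) \<in> k ` S'" by (auto simp: S'_def L1_def)
  show "k (pt (s2 $ 1) (d + 1)) \<in> k ` S'" by (auto simp: S'_def L2_def)
 qed (use P p con com ck cd in \<open>auto intro!: compact_continuous_image connected_continuous_image simp: k_def\<close>)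
 then obtain x where x: "x \<in> S'" "k x \<in> P" by blast
 then have "c <= k x $ 2" "k x $ 2 <= d" using P(3) by (auto simp: rect_def)
 then have "k x = x" using cd by (auto simp: k_def vec2_eq_iff max_def min_def split: if_splits)
 moreover have "x \<in> S"
  using x \<open>k x = x\<close> \<open>c <= k x $ 2\<close> \<open>k x $ 2 <= d\<close> s by (auto simp: S'_def dest!: L1 L2)
 ultimately show ?thesis using x by auto
qed

text \<open>Both sets are prolonged beyond the boundary line so that they become crossings of a rectangle.\<close>

lemma arc_crossing:
 fixes Y E :: "(real ^ 2) set"
 assumes Y: "compact Y" "connected Y" "!!x. x \<in> Y ==> a <= x $ 1 \<and> x $ 1 <= b"
  and y: "y1 \<in> Y" "y1 $ 1 = b" "y1 $ 2 >= h" "y2 \<in> Y" "y2 $ 1 = b" "y2 $ 2 <= g"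
  and E: "compact E" "connected E" "!!x. x \<in> E ==> x $ 1 <= b"
  and e: "e1 \<in> E" "e1 $ 1 <= a" "e2 \<in> E" "e2 $ 1 = b" "g <= e2 $ 2" "e2 $ 2 <= h"
 shows "E \<inter> Y ~= {}"
proof -
 define P where "P = E \<union> closed_segment e2 (pt (b + 1) (e2 $ 2))"
 have seg: "x $ 2 = e2 $ 2 \<and> b <= x $ 1 \<and> x $ 1 <= b + 1"
  if x: "x \<in> closed_segment e2 (pt (b + 1) (e2 $ 2))" for x
 proof -
  obtain u where u: "0 <= u" "u <= 1" "x = (1 - u) *\<^sub>R e2 + u *\<^sub>R pt (b + 1) (e2 $ 2)"
   using x by (auto simp: closed_segment_def)
  have "x $ 1 = b + u" unfolding u(3) using e by (simp add: algebra_simps)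
  moreover have "x $ 2 = e2 $ 2" unfolding u(3) by (simp add: algebra_simps)
  ultimately show ?thesis using u by auto
 qed
 have Pc: "compact P" "connected P"
  unfolding P_def using E e by (auto intro!: connected_Un)
 obtain e0 where e0: "e0 \<in> E" "!!x. x \<in> E ==> e0 $ 1 <= x $ 1"
 proof -
  have "continuous_on E (%x. x $ 1)" by (intro continuous_intros)
  then obtain z where "z \<in> E" "\<forall>x\<in>E. z $ 1 <= x $ 1"
   using continuous_attains_inf[OF E(1), of "%x. x $ 1"] e(1) by auto
  then show ?thesis by (intro that) auto
 qed
 have "bounded (P \<union> Y)" using Pc Y by (auto intro: compact_imp_bounded)
 then obtain B where B: "!!x. x \<in> P \<union> Y ==> norm x <= B" by (auto simp: bounded_iff)
 have B2: "\<bar>x $ 2\<bar> <= B" if "x \<in> P \<union> Y" for x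
  using B[OF that] component_le_norm_cart[of x 2] by linarith
 \<comment> \<open>Two hooks to the right of the line: from \<open>y1\<close> by \<open>1/2\<close>
   and then up, from \<open>y2\<close> by \<open>1/2\<close> and then down, past the height of
   everything. The segment added to \<open>E\<close> ends at abscissa \<open>b + 1\<close> and
   passes between the hooks.\<close>
 define S where "S = Y \<union> rect b (b + 1/2) (y1 $ 2) (y1 $ 2) \<union> rect (b + 1/2) (b + 1/2) (y1 $ 2) (B + 1)
   \<union> rect b (b + 1/2) (y2 $ 2) (y2 $ 2) \<union> rect (b + 1/2) (b + 1/2) (- B - 1) (y2 $ 2)"
 have rc: "connected (rect p q r s)" for p q r s
  by (simp add: rect_cbox convex_connected)
 have m: "y1 \<in> rect b (b + 1/2) (y1 $ 2) (y1 $ 2)" "y2 \<in> rect b (b + 1/2) (y2 $ 2) (y2 $ 2)"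
  "pt (b + 1/2) (y1 $ 2) \<in> rect b (b + 1/2) (y1 $ 2) (y1 $ 2)" "pt (b + 1/2) (y2 $ 2) \<in> rect b (b + 1/2) (y2 $ 2) (y2 $ 2)"
  "pt (b + 1/2) (y1 $ 2) \<in> rect (b + 1/2) (b + 1/2) (y1 $ 2) (B + 1)"
  "pt (b + 1/2) (y2 $ 2) \<in> rect (b + 1/2) (b + 1/2) (- B - 1) (y2 $ 2)"
  using B2[of y1] B2[of y2] y by (auto simp: rect_def)
 have Sc: "compact S" "connected S"
  unfolding S_def using Y y m rc
  by (auto intro!: compact_Un) (intro connected_Un; use m rc y in blast)
 have tops: "pt (b + 1/2) (B + 1) \<in> S" "pt (b + 1/2) (- B - 1) \<in> S"
  using B2[of y1] B2[of y2] y by (auto simp: S_def rect_def)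
 have "P \<inter> S ~= {}"
 proof (rule strip_crossing[of P "e0 $ 1" "b + 1" "- B - 1" "B + 1"])
  show "P \<subseteq> rect (e0 $ 1) (b + 1) (- B - 1) (B + 1)"
  proof
   fix x assume x: "x \<in> P"
   have "e0 $ 1 <= x $ 1 \<and> x $ 1 <= b + 1"
    using x e0 E(3)[of x] e(4) e0(2)[OF e(3)] seg[of x] by (fastforce simp: P_def)
   then show "x \<in> rect (e0 $ 1) (b + 1) (- B - 1) (B + 1)"
    using B2[of x] x by (auto simp: rect_def)
  qed
  show "e0 $ 1 <= x $ 1 \<and> x $ 1 <= b + 1" if "x \<in> S" for x
  proof -
   have "e0 $ 1 <= a" using e0(2)[OF e(1)] e by simp
   moreover have "a <= b" using Y(3)[OF y(1)] by simp
   ultimately show ?thesis using that Y(3)[of x] by (auto simp: S_def rect_def)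
  qed
  show "e0 \<in> P" "pt (b + 1) (e2 $ 2) \<in> P" using e0 by (auto simp: P_def)
  show "pt (b + 1/2) (- B - 1) \<in> S" "pt (b + 1/2) (B + 1) \<in> S" by (fact tops)+
 qed (use Pc Sc in auto)
 then obtain x where x: "x \<in> P" "x \<in> S" by blast
 \<comment> \<open>Boundary case of equal heights: both points have abscissa \<open>b\<close>, so
   \<open>e2\<close> is \<open>y1\<close> or \<open>y2\<close>.\<close>
 have e2: "e2 \<in> Y" if "e2 $ 2 = y1 $ 2 \<or> e2 $ 2 = y2 $ 2"
  using that y e by (metis vec2_eq_iff)
 show ?thesis
 proof (cases "x \<in> E")
  case True
  have "x \<in> Y"
   using x(2) E(3)[OF True] y vec2_eq_iff[of x y1] vec2_eq_iff[of x y2]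
   by (auto simp: S_def rect_def dest: antisym)
  then show ?thesis using True by blast
 next
  case False
  then have "x \<in> closed_segment e2 (pt (b + 1) (e2 $ 2))" using x by (simp add: P_def)
  note xseg = seg[OF this]
  note xs = conjunct1[OF xseg] conjunct1[OF conjunct2[OF xseg]]
  have "e2 \<in> Y"
  proof (cases "x \<in> Y")
   case True
   then have "x $ 1 <= b" using Y(3)[of x] by blast
   then have "x = e2" using xs e(4) unfolding vec2_eq_iff by linarith
   then show ?thesis using True by simp
  next
   case False
   then have "e2 $ 2 = y1 $ 2 \<or> e2 $ 2 = y2 $ 2"
    using x(2) xs y e by (auto simp: S_def rect_def)
   then show ?thesis by (rule e2)
  qed
  then show ?thesis using e by blast
 qed
qed

section \<open>Separation by clopen pieces and by levels of the distance\<close>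

text \<open>Boundary bumping. If the component \<open>S\<close> of \<open>x\<close> in
  \<open>C \<inter> Q\<close> missed the frontier of \<open>Q\<close>, the Sura-Bura theorem would
  give a relatively clopen set between \<open>S\<close> and the interior of \<open>Q\<close>; it
  would be clopen in \<open>C\<close> as well, against connectedness.\<close>

lemma bumping:
 fixes C :: "'a::euclidean_space set"
 assumes C: "closed C" "connected C" "x \<in> C" "x \<in> Q" and Q: "compact Q" and out: "\<not> C \<subseteq> interior Q"
 obtains S where "compact S" "connected S" "S \<subseteq> C \<inter> Q" "x \<in> S" "S \<inter> frontier Q ~= {}"
proof -
 define S where "S = connected_component_set (C \<inter> Q) x"
 have cpt: "compact (C \<inter> Q)" using C Q by (simp add: closed_Int_compact)
 have comp: "S \<in> components (C \<inter> Q)" using C by (auto simp: S_def components_def)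
 have S: "compact S" "connected S" "S \<subseteq> C \<inter> Q" "x \<in> S"
  using compact_components[OF cpt comp] in_components_connected[OF comp] in_components_subset[OF comp] C
  by (auto simp: S_def connected_component_refl)
 have "S \<inter> frontier Q ~= {}"
 proof
  assume e: "S \<inter> frontier Q = {}"
  then have "S \<subseteq> interior Q" using S Q by (auto simp: frontier_def compact_imp_closed)
  have "locally compact (C \<inter> Q)" using cpt by (intro closed_imp_locally_compact compact_imp_closed)
  from Sura_Bura_clopen_subset[OF this comp S(1) open_interior \<open>S \<subseteq> interior Q\<close>]
  obtain K where K: "openin (top_of_set (C \<inter> Q)) K" "compact K" "S \<subseteq> K" "K \<subseteq> interior Q" .
  obtain U where U: "open U" "K = C \<inter> Q \<inter> U" using K(1) by (auto simp: openin_open)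
  then have "K = C \<inter> (U \<inter> interior Q)" using K(4) interior_subset[of Q] by auto
  then have "openin (top_of_set C) K" using U(1) by (metis openin_open_Int open_Int open_interior)
  moreover have "closedin (top_of_set C) K"
   using K(2) U by (intro closed_subset) (auto simp: compact_imp_closed)
  ultimately have "K = {} \<or> K = C" using C(2) by (auto simp: connected_clopen)
  then show False using K S out by auto
 qed
 then show ?thesis by (rule that[OF S])
qed

text \<open>A level set of the distance need not be connected. A connected part that still separates
  is the frontier of a component \<open>E\<close> of the complement of the connected set
  \<open>O0\<close>: such frontiers are connected in Euclidean space, and this one lies in the
  frontier of \<open>O0\<close>, where the distance equals \<open>e\<close>.\<close>

lemma separating_level:
 fixes A :: "'a::euclidean_space set"
 assumes A0: "connected A0" "A0 ~= {}" "A0 \<subseteq> A" and B0: "connected B0" "B0 ~= {}"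
  and e: "e > 0" "!!b. b \<in> B0 ==> e <= infdist b A"
 obtains T where "closed T" "connected T" "!!x. x \<in> T ==> infdist x A = e"
  "!!S. connected S ==> S \<inter> A0 ~= {} ==> S \<inter> B0 ~= {} ==> S \<inter> T ~= {}"
proof -
 define U where "U = {x. infdist x A < e}"
 have ne: "A ~= {}" using A0 by auto
 have oU: "open U" unfolding U_def by (intro open_Collect_less continuous_intros)
 have AU: "A0 \<subseteq> U" using A0 e by (auto simp: U_def)
 obtain x0 where x0: "x0 \<in> A0" using A0 by auto
 define O0 where "O0 = connected_component_set U x0"
 have O0: "O0 \<in> components U" using x0 AU by (auto simp: O0_def components_def)
 have oO: "open O0" using O0 oU open_components by blast
 have cO: "connected O0" using O0 in_components_connected by blast
 have AO: "A0 \<subseteq> O0"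
  unfolding O0_def using A0 x0 AU by (intro connected_component_maximal) auto
 have BO: "B0 \<subseteq> - O0"
  using e in_components_subset[OF O0] by (force simp: U_def)
 obtain y0 where y0: "y0 \<in> B0" using B0 by auto
 define E where "E = connected_component_set (- O0) y0"
 have E: "E \<in> components (- O0)" using y0 BO by (auto simp: E_def components_def)
 have BE: "B0 \<subseteq> E"
  unfolding E_def using B0 y0 BO by (intro connected_component_maximal) auto
 \<comment> \<open>A frontier point inside the open set \<open>U\<close> would have its component of
   \<open>U\<close> meeting \<open>O0\<close>, hence equal to \<open>O0\<close>, which is
   open.\<close>
 have frU: "frontier O0 \<inter> U = {}"
 proof -
  have False if x: "x \<in> frontier O0" "x \<in> U" for x
  proof -
   have "connected_component_set U x \<in> components U" using x by (auto simp: components_def)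
   moreover have "open (connected_component_set U x)" using oU by (simp add: open_connected_component)
   moreover have "x \<in> connected_component_set U x" using x by (simp add: connected_component_refl)
   moreover have "x \<in> closure O0" using x(1) by (simp add: frontier_def)
   ultimately have "connected_component_set U x \<inter> closure O0 ~= {}" by blast
   then have "connected_component_set U x \<inter> O0 ~= {}"
    using open_Int_closure_eq_empty[OF \<open>open (connected_component_set U x)\<close>, of O0] by simp
   then have "connected_component_set U x = O0"
    using O0 \<open>connected_component_set U x \<in> components U\<close> components_nonoverlap by blast
   then have "x \<in> O0" using \<open>x \<in> connected_component_set U x\<close> by simp
   then show False using x(1) oO by (simp add: frontier_def interior_open)
  qed
  then show ?thesis by blast
 qed
 show ?thesis
 proof (rule that[of "frontier E"])
  show "closed (frontier E)" by simp
  show "connected (frontier E)"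
   using connected_frontier_component_complement[OF cO E] .
  fix x assume "x \<in> frontier E"
  then have x: "x \<in> frontier O0"
   using frontier_of_components_subset[OF E] by (auto simp: frontier_complement)
  have "O0 \<subseteq> {x. infdist x A <= e}" using in_components_subset[OF O0] by (auto simp: U_def)
  moreover have "closed {x. infdist x A <= e}" by (intro closed_Collect_le continuous_intros)
  ultimately have "closure O0 \<subseteq> {x. infdist x A <= e}" by (rule closure_minimal)
  then have "infdist x A <= e" using x by (auto simp: frontier_def)
  moreover have "x \<notin> U" using x frU by blast
  ultimately show "infdist x A = e" by (simp add: U_def)
 next
  fix S :: "'a set" assume S: "connected S" "S \<inter> A0 ~= {}" "S \<inter> B0 ~= {}"
  have "E \<inter> O0 = {}" using in_components_subset[OF E] by auto
  then show "S \<inter> frontier E ~= {}"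
   using S AO BE by (intro connected_Int_frontier) auto
 qed
qed

text \<open>Infinitely many of the components that meet \<open>B\<close> may accumulate. Sura-Bura
  gives each point of \<open>D \<inter> B\<close> a compact relatively clopen neighbourhood in
  \<open>D\<close>; finitely many cover, and their union can be kept at positive distance from the
  closed rest of \<open>D\<close>.\<close>

lemma bounded_components_compact_clopen:
 fixes D :: "'a::euclidean_space set"
 assumes D: "closed D" and B: "compact B"
  and bdd: "!!C. C \<in> components D ==> C \<inter> B ~= {} ==> bounded C"
 obtains K where "compact K" "K \<subseteq> D" "D \<inter> B \<subseteq> K" "closed (D - K)"
proof -
 have "\<exists>K. openin (top_of_set D) K \<and> compact K \<and> x \<in> K" if x: "x \<in> D \<inter> B" for x
 proof -
  let ?C = "connected_component_set D x"
  have C: "?C \<in> components D" "x \<in> ?C" using x by (auto simp: components_def connected_component_refl)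
  have "?C \<inter> B ~= {}" using x C(2) by blast
  then have "bounded ?C" by (rule bdd[OF C(1)])
  then have "compact ?C" using closed_components[OF D C(1)] by (simp add: compact_eq_bounded_closed)
  from Sura_Bura_clopen_subset[OF closed_imp_locally_compact[OF D] C(1) this open_UNIV subset_UNIV]
  obtain K where "openin (top_of_set D) K" "compact K" "?C \<subseteq> K" .
  then show ?thesis using C(2) by (intro exI[of _ K]) (simp add: subset_iff)
 qed
 then obtain K where K: "!!x. x \<in> D \<inter> B ==> openin (top_of_set D) (K x) \<and> compact (K x) \<and> x \<in> K x"
  by metis
 then have "\<exists>V. \<forall>x \<in> D \<inter> B. open (V x) \<and> K x = D \<inter> V x"
  unfolding openin_open by (intro bchoice[of "D \<inter> B" "%x v. open v \<and> K x = D \<inter> v", simplified]) auto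
 then obtain V where V: "!!x. x \<in> D \<inter> B ==> open (V x) \<and> K x = D \<inter> V x" by metis
 have "compact (D \<inter> B)" using D B by (simp add: closed_Int_compact)
 moreover have "D \<inter> B \<subseteq> (\<Union>x\<in>D \<inter> B. V x)" using K V by blast
 ultimately obtain F where F: "F \<subseteq> D \<inter> B" "finite F" "D \<inter> B \<subseteq> (\<Union>x\<in>F. V x)"
  using V by (elim compactE_image) auto
 show ?thesis
 proof (rule that[of "\<Union>x\<in>F. K x"])
  show "compact (\<Union>x\<in>F. K x)" using F K by (intro compact_UN) auto
  show "(\<Union>x\<in>F. K x) \<subseteq> D" using F V by auto
  show "D \<inter> B \<subseteq> (\<Union>x\<in>F. K x)" using F V by blast
  have "D - (\<Union>x\<in>F. K x) = D - (\<Union>x\<in>F. V x)" using F V by blast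
  moreover have "open (\<Union>x\<in>F. V x)" using F V by (intro open_UN) blast
  ultimately show "closed (D - (\<Union>x\<in>F. K x))" using D by (simp add: closed_Diff)
 qed
qed

text \<open>\<open>T\<close> is a connected part of the set at distance \<open>e\<close> from
  \<open>A\<close>, the ball together with the compact part \<open>K\<close> of \<open>D\<close>. As
  \<open>e\<close> is below the distance from \<open>A\<close> to the rest of \<open>D\<close>, it
  avoids \<open>D\<close> altogether; it separates the ball from the complement of a large
  ball.\<close>

lemma surrounding_set:
 fixes D :: "(real ^ 2) set"
 assumes D: "closed D" and bdd: "!!C. C \<in> components D ==> bounded C" and N: "N > 0"
 obtains T where "compact T" "connected T" "T \<inter> D = {}" "T \<inter> cball 0 N = {}"
  "!!S. connected S ==> S \<inter> cball 0 N ~= {} ==> \<not> bounded S ==> S \<inter> T ~= {}"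
proof -
 obtain K where K: "compact K" "K \<subseteq> D" "D \<inter> cball 0 N \<subseteq> K" "closed (D - K)"
  using bounded_components_compact_clopen[OF D compact_cball] bdd by blast
 define A where "A = cball 0 N \<union> K"
 have A: "compact A" "A ~= {}" "cball 0 N \<subseteq> A" using K N by (auto simp: A_def)
 have "A \<inter> (D - K) = {}" using K by (auto simp: A_def)
 then obtain d where d: "d > 0" "!!x y. x \<in> A ==> y \<in> D - K ==> d <= dist x y"
  using separate_compact_closed[OF A(1) K(4)] by blast
 define e where "e = min 1 (d / 2)"
 have e: "e > 0" "e < d" "e <= 1" using d by (auto simp: e_def)
 obtain R where R: "R > 0" "A \<subseteq> ball 0 R" using A(1) compact_imp_bounded bounded_subset_ballD by blast
 have far: "e <= infdist b A" if "b \<in> - ball 0 (R + 1)" for b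
 proof -
  have "infdist b A >= 1" unfolding infdist_notempty[OF A(2)]
  proof (rule cINF_greatest[OF A(2)])
   fix x assume "x \<in> A"
   then have "norm x < R" using R by auto
   then show "1 <= dist b x" using that norm_triangle_ineq2[of b x] by (auto simp: dist_norm)
  qed
  then show ?thesis using e by simp
 qed
 have conB: "connected (- ball (0::real^2) (R + 1))"
  by (intro connected_complement_bounded_convex) auto
 have neB: "- ball (0::real^2) (R + 1) ~= {}"
  by (metis Compl_empty_eq bounded_ball double_complement not_bounded_UNIV)
 obtain T where T: "closed T" "connected T" "!!x. x \<in> T ==> infdist x A = e"
  "!!S. connected S ==> S \<inter> cball 0 N ~= {} ==> S \<inter> - ball 0 (R + 1) ~= {} ==> S \<inter> T ~= {}"
  using separating_level[of "cball (0::real^2) N" A "- ball 0 (R + 1)" e] conB neB A N e(1) far by (auto simp: convex_connected)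
 have TA: "T \<inter> A = {}" using T(3) e by force
 have "T \<subseteq> ball 0 (R + 2)"
 proof
  fix x assume "x \<in> T"
  then have "infdist x A < 2" using T(3) e by force
  then obtain y where "y \<in> A" "dist x y < 2"
   using A(2) cInf_lessD[of "dist x ` A" 2] by (auto simp: infdist_notempty)
  moreover have "norm y < R" using R \<open>y \<in> A\<close> by auto
  ultimately show "x \<in> ball 0 (R + 2)" using norm_triangle_ineq2[of x y] by (auto simp: dist_norm)
 qed
 then have "compact T" using T(1) by (auto simp: compact_eq_bounded_closed intro: bounded_subset)
 moreover have "T \<inter> D = {}"
 proof -
  have False if x: "x \<in> T" "x \<in> D" for x
  proof -
   have "x \<in> D - K" using x TA by (auto simp: A_def)
   then have "d <= infdist x A" unfolding infdist_notempty[OF A(2)]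
    by (intro cINF_greatest[OF A(2)]) (use d in \<open>auto simp: dist_commute\<close>)
   then show False using T(3)[OF x(1)] e by simp
  qed
  then show ?thesis by blast
 qed
 moreover have "S \<inter> T ~= {}" if "connected S" "S \<inter> cball 0 N ~= {}" "\<not> bounded S" for S
 proof (rule T(4)[OF that(1,2)])
  show "S \<inter> - ball 0 (R + 1) ~= {}" using that(3) bounded_subset[OF bounded_ball, of S 0 "R + 1"] by auto
 qed
 moreover have "T \<inter> cball 0 N = {}" using TA A by blast
 ultimately show ?thesis using that[of T] T(2) by blast
qed

section \<open>Duality in a rectangle\<close>

text \<open>No component of \<open>K\<close> that meets \<open>A\<close> reaches \<open>B\<close>,
  so Sura-Bura gives it a relatively clopen neighbourhood away from \<open>B\<close>; compactness of
  \<open>K \<inter> A\<close> leaves finitely many of these.\<close>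

lemma compact_separate_components:
 fixes K :: "'a::euclidean_space set"
 assumes K: "compact K" and A: "closed A" and B: "closed B"
  and no: "!!C. connected C ==> compact C ==> C \<subseteq> K ==> C \<inter> A ~= {} ==> C \<inter> B = {}"
 obtains K1 K2 where "compact K1" "compact K2" "K1 \<union> K2 = K" "K1 \<inter> K2 = {}" "K \<inter> A \<subseteq> K1" "K1 \<inter> B = {}"
proof -
 define D where "D = K \<inter> - B"
 have lc: "locally compact K" using K by (intro closed_imp_locally_compact compact_imp_closed)
 have "\<exists>V. open V \<and> compact (K \<inter> V) \<and> x \<in> V \<and> K \<inter> V \<inter> B = {}" if x: "x \<in> K \<inter> A" for x
 proof -
  let ?C = "connected_component_set K x"
  have C: "?C \<in> components K" "x \<in> ?C" using x by (auto simp: components_def connected_component_refl)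
  have cC: "compact ?C" using compact_components[OF K C(1)] .
  have "?C \<inter> A ~= {}" using C(2) x by blast
  then have "?C \<inter> B = {}"
   using cC in_components_connected[OF C(1)] in_components_subset[OF C(1)] by (intro no)
  then have sub: "?C \<subseteq> - B" by blast
  from Sura_Bura_clopen_subset[OF lc C(1) cC open_Compl[OF B] sub]
  obtain L where L: "openin (top_of_set K) L" "compact L" "?C \<subseteq> L" "L \<subseteq> - B" .
  obtain V where V: "open V" "L = K \<inter> V" using L(1) by (auto simp: openin_open)
  have "x \<in> V" using L(3) C(2) V(2) by blast
  then show ?thesis using V L by (intro exI[of _ V]) auto
 qed
 then obtain V where V: "!!x. x \<in> K \<inter> A ==> open (V x) \<and> compact (K \<inter> V x) \<and> x \<in> V x \<and> K \<inter> V x \<inter> B = {}"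
  by metis
 have "compact (K \<inter> A)" using K A by (simp add: compact_Int_closed)
 moreover have "K \<inter> A \<subseteq> (\<Union>x\<in>K \<inter> A. V x)" using V by blast
 moreover have "open (V x)" if "x \<in> K \<inter> A" for x using V that by blast
 ultimately obtain F where F: "F \<subseteq> K \<inter> A" "finite F" "K \<inter> A \<subseteq> (\<Union>x\<in>F. V x)"
  using compactE_image[of "K \<inter> A" "K \<inter> A" V] by metis
 define W where "W = (\<Union>x\<in>F. V x)"
 have "open W" unfolding W_def using F V by (intro open_UN) blast
 have "K \<inter> W = (\<Union>x\<in>F. K \<inter> V x)" by (auto simp: W_def)
 moreover have "compact (\<Union>x\<in>F. K \<inter> V x)" using F V by (intro compact_UN) blast+
 ultimately have "compact (K \<inter> W)" by simp
 moreover have "compact (K - W)" using K \<open>open W\<close> by (rule compact_diff)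
 moreover have "K \<inter> W \<inter> B = {}" using F V by (fastforce simp: W_def)
 ultimately show ?thesis using F(3) by (intro that[of "K \<inter> W" "K - W"]) (auto simp: W_def)
qed

text \<open>The obstacle is extended vertically to the whole strip, separated there from the left half
  plane, and the separating set is pushed back into the rectangle.\<close>

lemma rect_duality:
 fixes f :: "real ^ 2 => real"
 assumes f: "continuous_on (rect a b c d) f" and ab: "a < b" "c <= d"
  and no: "!!C. connected C ==> compact C ==> C \<subseteq> rect a b c d ==> (!!x. x \<in> C ==> f x >= l) ==>
   C \<inter> {x. x $ 1 = a} ~= {} ==> C \<inter> {x. x $ 1 = b} ~= {} ==> False"
 obtains T where "compact T" "connected T" "T \<subseteq> rect a b c d" "!!x. x \<in> T ==> f x <= l"
  "T \<inter> {x. x $ 2 = c} ~= {}" "T \<inter> {x. x $ 2 = d} ~= {}"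
proof -
 define R where "R = rect a b c d"
 define K where "K = {x \<in> R. l <= f x}"
 have K: "compact K"
 proof -
  have "K = R \<inter> f -` {l..}" by (auto simp: K_def)
  moreover have "closed (R \<inter> f -` {l..})"
   using f by (intro continuous_closed_preimage) (auto simp: R_def)
  ultimately show ?thesis by (metis compact_Int_closed compact_rect R_def Int_absorb1 inf.cobounded1 inf_commute)
 qed
 have cl: "closed {x::real^2. x $ 1 = t}" for t by (intro closed_Collect_eq continuous_intros)
 have no': "C \<inter> {x. x $ 1 = b} = {}"
  if C: "connected C" "compact C" "C \<subseteq> K" "C \<inter> {x. x $ 1 = a} ~= {}" for C
 proof (rule ccontr)
  assume "C \<inter> {x. x $ 1 = b} ~= {}"
  then show False using no[of C] C by (auto simp: K_def R_def)
 qed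
 obtain K1 K2 where K12: "compact K1" "compact K2" "K1 \<union> K2 = K" "K1 \<inter> K2 = {}"
  "K \<inter> {x. x $ 1 = a} \<subseteq> K1" "K1 \<inter> {x. x $ 1 = b} = {}"
  by (rule compact_separate_components[OF K cl[of a] cl[of b] no'])
 define k where "k = (%x::real^2. pt (x $ 1) (max c (min d (x $ 2))))"
 have kdist: "dist (k x) (k y) <= dist x y" for x y
 proof -
  have "\<bar>max c (min d (x $ 2)) - max c (min d (y $ 2))\<bar> <= \<bar>x $ 2 - y $ 2\<bar>" by (auto simp: max_def min_def)
  then have "(max c (min d (x $ 2)) - max c (min d (y $ 2)))\<^sup>2 <= (x $ 2 - y $ 2)\<^sup>2"
   by (simp add: abs_le_square_iff)
  then show ?thesis
   by (simp add: k_def dist_vec_def L2_set_def sum_2 dist_real_def real_sqrt_le_mono)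
 qed
 have hdist: "\<bar>x $ 1 - y $ 1\<bar> <= dist x y" for x y :: "real^2"
  using component_le_norm_cart[of "x - y" 1] by (simp add: dist_norm)
 have ck: "continuous_on X k" for X unfolding k_def by (intro continuous_intros)
 have kR: "k x \<in> R" if "a <= x $ 1" "x $ 1 <= b" for x using that ab by (auto simp: k_def R_def rect_def)
 obtain e1 where e1: "e1 > 0" "!!x y. x \<in> K1 ==> y \<in> K2 ==> e1 <= dist x y"
  using separate_compact_closed[OF K12(1), of K2] K12 by (auto simp: compact_imp_closed)
 obtain e2 where e2: "e2 > 0" "!!x. x \<in> K1 ==> x $ 1 <= b - e2"
 proof -
  have "closed {x::real^2. x $ 1 = b}" by (rule cl)
  then obtain e where e: "e > 0" "!!x y. x \<in> K1 ==> y \<in> {x. x $ 1 = b} ==> e <= dist x y"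
   using separate_compact_closed[OF K12(1), of "{x. x $ 1 = b}"] K12(6) by auto
  show ?thesis
  proof (rule that[OF e(1)])
   fix x assume x: "x \<in> K1"
   then have "x $ 1 <= b" using K12(3) by (auto simp: K_def R_def rect_def)
   moreover have "dist x (pt b (x $ 2)) = \<bar>x $ 1 - b\<bar>"
    by (simp add: dist_vec_def L2_set_def sum_2 dist_real_def)
   ultimately show "x $ 1 <= b - e" using e(2)[OF x, of "pt b (x $ 2)"] by simp
  qed
 qed
 obtain e3 where e3: "e3 > 0" "!!x. x \<in> K2 ==> a + e3 <= x $ 1"
 proof -
  have "K2 \<inter> {x. x $ 1 = a} = {}" using K12 by blast
  then obtain e where e: "e > 0" "!!x y. x \<in> K2 ==> y \<in> {x. x $ 1 = a} ==> e <= dist x y"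
   using separate_compact_closed[OF K12(2) cl[of a]] by auto
  show ?thesis
  proof (rule that[OF e(1)])
   fix x assume x: "x \<in> K2"
   then have "a <= x $ 1" using K12(3) by (auto simp: K_def R_def rect_def)
   moreover have "dist x (pt a (x $ 2)) = \<bar>x $ 1 - a\<bar>"
    by (simp add: dist_vec_def L2_set_def sum_2 dist_real_def)
   ultimately show "a + e <= x $ 1" using e(2)[OF x, of "pt a (x $ 2)"] by simp
  qed
 qed
 \<comment> \<open>Below all relevant gaps: between \<open>K1\<close> and \<open>K2\<close>, from
   \<open>K1\<close> to the right side, from \<open>K2\<close> to the left side, and the width. A
   point at distance exactly \<open>e\<close> from \<open>A\<close> is then strictly inside the
   strip and is clamped to a point outside \<open>K\<close>.\<close>
 define e where "e = min (min e1 e2) (min e3 (b - a)) / 2"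
 have e: "e > 0" "e < e1" "e < e2" "e < e3" "e < b - a"
  using e1 e2 e3 ab by (auto simp: e_def)
 define H where "H = {x::real^2. x $ 1 <= a}"
 define A where "A = H \<union> {x. a <= x $ 1 \<and> x $ 1 <= b \<and> k x \<in> K1}"
 have H0: "pt a 0 \<in> H" by (simp add: H_def)
 have Ane: "A ~= {}" using H0 by (auto simp: A_def)
 have farA: "e <= infdist y A" if y: "y $ 1 >= b \<or> (a <= y $ 1 \<and> y $ 1 <= b \<and> k y \<in> K2)" for y
  unfolding infdist_notempty[OF Ane]
 proof (rule cINF_greatest[OF Ane])
  fix x assume x: "x \<in> A"
  have "k x $ 1 = x $ 1" "k y $ 1 = y $ 1" by (auto simp: k_def)
  then show "e <= dist y x"
   using x y hdist[of y x] e2(2)[of "k x"] e3(2)[of "k y"] e1(2)[of "k x" "k y"] kdist[of x y] e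
   by (auto simp: A_def H_def dist_commute)
 qed
 have conv: "connected H" "connected {x::real^2. b <= x $ 1}"
 proof -
  have "H = {x. inner (axis 1 1) x <= a}" "{x::real^2. b <= x $ 1} = {x. b <= inner (axis 1 1) x}"
   by (auto simp: H_def inner_axis inner_commute)
  then show "connected H" "connected {x::real^2. b <= x $ 1}"
   using convex_halfspace_le[of "axis 1 1 :: real^2" a] convex_halfspace_ge[of b "axis 1 1 :: real^2"]
   by (auto intro: convex_connected)
 qed
 have ne2: "{x::real^2. b <= x $ 1} ~= {}" by (auto intro!: exI[of _ "pt b 0"])
 have ne1: "H ~= {}" "H \<subseteq> A" using H0 by (auto simp: A_def)
 have far2: "e <= infdist y A" if "y \<in> {x::real^2. b <= x $ 1}" for y using farA that by auto
 obtain T where T: "closed T" "connected T" "!!x. x \<in> T ==> infdist x A = e"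
  "!!S. connected S ==> S \<inter> H ~= {} ==> S \<inter> {x. b <= x $ 1} ~= {} ==> S \<inter> T ~= {}"
  using separating_level[OF conv(1) ne1 conv(2) ne2 e(1) far2] by metis
 have Tx: "a < x $ 1 \<and> x $ 1 < b \<and> k x \<notin> K" if x: "x \<in> T" for x
 proof -
  have nA: "x \<notin> A" using T(3)[OF x] e by force
  then have 1: "a < x $ 1" by (auto simp: A_def H_def)
  have 2: "x $ 1 < b"
  proof (rule ccontr)
   assume "\<not> x $ 1 < b"
   have le: "b - a <= dist x y \<or> e2 <= dist x y" if "y \<in> A" for y
   proof -
    have "k y $ 1 = y $ 1" by (simp add: k_def)
    then show ?thesis using that hdist[of x y] e2(2)[of "k y"] \<open>\<not> x $ 1 < b\<close> by (auto simp: A_def H_def)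
   qed
   have "min (b - a) e2 <= infdist x A" unfolding infdist_notempty[OF Ane]
    by (rule cINF_greatest[OF Ane]) (use le in force)
   then show False using T(3)[OF x] e by auto
  qed
  have 3: "k x \<notin> K2"
  proof
   assume kx: "k x \<in> K2"
   have le: "min e3 e1 <= dist x y" if "y \<in> A" for y
   proof -
    have "k y $ 1 = y $ 1" "k x $ 1 = x $ 1" by (simp_all add: k_def)
    then show ?thesis
     using that hdist[of x y] e3(2)[OF kx] e1(2)[OF _ kx, of "k y"] kdist[of y x]
     by (auto simp: A_def H_def dist_commute)
   qed
   have "min e3 e1 <= infdist x A" unfolding infdist_notempty[OF Ane]
    by (rule cINF_greatest[OF Ane]) (use le in force)
   then show False using T(3)[OF x] e by auto
  qed
  have "k x \<notin> K1" using nA 1 2 by (auto simp: A_def)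
  then show ?thesis using 1 2 3 K12(3) by blast
 qed
 have kT: "k ` T \<subseteq> {x \<in> R. f x <= l}"
  using Tx kR by (force simp: K_def)
 have cR: "closed {x \<in> R. f x <= l}"
 proof -
  have "closed (R \<inter> f -` {..l})"
   using f by (intro continuous_closed_preimage) (auto simp: R_def)
  moreover have "R \<inter> f -` {..l} = {x \<in> R. f x <= l}" by auto
  ultimately show ?thesis by simp
 qed
 have clk: "closure (k ` T) \<subseteq> {x \<in> R. f x <= l}" using kT cR by (rule closure_minimal)
 \<comment> \<open>The horizontal segment at height \<open>t\<close> joins the two half planes, so
   \<open>T\<close> meets it.\<close>
 have hit: "k ` T \<inter> {x. x $ 2 = t} ~= {}" if t: "t = c \<or> t = d" for t
 proof -
  have "rect a b t t \<inter> T ~= {}"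
  proof (rule T(4))
   show "connected (rect a b t t)" by (simp add: rect_cbox convex_connected)
   have "pt a t \<in> rect a b t t \<inter> H" "pt b t \<in> rect a b t t \<inter> {x. b <= x $ 1}"
    using ab by (auto simp: rect_def H_def)
   then show "rect a b t t \<inter> H ~= {}" "rect a b t t \<inter> {x. b <= x $ 1} ~= {}" by blast+
  qed
  then obtain x where "x \<in> T" "x \<in> rect a b t t" by blast
  then have "x \<in> T" "x $ 2 = t" by (auto simp: rect_def)
  then have "k x \<in> k ` T" "k x $ 2 = t" using t ab by (auto simp: k_def)
  then show ?thesis by blast
 qed
 \<comment> \<open>\<open>T\<close> may be unbounded in the vertical direction, so its image under
   \<open>k\<close> need not be closed.\<close>
 show ?thesis
 proof (rule that[of "closure (k ` T)"])
  have "k ` T \<subseteq> rect a b c d" using kT by (auto simp: R_def)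
  then have "bounded (k ` T)" by (rule bounded_subset[OF bounded_rect])
  then show "compact (closure (k ` T))" by simp
  show "connected (closure (k ` T))"
   using T(2) ck by (intro connected_imp_connected_closure connected_continuous_image)
  show "closure (k ` T) \<subseteq> rect a b c d" "!!x. x \<in> closure (k ` T) ==> f x <= l"
   using clk by (auto simp: R_def)
  show "closure (k ` T) \<inter> {x. x $ 2 = c} ~= {}" "closure (k ` T) \<inter> {x. x $ 2 = d} ~= {}"
   using hit[of c] hit[of d] closure_subset[of "k ` T"] by blast+
 qed
qed

section \<open>The field and increasing threshold functionals\<close>

text \<open>Compact connected sets rather than paths: this is the form in which the duality above
  yields blocking sets.\<close>

definition conn :: "(real ^ 2) set => (real ^ 2) set => (real ^ 2) set => (real ^ 2) set set" where
 "conn K A B = {S. compact S \<and> connected S \<and> S \<subseteq> K \<and> S \<inter> A ~= {} \<and> S \<inter> B ~= {}}"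

text \<open>Bottleneck value: the supremum over the members of the infimum of \<open>g\<close>. For
  compact members and continuous \<open>g\<close>, \<open>l < thr \<C> g\<close> holds exactly when
  some member lies in \<open>{g > l}\<close>.\<close>

definition thr :: "'a set set => ('a => real) => real" where
 "thr \<C> g = Sup {l. \<exists>S\<in>\<C>. \<forall>x\<in>S. l <= g x}"

text \<open>Makes the supremum in \<open>thr\<close> one over a nonempty set that is bounded above
  whenever \<open>g\<close> is bounded on \<open>K\<close>.\<close>

definition fam :: "'a set => 'a set set => bool" where
 "fam K \<C> \<longleftrightarrow> \<C> ~= {} \<and> (\<forall>S\<in>\<C>. S ~= {} \<and> S \<subseteq> K)"

text \<open>Monotonicity and the 1-Lipschitz property for the supremum norm on \<open>K\<close> in one condition.\<close>

definition incr :: "'a set => (('a => real) => real) => bool" where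
 "incr K \<Phi> \<longleftrightarrow> (\<forall>g h c. bounded (g ` K) \<longrightarrow> bounded (h ` K) \<longrightarrow> (\<forall>x\<in>K. g x <= h x + c) \<longrightarrow> \<Phi> g <= \<Phi> h + c)"

lemma incrD: "incr K \<Phi> ==> bounded (g ` K) ==> bounded (h ` K) ==> (!!x. x \<in> K ==> g x <= h x + c) ==> \<Phi> g <= \<Phi> h + c"
 unfolding incr_def by blast

lemma incr_abs:
 assumes "incr K \<Phi>" "bounded (g ` K)" "bounded (h ` K)" "!!x. x \<in> K ==> \<bar>g x - h x\<bar> <= c"
 shows "\<bar>\<Phi> g - \<Phi> h\<bar> <= c"
proof -
 have "\<Phi> g <= \<Phi> h + c" by (rule incrD[OF assms(1-3)]) (use assms(4) in fastforce)
 moreover have "\<Phi> h <= \<Phi> g + c" by (rule incrD[OF assms(1) assms(3,2)]) (use assms(4) in fastforce)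
 ultimately show ?thesis by linarith
qed

lemma incr_cong:
 assumes "incr K \<Phi>" "bounded (g ` K)" "bounded (h ` K)" "!!x. x \<in> K ==> g x = h x"
 shows "\<Phi> g = \<Phi> h"
 using incr_abs[OF assms(1-3), of 0] assms(4) by simp

lemma incr_min: "incr K \<Phi> ==> incr K \<Psi> ==> incr K (%g. min (\<Phi> g) (\<Psi> g))"
 unfolding incr_def by (smt (verit))

lemma incr_max: "incr K \<Phi> ==> incr K \<Psi> ==> incr K (%g. max (\<Phi> g) (\<Psi> g))"
 unfolding incr_def by (smt (verit))

lemma incr_subset: "incr K \<Phi> ==> K \<subseteq> L ==> incr L \<Phi>"
 unfolding incr_def by (meson bounded_subset image_mono subsetD)

lemma incr_compose: "incr K \<Phi> ==> incr (T ` K) (%g. \<Phi> (g \<circ> T))"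
 unfolding incr_def by (auto simp: image_comp)

lemma thr_set:
 fixes g :: "'a => real"
 assumes "fam K \<C>" "bounded (g ` K)"
 shows "{l. \<exists>S\<in>\<C>. \<forall>x\<in>S. l <= g x} ~= {}" "bdd_above {l. \<exists>S\<in>\<C>. \<forall>x\<in>S. l <= g x}"
proof -
 obtain B where B: "!!x. x \<in> K ==> \<bar>g x\<bar> <= B" using assms(2) by (auto simp: bounded_iff)
 obtain S where S: "S \<in> \<C>" "S \<subseteq> K" using assms(1) by (auto simp: fam_def)
 have "- B <= g x" if "x \<in> S" for x using B[of x] that S by (auto simp: abs_le_iff)
 then show "{l. \<exists>S\<in>\<C>. \<forall>x\<in>S. l <= g x} ~= {}" using S by blast
 have "l <= B" if l: "T \<in> \<C>" "\<forall>x\<in>T. l <= g x" for l T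
 proof -
  obtain x where "x \<in> T" "x \<in> K" using assms(1) l(1) by (auto simp: fam_def)
  then show ?thesis using B[of x] l(2) by fastforce
 qed
 then show "bdd_above {l. \<exists>S\<in>\<C>. \<forall>x\<in>S. l <= g x}" by (intro bdd_aboveI) blast
qed

lemma thr_gt_iff:
 assumes "fam K \<C>" "bounded (g ` K)"
 shows "l < thr \<C> g \<longleftrightarrow> (\<exists>l'>l. \<exists>S\<in>\<C>. \<forall>x\<in>S. l' <= g x)"
 unfolding thr_def using less_cSup_iff[OF thr_set[OF assms]] by auto

lemma thr_ge:
 assumes "fam K \<C>" "bounded (g ` K)" "S \<in> \<C>" "!!x. x \<in> S ==> l <= g x"
 shows "l <= thr \<C> g"
 unfolding thr_def by (rule cSup_upper) (use thr_set[OF assms(1,2)] assms(3,4) in auto)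

lemma incr_thr:
 assumes "fam K \<C>"
 shows "incr K (thr \<C>)"
 unfolding incr_def
proof (intro allI impI)
 fix g h :: "'a => real" and c
 assume b: "bounded (g ` K)" "bounded (h ` K)" and le: "\<forall>x\<in>K. g x <= h x + c"
 show "thr \<C> g <= thr \<C> h + c"
 proof (rule dense_le)
  fix l assume "l < thr \<C> g"
  then obtain l' S where S: "l' > l" "S \<in> \<C>" "\<forall>x\<in>S. l' <= g x"
   using thr_gt_iff[OF assms b(1)] by blast
  have "l' - c <= h x" if "x \<in> S" for x
  proof -
   have "x \<in> K" using assms S(2) that by (auto simp: fam_def)
   then show ?thesis using le S(3) that by force
  qed
  then have "l' - c <= thr \<C> h" by (rule thr_ge[OF assms b(2) S(2)])
  then show "l <= thr \<C> h + c" using S(1) by simp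
 qed
qed

text \<open>The minimum of \<open>g\<close> over a compact member is attained, so a strict pointwise
  bound leaves room for a larger level.\<close>

lemma thr_gt_compact:
 fixes g :: "'a::topological_space => real"
 assumes "fam K \<C>" "bounded (g ` K)" "!!S. S \<in> \<C> ==> compact S" "continuous_on K g"
 shows "l < thr \<C> g \<longleftrightarrow> (\<exists>S\<in>\<C>. \<forall>x\<in>S. l < g x)"
proof
 assume "l < thr \<C> g"
 then show "\<exists>S\<in>\<C>. \<forall>x\<in>S. l < g x" using thr_gt_iff[OF assms(1,2)] by force
next
 assume "\<exists>S\<in>\<C>. \<forall>x\<in>S. l < g x"
 then obtain S where S: "S \<in> \<C>" "\<forall>x\<in>S. l < g x" by blast
 then have "S ~= {}" "S \<subseteq> K" using assms(1) by (auto simp: fam_def)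
 then obtain x where "x \<in> S" "\<forall>y\<in>S. g x <= g y"
  using continuous_attains_inf[of S g] assms S continuous_on_subset by blast
 then show "l < thr \<C> g" using S thr_gt_iff[OF assms(1,2)] by blast
qed

lemma bounded_cont_image:
 fixes g :: "'a::heine_borel => real"
 assumes "continuous_on UNIV g" "bounded K"
 shows "bounded (g ` K)"
proof -
 have "compact (g ` closure K)"
  using assms by (intro compact_continuous_image continuous_on_subset[OF assms(1)]) auto
 then show ?thesis using bounded_subset compact_imp_bounded closure_subset image_mono by metis
qed

lemma fam_conn: "conn K A B ~= {} ==> fam K (conn K A B)"
 unfolding fam_def conn_def by auto

lemma thr_conn_gt:
 fixes g :: "real ^ 2 => real"
 assumes "conn K A B ~= {}" "bounded K" "continuous_on UNIV g"
 shows "l < thr (conn K A B) g \<longleftrightarrow> (\<exists>S\<in>conn K A B. \<forall>x\<in>S. l < g x)"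
 using assms by (intro thr_gt_compact[of K] fam_conn bounded_cont_image continuous_on_subset[OF assms(3)])
  (auto simp: conn_def)

lemma thr_image:
 assumes "inj T"
 shows "thr ((`) T ` \<C>) g = thr \<C> (g \<circ> T)"
 unfolding thr_def by simp

text \<open>Off the set of coefficients for which the series converges absolutely everywhere \<open>fld\<close> is zero,
  so that it is always continuous.\<close>

definition basis :: "nat \<times> nat => real ^ 2 => real" where
 "basis n x = exp (- (1 / 2) * (norm x)\<^sup>2) * (x $ 1 ^ fst n * x $ 2 ^ snd n / sqrt (fact (fst n) * fact (snd n)))"

text \<open>Bound for \<open>basis n\<close> on the ball of radius \<open>r\<close>, with the
  Gaussian factor replaced by 1.\<close>

definition wt :: "real => nat \<times> nat => real" where
 "wt r n = r ^ (fst n + snd n) / sqrt (fact (fst n) * fact (snd n))"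

definition good :: "(nat \<times> nat => real) => bool" where
 "good z \<longleftrightarrow> (\<forall>r::nat. (%n. \<bar>z n\<bar> * wt (real r) n) summable_on UNIV)"

definition fld :: "(nat \<times> nat => real) => real ^ 2 => real" where
 "fld z x = (if good z then (\<Sum>\<^sub>\<infinity>n. z n * basis n x) else 0)"

definition lo :: "nat => (nat \<times> nat) set" where
 "lo k = {n. fst n + snd n < k}"

definition lin :: "(nat \<times> nat) set => (nat \<times> nat => real) => real ^ 2 => real" where
 "lin J z x = (\<Sum>n\<in>J. z n * basis n x)"

definition cut :: "(nat \<times> nat) set => (nat \<times> nat => real) => nat \<times> nat => real" where
 "cut J z n = (if n \<in> J then z n else 0)"

lemma finite_lo [simp]: "finite (lo k)"
 by (rule finite_subset[of _ "{..<k} \<times> {..<k}"]) (auto simp: lo_def)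

lemma filterlim_lo: "filterlim lo (finite_subsets_at_top UNIV) sequentially"
 unfolding filterlim_def le_filter_def eventually_filtermap
proof (intro allI impI)
 fix P :: "(nat \<times> nat) set => bool"
 assume "eventually P (finite_subsets_at_top UNIV)"
 then obtain X where X: "finite X" "!!Y. finite Y ==> X \<subseteq> Y ==> P Y"
  by (auto simp: eventually_finite_subsets_at_top)
 obtain k where k: "!!n. n \<in> X ==> fst n + snd n < k"
  using finite_nat_set_iff_bounded[of "(%n. fst n + snd n) ` X"] X(1) by auto
 show "\<forall>\<^sub>F m in sequentially. P (lo m)"
  using eventually_ge_at_top[of k]
 proof eventually_elim
  case (elim m)
  have "X \<subseteq> lo m" using elim by (auto simp: lo_def dest!: k intro: order.strict_trans2)
  then show ?case by (intro X(2)) simp_all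
 qed
qed

lemma wt_nonneg: "0 <= r ==> 0 <= wt r n"
 by (simp add: wt_def)

lemma wt_mono: "0 <= r ==> r <= s ==> wt r n <= wt s n"
 unfolding wt_def by (intro divide_right_mono power_mono) auto

lemma abs_basis_le_wt:
 assumes "norm x <= r"
 shows "\<bar>basis n x\<bar> <= wt r n"
proof -
 have r: "0 <= r" using assms norm_ge_zero order_trans by blast
 have "\<bar>x $ 1\<bar> ^ fst n * \<bar>x $ 2\<bar> ^ snd n <= r ^ fst n * r ^ snd n"
  using assms component_le_norm_cart[of x 1] component_le_norm_cart[of x 2] r
  by (intro mult_mono power_mono) auto
 then have "\<bar>x $ 1\<bar> ^ fst n * \<bar>x $ 2\<bar> ^ snd n / sqrt (fact (fst n) * fact (snd n)) <= wt r n"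
  unfolding wt_def power_add by (intro divide_right_mono) auto
 moreover have "\<bar>basis n x\<bar> = exp (- (1 / 2) * (norm x)\<^sup>2) * (\<bar>x $ 1\<bar> ^ fst n * \<bar>x $ 2\<bar> ^ snd n / sqrt (fact (fst n) * fact (snd n)))"
  by (simp add: basis_def abs_mult power_abs)
 moreover have "\<dots> <= 1 * (\<bar>x $ 1\<bar> ^ fst n * \<bar>x $ 2\<bar> ^ snd n / sqrt (fact (fst n) * fact (snd n)))"
  by (intro mult_right_mono) auto
 ultimately show ?thesis by simp
qed

lemma abs_summable_on_comparison:
 fixes f g :: "'a => real"
 assumes "f summable_on A" "!!x. x \<in> A ==> \<bar>g x\<bar> <= f x"
 shows "g summable_on A"
proof (rule abs_summable_summable)
 show "(%x. norm (g x)) summable_on A"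
  by (rule summable_on_comparison_test[OF assms(1)]) (use assms(2) in auto)
qed

lemma goodD:
 assumes "good z"
 shows "(%n. \<bar>z n\<bar> * wt r n) summable_on A"
proof -
 obtain k :: nat where k: "\<bar>r\<bar> <= real k" using real_arch_simple by blast
 have "(%n. \<bar>z n\<bar> * wt (real k) n) summable_on A"
  using assms summable_on_subset_banach unfolding good_def by blast
 then show ?thesis
 proof (rule abs_summable_on_comparison)
  fix n
  have "\<bar>wt r n\<bar> = wt \<bar>r\<bar> n" by (simp add: wt_def power_abs)
  also have "\<dots> <= wt (real k) n" using k by (intro wt_mono) auto
  finally show "\<bar>\<bar>z n\<bar> * wt r n\<bar> <= \<bar>z n\<bar> * wt (real k) n"
   by (simp add: abs_mult mult_left_mono)
 qed
qed

lemma good_dominated: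
 assumes "good z" "!!n. \<bar>w n\<bar> <= \<bar>z n\<bar>"
 shows "good w"
 unfolding good_def
proof
 fix r :: nat
 show "(%n. \<bar>w n\<bar> * wt (real r) n) summable_on UNIV"
  by (rule abs_summable_on_comparison[OF goodD[OF assms(1), of "real r"]])
    (auto simp: abs_mult wt_nonneg intro!: mult_right_mono assms(2))
qed

lemma good_cut: "good z ==> good (cut J z)"
 by (rule good_dominated) (auto simp: cut_def)

lemma good_basis_summable:
 assumes "good z"
 shows "(%n. z n * basis n x) summable_on A"
proof (rule abs_summable_on_comparison[OF goodD[OF assms, of "norm x"]])
 fix n show "\<bar>z n * basis n x\<bar> <= \<bar>z n\<bar> * wt (norm x) n"
  using abs_basis_le_wt[of x "norm x" n] by (simp add: abs_mult mult_left_mono)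
qed

lemma fld_cut:
 assumes "good z"
 shows "fld (cut J z) x = (\<Sum>\<^sub>\<infinity>n\<in>J. z n * basis n x)"
proof -
 have "fld (cut J z) x = (\<Sum>\<^sub>\<infinity>n. cut J z n * basis n x)" using good_cut[OF assms] by (simp add: fld_def)
 also have "\<dots> = (\<Sum>\<^sub>\<infinity>n\<in>J. z n * basis n x)"
  by (rule infsum_cong_neutral) (auto simp: cut_def)
 finally show ?thesis .
qed

lemma fld_cut_finite: "good z ==> finite J ==> fld (cut J z) = lin J z"
 by (simp add: fun_eq_iff fld_cut lin_def)

lemma fld_split:
 assumes "good z"
 shows "fld z x = fld (cut J z) x + fld (cut (- J) z) x"
proof -
 have "fld z x = (\<Sum>\<^sub>\<infinity>n\<in>J \<union> - J. z n * basis n x)" using assms by (simp add: fld_def)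
 also have "\<dots> = (\<Sum>\<^sub>\<infinity>n\<in>J. z n * basis n x) + (\<Sum>\<^sub>\<infinity>n\<in>-J. z n * basis n x)"
  using assms by (intro infsum_Un_disjoint good_basis_summable) auto
 finally show ?thesis using assms by (simp add: fld_cut)
qed

lemma fld_cut_le:
 assumes "good z" "!!n. n \<in> J ==> \<bar>basis n x\<bar> <= b n" "(%n. \<bar>z n\<bar> * b n) summable_on J"
 shows "\<bar>fld (cut J z) x\<bar> <= (\<Sum>\<^sub>\<infinity>n\<in>J. \<bar>z n\<bar> * b n)"
proof -
 have s: "(%n. norm (z n * basis n x)) summable_on J"
  by (rule summable_on_iff_abs_summable_on_real[THEN iffD1, OF good_basis_summable[OF assms(1)]])
 have "\<bar>fld (cut J z) x\<bar> = norm (\<Sum>\<^sub>\<infinity>n\<in>J. z n * basis n x)" using assms(1) by (simp add: fld_cut)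
 also have "\<dots> <= (\<Sum>\<^sub>\<infinity>n\<in>J. norm (z n * basis n x))" using s by (rule norm_infsum_bound)
 also have "\<dots> <= (\<Sum>\<^sub>\<infinity>n\<in>J. \<bar>z n\<bar> * b n)"
  using s assms(3) by (rule infsum_mono) (auto simp: abs_mult intro!: mult_left_mono assms(2))
 finally show ?thesis .
qed

definition tail :: "nat => real => (nat \<times> nat => real) => real" where
 "tail k r z = (\<Sum>\<^sub>\<infinity>n\<in>- lo k. \<bar>z n\<bar> * wt r n)"

lemma fld_lin_tail:
 assumes "good z" "norm x <= r"
 shows "\<bar>fld z x - lin (lo k) z x\<bar> <= tail k r z"
proof -
 have "fld z x - lin (lo k) z x = fld (cut (- lo k) z) x"
  using fld_split[OF assms(1), of x "lo k"] assms(1) by (simp add: fld_cut_finite)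
 then show ?thesis unfolding tail_def
  using fld_cut_le[OF assms(1), of "- lo k" x "wt r"] abs_basis_le_wt[OF assms(2)] goodD[OF assms(1)] by simp
qed

lemma tail_tendsto:
 assumes "good z"
 shows "(%k. tail k r z) \<longlonglongrightarrow> 0"
proof -
 let ?f = "%n. \<bar>z n\<bar> * wt r n"
 have "(?f has_sum infsum ?f UNIV) UNIV" using goodD[OF assms] by (rule has_sum_infsum)
 then have "((%F. sum ?f F) \<longlongrightarrow> infsum ?f UNIV) (finite_subsets_at_top UNIV)" by (simp add: has_sum_def)
 then have "(%k. sum ?f (lo k)) \<longlonglongrightarrow> infsum ?f UNIV"
  using filterlim_lo by (rule filterlim_compose)
 then have "(%k. infsum ?f UNIV - sum ?f (lo k)) \<longlonglongrightarrow> 0"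
  using tendsto_diff[of "%_. infsum ?f UNIV" "infsum ?f UNIV" sequentially] by fastforce
 moreover have "tail k r z = infsum ?f UNIV - sum ?f (lo k)" for k
 proof -
  have "infsum ?f (lo k \<union> - lo k) = infsum ?f (lo k) + infsum ?f (- lo k)"
   using goodD[OF assms] by (intro infsum_Un_disjoint) auto
  then show ?thesis by (simp add: tail_def)
 qed
 ultimately show ?thesis by simp
qed

lemma continuous_basis [continuous_intros]: "continuous_on A (basis n)"
 unfolding basis_def by (intro continuous_intros) auto

lemma continuous_lin [continuous_intros]: "continuous_on A (lin J z)"
 unfolding lin_def by (intro continuous_intros)

lemma continuous_fld [continuous_intros]: "continuous_on A (fld z)"
proof (cases "good z")
 case True
 have "continuous_on (ball 0 r) (fld z)" for r
 proof (rule uniform_limit_theorem[where F = sequentially and f = "%k. lin (lo k) z"])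
  show "\<forall>\<^sub>F k in sequentially. continuous_on (ball 0 r) (lin (lo k) z)"
   by (intro always_eventually allI continuous_intros)
  show "uniform_limit (ball 0 r) (%k. lin (lo k) z) (fld z) sequentially"
  proof (rule uniform_limitI)
   fix e :: real assume "e > 0"
   then have "\<forall>\<^sub>F k in sequentially. tail k r z < e"
    using tail_tendsto[OF True, of r] by (rule order_tendstoD(2)[rotated])
   then show "\<forall>\<^sub>F k in sequentially. \<forall>x\<in>ball 0 r. dist (lin (lo k) z x) (fld z x) < e"
   proof eventually_elim
    case (elim k)
    show ?case
    proof
     fix x :: "real^2" assume "x \<in> ball 0 r"
     then have "\<bar>fld z x - lin (lo k) z x\<bar> <= tail k r z" by (intro fld_lin_tail[OF True]) simp
     then show "dist (lin (lo k) z x) (fld z x) < e" using elim by (simp add: dist_real_def)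
    qed
   qed
  qed
 qed auto
 then have "continuous (at x) (fld z)" for x
  using continuous_on_eq_continuous_at[of "ball 0 (norm x + 1)" "fld z"] by (auto simp: open_ball)
 then show ?thesis by (simp add: continuous_at_imp_continuous_on)
next
 case False
 then have "fld z = (%_. 0)" by (auto simp: fld_def fun_eq_iff)
 then show ?thesis by simp
qed

lemma bounded_fld [simp, intro]: "bounded K ==> bounded (fld z ` K)"
 by (intro bounded_cont_image continuous_intros)

lemma bounded_lin [simp, intro]: "bounded K ==> bounded (lin J z ` K)"
 by (intro bounded_cont_image continuous_intros)

lemma incr_lin_tendsto:
 assumes "incr K \<Phi>" "bounded K" "good z"
 shows "(%k. \<Phi> (lin (lo k) z)) \<longlonglongrightarrow> \<Phi> (fld z)"
proof -
 obtain r where r: "!!x. x \<in> K ==> norm x <= r" using assms(2) by (auto simp: bounded_iff)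
 have "\<bar>\<Phi> (lin (lo k) z) - \<Phi> (fld z)\<bar> <= tail k r z" for k
  using fld_lin_tail[OF assms(3) r] assms
  by (intro incr_abs[OF assms(1)]) (auto simp: abs_minus_commute)
 then show ?thesis
  by (intro LIM_zero_cancel[OF Lim_null_comparison[OF _ tail_tendsto[OF assms(3), of r]]]) auto
qed

section \<open>Size of the modes\<close>

text \<open>A single term of the exponential series at \<open>s * t\<^sup>2\<close> is at most its
  sum; take square roots. The parameter \<open>s\<close> trades decay in the degree
  (\<open>s > 1\<close>) against growth in \<open>t\<close>.\<close>

lemma pow_fact_bound:
 fixes t s :: real
 assumes "s > 0"
 shows "\<bar>t\<bar> ^ i / sqrt (fact i) <= exp (s * t\<^sup>2 / 2) / sqrt s ^ i"
proof -
 have "(s * t\<^sup>2) ^ i / fact i <= exp (s * t\<^sup>2)"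
 proof -
  have "sum (%n. (s * t\<^sup>2) ^ n /\<^sub>R fact n) {i} <= (\<Sum>n. (s * t\<^sup>2) ^ n /\<^sub>R fact n)"
   using assms by (intro sum_le_suminf summable_exp_generic) auto
  then show ?thesis by (simp add: exp_def divide_inverse mult.commute)
 qed
 then have "sqrt ((s * t\<^sup>2) ^ i / fact i) <= sqrt (exp (s * t\<^sup>2))" by simp
 moreover have "sqrt (exp (s * t\<^sup>2)) = exp (s * t\<^sup>2 / 2)"
  by (rule real_sqrt_unique) (simp_all add: power2_eq_square exp_add[symmetric])
 moreover have "sqrt ((s * t\<^sup>2) ^ i / fact i) = sqrt s ^ i * (\<bar>t\<bar> ^ i / sqrt (fact i))"
 proof -
  have "sqrt (s * t\<^sup>2) ^ i = (sqrt s * \<bar>t\<bar>) ^ i" by (simp add: real_sqrt_mult)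
  then show ?thesis
   by (simp only: real_sqrt_divide real_sqrt_power power_mult_distrib[of "sqrt s"] times_divide_eq_right)
 qed
 ultimately have "sqrt s ^ i * (\<bar>t\<bar> ^ i / sqrt (fact i)) <= exp (s * t\<^sup>2 / 2)" by simp
 then show ?thesis using assms by (simp add: pos_le_divide_eq mult.commute)
qed

lemma wt_bound:
 assumes "s > 0" "r >= 0"
 shows "wt r n <= exp (s * r\<^sup>2) / sqrt s ^ (fst n + snd n)"
proof -
 have "wt r n = (\<bar>r\<bar> ^ fst n / sqrt (fact (fst n))) * (\<bar>r\<bar> ^ snd n / sqrt (fact (snd n)))"
  using assms by (simp add: wt_def power_add real_sqrt_mult)
 also have "\<dots> <= (exp (s * r\<^sup>2 / 2) / sqrt s ^ fst n) * (exp (s * r\<^sup>2 / 2) / sqrt s ^ snd n)"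
  using assms by (intro mult_mono pow_fact_bound) auto
 also have "\<dots> = exp (s * r\<^sup>2) / sqrt s ^ (fst n + snd n)"
  by (simp add: power_add exp_add[symmetric] field_simps)
 finally show ?thesis .
qed

text \<open>For \<open>s < 1\<close> part of the Gaussian factor survives, which makes the mode
  small far from the origin at the price of geometric growth in the degree.\<close>

lemma basis_bound:
 assumes "s > 0"
 shows "\<bar>basis n x\<bar> <= exp (- (1 - s) / 2 * (norm x)\<^sup>2) / sqrt s ^ (fst n + snd n)"
proof -
 have nx: "(norm x)\<^sup>2 = (x $ 1)\<^sup>2 + (x $ 2)\<^sup>2"
  by (simp add: norm_vec_def L2_set_def sum_2)
 have "\<bar>basis n x\<bar> = exp (- (1 / 2) * (norm x)\<^sup>2) * ((\<bar>x $ 1\<bar> ^ fst n / sqrt (fact (fst n))) * (\<bar>x $ 2\<bar> ^ snd n / sqrt (fact (snd n))))"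
  by (simp add: basis_def abs_mult power_abs real_sqrt_mult)
 also have "\<dots> <= exp (- (1 / 2) * (norm x)\<^sup>2) * ((exp (s * (x $ 1)\<^sup>2 / 2) / sqrt s ^ fst n) * (exp (s * (x $ 2)\<^sup>2 / 2) / sqrt s ^ snd n))"
  using assms by (intro mult_left_mono mult_mono pow_fact_bound) auto
 also have "\<dots> = exp (- (1 / 2) * (norm x)\<^sup>2 + s * (x $ 1)\<^sup>2 / 2 + s * (x $ 2)\<^sup>2 / 2) / sqrt s ^ (fst n + snd n)"
  by (simp only: power_add exp_add times_divide_eq_left times_divide_eq_right divide_divide_eq_left mult.assoc)
 also have "- (1 / 2) * (norm x)\<^sup>2 + s * (x $ 1)\<^sup>2 / 2 + s * (x $ 2)\<^sup>2 / 2 = - (1 - s) / 2 * (norm x)\<^sup>2"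
  by (simp add: nx field_simps)
 finally show ?thesis .
qed

section \<open>Gaussian coefficients\<close>

abbreviation N1 :: "real measure" where "N1 \<equiv> std_normal_distribution"

definition PP :: "(nat \<times> nat => real) measure" where
 "PP = PiM UNIV (%_. N1)"

lemma sets_N1 [simp, measurable_cong]: "sets N1 = sets borel"
 by simp

lemma space_N1 [simp]: "space N1 = UNIV"
 by simp

lemma prob_space_N1: "prob_space N1"
 by (rule prob_space_normal_density) simp

lemma product_prob_space_N1: "product_prob_space (%_. N1)"
 unfolding product_prob_space_def product_prob_space_axioms_def product_sigma_finite_def
 using prob_space_N1 prob_space_imp_sigma_finite by blast

interpretation PP: prob_space PP
 unfolding PP_def by (intro prob_space_PiM prob_space_N1)

abbreviation EE :: "((nat \<times> nat => real) => real) => real" where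
 "EE \<equiv> PP.expectation"

lemma space_PP [simp]: "space PP = UNIV"
 by (simp add: PP_def space_PiM)

lemma sets_PP [measurable_cong]: "sets PP = sets (PiM UNIV (%_. borel))"
 unfolding PP_def by (rule sets_PiM_cong) auto

lemma measurable_coord [measurable]: "(%z. z n) \<in> borel_measurable PP"
 by measurable

lemma distr_coord: "distr PP borel (%z. z n) = N1"
proof -
 interpret product_prob_space "%_. N1" UNIV by (rule product_prob_space_N1)
 have "distr PP N1 (%z. z n) = N1" unfolding PP_def by (rule PiM_component) simp
 moreover have "distr PP borel (%z. z n) = distr PP N1 (%z. z n)" by (rule distr_cong) simp_all
 ultimately show ?thesis by simp
qed

lemma PP_indep: "PP.indep_vars (%_. borel) (%n z. z n) UNIV"
proof (subst PP.indep_vars_iff_distr_eq_PiM')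
 have "distr PP (PiM UNIV (%_. borel)) (%x. x) = PP"
  by (rule distr_id2) (simp add: sets_PP)
 then show "distr PP (PiM UNIV (%_. borel)) (%x. \<lambda>i\<in>UNIV. x i) = PiM UNIV (%n. distr PP borel (%z. z n))"
  unfolding distr_coord by (simp add: PP_def[symmetric] restrict_def)
qed auto

lemma distr_PP_restrict:
 assumes "finite J"
 shows "distr PP (PiM J (%_. N1)) (%z. restrict z J) = PiM J (%_. N1)"
proof -
 interpret product_prob_space "%_. N1" UNIV by (rule product_prob_space_N1)
 show ?thesis unfolding PP_def using assms by (rule distr_PiM_restrict_finite) simp
qed

lemma measurable_restrict_PP [measurable]: "(%z. restrict z J) \<in> PP \<rightarrow>\<^sub>M PiM J (%_. N1)"
 unfolding PP_def by (rule measurable_restrict_subset) simp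

lemma measurable_cut [measurable]: "cut J \<in> PP \<rightarrow>\<^sub>M PP"
proof -
 have "(%z. cut J z) \<in> PP \<rightarrow>\<^sub>M PiM UNIV (%_. borel)"
 proof (rule measurable_PiM_single')
  fix i show "(%z. cut J z i) \<in> borel_measurable PP" by (simp add: cut_def)
 qed auto
 then show ?thesis using measurable_cong_sets[OF refl sets_PP] by blast
qed

lemma abs_moment_N1: "(\<integral>\<^sup>+ x. ennreal \<bar>x\<bar> \<partial>N1) <= 1"
proof -
 have i: "integrable N1 (%x. \<bar>x\<bar>)"
  using integrable_std_normal_distribution_moment[of 1] by (intro integrable_abs) simp
 have "(LINT x|N1. \<bar>x\<bar>) = sqrt (2 / pi)" using std_normal_distribution_odd_moments_abs[of 0] by simp
 also have "\<dots> <= 1" using pi_ge_two by simp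
 finally show ?thesis
  using nn_integral_eq_integral[OF i] by simp
qed

lemma UNIV_sets_PP [simp, intro]: "UNIV \<in> sets PP"
 using sets.top[of PP] by simp

lemma nn_integral_abs_coord: "(\<integral>\<^sup>+ z. ennreal \<bar>z n\<bar> \<partial>PP) <= 1"
proof -
 have "(\<integral>\<^sup>+ z. ennreal \<bar>z n\<bar> \<partial>PP) = (\<integral>\<^sup>+ x. ennreal \<bar>x\<bar> \<partial>distr PP borel (%z. z n))"
  by (rule nn_integral_distr[symmetric]) auto
 then show ?thesis using abs_moment_N1 by (simp only: distr_coord)
qed

text \<open>Markov's inequality with first absolute moments at most 1, applied to the increasing
  partial sums over \<open>lo k\<close>. The exceptional set is the countable union of the events
  for the partial sums, so the measurability of the infinite sum need not be settled.\<close>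

lemma weighted_sum_prob:
 assumes b: "!!n. n \<in> J ==> 0 <= b n" "b summable_on J" and \<eta>: "\<eta> > 0"
 obtains A where "A \<in> sets PP" "PP.prob A <= infsum b J / \<eta>"
  "!!z. z \<notin> A ==> (%n. \<bar>z n\<bar> * b n) summable_on J" "!!z. z \<notin> A ==> (\<Sum>\<^sub>\<infinity>n\<in>J. \<bar>z n\<bar> * b n) <= \<eta>"
proof -
 define T where "T k z = (\<Sum>n\<in>lo k \<inter> J. \<bar>z n\<bar> * b n)" for k and z :: "nat \<times> nat => real"
 define A where "A k = {z. T k z > \<eta>}" for k
 have Tm [measurable]: "T k \<in> borel_measurable PP" for k unfolding T_def by measurable
 have Am [measurable]: "A k \<in> sets PP" for k
 proof -
  have "{z \<in> space PP. T k z > \<eta>} \<in> sets PP" by measurable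
  then show ?thesis by (simp add: A_def)
 qed
 have Pk: "emeasure PP (A k) <= ennreal (infsum b J / \<eta>)" for k
 proof -
  have "(\<integral>\<^sup>+z. ennreal (T k z) \<partial>PP) = (\<integral>\<^sup>+z. (\<Sum>n\<in>lo k \<inter> J. ennreal (b n) * ennreal \<bar>z n\<bar>) \<partial>PP)"
   unfolding T_def using b by (intro nn_integral_cong) (subst sum_ennreal[symmetric], auto simp: ennreal_mult' mult.commute intro!: sum.cong)
  also have "\<dots> = (\<Sum>n\<in>lo k \<inter> J. ennreal (b n) * (\<integral>\<^sup>+z. ennreal \<bar>z n\<bar> \<partial>PP))"
   by (simp add: nn_integral_sum nn_integral_cmult)
  also have "\<dots> <= (\<Sum>n\<in>lo k \<inter> J. ennreal (b n) * 1)"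
   by (intro sum_mono mult_left_mono nn_integral_abs_coord) auto
  also have "\<dots> = ennreal (\<Sum>n\<in>lo k \<inter> J. b n)" using b by (subst mult_1_right, subst sum_ennreal) auto
  also have "\<dots> <= ennreal (infsum b J)"
   using b by (intro ennreal_leI finite_sum_le_infsum) auto
  finally have E: "(\<integral>\<^sup>+z. ennreal (T k z) \<partial>PP) <= ennreal (infsum b J)" .
  have "emeasure PP (A k) <= emeasure PP ({z \<in> space PP. 1 <= ennreal (1 / \<eta>) * ennreal (T k z)})"
  proof (rule emeasure_mono)
   show "A k \<subseteq> {z \<in> space PP. 1 <= ennreal (1 / \<eta>) * ennreal (T k z)}"
    using \<eta> by (auto simp: A_def ennreal_mult'[symmetric] ennreal_1[symmetric] simp del: ennreal_1)
  qed measurable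
  also have "\<dots> <= ennreal (1 / \<eta>) * (\<integral>\<^sup>+z. ennreal (T k z) * indicator (space PP) z \<partial>PP)"
   by (intro nn_integral_Markov_inequality sets.top) auto
  also have "\<dots> <= ennreal (1 / \<eta>) * ennreal (infsum b J)"
   using E by (intro mult_left_mono) auto
  also have "\<dots> = ennreal (infsum b J / \<eta>)" using \<eta> by (simp add: ennreal_mult'[symmetric])
  finally show ?thesis .
 qed
 have inc: "incseq A"
 proof (rule incseq_SucI)
  fix k
  have "lo k \<subseteq> lo (Suc k)" by (auto simp: lo_def)
  then have "T k z <= T (Suc k) z" for z unfolding T_def
   using b by (intro sum_mono2) auto
  then show "A k \<subseteq> A (Suc k)" using order_less_le_trans by (fastforce simp: A_def)
 qed
 have "emeasure PP (\<Union>k. A k) = (SUP k. emeasure PP (A k))"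
  using inc by (intro SUP_emeasure_incseq[symmetric]) auto
 also have "\<dots> <= ennreal (infsum b J / \<eta>)" by (intro SUP_least Pk)
 finally have "emeasure PP (\<Union>k. A k) <= ennreal (infsum b J / \<eta>)" .
 moreover have B: "0 <= infsum b J" using b by (intro infsum_nonneg) auto
 ultimately have P: "PP.prob (\<Union>k. A k) <= infsum b J / \<eta>"
  using \<eta> by (simp add: PP.emeasure_eq_measure)
 have fin: "(\<Sum>n\<in>F. \<bar>z n\<bar> * b n) <= \<eta>" if z: "z \<notin> (\<Union>k. A k)" and F: "finite F" "F \<subseteq> J" for z F
 proof -
  have "\<forall>\<^sub>F k in sequentially. F \<subseteq> lo k"
   using filterlim_lo[unfolded filterlim_def le_filter_def eventually_filtermap, rule_format, of "%Y. F \<subseteq> Y"] F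
   by (auto simp: eventually_finite_subsets_at_top)
  then obtain k where "F \<subseteq> lo k" by (auto simp: eventually_sequentially)
  then have "(\<Sum>n\<in>F. \<bar>z n\<bar> * b n) <= T k z" unfolding T_def using F b by (intro sum_mono2) auto
  also have "\<dots> <= \<eta>"
  proof -
   have "z \<notin> A k" using z by blast
   then show ?thesis by (simp add: A_def)
  qed
  finally show ?thesis .
 qed
 have summ: "(%n. \<bar>z n\<bar> * b n) summable_on J" if "z \<notin> (\<Union>k. A k)" for z
  using b fin[OF that] by (intro nonneg_bounded_partial_sums_imp_summable_on[where C = \<eta>] eventually_finite_subsets_at_top_weakI) auto
 have "(\<Sum>\<^sub>\<infinity>n\<in>J. \<bar>z n\<bar> * b n) <= \<eta>" if "z \<notin> (\<Union>k. A k)" for z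
  using summ[OF that] fin[OF that] by (intro infsum_le_finite_sums) auto
 then show ?thesis using that[of "\<Union>k. A k"] P summ by auto
qed

lemma geometric_pairs:
 fixes c :: real
 assumes "0 <= c" "c < 1"
 shows "(%n::nat \<times> nat. c ^ (fst n + snd n)) summable_on UNIV"
  "(\<Sum>\<^sub>\<infinity>n::nat \<times> nat. c ^ (fst n + snd n)) <= (1 / (1 - c))\<^sup>2"
proof -
 have fin: "(\<Sum>n\<in>F. c ^ (fst n + snd n)) <= (1 / (1 - c))\<^sup>2" if F: "finite F" for F :: "(nat \<times> nat) set"
 proof -
  obtain k where k: "F \<subseteq> {..<k} \<times> {..<k}"
  proof -
   obtain k1 k2 where "!!m. m \<in> fst ` F ==> m < k1" "!!m. m \<in> snd ` F ==> m < k2"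
    using finite_nat_set_iff_bounded[of "fst ` F"] finite_nat_set_iff_bounded[of "snd ` F"] F by auto
   then have "F \<subseteq> {..<max k1 k2} \<times> {..<max k1 k2}" by (fastforce simp: less_max_iff_disj)
   then show ?thesis by (rule that)
  qed
  have "(\<Sum>n\<in>F. c ^ (fst n + snd n)) <= (\<Sum>n\<in>{..<k} \<times> {..<k}. c ^ (fst n + snd n))"
   using assms by (intro sum_mono2 k) auto
  also have "\<dots> = (\<Sum>i<k. c ^ i)\<^sup>2"
   by (simp add: power2_eq_square sum_product sum.cartesian_product power_add case_prod_unfold)
  also have "\<dots> <= (1 / (1 - c))\<^sup>2"
  proof (rule power_mono)
   have "(\<Sum>i<k. c ^ i) = (1 - c ^ k) / (1 - c)" using assms by (simp add: sum_gp_strict)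
   also have "\<dots> <= 1 / (1 - c)" using assms by (intro divide_right_mono) auto
   finally show "(\<Sum>i<k. c ^ i) <= 1 / (1 - c)" .
  qed (use assms in \<open>auto intro: sum_nonneg\<close>)
  finally show ?thesis .
 qed
 show s: "(%n::nat \<times> nat. c ^ (fst n + snd n)) summable_on UNIV"
  using fin assms by (intro nonneg_bounded_partial_sums_imp_summable_on eventually_finite_subsets_at_top_weakI) auto
 show "(\<Sum>\<^sub>\<infinity>n::nat \<times> nat. c ^ (fst n + snd n)) <= (1 / (1 - c))\<^sup>2"
  using s fin by (intro infsum_le_finite_sums) auto
qed

lemma wt_summable: "r >= 0 ==> wt r summable_on A"
proof -
 assume r: "r >= 0"
 have "(%n. exp (4 * r\<^sup>2) * (1/2) ^ (fst n + snd n)) summable_on A"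
  using geometric_pairs(1)[of "1/2 :: real"] by (intro summable_on_cmult_right) (auto intro: summable_on_subset_banach)
 then show ?thesis
 proof (rule abs_summable_on_comparison)
  fix n show "\<bar>wt r n\<bar> <= exp (4 * r\<^sup>2) * (1/2) ^ (fst n + snd n)"
   using wt_bound[of 4 r n] wt_nonneg[OF r, of n] r by (simp add: power_one_over field_simps)
 qed
qed

lemma sets_good [measurable]: "{z. good z} \<in> sets PP" "Measurable.pred PP good"
proof -
 let ?f = "%z r n. \<bar>z n\<bar> * wt (real r) n"
 \<comment> \<open>For non-negative terms, summability is boundedness of the partial sums over
   \<open>lo k\<close>: a countable condition, hence measurable.\<close>
 have eq: "good z \<longleftrightarrow> (\<forall>r. \<exists>B::nat. \<forall>k. (\<Sum>n\<in>lo k. ?f z r n) <= real B)" for z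
 proof
  assume g: "good z"
  show "\<forall>r. \<exists>B::nat. \<forall>k. (\<Sum>n\<in>lo k. ?f z r n) <= real B"
  proof
   fix r :: nat
   obtain B :: nat where "(\<Sum>\<^sub>\<infinity>n. ?f z r n) <= real B" using real_arch_simple by blast
   moreover have "(\<Sum>n\<in>lo k. ?f z r n) <= (\<Sum>\<^sub>\<infinity>n. ?f z r n)" for k
    using goodD[OF g] by (intro finite_sum_le_infsum) (auto simp: wt_nonneg)
   ultimately show "\<exists>B::nat. \<forall>k. (\<Sum>n\<in>lo k. ?f z r n) <= real B"
    using order_trans by blast
  qed
 next
  assume *: "\<forall>r. \<exists>B::nat. \<forall>k. (\<Sum>n\<in>lo k. ?f z r n) <= real B"
  show "good z" unfolding good_def
  proof
   fix r :: nat
   obtain B :: nat where B: "!!k. (\<Sum>n\<in>lo k. ?f z r n) <= real B" using * by blast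
   show "(%n. ?f z r n) summable_on UNIV"
   proof (rule nonneg_bounded_partial_sums_imp_summable_on[where C = "real B"])
    show "\<forall>\<^sub>F X in finite_subsets_at_top UNIV. (\<Sum>n\<in>X. ?f z r n) <= real B"
    proof (rule eventually_finite_subsets_at_top_weakI)
     fix X :: "(nat \<times> nat) set" assume X: "finite X"
     have "\<forall>\<^sub>F k in sequentially. X \<subseteq> lo k"
      using filterlim_lo[unfolded filterlim_def le_filter_def eventually_filtermap, rule_format, of "%Y. X \<subseteq> Y"] X
      by (auto simp: eventually_finite_subsets_at_top)
     then obtain k where "X \<subseteq> lo k" by (auto simp: eventually_sequentially)
     then have "(\<Sum>n\<in>X. ?f z r n) <= (\<Sum>n\<in>lo k. ?f z r n)"
      by (intro sum_mono2) (auto simp: wt_nonneg)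
     then show "(\<Sum>n\<in>X. ?f z r n) <= real B" using B[of k] by simp
    qed
   qed (auto simp: wt_nonneg)
  qed
 qed
 show p: "Measurable.pred PP good" unfolding eq by measurable
 then show "{z. good z} \<in> sets PP" by (simp add: pred_def)
qed

text \<open>For each integer radius the exceptional sets with thresholds \<open>Suc m\<close> have
  probability of order \<open>1 / Suc m\<close>, so their intersection is null.\<close>

lemma AE_good: "AE z in PP. good z"
proof -
 have "AE z in PP. (%n. \<bar>z n\<bar> * wt (real r) n) summable_on UNIV" for r :: nat
 proof -
  define B where "B = infsum (wt (real r)) UNIV"
  have "\<forall>m. \<exists>A. A \<in> sets PP \<and> PP.prob A <= B / real (Suc m) \<and> (\<forall>z. z \<notin> A \<longrightarrow> (%n. \<bar>z n\<bar> * wt (real r) n) summable_on UNIV)"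
   unfolding B_def
  proof
   fix m
   show "\<exists>A. A \<in> sets PP \<and> PP.prob A <= infsum (wt (real r)) UNIV / real (Suc m) \<and> (\<forall>z. z \<notin> A \<longrightarrow> (%n. \<bar>z n\<bar> * wt (real r) n) summable_on UNIV)"
    by (rule weighted_sum_prob[of UNIV "wt (real r)" "real (Suc m)"]) (auto simp: wt_summable wt_nonneg)
  qed
  then obtain A where "\<forall>m. A m \<in> sets PP \<and> PP.prob (A m) <= B / real (Suc m) \<and> (\<forall>z. z \<notin> A m \<longrightarrow> (%n. \<bar>z n\<bar> * wt (real r) n) summable_on UNIV)"
   by (rule choice[THEN exE])
  then have A: "!!m. A m \<in> sets PP" "!!m. PP.prob (A m) <= B / real (Suc m)"
   "!!m z. z \<notin> A m ==> (%n. \<bar>z n\<bar> * wt (real r) n) summable_on UNIV" by blast+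
  have "PP.prob (\<Inter>m. A m) <= B / real (Suc m)" for m
   using A(1) A(2)[of m] by (intro order_trans[OF PP.finite_measure_mono A(2)]) auto
  moreover have "(%m. B / real (Suc m)) \<longlonglongrightarrow> 0"
   by (intro lim_const_over_n[THEN LIMSEQ_Suc])
  ultimately have "PP.prob (\<Inter>m. A m) <= 0" by (meson LIMSEQ_le_const)
  then have "(\<Inter>m. A m) \<in> null_sets PP"
   using A(1) by (auto simp: null_sets_def PP.emeasure_eq_measure measure_le_0_iff)
  then show ?thesis by (rule AE_I') (use A(3) in auto)
 qed
 then show ?thesis unfolding good_def by (simp add: AE_all_countable)
qed

section \<open>Measurability of functionals of the field\<close>

lemma lin_cong: "(!!n. n \<in> J ==> y n = z n) ==> lin J y = lin J z"
 by (auto simp: lin_def fun_eq_iff intro!: sum.cong)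

text \<open>A threshold functional is a supremum over an uncountable family, so its measurability is
  derived from continuity: for a finite truncation, the supremum norm on \<open>K\<close> is
  controlled by finitely many coefficients.\<close>

lemma continuous_incr_lin:
 assumes "incr K \<Phi>" "bounded K"
 shows "continuous_on UNIV (%z. \<Phi> (lin J z))"
proof (cases "finite J")
 case True
 obtain r where r: "!!x. x \<in> K ==> norm x <= r" using assms(2) by (auto simp: bounded_iff)
 have le: "\<bar>\<Phi> (lin J z) - \<Phi> (lin J y)\<bar> <= (\<Sum>n\<in>J. \<bar>z n - y n\<bar> * wt r n)" for y z
 proof (rule incr_abs[OF assms(1)])
  fix x assume "x \<in> K"
  have "lin J z x - lin J y x = (\<Sum>n\<in>J. (z n - y n) * basis n x)"
   by (simp add: lin_def sum_subtractf algebra_simps)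
  also have "\<bar>\<dots>\<bar> <= (\<Sum>n\<in>J. \<bar>(z n - y n) * basis n x\<bar>)" by (rule sum_abs)
  also have "\<dots> <= (\<Sum>n\<in>J. \<bar>z n - y n\<bar> * wt r n)"
   using abs_basis_le_wt[OF r[OF \<open>x \<in> K\<close>]] by (intro sum_mono) (auto simp: abs_mult intro!: mult_left_mono)
  finally show "\<bar>lin J z x - lin J y x\<bar> <= (\<Sum>n\<in>J. \<bar>z n - y n\<bar> * wt r n)" .
 qed (use assms in auto)
 show ?thesis unfolding continuous_on_def
 proof
  fix y :: "nat \<times> nat => real"
  have "((%z. \<Sum>n\<in>J. \<bar>z n - y n\<bar> * wt r n) \<longlongrightarrow> (\<Sum>n\<in>J. \<bar>y n - y n\<bar> * wt r n)) (at y)"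
  proof (intro tendsto_intros)
   fix n
   have "isCont (%z::nat \<times> nat => real. z n) y"
    by (rule bspec[OF iffD1[OF continuous_on_eq_continuous_at[OF open_UNIV] continuous_on_product_coordinates]]) simp
   then show "((%z. z n) \<longlongrightarrow> y n) (at y)" by (simp add: isCont_def)
  qed
  then have "((%z. \<Sum>n\<in>J. \<bar>z n - y n\<bar> * wt r n) \<longlongrightarrow> 0) (at y)" by simp
  moreover have "\<forall>\<^sub>F z in at y. norm (\<Phi> (lin J z) - \<Phi> (lin J y)) <= (\<Sum>n\<in>J. \<bar>z n - y n\<bar> * wt r n)"
   unfolding real_norm_def by (rule always_eventually) (use le in blast)
  ultimately have "((%z. \<Phi> (lin J z) - \<Phi> (lin J y)) \<longlongrightarrow> 0) (at y)"
   by (rule Lim_null_comparison[rotated])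
  then show "((%z. \<Phi> (lin J z)) \<longlongrightarrow> \<Phi> (lin J y)) (at y within UNIV)"
   by (simp add: LIM_zero_iff)
 qed
next
 case False
 \<comment> \<open>A sum over an infinite set is 0 by convention, so the functional is
   constant.\<close>
 then have eq: "(%z. \<Phi> (lin J z)) = (%_. \<Phi> (%_. 0))" by (simp add: lin_def[abs_def])
 show ?thesis unfolding eq by (rule continuous_on_const)
qed

lemma measurable_incr_lin [measurable (raw)]:
 assumes "incr K \<Phi>" "bounded K"
 shows "(%z. \<Phi> (lin J z)) \<in> borel_measurable PP"
proof -
 have "sets PP = sets borel" unfolding sets_PP by (rule sets_PiM_equal_borel)
 then show ?thesis
  using borel_measurable_continuous_onI[OF continuous_incr_lin[OF assms, of J]] measurable_cong_sets by blast
qed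

lemma measurable_incr_lin_PiM:
 assumes "incr K \<Phi>" "bounded K"
 shows "(%z. \<Phi> (lin J z)) \<in> borel_measurable (PiM J (%_. N1))"
proof -
 have m: "(%z n. if n \<in> J then z n else 0) \<in> PiM J (%_. N1) \<rightarrow>\<^sub>M PP"
 proof -
  have "(%z n. if n \<in> J then z n else 0) \<in> PiM J (%_. N1) \<rightarrow>\<^sub>M PiM UNIV (%_. borel)"
  proof (rule measurable_PiM_single')
   fix i :: "nat \<times> nat"
   show "(%z. if i \<in> J then z i else 0) \<in> borel_measurable (PiM J (%_. N1))"
    using measurable_component_singleton[of i J "%_. N1"] by (cases "i \<in> J") (auto simp: measurable_cong_sets[of _ _ N1 borel])
  qed auto
  then show ?thesis using measurable_cong_sets[OF refl sets_PP] by blast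
 qed
 have "(%z. \<Phi> (lin J z)) = (%z. \<Phi> (lin J z)) \<circ> (%z n. if n \<in> J then z n else 0)"
  by (auto simp: fun_eq_iff intro!: arg_cong[of _ _ \<Phi>] lin_cong)
 then show ?thesis using measurable_comp[OF m measurable_incr_lin[OF assms, of J]] by simp
qed

lemma measurable_incr_fld [measurable (raw)]:
 assumes "incr K \<Phi>" "bounded K"
 shows "(%z. \<Phi> (fld z)) \<in> borel_measurable PP"
proof (rule borel_measurable_LIMSEQ_real)
 fix z :: "nat \<times> nat => real"
 show "(%k. if good z then \<Phi> (lin (lo k) z) else \<Phi> (%_. 0)) \<longlonglongrightarrow> \<Phi> (fld z)"
 proof (cases "good z")
  case True then show ?thesis using incr_lin_tendsto[OF assms True] by simp
 next
  case False
  then have "fld z = (%_. 0)" by (auto simp: fld_def)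
  then show ?thesis using False by simp
 qed
next
 fix k show "(%z. if good z then \<Phi> (lin (lo k) z) else \<Phi> (%_. 0)) \<in> borel_measurable PP"
  using measurable_incr_lin[OF assms, of "lo k"] by measurable
qed

lemma sets_incr_fld:
 assumes "incr K \<Phi>" "bounded K"
 shows "{z. l < \<Phi> (fld z)} \<in> sets PP" "{z. l <= \<Phi> (fld z)} \<in> sets PP"
  "{z. l < \<Phi> (fld (cut J z))} \<in> sets PP"
proof -
 note m [measurable] = measurable_incr_fld[OF assms]
 have "{z \<in> space PP. l < \<Phi> (fld z)} \<in> sets PP" "{z \<in> space PP. l <= \<Phi> (fld z)} \<in> sets PP" by measurable
 then show "{z. l < \<Phi> (fld z)} \<in> sets PP" "{z. l <= \<Phi> (fld z)} \<in> sets PP" by simp_all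
 have "(%z. \<Phi> (fld (cut J z))) \<in> borel_measurable PP"
  using measurable_compose[OF measurable_cut m] .
 then have "{z \<in> space PP. l < \<Phi> (fld (cut J z))} \<in> sets PP" by measurable
 then show "{z. l < \<Phi> (fld (cut J z))} \<in> sets PP" by simp
qed

section \<open>Absence of atoms and the Harris inequality\<close>

lemma prob_PP_restrict:
 assumes J: "finite J" and A: "{z \<in> space (PiM J (%_. N1)). Q z} \<in> sets (PiM J (%_. N1))"
  and Q: "!!z. Q (restrict z J) = Q z"
 shows "PP.prob {z. Q z} = measure (PiM J (%_. N1)) {z \<in> space (PiM J (%_. N1)). Q z}"
proof -
 have "measure (distr PP (PiM J (%_. N1)) (%z. restrict z J)) {z \<in> space (PiM J (%_. N1)). Q z}
   = measure PP ((%z. restrict z J) -` {z \<in> space (PiM J (%_. N1)). Q z} \<inter> space PP)"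
  by (rule measure_distr) (use A in auto)
 also have "(%z. restrict z J) -` {z \<in> space (PiM J (%_. N1)). Q z} \<inter> space PP = {z. Q z}"
  using Q by (auto simp: space_PiM)
 finally show ?thesis unfolding distr_PP_restrict[OF J] by (rule sym)
qed

lemma lin_restrict [simp]: "lin J (restrict z J) = lin J z"
 by (rule lin_cong) auto

lemma N1_interval:
 assumes "A \<in> sets borel" "!!s t. s \<in> A ==> t \<in> A ==> \<bar>s - t\<bar> <= d" "d >= 0"
 shows "emeasure N1 A <= ennreal (2 * d)"
proof (cases "A = {}")
 case False
 then obtain t where t: "t \<in> A" by auto
 have sub: "A \<subseteq> {t - d..t + d}" using assms(2)[OF _ t] by force
 have "emeasure N1 A <= emeasure N1 {t - d..t + d}" by (intro emeasure_mono sub) auto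
 also have "\<dots> = (\<integral>\<^sup>+x. ennreal (std_normal_density x) * indicator {t - d..t + d} x \<partial>lborel)"
  by (subst emeasure_density) auto
 also have "\<dots> <= (\<integral>\<^sup>+x. 1 * indicator {t - d..t + d} x \<partial>lborel)"
 proof (intro nn_integral_mono mult_right_mono)
  fix x :: real
  have "std_normal_density x <= 1 * 1" unfolding std_normal_density_def
  proof (intro mult_mono)
   have "1 <= sqrt (2 * pi)" using pi_ge_two by simp
   then show "1 / sqrt (2 * pi) <= 1" by simp
  qed auto
  then show "ennreal (std_normal_density x) <= 1" by simp
 qed simp
 also have "\<dots> = emeasure lborel {t - d..t + d}" by simp
 also have "\<dots> = ennreal (2 * d)" using assms(3) by simp
 finally show ?thesis .
qed simp

text \<open>The mode of degree 0 is at least \<open>c\<close> on \<open>K\<close>, so raising its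
  coefficient by \<open>d\<close> raises the functional by at least \<open>c * d\<close>. With the
  other coefficients fixed, the window is hit for a set of values of diameter at most
  \<open>2 * \<theta> / c\<close>, and the normal density is at most 1.\<close>

lemma incr_lin_window:
 assumes \<Phi>: "incr K \<Phi>" "bounded K" and c: "c > 0" "!!x. x \<in> K ==> c <= basis (0, 0) x" and k: "k > 0" and \<theta>: "\<theta> > 0"
 shows "PP.prob {z. \<bar>\<Phi> (lin (lo k) z) - l\<bar> < \<theta>} <= 4 * \<theta> / c"
proof -
 interpret product_sigma_finite "%_::nat \<times> nat. N1"
  using prob_space_N1 prob_space_imp_sigma_finite by (simp add: product_sigma_finite_def)
 define J where "J = lo k - {(0, 0)}"
 have J: "insert (0, 0) J = lo k" "finite J" "(0, 0) \<notin> J"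
  using k finite_lo[of k] by (auto simp: J_def) (auto simp: lo_def)
 let ?M = "PiM (lo k) (%_. N1)"
 let ?Q = "%z. \<bar>\<Phi> (lin (lo k) z) - l\<bar> < \<theta>"
 define A where "A = {z \<in> space ?M. ?Q z}"
 note m [measurable] = measurable_incr_lin_PiM[OF \<Phi>, of "lo k"]
 have A [measurable]: "A \<in> sets ?M" unfolding A_def by measurable
 have "emeasure ?M A = (\<integral>\<^sup>+z. indicator A z \<partial>?M)" by simp
 also have "\<dots> = (\<integral>\<^sup>+y. (\<integral>\<^sup>+t. indicator A (y((0,0) := t)) \<partial>N1) \<partial>PiM J (%_. N1))"
  using product_nn_integral_insert[OF J(2,3), of "indicator A"] A J(1) by simp
 also have "\<dots> <= (\<integral>\<^sup>+y. ennreal (4 * \<theta> / c) \<partial>PiM J (%_. N1))"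
 proof (rule nn_integral_mono)
  fix y assume y: "y \<in> space (PiM J (%_. N1))"
  define B where "B = {t. ?Q (y((0,0) := t))}"
  have eqA: "y((0,0) := t) \<in> A \<longleftrightarrow> t \<in> B" for t
   using y J(1) by (auto simp: A_def B_def space_PiM PiE_def extensional_def)
  have eqB: "indicator A (y((0,0) := t)) = (indicator B t :: ennreal)" for t
   using eqA by (simp add: indicator_def)
  have step: "t <= s ==> \<Phi> (lin (lo k) (y((0,0) := t))) <= \<Phi> (lin (lo k) (y((0,0) := s))) - c * (s - t)" for s t
  proof -
   assume ts: "t <= s"
   \<comment> \<open>The condition \<open>incr\<close> is used with a negative constant, which turns
     monotonicity into a lower bound on the slope.\<close>
   have "\<Phi> (lin (lo k) (y((0,0) := t))) <= \<Phi> (lin (lo k) (y((0,0) := s))) + (- c * (s - t))"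
   proof (rule incrD[OF \<Phi>(1)])
    fix x assume x: "x \<in> K"
    have "lin (lo k) (y((0,0) := u)) x = u * basis (0,0) x + (\<Sum>n\<in>J. y n * basis n x)" for u
    proof -
     have "(\<Sum>n\<in>insert (0, 0) J. (y((0,0) := u)) n * basis n x)
       = (y((0,0) := u)) (0, 0) * basis (0, 0) x + (\<Sum>n\<in>J. (y((0,0) := u)) n * basis n x)"
      using J(2,3) by (rule sum.insert)
     also have "(\<Sum>n\<in>J. (y((0,0) := u)) n * basis n x) = (\<Sum>n\<in>J. y n * basis n x)"
      using J(3) by (intro sum.cong) auto
     finally show ?thesis by (simp add: lin_def J(1))
    qed
    moreover have "c * (s - t) <= basis (0,0) x * (s - t)" using c(2)[OF x] ts by (intro mult_right_mono) auto
    ultimately show "lin (lo k) (y((0,0) := t)) x <= lin (lo k) (y((0,0) := s)) x + (- c * (s - t))"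
     by (simp add: algebra_simps)
   qed (use \<Phi>(2) in auto)
   then show ?thesis by simp
  qed
  have diam: "\<bar>s - t\<bar> <= 2 * \<theta> / c" if "s \<in> B" "t \<in> B" for s t
  proof -
   have *: "c * \<bar>s - t\<bar> <= 2 * \<theta>"
    using that step[of s t] step[of t s] by (cases "s <= t") (auto simp: B_def abs_if split: if_splits)
   then show ?thesis using c(1) by (simp add: field_simps)
  qed
  have "B \<in> sets borel"
  proof -
   have "(%t. y((0,0) := t)) \<in> N1 \<rightarrow>\<^sub>M ?M"
    unfolding J(1)[symmetric] using y by (intro measurable_fun_upd[where J = J]) auto
   then have "(%t. y((0,0) := t)) -` A \<inter> space N1 \<in> sets N1" using A by (rule measurable_sets)
   moreover have "(%t. y((0,0) := t)) -` A \<inter> space N1 = B"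
    using eqA by auto
   ultimately show ?thesis by simp
  qed
  then have "emeasure N1 B <= ennreal (2 * (2 * \<theta> / c))"
   using diam \<theta> c(1) by (intro N1_interval) auto
  moreover have "(\<integral>\<^sup>+t. indicator A (y((0,0) := t)) \<partial>N1) = emeasure N1 B"
   unfolding eqB using \<open>B \<in> sets borel\<close> by simp
  ultimately show "(\<integral>\<^sup>+t. indicator A (y((0,0) := t)) \<partial>N1) <= ennreal (4 * \<theta> / c)" by simp
 qed
 also have "\<dots> = ennreal (4 * \<theta> / c)"
  using prob_space.emeasure_space_1[OF prob_space_PiM[of J "%_. N1"]] prob_space_N1 by simp
 finally have "emeasure ?M A <= ennreal (4 * \<theta> / c)" .
 interpret M: prob_space ?M by (intro prob_space_PiM prob_space_N1)
 from \<open>emeasure ?M A <= ennreal (4 * \<theta> / c)\<close> have "measure ?M A <= 4 * \<theta> / c"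
  using \<theta> c(1) by (simp add: M.emeasure_eq_measure)
 then show ?thesis using prob_PP_restrict[of "lo k" ?Q] A by (simp add: A_def)
qed

lemma basis00_lower:
 assumes "bounded K"
 obtains c where "c > 0" "!!x. x \<in> K ==> c <= basis (0, 0) x"
proof -
 obtain r where r: "!!x. x \<in> K ==> norm x <= r" using assms by (auto simp: bounded_iff)
 show ?thesis
 proof (rule that[of "exp (- (1/2) * r\<^sup>2)"])
  fix x assume "x \<in> K"
  then have "(norm x)\<^sup>2 <= r\<^sup>2" using r by (intro power_mono) auto
  then show "exp (- (1/2) * r\<^sup>2) <= basis (0, 0) x" by (simp add: basis_def)
 qed simp
qed

text \<open>The window bound does not depend on the truncation, so it passes to the field by Fatou's
  lemma; then the window shrinks to a point.\<close>

lemma incr_fld_no_atom: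
 assumes \<Phi>: "incr K \<Phi>" "bounded K"
 shows "PP.prob {z. \<Phi> (fld z) = l} = 0"
proof -
 obtain c where c: "c > 0" "!!x. x \<in> K ==> c <= basis (0, 0) x" using basis00_lower[OF \<Phi>(2)] by blast
 note [measurable] = measurable_incr_fld[OF \<Phi>] measurable_incr_lin[OF \<Phi>]
 have le: "PP.prob {z. \<Phi> (fld z) = l} <= 4 * \<theta> / c" if \<theta>: "\<theta> > 0" for \<theta>
 proof -
  let ?A = "%k. {z. \<bar>\<Phi> (lin (lo k) z) - l\<bar> < \<theta>}"
  let ?B = "{z. \<Phi> (fld z) = l}"
  have Am [measurable]: "?A k \<in> sets PP" for k
  proof -
   have "{z \<in> space PP. \<bar>\<Phi> (lin (lo k) z) - l\<bar> < \<theta>} \<in> sets PP" by measurable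
   then show ?thesis by simp
  qed
  have Bm [measurable]: "?B \<in> sets PP"
  proof -
   have "{z \<in> space PP. \<Phi> (fld z) = l} \<in> sets PP" by measurable
   then show ?thesis by simp
  qed
  have "emeasure PP ?B = (\<integral>\<^sup>+z. indicator ?B z \<partial>PP)" by simp
  also have "\<dots> <= (\<integral>\<^sup>+z. liminf (%k. indicator (?A k) z) \<partial>PP)"
  proof (rule nn_integral_mono_AE)
   show "AE z in PP. indicator ?B z <= liminf (%k. indicator (?A k) z :: ennreal)"
    using AE_good
   proof eventually_elim
    case (elim z)
    show ?case
    proof (cases "z \<in> ?B")
     case True
     have "(%k. \<Phi> (lin (lo k) z)) \<longlonglongrightarrow> l" using incr_lin_tendsto[OF \<Phi> elim] True by simp
     then have "\<forall>\<^sub>F k in sequentially. dist (\<Phi> (lin (lo k) z)) l < \<theta>" using \<theta> by (rule tendstoD)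
     then have "\<forall>\<^sub>F k in sequentially. 1 <= (indicator (?A k) z :: ennreal)"
      by eventually_elim (simp add: dist_real_def indicator_def)
     then have "1 <= liminf (%k. indicator (?A k) z :: ennreal)" by (rule Liminf_bounded)
     then show ?thesis using True by simp
    qed simp
   qed
  qed
  also have "\<dots> <= liminf (%k. \<integral>\<^sup>+z. indicator (?A k) z \<partial>PP)" by (rule nn_integral_liminf) simp
  also have "\<dots> <= ennreal (4 * \<theta> / c)"
  proof (rule Liminf_le)
   show "\<forall>\<^sub>F k in sequentially. (\<integral>\<^sup>+z. indicator (?A k) z \<partial>PP) <= ennreal (4 * \<theta> / c)"
    using eventually_gt_at_top[of 0]
   proof eventually_elim
    case (elim k)
    then show ?case using incr_lin_window[OF \<Phi> c elim \<theta>, of l]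
     by (simp add: PP.emeasure_eq_measure ennreal_leI)
   qed
  qed simp
  finally show ?thesis using \<theta> c(1) by (simp add: PP.emeasure_eq_measure)
 qed
 have "((%\<theta>. 4 * \<theta> / c) \<longlongrightarrow> 4 * 0 / c) (at_right 0)"
  by (intro tendsto_intros) (use c(1) in auto)
 then have "PP.prob {z. \<Phi> (fld z) = l} <= 4 * 0 / c"
  by (rule tendsto_lowerbound) (auto intro!: eventually_at_rightI[of 0 1] le)
 then show ?thesis by (simp add: measure_le_0_iff)
qed

lemma prob_gt_eq_ge:
 assumes \<Phi>: "incr K \<Phi>" "bounded K"
 shows "PP.prob {z. l < \<Phi> (fld z)} = PP.prob {z. l <= \<Phi> (fld z)}"
proof -
 note [measurable] = measurable_incr_fld[OF \<Phi>]
 have "{z \<in> space PP. l < \<Phi> (fld z)} \<in> sets PP" "{z \<in> space PP. \<Phi> (fld z) = l} \<in> sets PP" by measurable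
 then have "PP.prob ({z. l < \<Phi> (fld z)} \<union> {z. \<Phi> (fld z) = l}) = PP.prob {z. l < \<Phi> (fld z)} + PP.prob {z. \<Phi> (fld z) = l}"
  by (intro PP.finite_measure_Union) auto
 moreover have "{z. l < \<Phi> (fld z)} \<union> {z. \<Phi> (fld z) = l} = {z. l <= \<Phi> (fld z)}" by auto
 ultimately show ?thesis using incr_fld_no_atom[OF \<Phi>, of l] by simp
qed

section \<open>Positive association\<close>

text \<open>For monotone functions \<open>(\<phi> x - \<phi> y) * (\<psi> x - \<psi> y)\<close> is
  non-negative; integrate over two independent points.\<close>

lemma chebyshev_correlation:
 fixes \<phi> \<psi> :: "real => real" and M :: "real measure"
 assumes "prob_space M" and m: "\<phi> \<in> borel_measurable M" "\<psi> \<in> borel_measurable M"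
  and b: "!!x. \<bar>\<phi> x\<bar> <= 1" "!!x. \<bar>\<psi> x\<bar> <= 1" and mono: "mono \<phi>" "mono \<psi>"
 shows "integral\<^sup>L M \<phi> * integral\<^sup>L M \<psi> <= (\<integral>x. \<phi> x * \<psi> x \<partial>M)"
proof -
 interpret prob_space M by fact
 note [measurable] = m
 have i [simp]: "integrable M \<phi>" "integrable M \<psi>" "integrable M (%x. \<phi> x * \<psi> x)"
  using b by (auto intro!: integrable_const_bound[where B = 1] simp: abs_mult mult_le_one)
 have "0 <= (\<integral>y. (\<integral>x. (\<phi> x - \<phi> y) * (\<psi> x - \<psi> y) \<partial>M) \<partial>M)"
 proof (intro Bochner_Integration.integral_nonneg)
  fix x y
  show "0 <= (\<phi> x - \<phi> y) * (\<psi> x - \<psi> y)"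
   using monoD[OF mono(1), of x y] monoD[OF mono(2), of x y] monoD[OF mono(1), of y x] monoD[OF mono(2), of y x]
   by (cases "x <= y") (auto simp: mult_nonpos_nonpos)
 qed
 also have "\<dots> = (\<integral>y. expectation (%x. \<phi> x * \<psi> x) - \<psi> y * expectation \<phi> - \<phi> y * expectation \<psi> + \<phi> y * \<psi> y \<partial>M)"
  by (intro Bochner_Integration.integral_cong) (simp_all add: algebra_simps prob_space)
 also have "\<dots> = 2 * (expectation (%x. \<phi> x * \<psi> x) - expectation \<phi> * expectation \<psi>)"
  by (simp add: prob_space algebra_simps)
 finally show ?thesis by simp
qed

text \<open>Induction on the coordinates: integrating one coordinate out keeps monotonicity, and
  within that coordinate Chebyshev's inequality applies.\<close>

lemma harris_PiM:
 fixes N :: "real measure" and \<phi> \<psi> :: "('i => real) => real"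
 assumes N: "prob_space N" "sets N = sets borel" and J: "finite J"
  and m: "\<phi> \<in> borel_measurable (PiM J (%_. N))" "\<psi> \<in> borel_measurable (PiM J (%_. N))"
  and b: "!!x. \<bar>\<phi> x\<bar> <= 1" "!!x. \<bar>\<psi> x\<bar> <= 1"
  and mono: "!!x y. (!!i. i \<in> J ==> x i <= y i) ==> \<phi> x <= \<phi> y" "!!x y. (!!i. i \<in> J ==> x i <= y i) ==> \<psi> x <= \<psi> y"
 shows "(\<integral>x. \<phi> x \<partial>PiM J (%_. N)) * (\<integral>x. \<psi> x \<partial>PiM J (%_. N)) <= (\<integral>x. \<phi> x * \<psi> x \<partial>PiM J (%_. N))"
 using J m b mono
proof (induction J arbitrary: \<phi> \<psi> rule: finite_induct)
 case empty
 then show ?case by (simp add: lebesgue_integral_count_space_finite PiM_empty)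
next
 case (insert i J)
 interpret N: prob_space N by (rule N(1))
 interpret product_sigma_finite "%_::'i. N"
  by (simp add: product_sigma_finite_def N.sigma_finite_measure_axioms)
 let ?J = "PiM J (%_. N)" and ?I = "PiM (insert i J) (%_. N)"
 interpret PJ: prob_space ?J by (intro prob_space_PiM N(1))
 interpret PI: prob_space ?I by (intro prob_space_PiM N(1))
 have spN: "space N = UNIV" using sets_eq_imp_space_eq[OF N(2)] by simp
 have upd: "(%p. (fst p)(i := snd p)) \<in> ?J \<Otimes>\<^sub>M N \<rightarrow>\<^sub>M ?I"
  by (intro measurable_fun_upd[where J = J]) auto
 have mm: "(%(y, t). \<phi>' (y(i := t))) \<in> borel_measurable (?J \<Otimes>\<^sub>M N)" if "\<phi>' \<in> borel_measurable ?I" for \<phi>' :: "('i => real) => real"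
  using measurable_comp[OF upd that] by (simp add: comp_def case_prod_unfold)
 have ms: "(%t. \<phi>' (y(i := t))) \<in> borel_measurable N" if "\<phi>' \<in> borel_measurable ?I" "y \<in> space ?J" for \<phi>' :: "('i => real) => real" and y
  using measurable_Pair2[OF mm[OF that(1)] that(2)] by simp
 \<comment> \<open>The induction hypothesis quantifies over all functions \<open>y\<close>, not only
   those in the space of the product, so outside that space the integral is taken at
   \<open>restrict y J\<close>.\<close>
 define \<phi>1 where "\<phi>1 = (%y. if y \<in> space ?J then \<integral>t. \<phi> (y(i := t)) \<partial>N else \<integral>t. \<phi> ((restrict y J)(i := t)) \<partial>N)"
 define \<psi>1 where "\<psi>1 = (%y. if y \<in> space ?J then \<integral>t. \<psi> (y(i := t)) \<partial>N else \<integral>t. \<psi> ((restrict y J)(i := t)) \<partial>N)"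
 have restr: "y \<in> space ?J ==> restrict y J = y" for y by (auto simp: space_PiM PiE_def extensional_def restrict_def fun_eq_iff)
 have \<phi>1: "\<phi>1 y = (\<integral>t. \<phi> ((restrict y J)(i := t)) \<partial>N)" for y by (simp add: \<phi>1_def restr)
 have \<psi>1: "\<psi>1 y = (\<integral>t. \<psi> ((restrict y J)(i := t)) \<partial>N)" for y by (simp add: \<psi>1_def restr)
 have rs: "restrict y J \<in> space ?J" for y by (simp add: space_PiM spN)
 have int: "integrable N (%t. \<phi>' ((restrict y J)(i := t)))"
  if "\<phi>' \<in> borel_measurable ?I" "!!x. \<bar>\<phi>' x\<bar> <= 1" for \<phi>' :: "('i => real) => real" and y
  using ms[OF that(1) rs] that(2) by (intro N.integrable_const_bound[where B = 1]) auto
 have bd: "\<bar>\<integral>t. \<phi>' ((restrict y J)(i := t)) \<partial>N\<bar> <= 1"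
  if "\<phi>' \<in> borel_measurable ?I" "!!x. \<bar>\<phi>' x\<bar> <= 1" for \<phi>' :: "('i => real) => real" and y
 proof -
  have "\<bar>\<integral>t. \<phi>' ((restrict y J)(i := t)) \<partial>N\<bar> <= (\<integral>t. \<bar>\<phi>' ((restrict y J)(i := t))\<bar> \<partial>N)" by (rule integral_abs_bound)
  also have "\<dots> <= (\<integral>t. 1 \<partial>N)" using int[OF that] that by (intro integral_mono) auto
  finally show ?thesis by (simp add: N.prob_space)
 qed
 have mon: "(\<integral>t. \<phi>' ((restrict x J)(i := t)) \<partial>N) <= (\<integral>t. \<phi>' ((restrict y J)(i := t)) \<partial>N)"
  if "\<phi>' \<in> borel_measurable ?I" "!!x. \<bar>\<phi>' x\<bar> <= 1" "!!x y. (!!j. j \<in> insert i J ==> x j <= y j) ==> \<phi>' x <= \<phi>' y"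
   "!!j. j \<in> J ==> x j <= y j" for \<phi>' :: "('i => real) => real" and x y
  using that int[OF that(1,2)] by (intro integral_mono) auto
 have bm: "(%y. \<integral>t. \<phi>' (y(i := t)) \<partial>N) \<in> borel_measurable ?J" if "\<phi>' \<in> borel_measurable ?I" for \<phi>' :: "('i => real) => real"
  using N.borel_measurable_lebesgue_integral[OF mm[OF that]] by simp
 have m1: "\<phi>1 \<in> borel_measurable ?J" "\<psi>1 \<in> borel_measurable ?J"
 proof -
  have "\<phi>1 w = (\<integral>t. \<phi> (w(i := t)) \<partial>N)" "\<psi>1 w = (\<integral>t. \<psi> (w(i := t)) \<partial>N)" if "w \<in> space ?J" for w
   using that by (simp_all add: \<phi>1_def \<psi>1_def)
  then show "\<phi>1 \<in> borel_measurable ?J" "\<psi>1 \<in> borel_measurable ?J"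
   using measurable_cong[of ?J \<phi>1 "%w. \<integral>t. \<phi> (w(i := t)) \<partial>N" borel] bm[OF insert.prems(1)]
    measurable_cong[of ?J \<psi>1 "%w. \<integral>t. \<psi> (w(i := t)) \<partial>N" borel] bm[OF insert.prems(2)] by blast+
 qed
 have IH: "(\<integral>y. \<phi>1 y \<partial>?J) * (\<integral>y. \<psi>1 y \<partial>?J) <= (\<integral>y. \<phi>1 y * \<psi>1 y \<partial>?J)"
 proof (rule insert.IH)
  show "\<phi>1 \<in> borel_measurable ?J" "\<psi>1 \<in> borel_measurable ?J" by (fact m1)+
  show "\<bar>\<phi>1 y\<bar> <= 1" "\<bar>\<psi>1 y\<bar> <= 1" for y
   unfolding \<phi>1 \<psi>1 by (rule bd[OF insert.prems(1,3)], rule bd[OF insert.prems(2,4)])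
  show "\<phi>1 x <= \<phi>1 y" if "!!j. j \<in> J ==> x j <= y j" for x y
   unfolding \<phi>1 by (rule mon[OF insert.prems(1,3,5) that]) auto
  show "\<psi>1 x <= \<psi>1 y" if "!!j. j \<in> J ==> x j <= y j" for x y
   unfolding \<psi>1 by (rule mon[OF insert.prems(2,4,6) that]) auto
 qed
 have ii: "integrable ?I \<phi>" "integrable ?I \<psi>" "integrable ?I (%x. \<phi> x * \<psi> x)"
  using insert.prems by (auto intro!: PI.integrable_const_bound[where B = 1] simp: abs_mult mult_le_one)
 have split: "(\<integral>x. \<phi>' x \<partial>?I) = (\<integral>y. (\<integral>t. \<phi>' (y(i := t)) \<partial>N) \<partial>?J)" if "integrable ?I \<phi>'" for \<phi>' :: "('i => real) => real"
  using product_integral_insert[OF insert.hyps that] .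
 have e1: "(\<integral>x. \<phi> x \<partial>?I) = (\<integral>y. \<phi>1 y \<partial>?J)" "(\<integral>x. \<psi> x \<partial>?I) = (\<integral>y. \<psi>1 y \<partial>?J)"
  unfolding split[OF ii(1)] split[OF ii(2)]
  by (auto intro!: Bochner_Integration.integral_cong simp: \<phi>1_def \<psi>1_def)
 have "(\<integral>y. \<phi>1 y * \<psi>1 y \<partial>?J) <= (\<integral>y. (\<integral>t. \<phi> (y(i := t)) * \<psi> (y(i := t)) \<partial>N) \<partial>?J)"
 proof (rule integral_mono)
  show "integrable ?J (%y. \<phi>1 y * \<psi>1 y)"
  proof (rule PJ.integrable_const_bound[where B = 1])
   have "\<bar>\<phi>1 y * \<psi>1 y\<bar> <= 1" for y unfolding abs_mult \<phi>1 \<psi>1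
    by (intro mult_le_one bd[OF insert.prems(1,3)] bd[OF insert.prems(2,4)] abs_ge_zero)
   then show "AE y in ?J. norm (\<phi>1 y * \<psi>1 y) <= 1" by simp
   show "(%y. \<phi>1 y * \<psi>1 y) \<in> borel_measurable ?J"
    using m1 by (intro borel_measurable_times)
  qed
  show "integrable ?J (%y. \<integral>t. \<phi> (y(i := t)) * \<psi> (y(i := t)) \<partial>N)"
  proof (rule PJ.integrable_const_bound[where B = 1])
   have mf: "(%x. \<phi> x * \<psi> x) \<in> borel_measurable ?I" using insert.prems by (intro borel_measurable_times)
   have bf: "\<bar>\<phi> x * \<psi> x\<bar> <= 1" for x using insert.prems by (simp add: abs_mult mult_le_one)
   show "AE y in ?J. norm (\<integral>t. \<phi> (y(i := t)) * \<psi> (y(i := t)) \<partial>N) <= 1"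
   proof (rule AE_I2)
    fix y assume "y \<in> space ?J"
    then show "norm (\<integral>t. \<phi> (y(i := t)) * \<psi> (y(i := t)) \<partial>N) <= 1"
     using bd[OF mf bf, of y] by (simp only: restr real_norm_def)
   qed
   show "(%y. \<integral>t. \<phi> (y(i := t)) * \<psi> (y(i := t)) \<partial>N) \<in> borel_measurable ?J" by (rule bm[OF mf])
  qed
  fix y assume y: "y \<in> space ?J"
  show "\<phi>1 y * \<psi>1 y <= (\<integral>t. \<phi> (y(i := t)) * \<psi> (y(i := t)) \<partial>N)"
   unfolding \<phi>1_def \<psi>1_def using y
   by (simp, intro chebyshev_correlation N(1) ms insert.prems monoI) auto
 qed
 also have "\<dots> = (\<integral>x. \<phi> x * \<psi> x \<partial>?I)" using split[OF ii(3)] by simp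
 finally show ?case unfolding e1 using IH by simp
qed

text \<open>Continuous function of slope \<open>m\<close> that approximates the indicator of
  \<open>l < t\<close> from below, for limits that require continuous test functions.\<close>

definition ramp :: "nat => real => real => real" where
 "ramp m l t = min 1 (max 0 (real m * (t - l)))"

lemma ramp_bounds: "0 <= ramp m l t" "ramp m l t <= 1" "\<bar>ramp m l t\<bar> <= 1"
 by (auto simp: ramp_def)

lemma ramp_mono: "s <= t ==> ramp m l s <= ramp m l t"
 unfolding ramp_def by (intro min.mono max.mono mult_left_mono) auto

lemma continuous_ramp [continuous_intros]: "continuous_on A (ramp m l)"
 unfolding ramp_def by (intro continuous_intros)

lemma measurable_ramp [measurable]: "ramp m l \<in> borel_measurable borel"
 by (intro borel_measurable_continuous_onI continuous_intros)

lemma ramp_tendsto: "(%m. ramp m l t) \<longlonglongrightarrow> of_bool (l < t)"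
proof (cases "l < t")
 case True
 then obtain m0 where m0: "1 < real m0 * (t - l)" using reals_Archimedean3[of "t - l"] by auto
 have "\<forall>\<^sub>F m in sequentially. ramp m l t = of_bool (l < t)"
  using eventually_ge_at_top[of m0]
 proof eventually_elim
  case (elim m)
  have "real m0 * (t - l) <= real m * (t - l)" using elim True by (intro mult_right_mono) auto
  then have "1 <= real m * (t - l)" using m0 by linarith
  then show ?case using True by (simp add: ramp_def)
 qed
 then show ?thesis by (rule tendsto_eventually)
next
 case False
 then have "real m * (t - l) <= 0" for m by (simp add: mult_nonneg_nonpos)
 then have "ramp m l t = 0" for m by (simp add: ramp_def)
 then show ?thesis using False by simp
qed

text \<open>In the closed quadrant all basis functions are non-negative, so that increasing functionals of
  the field are increasing in the coefficients.\<close>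

lemma fkg_quadrant:
 assumes \<Phi>: "incr K \<Phi>" and \<Psi>: "incr K \<Psi>" and K: "bounded K" "!!x. x \<in> K ==> 0 <= x $ 1 \<and> 0 <= x $ 2"
 shows "PP.prob {z. l < \<Phi> (fld z)} * PP.prob {z. l' < \<Psi> (fld z)} <= PP.prob {z. l < \<Phi> (fld z) \<and> l' < \<Psi> (fld z)}"
proof -
 note [measurable] = measurable_incr_fld[OF \<Phi> K(1)] measurable_incr_fld[OF \<Psi> K(1)]
  measurable_incr_lin[OF \<Phi> K(1)] measurable_incr_lin[OF \<Psi> K(1)]
 have mono: "\<Theta> (lin J y) <= \<Theta> (lin J z)" if "incr K \<Theta>" "!!n. n \<in> J ==> y n <= z n" for \<Theta> J y z
 proof -
  have "\<Theta> (lin J y) <= \<Theta> (lin J z) + 0"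
  proof (rule incrD[OF that(1)])
   fix x assume x: "x \<in> K"
   then have "0 <= basis n x" for n using K(2)[OF x] by (simp add: basis_def)
   then show "lin J y x <= lin J z x + 0" unfolding lin_def using that(2) by (auto intro!: sum_mono mult_right_mono)
  qed (use K in auto)
  then show ?thesis by simp
 qed
 \<comment> \<open>Fixed truncation and slope. The truncation is removed next, while the test
   functions are still continuous; the slope goes to infinity last.\<close>
 have fin: "EE (%z. ramp m l (\<Phi> (lin (lo k) z))) * EE (%z. ramp m l' (\<Psi> (lin (lo k) z)))
  <= EE (%z. ramp m l (\<Phi> (lin (lo k) z)) * ramp m l' (\<Psi> (lin (lo k) z)))" for m k
 proof -
  let ?M = "PiM (lo k) (%_. N1)"
  note [measurable] = measurable_incr_lin_PiM[OF \<Phi> K(1), of "lo k"] measurable_incr_lin_PiM[OF \<Psi> K(1), of "lo k"]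
  have tr: "EE h = (\<integral>z. h z \<partial>?M)" if "h \<in> borel_measurable ?M" "!!z. h (restrict z (lo k)) = h z" for h :: "_ => real"
  proof -
   have "(\<integral>z. h z \<partial>distr PP ?M (%z. restrict z (lo k))) = EE (%z. h (restrict z (lo k)))"
    by (rule integral_distr) (use that in auto)
   then show ?thesis using that distr_PP_restrict[OF finite_lo[of k]] by simp
  qed
  have "(\<integral>z. ramp m l (\<Phi> (lin (lo k) z)) \<partial>?M) * (\<integral>z. ramp m l' (\<Psi> (lin (lo k) z)) \<partial>?M)
   <= (\<integral>z. ramp m l (\<Phi> (lin (lo k) z)) * ramp m l' (\<Psi> (lin (lo k) z)) \<partial>?M)"
   by (rule harris_PiM[OF prob_space_N1]) (auto simp: ramp_bounds intro!: ramp_mono mono \<Phi> \<Psi>)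
  then show ?thesis by (subst (1 2 3) tr) auto
 qed
 have lim1: "EE (%z. ramp m l (\<Phi> (fld z))) * EE (%z. ramp m l' (\<Psi> (fld z)))
  <= EE (%z. ramp m l (\<Phi> (fld z)) * ramp m l' (\<Psi> (fld z)))" for m
 proof (rule LIMSEQ_le[OF tendsto_mult])
  have conv: "(%k. ramp m l (\<Theta> (lin (lo k) z))) \<longlonglongrightarrow> ramp m l (\<Theta> (fld z))" if "incr K \<Theta>" "good z" for \<Theta> l z
   using continuous_on_tendsto_compose[OF continuous_ramp[of UNIV m l] incr_lin_tendsto[OF that(1) K(1) that(2)]] by simp
  show "(%k. EE (%z. ramp m l (\<Phi> (lin (lo k) z)))) \<longlonglongrightarrow> EE (%z. ramp m l (\<Phi> (fld z)))"
   by (rule integral_dominated_convergence[where w = "%_. 1"])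
     (use AE_good conv[OF \<Phi>] in \<open>auto simp: ramp_bounds\<close>)
  show "(%k. EE (%z. ramp m l' (\<Psi> (lin (lo k) z)))) \<longlonglongrightarrow> EE (%z. ramp m l' (\<Psi> (fld z)))"
   by (rule integral_dominated_convergence[where w = "%_. 1"])
     (use AE_good conv[OF \<Psi>] in \<open>auto simp: ramp_bounds\<close>)
  show "(%k. EE (%z. ramp m l (\<Phi> (lin (lo k) z)) * ramp m l' (\<Psi> (lin (lo k) z)))) \<longlonglongrightarrow> EE (%z. ramp m l (\<Phi> (fld z)) * ramp m l' (\<Psi> (fld z)))"
   by (rule integral_dominated_convergence[where w = "%_. 1"])
     (use AE_good in \<open>auto simp: ramp_bounds abs_mult mult_le_one intro!: tendsto_mult conv \<Phi> \<Psi>\<close>)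
 qed (use fin in auto)
 have ind: "EE (%z. of_bool (Q z) :: real) = PP.prob {z. Q z}" if "{z. Q z} \<in> sets PP" for Q
 proof -
  have "(%z. of_bool (Q z) :: real) = indicator {z. Q z}" by (auto simp: indicator_def fun_eq_iff)
  then show ?thesis using that by simp
 qed
 have sets: "{z. l < \<Phi> (fld z)} \<in> sets PP" "{z. l' < \<Psi> (fld z)} \<in> sets PP" "{z. l < \<Phi> (fld z) \<and> l' < \<Psi> (fld z)} \<in> sets PP"
 proof -
  have "{z \<in> space PP. l < \<Phi> (fld z)} \<in> sets PP" "{z \<in> space PP. l' < \<Psi> (fld z)} \<in> sets PP" "{z \<in> space PP. l < \<Phi> (fld z) \<and> l' < \<Psi> (fld z)} \<in> sets PP"
   by measurable
  then show "{z. l < \<Phi> (fld z)} \<in> sets PP" "{z. l' < \<Psi> (fld z)} \<in> sets PP" "{z. l < \<Phi> (fld z) \<and> l' < \<Psi> (fld z)} \<in> sets PP" by simp_all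
 qed
 have "EE (%z. of_bool (l < \<Phi> (fld z)) :: real) * EE (%z. of_bool (l' < \<Psi> (fld z)))
  <= EE (%z. of_bool (l < \<Phi> (fld z) \<and> l' < \<Psi> (fld z)))"
 proof (rule LIMSEQ_le[OF tendsto_mult])
  show "(%m. EE (%z. ramp m l (\<Phi> (fld z)))) \<longlonglongrightarrow> EE (%z. of_bool (l < \<Phi> (fld z)))"
   by (rule integral_dominated_convergence[where w = "%_. 1"]) (auto simp: ramp_bounds ramp_tendsto)
  show "(%m. EE (%z. ramp m l' (\<Psi> (fld z)))) \<longlonglongrightarrow> EE (%z. of_bool (l' < \<Psi> (fld z)))"
   by (rule integral_dominated_convergence[where w = "%_. 1"]) (auto simp: ramp_bounds ramp_tendsto)
  show "(%m. EE (%z. ramp m l (\<Phi> (fld z)) * ramp m l' (\<Psi> (fld z)))) \<longlonglongrightarrow> EE (%z. of_bool (l < \<Phi> (fld z) \<and> l' < \<Psi> (fld z)))"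
   unfolding of_bool_conj
  proof (rule integral_dominated_convergence[where w = "%_. 1"])
   show "AE z in PP. (%m. ramp m l (\<Phi> (fld z)) * ramp m l' (\<Psi> (fld z))) \<longlonglongrightarrow> of_bool (l < \<Phi> (fld z)) * of_bool (l' < \<Psi> (fld z))"
    by (intro AE_I2 tendsto_mult ramp_tendsto)
  qed (auto simp: ramp_bounds abs_mult mult_le_one)
 qed (use lim1 in auto)
 then show ?thesis by (simp add: ind sets)
qed

section \<open>Invariance of the law\<close>

text \<open>Divided by their common mean, the weights are densities. The phases \<open>0\<close> and
  \<open>- pi / 2\<close> give the real and imaginary parts of the characteristic function of
  \<open>X\<close> under the weighted law, so Levy's uniqueness theorem applies; if the common mean
  is 0, both sides vanish.\<close>

lemma (in prob_space) weighted_cos_unique: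
 fixes X X' W W' :: "'a => real"
 assumes m [measurable]: "X \<in> borel_measurable M" "X' \<in> borel_measurable M" "W \<in> borel_measurable M" "W' \<in> borel_measurable M"
  and b: "!!\<omega>. 0 <= W \<omega> \<and> W \<omega> <= B" "!!\<omega>. 0 <= W' \<omega> \<and> W' \<omega> <= B"
  and eq: "!!s \<psi>. expectation (%\<omega>. W \<omega> * cos (\<psi> + s * X \<omega>)) = expectation (%\<omega>. W' \<omega> * cos (\<psi> + s * X' \<omega>))"
  and A [measurable]: "A \<in> sets borel"
 shows "expectation (%\<omega>. W \<omega> * indicator A (X \<omega>)) = expectation (%\<omega>. W' \<omega> * indicator A (X' \<omega>))"
proof -
 define c where "c = expectation W"
 have c': "c = expectation W'" using eq[of 0 0] by (simp add: c_def)
 have iW: "integrable M W" "integrable M W'"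
  using b by (auto intro!: integrable_const_bound[where B = B])
 have c0: "c >= 0" unfolding c_def using b by (intro Bochner_Integration.integral_nonneg) auto
 show ?thesis
 proof (cases "c = 0")
  case True
  have "expectation (%\<omega>. V \<omega> * indicator A (Y \<omega>)) = 0"
   if "integrable M V" "expectation V = 0" "!!\<omega>. 0 <= V \<omega>" for V :: "'a => real" and Y :: "'a => real"
  proof -
   have "AE \<omega> in M. V \<omega> = 0" using integral_nonneg_eq_0_iff_AE[OF that(1)] that by auto
   then have "AE \<omega> in M. V \<omega> * indicator A (Y \<omega>) = 0" by eventually_elim simp
   then show ?thesis by (rule integral_eq_zero_AE)
  qed
  from this[of W] this[of W'] show ?thesis using True c' c_def iW b by auto
 next
  case False
  then have cp: "c > 0" using c0 by simp
  define mk where "mk V Y = distr (density M (%\<omega>. ennreal (V \<omega> / c))) borel Y" for V Y :: "'a => real"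
  have rd: "real_distribution (mk V Y)"
   and int: "!!g :: real => real. g \<in> borel_measurable borel ==> (\<integral>x. g x \<partial>mk V Y) = expectation (%\<omega>. V \<omega> * g (Y \<omega>)) / c"
   and ch: "!!t. char (mk V Y) t = Complex (expectation (%\<omega>. V \<omega> * cos (0 + t * Y \<omega>)) / c) (expectation (%\<omega>. V \<omega> * cos (- (pi / 2) + t * Y \<omega>)) / c)"
   if V: "V \<in> borel_measurable M" "!!\<omega>. 0 <= V \<omega> \<and> V \<omega> <= B" "expectation V = c" and Y: "Y \<in> borel_measurable M" for V Y
  proof -
   note [measurable] = V(1) Y
   have iV: "integrable M V" using V by (auto intro!: integrable_const_bound[where B = B])
   have "emeasure (density M (%\<omega>. ennreal (V \<omega> / c))) (space M) = (\<integral>\<^sup>+\<omega>. ennreal (V \<omega> / c) \<partial>M)"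
    by (subst emeasure_density) (auto intro!: nn_integral_cong)
   also have "\<dots> = ennreal (expectation (%\<omega>. V \<omega> / c))"
    using iV V cp by (intro nn_integral_eq_integral) auto
   also have "\<dots> = 1" using V(3) cp by simp
   finally have "prob_space (density M (%\<omega>. ennreal (V \<omega> / c)))" by (intro prob_spaceI) simp
   then interpret D: prob_space "density M (%\<omega>. ennreal (V \<omega> / c))" .
   have "Y \<in> borel_measurable (density M (%\<omega>. ennreal (V \<omega> / c)))" by simp
   then show rd: "real_distribution (mk V Y)" unfolding mk_def by (rule D.real_distribution_distr)
   show int: "(\<integral>x. g x \<partial>mk V Y) = expectation (%\<omega>. V \<omega> * g (Y \<omega>)) / c" if [measurable]: "g \<in> borel_measurable borel" for g :: "real => real"
   proof -
    have "(\<integral>x. g x \<partial>mk V Y) = (\<integral>\<omega>. g (Y \<omega>) \<partial>density M (%\<omega>. ennreal (V \<omega> / c)))"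
     unfolding mk_def by (rule integral_distr) auto
    also have "\<dots> = expectation (%\<omega>. (V \<omega> / c) *\<^sub>R g (Y \<omega>))"
     using V cp by (intro integral_density) auto
    also have "\<dots> = expectation (%\<omega>. V \<omega> * g (Y \<omega>)) / c" by simp
    finally show ?thesis .
   qed
   show "char (mk V Y) t = Complex (expectation (%\<omega>. V \<omega> * cos (0 + t * Y \<omega>)) / c) (expectation (%\<omega>. V \<omega> * cos (- (pi / 2) + t * Y \<omega>)) / c)" for t
   proof -
    interpret R: real_distribution "mk V Y" by (rule rd)
    have i: "integrable (mk V Y) (%x. iexp (t * x))" by (intro R.integrable_const_bound[where B = 1]) auto
    have "Re (char (mk V Y) t) = (\<integral>x. Re (iexp (t * x)) \<partial>mk V Y)" unfolding char_def by (rule integral_Re[OF i, symmetric])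
    also have "\<dots> = (\<integral>x. cos (t * x) \<partial>mk V Y)" by (simp add: Re_exp)
    finally have r: "Re (char (mk V Y) t) = expectation (%\<omega>. V \<omega> * cos (0 + t * Y \<omega>)) / c" by (simp add: int)
    have "Im (char (mk V Y) t) = (\<integral>x. Im (iexp (t * x)) \<partial>mk V Y)" unfolding char_def by (rule integral_Im[OF i, symmetric])
    also have "\<dots> = (\<integral>x. cos (- (pi / 2) + t * x) \<partial>mk V Y)" by (simp add: Im_exp cos_diff add.commute[of "- (pi/2)"])
    finally have "Im (char (mk V Y) t) = expectation (%\<omega>. V \<omega> * cos (- (pi / 2) + t * Y \<omega>)) / c" by (subst (asm) int) auto
    with r show ?thesis by (simp add: complex_eq_iff)
   qed
  qed
  have "char (mk W X) t = char (mk W' X') t" for t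
   unfolding ch[OF m(3) b(1) c_def[symmetric] m(1)] ch[OF m(4) b(2) c'[symmetric] m(2)] eq ..
  then have "char (mk W X) = char (mk W' X')" by (rule ext)
  then have "mk W X = mk W' X'"
   using rd[of W X] rd[of W' X'] b c' c_def by (intro Levy_uniqueness) auto
  then have "(\<integral>x. indicator A x \<partial>mk W X) = (\<integral>x. indicator A x \<partial>mk W' X' :: real)" by simp
  then show ?thesis using int[of W X "indicator A"] int[of W' X' "indicator A"] b c' c_def cp by simp
 qed
qed

lemma cos_product: "cos a * cos b = (cos (a + b) + cos (a - b)) / 2" for a b :: real
 by (simp add: cos_add cos_diff)

text \<open>Uniqueness for vectors from the one-dimensional case: coordinate by coordinate the
  cosine is exchanged for indicators, while the coordinates not yet treated stay inside a
  cosine.\<close>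

lemma (in prob_space) joint_cos_unique:
 fixes Y Y' :: "'v => 'a => real"
 assumes V: "finite V" and m [measurable]: "!!v. Y v \<in> borel_measurable M" "!!v. Y' v \<in> borel_measurable M"
  and eq: "!!t \<theta>. expectation (%\<omega>. cos (\<theta> + (\<Sum>v\<in>V. t v * Y v \<omega>))) = expectation (%\<omega>. cos (\<theta> + (\<Sum>v\<in>V. t v * Y' v \<omega>)))"
 shows "distr M (PiM V (%_. borel)) (%\<omega>. \<lambda>v\<in>V. Y v \<omega>) = distr M (PiM V (%_. borel)) (%\<omega>. \<lambda>v\<in>V. Y' v \<omega>)"
proof -
 have main: "J \<subseteq> V ==> (!!v. A v \<in> sets borel) ==>
  expectation (%\<omega>. (\<Prod>v\<in>J. indicator (A v) (Y v \<omega>)) * cos (\<theta> + (\<Sum>v\<in>V - J. t v * Y v \<omega>)))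
  = expectation (%\<omega>. (\<Prod>v\<in>J. indicator (A v) (Y' v \<omega>)) * cos (\<theta> + (\<Sum>v\<in>V - J. t v * Y' v \<omega>)))"
  if "finite J" for J A t \<theta>
  using that
 proof (induction J arbitrary: A t \<theta> rule: finite_induct)
  case empty
  then show ?case using eq by simp
 next
  case (insert w J)
  note [measurable] = insert.prems(2)
  define R where "R = V - insert w J"
  have w: "w \<in> V" "w \<notin> J" and VJ: "V - J = insert w R" "finite R" "w \<notin> R" using insert V by (auto simp: R_def)
  define G where "G Z \<omega> = (\<Prod>v\<in>J. indicator (A v) (Z v \<omega>) :: real)" for Z :: "'v => 'a => real" and \<omega>
  define S where "S Z \<omega> = \<theta> + (\<Sum>v\<in>R. t v * Z v \<omega>)" for Z :: "'v => 'a => real" and \<omega>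
  have Gm [measurable]: "G Y \<in> borel_measurable M" "G Y' \<in> borel_measurable M" unfolding G_def by measurable
  have Sm [measurable]: "S Y \<in> borel_measurable M" "S Y' \<in> borel_measurable M" unfolding S_def by measurable
  have G: "0 <= G Z \<omega> \<and> G Z \<omega> <= 1" for Z \<omega> unfolding G_def by (auto intro!: prod_nonneg prod_le_1)
  have ip: "integrable M (%\<omega>. G Z \<omega> * cos (h \<omega>))" if "G Z \<in> borel_measurable M" "h \<in> borel_measurable M" for Z h
   using that G by (intro integrable_const_bound[where B = 1]) (auto simp: abs_mult intro!: mult_le_one)
  have IH: "expectation (%\<omega>. G Y \<omega> * cos (\<psi> + \<epsilon> * S Y \<omega> + s * Y w \<omega>)) = expectation (%\<omega>. G Y' \<omega> * cos (\<psi> + \<epsilon> * S Y' \<omega> + s * Y' w \<omega>))" for \<psi> s \<epsilon>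
  proof -
   have e: "\<psi> + \<epsilon> * S Z \<omega> + s * Z w \<omega> = (\<psi> + \<epsilon> * \<theta>) + (\<Sum>v\<in>V - J. (if v = w then s else \<epsilon> * t v) * Z v \<omega>)" for Z \<omega>
   proof -
    have "(\<Sum>v\<in>insert w R. (if v = w then s else \<epsilon> * t v) * Z v \<omega>) = s * Z w \<omega> + (\<Sum>v\<in>R. \<epsilon> * t v * Z v \<omega>)"
     using VJ by (subst sum.insert) (auto intro!: sum.cong)
    then show ?thesis unfolding VJ(1) by (simp add: S_def algebra_simps sum_distrib_left)
   qed
   show ?thesis unfolding e G_def using insert.prems by (intro insert.IH) auto
  qed
  \<comment> \<open>The one-dimensional lemma needs a non-negative weight, so \<open>cos\<close> is
    replaced by \<open>1 + cos\<close>; the extra term is subtracted at the end.\<close>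
  have Wb: "0 <= G Z \<omega> * (1 + cos (S Z \<omega>)) \<and> G Z \<omega> * (1 + cos (S Z \<omega>)) <= 2" for Z \<omega>
  proof -
   have "0 <= 1 + cos (S Z \<omega>)" "1 + cos (S Z \<omega>) <= 2"
    using cos_ge_minus_one[of "S Z \<omega>"] cos_le_one[of "S Z \<omega>"] by linarith+
   then show ?thesis using G[of Z \<omega>] mult_mono[of "G Z \<omega>" 1 "1 + cos (S Z \<omega>)" 2] by auto
  qed
  \<comment> \<open>The product formula turns weight times cosine back into cosines of linear forms,
    to which the induction hypothesis applies with \<open>\<epsilon>\<close> equal to 0, 1 and
    -1.\<close>
  have expand: "expectation (%\<omega>. G Z \<omega> * (1 + cos (S Z \<omega>)) * cos (\<psi> + s * Z w \<omega>)) =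
    expectation (%\<omega>. G Z \<omega> * cos (\<psi> + 0 * S Z \<omega> + s * Z w \<omega>)) +
    (expectation (%\<omega>. G Z \<omega> * cos (\<psi> + 1 * S Z \<omega> + s * Z w \<omega>)) + expectation (%\<omega>. G Z \<omega> * cos (\<psi> + (- 1) * S Z \<omega> + s * Z w \<omega>))) / 2"
   if [measurable]: "G Z \<in> borel_measurable M" "S Z \<in> borel_measurable M" "Z w \<in> borel_measurable M" for Z \<psi> s
  proof -
   have p: "G Z \<omega> * (1 + cos (S Z \<omega>)) * cos (\<psi> + s * Z w \<omega>) = G Z \<omega> * cos (\<psi> + 0 * S Z \<omega> + s * Z w \<omega>) +
     (G Z \<omega> * cos (\<psi> + 1 * S Z \<omega> + s * Z w \<omega>) + G Z \<omega> * cos (\<psi> + (- 1) * S Z \<omega> + s * Z w \<omega>)) / 2" for \<omega>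
   proof -
    have "cos (\<psi> + s * Z w \<omega>) * cos (S Z \<omega>) = (cos (\<psi> + 1 * S Z \<omega> + s * Z w \<omega>) + cos (\<psi> + (- 1) * S Z \<omega> + s * Z w \<omega>)) / 2"
     unfolding cos_product by (simp add: algebra_simps)
    then show ?thesis by (simp add: algebra_simps)
   qed
   show ?thesis unfolding p by (simp add: ip)
  qed
  have "expectation (%\<omega>. G Y \<omega> * (1 + cos (S Y \<omega>)) * indicator (A w) (Y w \<omega>)) = expectation (%\<omega>. G Y' \<omega> * (1 + cos (S Y' \<omega>)) * indicator (A w) (Y' w \<omega>))"
  proof (rule weighted_cos_unique[OF _ _ _ _ Wb Wb])
   show "expectation (%\<omega>. G Y \<omega> * (1 + cos (S Y \<omega>)) * cos (\<psi> + s * Y w \<omega>)) = expectation (%\<omega>. G Y' \<omega> * (1 + cos (S Y' \<omega>)) * cos (\<psi> + s * Y' w \<omega>))" for \<psi> s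
    by (simp only: expand[OF Gm(1) Sm(1) m(1)] expand[OF Gm(2) Sm(2) m(2)] IH)
  qed auto
  moreover have "expectation (%\<omega>. G Y \<omega> * indicator (A w) (Y w \<omega>)) = expectation (%\<omega>. G Y' \<omega> * indicator (A w) (Y' w \<omega>))"
   using IH[of _ 0] by (intro weighted_cos_unique[OF _ _ _ _ G G]) auto
  moreover have "expectation (%\<omega>. G Z \<omega> * (1 + cos (S Z \<omega>)) * indicator (A w) (Z w \<omega>)) =
    expectation (%\<omega>. G Z \<omega> * indicator (A w) (Z w \<omega>)) + expectation (%\<omega>. G Z \<omega> * indicator (A w) (Z w \<omega>) * cos (S Z \<omega>))"
   if [measurable]: "G Z \<in> borel_measurable M" "S Z \<in> borel_measurable M" "Z w \<in> borel_measurable M" for Z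
  proof -
   have "expectation (%\<omega>. G Z \<omega> * (1 + cos (S Z \<omega>)) * indicator (A w) (Z w \<omega>)) =
     expectation (%\<omega>. G Z \<omega> * indicator (A w) (Z w \<omega>) + G Z \<omega> * indicator (A w) (Z w \<omega>) * cos (S Z \<omega>))"
    by (simp add: algebra_simps)
   also have "\<dots> = expectation (%\<omega>. G Z \<omega> * indicator (A w) (Z w \<omega>)) + expectation (%\<omega>. G Z \<omega> * indicator (A w) (Z w \<omega>) * cos (S Z \<omega>))"
    using G by (intro Bochner_Integration.integral_add integrable_const_bound[where B = 1]) (auto simp: abs_mult intro!: mult_le_one AE_I2)
   finally show ?thesis .
  qed
  ultimately have "expectation (%\<omega>. G Y \<omega> * indicator (A w) (Y w \<omega>) * cos (S Y \<omega>)) = expectation (%\<omega>. G Y' \<omega> * indicator (A w) (Y' w \<omega>) * cos (S Y' \<omega>))"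
   by simp
  then show ?case
   using insert.hyps by (simp add: G_def S_def R_def[symmetric] mult.commute)
 qed
 let ?D = "%Z. distr M (PiM V (%_. borel)) (%\<omega>. \<lambda>v\<in>V. Z v \<omega>)"
 show ?thesis
 proof (rule measure_eqI_PiM_finite[OF V])
  fix A assume A: "!!v. v \<in> V ==> A v \<in> sets (borel :: real measure)"
  define A' where "A' v = (if v \<in> V then A v else {})" for v
  have A': "A' v \<in> sets borel" for v using A by (simp add: A'_def)
  have e: "emeasure (?D Z) (Pi\<^sub>E V A) = ennreal (expectation (%\<omega>. (\<Prod>v\<in>V. indicator (A' v) (Z v \<omega>))))"
   if [measurable]: "!!v. Z v \<in> borel_measurable M" for Z
  proof -
   have "emeasure (?D Z) (Pi\<^sub>E V A) = emeasure M ((%\<omega>. \<lambda>v\<in>V. Z v \<omega>) -` Pi\<^sub>E V A \<inter> space M)"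
    using A V by (intro emeasure_distr sets_PiM_I_finite) auto
   also have "\<dots> = (\<integral>\<^sup>+\<omega>. indicator ((%\<omega>. \<lambda>v\<in>V. Z v \<omega>) -` Pi\<^sub>E V A \<inter> space M) \<omega> \<partial>M)"
   proof (rule nn_integral_indicator[symmetric])
    have "(%\<omega>. \<lambda>v\<in>V. Z v \<omega>) \<in> M \<rightarrow>\<^sub>M PiM V (%_. borel)" by measurable
    moreover have "Pi\<^sub>E V A \<in> sets (PiM V (%_. borel))" using A V by (intro sets_PiM_I_finite) auto
    ultimately show "(%\<omega>. \<lambda>v\<in>V. Z v \<omega>) -` Pi\<^sub>E V A \<inter> space M \<in> events"
     by (rule measurable_sets)
   qed
   also have "\<dots> = (\<integral>\<^sup>+\<omega>. ennreal (\<Prod>v\<in>V. indicator (A' v) (Z v \<omega>)) \<partial>M)"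
   proof (rule nn_integral_cong)
    fix \<omega> assume "\<omega> \<in> space M"
    have "(\<Prod>v\<in>V. indicator (A' v) (Z v \<omega>) :: real) = (if \<forall>v\<in>V. Z v \<omega> \<in> A v then 1 else 0)"
     using V by (auto simp: A'_def indicator_def intro!: prod.neutral)
    then show "indicator ((%\<omega>. \<lambda>v\<in>V. Z v \<omega>) -` Pi\<^sub>E V A \<inter> space M) \<omega> = ennreal (\<Prod>v\<in>V. indicator (A' v) (Z v \<omega>))"
     using \<open>\<omega> \<in> space M\<close> by (auto simp: indicator_def PiE_iff)
   qed
   also have "\<dots> = ennreal (expectation (%\<omega>. (\<Prod>v\<in>V. indicator (A' v) (Z v \<omega>))))"
   proof (rule nn_integral_eq_integral)
    have [measurable]: "A' v \<in> sets borel" for v by (rule A')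
    show "integrable M (%\<omega>. (\<Prod>v\<in>V. indicator (A' v) (Z v \<omega>)) :: real)"
     by (intro integrable_const_bound[where B = 1]) (auto simp: abs_prod intro!: prod_le_1)
   qed (auto intro!: prod_nonneg)
   finally show ?thesis .
  qed
  show "emeasure (?D Y) (Pi\<^sub>E V A) = emeasure (?D Y') (Pi\<^sub>E V A)"
  proof -
   have "expectation (%\<omega>. (\<Prod>v\<in>V. indicator (A' v) (Y v \<omega>)) * cos (0 + (\<Sum>v\<in>V - V. 0 * Y v \<omega>)))
    = expectation (%\<omega>. (\<Prod>v\<in>V. indicator (A' v) (Y' v \<omega>)) * cos (0 + (\<Sum>v\<in>V - V. 0 * Y' v \<omega>)))"
    by (rule main[OF V order_refl A'])
   then show ?thesis using e[OF m(1)] e[OF m(2)] by simp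
  qed
 next
  have sp: "Pi\<^sub>E V (%_. UNIV) \<in> prod_algebra V (%_. borel :: real measure)"
   using V by (intro prod_algebraI_finite) auto
  then show "range (%_::nat. Pi\<^sub>E V (%_. UNIV)) \<subseteq> prod_algebra V (%_. borel :: real measure)" by auto
  show "(\<Union>i::nat. Pi\<^sub>E V (%_. UNIV)) = space (PiM V (%_. borel :: real measure))" by (simp add: space_PiM)
  have "(%\<omega>. \<lambda>v\<in>V. Y v \<omega>) \<in> M \<rightarrow>\<^sub>M PiM V (%_. borel)" by measurable
  then interpret D: prob_space "?D Y" by (rule prob_space_distr)
  show "emeasure (?D Y) (Pi\<^sub>E V (%_. UNIV)) ~= \<infinity>" by simp
 qed simp_all
qed

section \<open>The covariance kernel\<close>

text \<open>The double series factorises into two exponential series in the coordinates, whose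
  product is the exponential of the scalar product; completing the square with the two Gaussian
  factors gives the stationary covariance.\<close>

lemma kernel_has_sum: "((%n. basis n x * basis n y) has_sum exp (- (1 / 2) * (norm (x - y))\<^sup>2)) UNIV"
proof -
 define r where "r = max (norm x) (norm y)"
 have r: "norm x <= r" "norm y <= r" "0 <= r" by (auto simp: r_def max.coboundedI1)
 let ?f = "%n. basis n x * basis n y"
 have summ: "?f summable_on UNIV"
 proof (rule abs_summable_on_comparison)
  show "(%n. exp (4 * r\<^sup>2) * wt r n) summable_on UNIV" using wt_summable[OF r(3)] by (rule summable_on_cmult_right)
  fix n
  have "\<bar>basis n x\<bar> <= exp (4 * r\<^sup>2)"
  proof -
   have "exp (4 * r\<^sup>2) / sqrt 4 ^ (fst n + snd n) <= exp (4 * r\<^sup>2) / 1" by (intro divide_left_mono) auto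
   then show ?thesis using abs_basis_le_wt[OF r(1), of n] wt_bound[of 4 r n] r by simp
  qed
  then show "\<bar>?f n\<bar> <= exp (4 * r\<^sup>2) * wt r n"
   unfolding abs_mult using abs_basis_le_wt[OF r(2), of n] by (intro mult_mono) auto
 qed
 then have hs: "(?f has_sum infsum ?f UNIV) UNIV" by (rule has_sum_infsum)
 \<comment> \<open>Squares rather than the triangles \<open>lo k\<close>, because a sum over a
   square is a product of two partial sums.\<close>
 define sq where "sq k = {..<k} \<times> {..<k}" for k :: nat
 have "filterlim sq (finite_subsets_at_top UNIV) sequentially"
  unfolding filterlim_def le_filter_def eventually_filtermap
 proof (intro allI impI)
  fix P :: "(nat \<times> nat) set => bool"
  assume "eventually P (finite_subsets_at_top UNIV)"
  then obtain X where X: "finite X" "!!Y. finite Y ==> X \<subseteq> Y ==> P Y"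
   by (auto simp: eventually_finite_subsets_at_top)
  obtain k where k: "!!n. n \<in> X ==> fst n + snd n < k"
   using finite_nat_set_iff_bounded[of "(%n. fst n + snd n) ` X"] X(1) by auto
  show "\<forall>\<^sub>F m in sequentially. P (sq m)"
   using eventually_ge_at_top[of k]
  proof eventually_elim
   case (elim m)
   have "X \<subseteq> sq m" using elim by (fastforce simp: sq_def dest!: k)
   then show ?case by (intro X(2)) (simp_all add: sq_def)
  qed
 qed
 then have l1: "(%k. sum ?f (sq k)) \<longlonglongrightarrow> infsum ?f UNIV"
  using hs unfolding has_sum_def by (rule filterlim_compose[rotated])
 define c where "c = exp (- (1 / 2) * (norm x)\<^sup>2) * exp (- (1 / 2) * (norm y)\<^sup>2)"
 have s: "sum ?f (sq k) = c * ((\<Sum>i<k. (x $ 1 * y $ 1) ^ i /\<^sub>R fact i) * (\<Sum>j<k. (x $ 2 * y $ 2) ^ j /\<^sub>R fact j))" for k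
 proof -
  have "?f (i, j) = c * (((x $ 1 * y $ 1) ^ i /\<^sub>R fact i) * ((x $ 2 * y $ 2) ^ j /\<^sub>R fact j))" for i j
  proof -
   have "sqrt (fact i * fact j) * sqrt (fact i * fact j) = (fact i * fact j :: real)" by (simp add: real_sqrt_mult_self)
   then show ?thesis by (simp add: basis_def c_def power_mult_distrib divide_simps)
  qed
  moreover have "sum ?f (sq k) = (\<Sum>i<k. \<Sum>j<k. ?f (i, j))"
   unfolding sq_def by (simp only: sum.cartesian_product case_prod_unfold prod.collapse)
  ultimately show ?thesis by (subst sum_product) (simp only: sum_distrib_left)
 qed
 have "(%k. sum ?f (sq k)) \<longlonglongrightarrow> c * (exp (x $ 1 * y $ 1) * exp (x $ 2 * y $ 2))"
  unfolding s using exp_converges[of "x $ 1 * y $ 1"] exp_converges[of "x $ 2 * y $ 2"]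
  unfolding sums_def by (intro tendsto_intros)
 then have "infsum ?f UNIV = c * (exp (x $ 1 * y $ 1) * exp (x $ 2 * y $ 2))" using l1 LIMSEQ_unique by blast
 also have "\<dots> = exp (- (1 / 2) * (norm (x - y))\<^sup>2)"
 proof -
  have "(norm (x - y))\<^sup>2 = (norm x)\<^sup>2 + (norm y)\<^sup>2 - 2 * (x $ 1 * y $ 1 + x $ 2 * y $ 2)"
  proof -
   have n: "(norm v)\<^sup>2 = (v $ 1)\<^sup>2 + (v $ 2)\<^sup>2" for v :: "real ^ 2"
    by (simp add: norm_vec_def L2_set_def sum_2)
   show ?thesis unfolding n by (simp add: power2_eq_square algebra_simps)
  qed
  then have "- (1 / 2) * (norm (x - y))\<^sup>2 = - (1 / 2) * (norm x)\<^sup>2 + - (1 / 2) * (norm y)\<^sup>2 + x $ 1 * y $ 1 + x $ 2 * y $ 2"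
   by (simp add: field_simps)
  then show ?thesis unfolding c_def by (simp only: exp_add mult.assoc)
 qed
 finally show ?thesis using hs by simp
qed

text \<open>Variance of the linear combination of field values at the points \<open>\<tau> v\<close>
  with coefficients \<open>t v\<close>.\<close>

definition qform :: "'v set => ('v => real ^ 2) => ('v => real) => real" where
 "qform V \<tau> t = (\<Sum>v\<in>V. \<Sum>w\<in>V. t v * t w * exp (- (1 / 2) * (norm (\<tau> v - \<tau> w))\<^sup>2))"

lemma PP_linear_cos:
 assumes "finite J"
 shows "PP.expectation (%z. cos (\<theta> + (\<Sum>n\<in>J. c n * z n))) = cos \<theta> * exp (- (1 / 2) * (\<Sum>n\<in>J. (c n)\<^sup>2))"
proof -
 let ?S = "%z. \<Sum>n\<in>J. c n * z n"
 let ?D = "distr PP borel ?S"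
 have [measurable]: "?S \<in> borel_measurable PP" by measurable
 have ind: "PP.indep_vars (%_. borel) (%n z. c n * z n) J"
  by (rule PP.indep_vars_compose2[OF PP.indep_vars_subset[OF PP_indep]]) auto
 have ch1: "char (distr PP borel (%z. c n * z n)) 1 = exp (- (c n)\<^sup>2 / 2)" for n
 proof -
  have "distr PP borel (%z. c n * z n) = distr N1 borel (%x. c n * x)"
   by (subst distr_coord[of n, symmetric], subst distr_distr) (auto simp: comp_def)
  then have "char (distr PP borel (%z. c n * z n)) 1 = char N1 (c n)"
   by (simp add: char_def integral_distr)
  then show ?thesis by (simp add: char_std_normal_distribution exp_of_real)
 qed
 have ch: "char ?D 1 = exp (- (1 / 2) * (\<Sum>n\<in>J. (c n)\<^sup>2))"
  unfolding PP.char_distr_sum[OF ind] ch1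
  using assms by (simp add: exp_sum[symmetric] sum_negf sum_divide_distrib[symmetric] of_real_prod[symmetric] exp_of_real[symmetric] del: of_real_exp)
 have i: "integrable PP (%z. iexp (?S z))" by (intro PP.integrable_const_bound[where B = 1]) auto
 have e: "PP.expectation (%z. iexp (?S z)) = exp (- (1 / 2) * (\<Sum>n\<in>J. (c n)\<^sup>2))"
  using ch by (simp add: char_def integral_distr)
 have ic: "integrable PP (%z. cos (?S z))" "integrable PP (%z. sin (?S z))"
  by (auto intro!: PP.integrable_const_bound[where B = 1])
 have "PP.expectation (%z. cos (?S z)) = Re (PP.expectation (%z. iexp (?S z)))"
  unfolding integral_Re[OF i, symmetric] by (simp add: Re_exp)
 then have ec: "PP.expectation (%z. cos (?S z)) = exp (- (1 / 2) * (\<Sum>n\<in>J. (c n)\<^sup>2))"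
  using e by simp
 have "PP.expectation (%z. sin (?S z)) = Im (PP.expectation (%z. iexp (?S z)))"
  unfolding integral_Im[OF i, symmetric] by (simp add: Im_exp)
 then have es: "PP.expectation (%z. sin (?S z)) = 0"
  using e by simp
 show ?thesis using ic ec es by (simp add: cos_add)
qed

lemma measurable_fld_point [measurable]: "(%z. fld z x) \<in> borel_measurable PP"
proof -
 have "incr {x} (%g. g x)" by (auto simp: incr_def)
 from measurable_incr_fld[OF this] show ?thesis by simp
qed

lemma fld_cos:
 assumes V: "finite V"
 shows "EE (%z. cos (\<theta> + (\<Sum>v\<in>V. t v * fld z (\<tau> v)))) = cos \<theta> * exp (- (1 / 2) * qform V \<tau> t)"
proof -
 define c where "c n = (\<Sum>v\<in>V. t v * basis n (\<tau> v))" for n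
 have lin: "(\<Sum>v\<in>V. t v * lin (lo k) z (\<tau> v)) = (\<Sum>n\<in>lo k. c n * z n)" for k z
  unfolding lin_def c_def sum_distrib_left sum_distrib_right by (subst sum.swap) (simp add: mult_ac)
 have point: "(%k. lin (lo k) z x) \<longlonglongrightarrow> fld z x" if "good z" for z x
 proof -
  have "incr {x} (%g. g x)" by (auto simp: incr_def)
  from incr_lin_tendsto[OF this _ that] show ?thesis by simp
 qed
 have l1: "(%k. EE (%z. cos (\<theta> + (\<Sum>v\<in>V. t v * lin (lo k) z (\<tau> v))))) \<longlonglongrightarrow> EE (%z. cos (\<theta> + (\<Sum>v\<in>V. t v * fld z (\<tau> v))))"
 proof (rule integral_dominated_convergence[where w = "%_. 1"])
  show "AE z in PP. (%k. cos (\<theta> + (\<Sum>v\<in>V. t v * lin (lo k) z (\<tau> v)))) \<longlonglongrightarrow> cos (\<theta> + (\<Sum>v\<in>V. t v * fld z (\<tau> v)))"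
   using AE_good by eventually_elim (intro tendsto_intros point)
  show "(%z. cos (\<theta> + (\<Sum>v\<in>V. t v * lin (lo k) z (\<tau> v)))) \<in> borel_measurable PP" for k unfolding lin by measurable
 qed auto
 have cc: "(%k. \<Sum>n\<in>lo k. (c n)\<^sup>2) \<longlonglongrightarrow> qform V \<tau> t"
 proof -
  have "(\<Sum>n\<in>lo k. (c n)\<^sup>2) = (\<Sum>v\<in>V. \<Sum>w\<in>V. t v * t w * (\<Sum>n\<in>lo k. basis n (\<tau> v) * basis n (\<tau> w)))" for k
  proof -
   have "(\<Sum>n\<in>lo k. (c n)\<^sup>2) = (\<Sum>n\<in>lo k. \<Sum>v\<in>V. \<Sum>w\<in>V. t v * t w * (basis n (\<tau> v) * basis n (\<tau> w)))"
    by (simp add: c_def power2_eq_square sum_product mult_ac)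
   also have "\<dots> = (\<Sum>v\<in>V. \<Sum>n\<in>lo k. \<Sum>w\<in>V. t v * t w * (basis n (\<tau> v) * basis n (\<tau> w)))" by (rule sum.swap)
   also have "\<dots> = (\<Sum>v\<in>V. \<Sum>w\<in>V. \<Sum>n\<in>lo k. t v * t w * (basis n (\<tau> v) * basis n (\<tau> w)))"
    by (rule sum.cong[OF refl], rule sum.swap)
   finally show ?thesis by (simp add: sum_distrib_left)
  qed
  moreover have "(%k. \<Sum>n\<in>lo k. basis n x * basis n y) \<longlonglongrightarrow> exp (- (1 / 2) * (norm (x - y))\<^sup>2)" for x y
   using kernel_has_sum[of x y] filterlim_lo unfolding has_sum_def by (rule filterlim_compose)
  ultimately show ?thesis unfolding qform_def by (simp only:) (intro tendsto_intros)
 qed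
 have "(%k. EE (%z. cos (\<theta> + (\<Sum>v\<in>V. t v * lin (lo k) z (\<tau> v))))) \<longlonglongrightarrow> cos \<theta> * exp (- (1 / 2) * qform V \<tau> t)"
  unfolding lin PP_linear_cos[OF finite_lo] by (intro tendsto_intros cc)
 then show ?thesis using l1 LIMSEQ_unique by blast
qed

section \<open>Discretization on a grid\<close>

text \<open>Index of the lower left corner of the cell of \<open>x\<close> in the grid of mesh
  \<open>1 / Suc j\<close>.\<close>

definition gidx :: "nat => real ^ 2 => int \<times> int" where
 "gidx j x = (\<lfloor>x $ 1 * real (Suc j)\<rfloor>, \<lfloor>x $ 2 * real (Suc j)\<rfloor>)"

definition gpt :: "nat => int \<times> int => real ^ 2" where
 "gpt j v = pt (real_of_int (fst v) / real (Suc j)) (real_of_int (snd v) / real (Suc j))"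

lemma floor_div_dist: "\<bar>real_of_int \<lfloor>t * real (Suc j)\<rfloor> / real (Suc j) - t\<bar> <= 1 / real (Suc j)"
proof -
 have "\<bar>real_of_int \<lfloor>t * real (Suc j)\<rfloor> - t * real (Suc j)\<bar> <= 1"
  using floor_correct[of "t * real (Suc j)"] by linarith
 then have "\<bar>real_of_int \<lfloor>t * real (Suc j)\<rfloor> - t * real (Suc j)\<bar> / real (Suc j) <= 1 / real (Suc j)"
  by (intro divide_right_mono) auto
 moreover have "\<bar>real_of_int \<lfloor>t * real (Suc j)\<rfloor> - t * real (Suc j)\<bar> / real (Suc j) = \<bar>real_of_int \<lfloor>t * real (Suc j)\<rfloor> / real (Suc j) - t\<bar>"
 proof -
  have "real_of_int \<lfloor>t * real (Suc j)\<rfloor> / real (Suc j) - t = (real_of_int \<lfloor>t * real (Suc j)\<rfloor> - t * real (Suc j)) / real (Suc j)"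
   by (simp add: field_simps)
  then show ?thesis by (simp only: abs_divide abs_of_nat)
 qed
 ultimately show ?thesis by simp
qed

lemma grid_dist: "norm (gpt j (gidx j x) - x) <= 2 / real (Suc j)"
proof -
 have "norm (gpt j (gidx j x) - x) <= (\<Sum>i\<in>UNIV. \<bar>(gpt j (gidx j x) - x) $ i\<bar>)"
  by (rule norm_le_l1_cart)
 also have "\<dots> <= 1 / real (Suc j) + 1 / real (Suc j)"
  unfolding sum_2 by (intro add_mono) (auto simp only: gpt_def gidx_def vector_minus_component pt_nth fst_conv snd_conv floor_div_dist)
 finally show ?thesis by simp
qed

lemma finite_grid_index: "bounded K ==> finite (gidx j ` K)"
proof -
 assume "bounded K"
 then obtain r where r: "!!x. x \<in> K ==> norm x <= r" by (auto simp: bounded_iff)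
 have "gidx j ` K \<subseteq> {\<lfloor>- r * real (Suc j)\<rfloor>..\<lfloor>r * real (Suc j)\<rfloor>} \<times> {\<lfloor>- r * real (Suc j)\<rfloor>..\<lfloor>r * real (Suc j)\<rfloor>}"
 proof
  fix v assume "v \<in> gidx j ` K"
  then obtain x where x: "x \<in> K" "v = gidx j x" by auto
  have "- r <= x $ i \<and> x $ i <= r" for i
   using r[OF x(1)] component_le_norm_cart[of x i] by linarith
  then have "\<lfloor>- r * real (Suc j)\<rfloor> <= \<lfloor>x $ i * real (Suc j)\<rfloor> \<and> \<lfloor>x $ i * real (Suc j)\<rfloor> <= \<lfloor>r * real (Suc j)\<rfloor>" for i
   by (intro conjI floor_mono mult_right_mono) auto
  then show "v \<in> {\<lfloor>- r * real (Suc j)\<rfloor>..\<lfloor>r * real (Suc j)\<rfloor>} \<times> {\<lfloor>- r * real (Suc j)\<rfloor>..\<lfloor>r * real (Suc j)\<rfloor>}"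
   unfolding x(2) gidx_def by auto
 qed
 then show ?thesis by (rule finite_subset) simp
qed

text \<open>Uniform continuity on a ball; its radius \<open>r + 2\<close> makes room for the rounded
  points. The rounded function has finitely many values on \<open>K\<close>, which reduces laws of
  functionals to finite-dimensional ones.\<close>

lemma incr_grid_tendsto:
 fixes g :: "real ^ 2 => real"
 assumes \<Phi>: "incr K \<Phi>" "bounded K" and g: "continuous_on UNIV g"
 shows "(%j. \<Phi> (%x. g (gpt j (gidx j x)))) \<longlonglongrightarrow> \<Phi> g"
proof -
 obtain r where r: "r > 0" "K \<subseteq> ball 0 r" using \<Phi>(2) bounded_subset_ballD by blast
 have bg: "bounded ((%x. g (gpt j (gidx j x))) ` K)" for j
 proof -
  have "finite ((%v. g (gpt j v)) ` (gidx j ` K))" using finite_grid_index[OF \<Phi>(2)] by blast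
  then show ?thesis by (auto simp: image_image intro: finite_imp_bounded)
 qed
 have uc: "uniformly_continuous_on (cball 0 (r + 2)) g"
  using g by (intro compact_uniformly_continuous) (auto intro: continuous_on_subset)
 show ?thesis
 proof (rule LIMSEQ_I)
  fix e :: real assume e: "e > 0"
  obtain d where d: "d > 0" "!!x y. x \<in> cball 0 (r + 2) ==> y \<in> cball 0 (r + 2) ==> dist y x < d ==> dist (g y) (g x) < e / 2"
   using uc e unfolding uniformly_continuous_on_def by (metis half_gt_zero)
  obtain N :: nat where N: "2 / d < real N" using reals_Archimedean2 by blast
  have "norm (\<Phi> (%x. g (gpt j (gidx j x))) - \<Phi> g) < e" if "j >= N" for j
  proof -
   have "2 / real (Suc j) < d" using N that d(1) by (simp add: field_simps) (smt (verit) mult_left_mono of_nat_mono)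
   moreover have "2 / real (Suc j) <= 2" by (simp add: field_simps)
   ultimately have cl: "\<bar>g (gpt j (gidx j x)) - g x\<bar> <= e / 2" if "x \<in> K" for x
   proof -
    have n: "norm (gpt j (gidx j x) - x) < d" "norm (gpt j (gidx j x) - x) <= 2"
     using grid_dist[of j x] \<open>2 / real (Suc j) < d\<close> \<open>2 / real (Suc j) <= 2\<close> by linarith+
    have nx: "norm x < r" using that r by auto
    have "norm (gpt j (gidx j x)) <= r + 2"
     using norm_triangle_ineq2[of "gpt j (gidx j x)" x] n(2) nx by linarith
    then have "dist (g (gpt j (gidx j x))) (g x) < e / 2"
     using n(1) nx by (intro d(2)) (auto simp: dist_norm)
    then show ?thesis by (simp add: dist_real_def)
   qed
   have "\<bar>\<Phi> (%x. g (gpt j (gidx j x))) - \<Phi> g\<bar> <= e / 2"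
    using cl by (intro incr_abs[OF \<Phi>(1)] bg bounded_cont_image g \<Phi>(2))
   then show ?thesis using e by simp
  qed
  then show "\<exists>N. \<forall>j\<ge>N. norm (\<Phi> (%x. g (gpt j (gidx j x))) - \<Phi> g) < e" by blast
 qed
qed

lemma measurable_incr_grid:
 assumes \<Phi>: "incr K \<Phi>" "bounded K"
 shows "(%y. \<Phi> (%x. y (gidx j x))) \<in> borel_measurable (PiM (gidx j ` K) (%_. borel :: real measure))"
proof -
 let ?Y = "%y. \<Phi> (%x. y (gidx j x))"
 let ?c = "%(y :: int \<times> int => real) v. if v \<in> V then y v else 0"
 define V where "V = gidx j ` K"
 have V: "finite V" unfolding V_def using \<Phi>(2) by (rule finite_grid_index)
 have bd: "bounded ((%x. y (gidx j x)) ` K)" for y :: "int \<times> int => real"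
 proof -
  have "finite (y ` V)" using V by simp
  then show ?thesis by (auto simp: V_def image_image intro: finite_imp_bounded)
 qed
 have le: "\<bar>?Y y - ?Y y'\<bar> <= (\<Sum>v\<in>V. \<bar>y v - y' v\<bar>)" for y y'
 proof (rule incr_abs[OF \<Phi>(1) bd bd])
  fix x assume "x \<in> K"
  then show "\<bar>y (gidx j x) - y' (gidx j x)\<bar> <= (\<Sum>v\<in>V. \<bar>y v - y' v\<bar>)"
   using V by (intro member_le_sum) (auto simp: V_def)
 qed
 have "continuous_on UNIV ?Y"
  unfolding continuous_on_def
 proof
  fix y :: "int \<times> int => real"
  have "((%z. \<Sum>v\<in>V. \<bar>z v - y v\<bar>) \<longlongrightarrow> (\<Sum>v\<in>V. \<bar>y v - y v\<bar>)) (at y)"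
  proof (intro tendsto_intros)
   fix n
   have "isCont (%z::int \<times> int => real. z n) y"
    by (rule bspec[OF iffD1[OF continuous_on_eq_continuous_at[OF open_UNIV] continuous_on_product_coordinates]]) simp
   then show "((%z. z n) \<longlongrightarrow> y n) (at y)" by (simp add: isCont_def)
  qed
  then have "((%z. \<Sum>v\<in>V. \<bar>z v - y v\<bar>) \<longlongrightarrow> 0) (at y)" by simp
  moreover have "\<forall>\<^sub>F z in at y. norm (?Y z - ?Y y) <= (\<Sum>v\<in>V. \<bar>z v - y v\<bar>)"
   unfolding real_norm_def by (rule always_eventually) (use le in blast)
  ultimately have "((%z. ?Y z - ?Y y) \<longlongrightarrow> 0) (at y)"
   by (rule Lim_null_comparison[rotated])
  then show "((%z. ?Y z) \<longlongrightarrow> ?Y y) (at y within UNIV)"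
   by (simp add: LIM_zero_iff)
 qed
 then have b: "?Y \<in> borel_measurable (PiM UNIV (%_. borel))"
  using borel_measurable_continuous_onI measurable_cong_sets[OF sets_PiM_equal_borel refl] by blast
 have m: "(%y v. if v \<in> V then y v else 0) \<in> PiM V (%_. borel) \<rightarrow>\<^sub>M PiM UNIV (%_. borel :: real measure)"
 proof (rule measurable_PiM_single')
  fix i :: "int \<times> int"
  show "(%y. if i \<in> V then y i else 0) \<in> borel_measurable (PiM V (%_. borel :: real measure))"
   using measurable_component_singleton[of i V "%_. borel"] by (cases "i \<in> V") auto
 qed auto
 have "?Y = ?Y \<circ> (%y v. if v \<in> V then y v else 0)"
 proof
  fix y :: "int \<times> int => real"
  have "?Y y = \<Phi> (%x. (%v. if v \<in> V then y v else 0) (gidx j x))"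
   by (rule incr_cong[OF \<Phi>(1) bd bd]) (simp add: V_def)
  then show "?Y y = (?Y \<circ> (%y v. if v \<in> V then y v else 0)) y" by simp
 qed
 then show ?thesis using measurable_comp[OF m b] unfolding V_def by simp
qed

text \<open>On the grid the functional depends on finitely many field values, whose joint laws agree
  by the hypothesis on cosines. Expectations of \<open>ramp\<close> pass to the limit of fine grids
  by continuity, and then the slope tends to infinity.\<close>

lemma law_general:
 fixes F F' :: "(nat \<times> nat => real) => real ^ 2 => real"
 assumes \<Phi>: "incr K \<Phi>" "bounded K"
  and F: "!!z. continuous_on UNIV (F z)" "!!x. (%z. F z x) \<in> borel_measurable PP"
  and F': "!!z. continuous_on UNIV (F' z)" "!!x. (%z. F' z x) \<in> borel_measurable PP"
  and eq: "!!(V::(int \<times> int) set) \<tau> t \<theta>. finite V ==>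
   EE (%z. cos (\<theta> + (\<Sum>v\<in>V. t v * F z (\<tau> v)))) = EE (%z. cos (\<theta> + (\<Sum>v\<in>V. t v * F' z (\<tau> v))))"
 shows "(%z. \<Phi> (F z)) \<in> borel_measurable PP" "PP.prob {z. l < \<Phi> (F z)} = PP.prob {z. l < \<Phi> (F' z)}"
proof -
 let ?Q = "%(G :: (nat \<times> nat => real) => real ^ 2 => real) z j. \<Phi> (%x. G z (gpt j (gidx j x)))"
 let ?Y = "%y j. \<Phi> (%x. y (gidx j x))"
 let ?P = "%j. PiM (gidx j ` K) (%_. borel :: real measure)"
 let ?V = "%(G :: (nat \<times> nat => real) => real ^ 2 => real) j z. \<lambda>v\<in>gidx j ` K. G z (gpt j v)"
 have bd: "bounded ((%x. y (gidx j x)) ` K)" for y :: "int \<times> int => real" and j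
 proof -
  have "finite (y ` gidx j ` K)" using finite_grid_index[OF \<Phi>(2)] by blast
  then show ?thesis by (auto simp: image_image intro: finite_imp_bounded)
 qed
 have step: "(%z. ?Q G z j) \<in> borel_measurable PP"
  and int: "!!h. h \<in> borel_measurable borel ==> EE (%z. h (?Q G z j)) =
    (\<integral>y. h (?Y y j) \<partial>distr PP (?P j) (?V G j) :: real)"
  if G: "!!x. (%z. G z x) \<in> borel_measurable PP" for G :: "(nat \<times> nat => real) => real ^ 2 => real" and j
 proof -
  note [measurable] = G measurable_incr_grid[OF \<Phi>, of j]
  have "?Q G z j = \<Phi> (%x. ?V G j z (gidx j x))" for z
   by (rule incr_cong[OF \<Phi>(1) bd bd]) simp
  then have e: "(%z. ?Q G z j) = (%z. \<Phi> (%x. ?V G j z (gidx j x)))" by blast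
  have mr: "(?V G j) \<in> PP \<rightarrow>\<^sub>M ?P j"
   by (rule measurable_restrict) (rule G)
  show "(%z. ?Q G z j) \<in> borel_measurable PP"
   unfolding e by (rule measurable_compose[OF mr measurable_incr_grid[OF \<Phi>]])
  fix h :: "real => real" assume h [measurable]: "h \<in> borel_measurable borel"
  have "(%y. h (?Y y j)) \<in> borel_measurable (?P j)"
   by (rule measurable_compose[OF measurable_incr_grid[OF \<Phi>] h])
  from integral_distr[OF mr this]
  show "EE (%z. h (?Q G z j)) =
    (\<integral>y. h (?Y y j) \<partial>distr PP (?P j) (?V G j))"
   using e by (simp add: fun_eq_iff)
 qed
 have meas: "(%z. \<Phi> (G z)) \<in> borel_measurable PP"
  if G: "!!z. continuous_on UNIV (G z)" "!!x. (%z. G z x) \<in> borel_measurable PP" for G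
  by (rule borel_measurable_LIMSEQ_real[OF incr_grid_tendsto[OF \<Phi> G(1)] step[OF G(2)]])
 show m [measurable]: "(%z. \<Phi> (F z)) \<in> borel_measurable PP" by (rule meas[OF F])
 have m' [measurable]: "(%z. \<Phi> (F' z)) \<in> borel_measurable PP" by (rule meas[OF F'])
 have jeq: "EE (%z. ramp m l (?Q F z j)) = EE (%z. ramp m l (?Q F' z j))" for m j
 proof -
  have "distr PP (?P j) (?V F j) =
   distr PP (?P j) (?V F' j)"
   by (rule PP.joint_cos_unique[OF finite_grid_index[OF \<Phi>(2)] F(2) F'(2) eq[OF finite_grid_index[OF \<Phi>(2)]]])
  moreover have "EE (%z. ramp m l (?Q F z j)) =
    (\<integral>y. ramp m l (?Y y j) \<partial>distr PP (?P j) (?V F j))"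
   by (rule int[OF F(2) measurable_ramp])
  moreover have "EE (%z. ramp m l (?Q F' z j)) =
    (\<integral>y. ramp m l (?Y y j) \<partial>distr PP (?P j) (?V F' j))"
   by (rule int[OF F'(2) measurable_ramp])
  ultimately show ?thesis by (simp only:)
 qed
 have lim: "(%j. EE (%z. ramp m l (?Q G z j))) \<longlonglongrightarrow> EE (%z. ramp m l (\<Phi> (G z)))"
  if G: "!!z. continuous_on UNIV (G z)" "!!x. (%z. G z x) \<in> borel_measurable PP" for G m
 proof (rule integral_dominated_convergence[where w = "%_. 1"])
  note [measurable] = step[OF G(2)] meas[OF G]
  show "AE z in PP. (%j. ramp m l (?Q G z j)) \<longlonglongrightarrow> ramp m l (\<Phi> (G z))"
   using continuous_on_tendsto_compose[OF continuous_ramp[of UNIV m l] incr_grid_tendsto[OF \<Phi> G(1)]] by simp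
  show "(%z. ramp m l (\<Phi> (G z))) \<in> borel_measurable PP"
   by (rule measurable_compose[OF meas[OF G] measurable_ramp])
  show "(%z. ramp m l (?Q G z j)) \<in> borel_measurable PP" for j
   by (rule measurable_compose[OF step[OF G(2)] measurable_ramp])
 qed (auto simp: ramp_bounds)
 have req: "EE (%z. ramp m l (\<Phi> (F z))) = EE (%z. ramp m l (\<Phi> (F' z)))" for m
  using LIMSEQ_unique[OF lim[OF F, of m] lim[OF F', of m, folded jeq]] .
 have fin: "(%m. EE (%z. ramp m l (\<Phi> (G z)))) \<longlonglongrightarrow> PP.prob {z. l < \<Phi> (G z)}" if [measurable]: "(%z. \<Phi> (G z)) \<in> borel_measurable PP" for G
 proof -
  have "(%m. EE (%z. ramp m l (\<Phi> (G z)))) \<longlonglongrightarrow> EE (%z. of_bool (l < \<Phi> (G z)))"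
  proof (rule integral_dominated_convergence[where w = "%_. 1"])
   show "AE z in PP. (%m. ramp m l (\<Phi> (G z))) \<longlonglongrightarrow> of_bool (l < \<Phi> (G z))" by (intro AE_I2 ramp_tendsto)
  qed (auto simp: ramp_bounds)
  moreover have "{z \<in> space PP. l < \<Phi> (G z)} \<in> sets PP" by measurable
  moreover have "(%z. of_bool (l < \<Phi> (G z)) :: real) = indicator {z. l < \<Phi> (G z)}" by (auto simp: indicator_def fun_eq_iff)
  ultimately show ?thesis by simp
 qed
 show "PP.prob {z. l < \<Phi> (F z)} = PP.prob {z. l < \<Phi> (F' z)}"
  using LIMSEQ_unique[OF fin[OF m] fin[OF m', folded req]] .
qed

text \<open>The variance \<open>qform\<close> depends only on distances and on products of two
  coefficients, hence is unchanged by an isometry and by a global sign.\<close>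

lemma fld_law:
 assumes \<Phi>: "incr K \<Phi>" "bounded K" and T: "!!x y. dist (T x) (T y) = dist x y" and s: "\<bar>s\<bar> = 1"
 shows "PP.prob {z. l < \<Phi> (%x. s * fld z (T x))} = PP.prob {z. l < \<Phi> (fld z)}"
  and "(%z. \<Phi> (%x. s * fld z (T x))) \<in> borel_measurable PP"
proof -
 have cT: "continuous_on UNIV T"
  unfolding continuous_on_iff using T by (metis)
 have c: "continuous_on UNIV (%x. s * fld z (T x))" for z
  by (intro continuous_intros continuous_on_compose2[OF continuous_fld[of UNIV] cT]) auto
 have eq: "EE (%z. cos (\<theta> + (\<Sum>v\<in>V. t v * (s * fld z (T (\<tau> v)))))) = EE (%z. cos (\<theta> + (\<Sum>v\<in>V. t v * fld z (\<tau> v))))"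
  if "finite V" for V :: "(int \<times> int) set" and \<tau> t \<theta>
 proof -
  have "(\<Sum>v\<in>V. t v * (s * fld z (T (\<tau> v)))) = (\<Sum>v\<in>V. (t v * s) * fld z ((T \<circ> \<tau>) v))" for z by (simp add: mult_ac)
  then have "EE (%z. cos (\<theta> + (\<Sum>v\<in>V. t v * (s * fld z (T (\<tau> v)))))) = cos \<theta> * exp (- (1 / 2) * qform V (T \<circ> \<tau>) (%v. t v * s))"
   by (simp only: fld_cos[OF that])
  also have "qform V (T \<circ> \<tau>) (%v. t v * s) = qform V \<tau> t"
  proof -
   have "s * s = 1" using s by (simp add: power2_eq_square[symmetric] abs_square_eq_1)
   then have e: "t v * s * (t w * s) = t v * t w" for v w by (simp add: mult_ac)
   have d: "norm ((T \<circ> \<tau>) v - (T \<circ> \<tau>) w) = norm (\<tau> v - \<tau> w)" for v w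
    using T[of "\<tau> v" "\<tau> w"] by (simp add: dist_norm)
   show ?thesis unfolding qform_def e d ..
  qed
  finally show ?thesis by (simp only: fld_cos[OF that])
 qed
 show "PP.prob {z. l < \<Phi> (%x. s * fld z (T x))} = PP.prob {z. l < \<Phi> (fld z)}"
  by (rule law_general(2)[OF \<Phi> c _ continuous_fld _ eq]) auto
 show "(%z. \<Phi> (%x. s * fld z (T x))) \<in> borel_measurable PP"
  by (rule law_general(1)[OF \<Phi> c _ continuous_fld _ eq]) auto
qed

section \<open>Quasi-independence\<close>

definition pr :: "((real ^ 2 => real) => real) => real => real" where
 "pr \<Phi> l = PP.prob {z. l < \<Phi> (fld z)}"

lemma pr_bounds: "0 <= pr \<Phi> l" "pr \<Phi> l <= 1"
 by (auto simp: pr_def)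

lemma pr_mono:
 assumes "incr K \<Psi>" "bounded K" "!!z. l < \<Phi> (fld z) ==> l' < \<Psi> (fld z)"
 shows "pr \<Phi> l <= pr \<Psi> l'"
 unfolding pr_def using assms(3) sets_incr_fld(1)[OF assms(1,2)] by (intro PP.finite_measure_mono) auto

lemma pr_ge_eq: "incr K \<Phi> ==> bounded K ==> PP.prob {z. l <= \<Phi> (fld z)} = pr \<Phi> l"
 using prob_gt_eq_ge by (simp add: pr_def)

lemma pr_not_gt:
 assumes "incr K \<Phi>" "bounded K"
 shows "PP.prob {z. \<Phi> (fld z) <= l} = 1 - pr \<Phi> l"
proof -
 have "PP.prob (space PP - {z. l < \<Phi> (fld z)}) = 1 - PP.prob {z. l < \<Phi> (fld z)}"
  using sets_incr_fld(1)[OF assms] by (intro PP.prob_compl)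
 moreover have "space PP - {z. l < \<Phi> (fld z)} = {z. \<Phi> (fld z) <= l}" by auto
 ultimately show ?thesis by (simp add: pr_def)
qed

lemma pr_isometry:
 assumes "incr K \<Phi>" "bounded K" "!!x y. dist (T x) (T y) = dist x y"
 shows "pr (%g. \<Phi> (g \<circ> T)) l = pr \<Phi> l"
 using fld_law(1)[OF assms, of 1 l] by (simp add: pr_def comp_def)

lemma pr_uminus:
 assumes "incr K \<Phi>" "bounded K"
 shows "PP.prob {z. l < \<Phi> (%x. - fld z x)} = pr \<Phi> l" "(%z. \<Phi> (%x. - fld z x)) \<in> borel_measurable PP"
 using fld_law[OF assms, of "%x. x" "- 1"] by (simp_all add: pr_def)

text \<open>A translation moves the bounded set into the quadrant, and the law is
  stationary.\<close>

lemma fkg: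
 assumes \<Phi>: "incr K \<Phi>" and \<Psi>: "incr K \<Psi>" and K: "bounded K"
 shows "pr \<Phi> l * pr \<Psi> l <= pr (%g. min (\<Phi> g) (\<Psi> g)) l"
proof -
 obtain r where r: "!!x. x \<in> K ==> norm x <= r" using K by (auto simp: bounded_iff)
 define T where "T x = x + pt r r" for x
 have T: "dist (T x) (T y) = dist x y" for x y by (simp add: T_def)
 have K': "bounded (T ` K)"
  unfolding T_def using K by (rule bounded_translation_minus[where a = "- pt r r", simplified])
 have q: "0 <= x $ 1 \<and> 0 <= x $ 2" if "x \<in> T ` K" for x
 proof -
  obtain y where y: "y \<in> K" "x = y + pt r r" using \<open>x \<in> T ` K\<close> by (auto simp: T_def)
  have "\<bar>y $ i\<bar> <= r" for i using r[OF y(1)] component_le_norm_cart[of y i] by linarith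
  from this[of 1] this[of 2] show ?thesis by (simp add: y(2) abs_le_iff)
 qed
 from fkg_quadrant[OF incr_compose[OF \<Phi>] incr_compose[OF \<Psi>] K' q]
 have "pr (%g. \<Phi> (g \<circ> T)) l * pr (%g. \<Psi> (g \<circ> T)) l <= pr (%g. min (\<Phi> (g \<circ> T)) (\<Psi> (g \<circ> T))) l"
  by (simp add: pr_def)
 then show ?thesis
  using pr_isometry[OF \<Phi> K T] pr_isometry[OF \<Psi> K T] pr_isometry[OF incr_min[OF \<Phi> \<Psi>] K T] by simp
qed

text \<open>The Harris inequality for the complementary events, by inclusion and exclusion; with
  equal probabilities this is the square root trick.\<close>

lemma pr_max_le:
 assumes \<Phi>: "incr K \<Phi>" and \<Psi>: "incr K \<Psi>" and K: "bounded K"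
 shows "(1 - pr \<Phi> l) * (1 - pr \<Psi> l) <= 1 - pr (%g. max (\<Phi> g) (\<Psi> g)) l"
proof -
 note s = sets_incr_fld(1)[OF \<Phi> K, of l] sets_incr_fld(1)[OF \<Psi> K, of l]
 have "PP.prob ({z. l < \<Phi> (fld z)} \<union> {z. l < \<Psi> (fld z)}) = pr \<Phi> l + pr \<Psi> l - PP.prob ({z. l < \<Phi> (fld z)} \<inter> {z. l < \<Psi> (fld z)})"
  unfolding pr_def using s by (simp add: PP.finite_measure_Union' PP.finite_measure_Diff' Int_commute)
 moreover have "{z. l < \<Phi> (fld z)} \<union> {z. l < \<Psi> (fld z)} = {z. l < max (\<Phi> (fld z)) (\<Psi> (fld z))}"
  "{z. l < \<Phi> (fld z)} \<inter> {z. l < \<Psi> (fld z)} = {z. l < min (\<Phi> (fld z)) (\<Psi> (fld z))}" by auto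
 ultimately show ?thesis using fkg[OF \<Phi> \<Psi> K, of l] by (simp add: pr_def algebra_simps)
qed

lemma indep_cut:
 assumes \<Phi>: "incr K \<Phi>" "bounded K" and \<Psi>: "incr L \<Psi>" "bounded L"
 shows "PP.prob {z. l < \<Phi> (fld (cut J z)) \<and> l' < \<Psi> (fld (cut (- J) z))} =
  PP.prob {z. l < \<Phi> (fld (cut J z))} * PP.prob {z. l' < \<Psi> (fld (cut (- J) z))}"
proof -
 have ind: "PP.indep_var (PiM J (%_. borel)) (%z. restrict (%i. z i) J) (PiM (- J) (%_. borel)) (%z. restrict (%i. z i) (- J))"
  using PP.indep_var_restrict[OF PP_indep, of J "- J"] by simp
 define B where "B I \<Theta> t = {y \<in> space (PiM I (%_. borel)). t < \<Theta> (fld (%n. if n \<in> I then y n else 0))}"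
  for I :: "(nat \<times> nat) set" and \<Theta> :: "(real^2 => real) => real" and t :: real
 have B: "B I \<Theta> t \<in> sets (PiM I (%_. borel))" if "incr K' \<Theta>" "bounded K'" for I K' \<Theta> t
 proof -
  have "(%y n. if n \<in> I then y n else 0) \<in> PiM I (%_. borel) \<rightarrow>\<^sub>M PiM UNIV (%_. borel :: real measure)"
  proof (rule measurable_PiM_single')
   fix i :: "nat \<times> nat"
   show "(%y. if i \<in> I then y i else 0) \<in> borel_measurable (PiM I (%_. borel :: real measure))"
    using measurable_component_singleton[of i I "%_. borel"] by (cases "i \<in> I") auto
  qed auto
  then have "(%y n. if n \<in> I then y n else 0) \<in> PiM I (%_. borel :: real measure) \<rightarrow>\<^sub>M PP"
   using measurable_cong_sets[OF refl sets_PP] by blast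
  from measurable_compose[OF this measurable_incr_fld[OF that]]
  have [measurable]: "(%y. \<Theta> (fld (%n. if n \<in> I then y n else 0))) \<in> borel_measurable (PiM I (%_. borel))" .
  show ?thesis unfolding B_def by measurable
 qed
 have pre: "(%z. restrict z I) -` B I \<Theta> t \<inter> space PP = {z. t < \<Theta> (fld (cut I z))}" for I \<Theta> t
 proof -
  have "(%n. if n \<in> I then restrict z I n else 0) = cut I z" for z by (auto simp: cut_def fun_eq_iff)
  then show ?thesis by (auto simp: B_def space_PiM)
 qed
 have "PP.prob ((%z. (restrict (%i. z i) J, restrict (%i. z i) (- J))) -` (B J \<Phi> l \<times> B (- J) \<Psi> l') \<inter> space PP)
  = PP.prob ((%z. restrict z J) -` B J \<Phi> l \<inter> space PP) * PP.prob ((%z. restrict z (- J)) -` B (- J) \<Psi> l' \<inter> space PP)"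
  by (rule PP.indep_varD[OF ind B[OF \<Phi>] B[OF \<Psi>]])
 moreover have "(%z. (restrict (%i. z i) J, restrict (%i. z i) (- J))) -` (B J \<Phi> l \<times> B (- J) \<Psi> l') \<inter> space PP
  = ((%z. restrict z J) -` B J \<Phi> l \<inter> space PP) \<inter> ((%z. restrict z (- J)) -` B (- J) \<Psi> l' \<inter> space PP)" by auto
 moreover have "{z. l < \<Phi> (fld (cut J z))} \<inter> {z. l' < \<Psi> (fld (cut (- J) z))} = {z. l < \<Phi> (fld (cut J z)) \<and> l' < \<Psi> (fld (cut (- J) z))}" by auto
 ultimately show ?thesis by (simp only: pre)
qed

section \<open>Splitting the modes by degree\<close>

text \<open>Bounds the expected weight of the discarded modes, near the origin as well as far from
  it. The factor 16 is the double geometric sum of ratio \<open>3/4\<close>.\<close>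

definition err :: "real => real" where
 "err r = 16 * exp (- r\<^sup>2)"

lemma err_nonneg: "0 <= err r" by (simp add: err_def)

text \<open>With \<open>s = 4\<close> the weights are at most \<open>exp (4 * r\<^sup>2)\<close>
  times a power of \<open>1/2 = 2/3 * 3/4\<close>. The powers of \<open>3/4\<close> are summed,
  those of \<open>2/3\<close> give \<open>(2/3) ^ k\<close>, which beats
  \<open>exp (4 * r\<^sup>2)\<close> because \<open>ln (2/3) \<le> - 1/3\<close> and
  \<open>16/3 - 4 > 1\<close>.\<close>

lemma inner_mode_bound:
 assumes r: "r >= 0" and k: "16 * r\<^sup>2 <= real k"
 shows "(\<Sum>\<^sub>\<infinity>n\<in>- lo k. wt r n) <= err r"
proof -
 let ?g = "%n::nat \<times> nat. exp (4 * r\<^sup>2) * (2/3) ^ k * (3/4) ^ (fst n + snd n)"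
 have gs: "?g summable_on UNIV" using geometric_pairs(1)[of "3/4 :: real"] by (intro summable_on_cmult_right) auto
 have le: "wt r n <= ?g n" if n: "n \<in> - lo k" for n
 proof -
  have kn: "k <= fst n + snd n" using n by (auto simp: lo_def)
  have "wt r n <= exp (4 * r\<^sup>2) * (1/2) ^ (fst n + snd n)"
   using wt_bound[of 4 r n] r by (simp add: power_one_over field_simps)
  also have "(1/2 :: real) ^ (fst n + snd n) = (2/3) ^ (fst n + snd n) * (3/4) ^ (fst n + snd n)"
   by (simp add: power_mult_distrib[symmetric])
  also have "\<dots> <= (2/3) ^ k * (3/4) ^ (fst n + snd n)"
   using kn by (intro mult_right_mono power_decreasing) auto
  finally show ?thesis by (simp add: mult.assoc)
 qed
 have "(\<Sum>\<^sub>\<infinity>n\<in>- lo k. wt r n) <= (\<Sum>\<^sub>\<infinity>n\<in>- lo k. ?g n)"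
  using le summable_on_subset_banach[OF gs, of "- lo k"] by (intro infsum_mono wt_summable r) auto
 also have "\<dots> <= (\<Sum>\<^sub>\<infinity>n. ?g n)"
  using gs summable_on_subset_banach[OF gs, of "- lo k"] by (intro infsum_mono_neutral) auto
 also have "\<dots> = exp (4 * r\<^sup>2) * (2/3) ^ k * (\<Sum>\<^sub>\<infinity>n::nat \<times> nat. (3/4) ^ (fst n + snd n))"
  using geometric_pairs(1)[of "3/4 :: real"] by (intro infsum_cmult_right) auto
 also have "\<dots> <= exp (4 * r\<^sup>2) * (2/3) ^ k * 16"
  using geometric_pairs(2)[of "3/4 :: real"] by (intro mult_left_mono) (auto simp: power2_eq_square)
 also have "exp (4 * r\<^sup>2) * (2/3) ^ k <= exp (- r\<^sup>2)"
 proof -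
  have "(2/3 :: real) ^ k = exp (real k * ln (2/3))" by (simp add: exp_of_nat_mult)
  also have "\<dots> <= exp (- (16 * r\<^sup>2) / 3)"
  proof -
   have "ln (2/3 :: real) <= - 1/3" using ln_le_minus_one[of "2/3 :: real"] by simp
   then have "real k * ln (2/3) <= real k * (- 1/3)" by (intro mult_left_mono) auto
   also have "\<dots> <= - (16 * r\<^sup>2) / 3" using k by simp
   finally show ?thesis by simp
  qed
  finally have "exp (4 * r\<^sup>2) * (2/3) ^ k <= exp (4 * r\<^sup>2) * exp (- (16 * r\<^sup>2) / 3)" by (intro mult_left_mono) auto
  also have "\<dots> = exp (4 * r\<^sup>2 + - (16 * r\<^sup>2) / 3)" by (simp only: exp_add)
  also have "\<dots> <= exp (- r\<^sup>2)" by (simp add: field_simps)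
  finally show ?thesis .
 qed
 finally show ?thesis by (simp add: err_def)
qed

text \<open>The exponent 24 is \<open>3/8 * 64\<close>, from the mode bound with
  \<open>s = 1/4\<close> at distance \<open>8 * r\<close>. The sum of the powers of 2 is at most
  \<open>4 ^ k\<close>, a constant times \<open>exp (22.3 * r\<^sup>2)\<close> at most, so a factor
  \<open>exp (- r\<^sup>2)\<close> is left.\<close>

lemma outer_mode_bound:
 assumes k: "real k <= 16 * r\<^sup>2 + 1"
 shows "(\<Sum>n\<in>lo k. exp (- 24 * r\<^sup>2) * 2 ^ (fst n + snd n)) <= err r"
proof -
 have "(\<Sum>n\<in>lo k. (2::real) ^ (fst n + snd n)) <= (\<Sum>n\<in>{..<k} \<times> {..<k}. 2 ^ (fst n + snd n))"
  by (intro sum_mono2) (auto simp: lo_def)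
 also have "\<dots> = (\<Sum>i<k. (2::real) ^ i)\<^sup>2"
  by (simp add: power2_eq_square sum_product sum.cartesian_product power_add case_prod_unfold)
 also have "\<dots> <= (2 ^ k)\<^sup>2"
  by (intro power_mono sum_nonneg) (auto simp: sum_gp_strict)
 also have "\<dots> = exp (real k * (2 * ln 2))"
 proof -
  have "exp (real k * (2 * ln 2)) = (exp (2 * ln (2::real))) ^ k" by (simp only: exp_of_nat_mult)
  also have "exp (2 * ln (2::real)) = 4" by (simp add: exp_double)
  finally show ?thesis by (simp add: power2_eq_square power_mult_distrib[symmetric])
 qed
 also have "\<dots> <= exp ((16 * r\<^sup>2 + 1) * (25/18))"
  using k ln2_le_25_over_36 by (subst exp_le_cancel_iff, intro mult_mono) auto
 finally have "exp (- 24 * r\<^sup>2) * (\<Sum>n\<in>lo k. (2::real) ^ (fst n + snd n)) <= exp (- 24 * r\<^sup>2) * exp ((16 * r\<^sup>2 + 1) * (25/18))"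
  by (intro mult_left_mono) auto
 also have "\<dots> = exp (- 24 * r\<^sup>2 + (16 * r\<^sup>2 + 1) * (25/18))" by (simp only: exp_add)
 also have "\<dots> <= exp (2 + - r\<^sup>2)" by (simp add: field_simps)
 also have "\<dots> = exp 1 * exp 1 * exp (- r\<^sup>2)" by (simp only: exp_add[symmetric]) simp
 also have "\<dots> <= 3 * 3 * exp (- r\<^sup>2)"
  using exp_le by (intro mult_right_mono mult_mono) auto
 also have "\<dots> <= err r" by (simp add: err_def)
 finally show ?thesis by (simp add: sum_distrib_left)
qed

text \<open>Near the origin the modes of high degree are negligible, far from it those of low degree are; the
  truncated functionals depend on disjoint sets of coefficients.\<close>

lemma quasi_independence_centered:
 assumes \<Phi>: "incr K \<Phi>" "bounded K" and \<Psi>: "incr L \<Psi>" "bounded L"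
  and r: "r >= 0" and K: "!!x. x \<in> K ==> norm x <= r" and L: "!!x. x \<in> L ==> 8 * r <= norm x" and \<eta>: "\<eta> > 0"
 shows "PP.prob {z. l < \<Phi> (fld z) \<and> l < \<Psi> (fld z)} <=
  (pr \<Phi> (l - 2 * \<eta>) + err r / \<eta>) * (pr \<Psi> (l - 2 * \<eta>) + err r / \<eta>) + 2 * (err r / \<eta>)"
proof -
 define e where "e = err r / \<eta>"
 \<comment> \<open>Degree at which the modes are split: above it they are negligible in the ball of
   radius \<open>r\<close>, below it they are negligible beyond \<open>8 * r\<close>.\<close>
 define k where "k = nat \<lceil>16 * r\<^sup>2\<rceil>"
 have k: "16 * r\<^sup>2 <= real k" "real k <= 16 * r\<^sup>2 + 1"
  by (simp_all add: k_def real_nat_ceiling_ge of_nat_ceiling)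
 have e0: "0 <= e" using err_nonneg \<eta> by (simp add: e_def)
 obtain A where A: "A \<in> sets PP" "PP.prob A <= (\<Sum>\<^sub>\<infinity>n\<in>- lo k. wt r n) / \<eta>"
  "!!z. z \<notin> A ==> (%n. \<bar>z n\<bar> * wt r n) summable_on - lo k" "!!z. z \<notin> A ==> (\<Sum>\<^sub>\<infinity>n\<in>- lo k. \<bar>z n\<bar> * wt r n) <= \<eta>"
  by (rule weighted_sum_prob[of "- lo k" "wt r" \<eta>]) (simp_all add: wt_nonneg r wt_summable \<eta>)
 define b where "b n = exp (- 24 * r\<^sup>2) * 2 ^ (fst n + snd n)" for n :: "nat \<times> nat"
 obtain B where B: "B \<in> sets PP" "PP.prob B <= infsum b (lo k) / \<eta>"
  "!!z. z \<notin> B ==> (%n. \<bar>z n\<bar> * b n) summable_on lo k" "!!z. z \<notin> B ==> (\<Sum>\<^sub>\<infinity>n\<in>lo k. \<bar>z n\<bar> * b n) <= \<eta>"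
  by (rule weighted_sum_prob[of "lo k" b \<eta>]) (simp_all add: \<eta> b_def)
 have PA: "PP.prob A <= e" unfolding e_def
  using A(2) inner_mode_bound[OF r k(1)] \<eta> by (meson divide_right_mono less_imp_le order_trans)
 have PB: "PP.prob B <= e" unfolding e_def
  using B(2) outer_mode_bound[OF k(2)] \<eta> by (simp add: b_def) (meson divide_right_mono less_imp_le order_trans)
 obtain N where N: "N \<in> null_sets PP" "!!z. z \<notin> N ==> good z"
  using AE_good by (elim AE_E) (auto simp: null_sets_def)
 have f2: "\<bar>fld z x - fld (cut (lo k) z) x\<bar> <= \<eta>" if z: "good z" "z \<notin> A" and x: "x \<in> K" for z x
 proof -
  have "\<bar>fld (cut (- lo k) z) x\<bar> <= (\<Sum>\<^sub>\<infinity>n\<in>- lo k. \<bar>z n\<bar> * wt r n)"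
   using abs_basis_le_wt[OF K[OF x]] A(3)[OF z(2)] by (intro fld_cut_le z)
  then show ?thesis using A(4)[OF z(2)] fld_split[OF z(1), of x "lo k"] by simp
 qed
 have f1: "\<bar>fld z x - fld (cut (- lo k) z) x\<bar> <= \<eta>" if z: "good z" "z \<notin> B" and x: "x \<in> L" for z x
 proof -
  have bb: "\<bar>basis n x\<bar> <= b n" for n
  proof -
   have "(8 * r)\<^sup>2 <= (norm x)\<^sup>2" using L[OF x] r by (intro power_mono) auto
   then have "exp (- (1 - 1/4) / 2 * (norm x)\<^sup>2) <= exp (- 24 * r\<^sup>2)"
    by (simp add: power_mult_distrib)
   moreover have "sqrt (1/4) = (1/2 :: real)" by (rule real_sqrt_unique) (auto simp: power2_eq_square)
   ultimately have "exp (- (1 - 1/4) / 2 * (norm x)\<^sup>2) / sqrt (1/4) ^ (fst n + snd n) <= b n"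
    unfolding b_def by (simp only: power_one_over divide_divide_eq_right) (simp add: divide_simps mult_right_mono)
   then show ?thesis using basis_bound[of "1/4" n x] by linarith
  qed
  have "\<bar>fld (cut (lo k) z) x\<bar> <= (\<Sum>\<^sub>\<infinity>n\<in>lo k. \<bar>z n\<bar> * b n)"
   using bb B(3)[OF z(2)] by (intro fld_cut_le z)
  then show ?thesis using B(4)[OF z(2)] fld_split[OF z(1), of x "lo k"] by simp
 qed
 have \<Phi>1: "\<bar>\<Phi> (fld z) - \<Phi> (fld (cut (lo k) z))\<bar> <= \<eta>" if "good z" "z \<notin> A" for z
  using f2[OF that] \<Phi> by (intro incr_abs[OF \<Phi>(1)]) auto
 have \<Psi>1: "\<bar>\<Psi> (fld z) - \<Psi> (fld (cut (- lo k) z))\<bar> <= \<eta>" if "good z" "z \<notin> B" for z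
  using f1[OF that] \<Psi> by (intro incr_abs[OF \<Psi>(1)]) auto
 \<comment> \<open>The level drops by \<open>\<eta>\<close> when the field is replaced by a
   truncation and by another \<open>\<eta>\<close> on the way back to the field.\<close>
 let ?E1 = "{z. l - \<eta> < \<Phi> (fld (cut (lo k) z))}" and ?E2 = "{z. l - \<eta> < \<Psi> (fld (cut (- lo k) z))}"
 have s: "?E1 \<in> sets PP" "?E2 \<in> sets PP" "N \<in> sets PP" using sets_incr_fld(3)[OF \<Phi>] sets_incr_fld(3)[OF \<Psi>] N by auto
 have "PP.prob {z. l < \<Phi> (fld z) \<and> l < \<Psi> (fld z)} <= PP.prob ((?E1 \<inter> ?E2) \<union> (A \<union> B \<union> N))"
 proof (intro PP.finite_measure_mono subsetI)
  fix z assume z: "z \<in> {z. l < \<Phi> (fld z) \<and> l < \<Psi> (fld z)}"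
  show "z \<in> (?E1 \<inter> ?E2) \<union> (A \<union> B \<union> N)"
  proof (cases "z \<in> A \<union> B \<union> N")
   case False
   then show ?thesis using \<Phi>1[of z] \<Psi>1[of z] N(2)[of z] z by auto
  qed simp
 qed (use s A B in auto)
 also have "\<dots> <= PP.prob (?E1 \<inter> ?E2) + PP.prob (A \<union> B \<union> N)"
  using s A B by (intro measure_Un_le) auto
 also have "\<dots> <= PP.prob (?E1 \<inter> ?E2) + 2 * e"
 proof -
  have "PP.prob (A \<union> B \<union> N) <= PP.prob A + PP.prob B + PP.prob N"
   using s A B measure_Un_le[of "A \<union> B" PP N] measure_Un_le[of A PP B] by auto
  moreover have "PP.prob N = 0" using N(1) by (simp add: null_setsD1 measure_def)
  ultimately show ?thesis using PA PB by simp
 qed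
 also have "PP.prob (?E1 \<inter> ?E2) = PP.prob ?E1 * PP.prob ?E2"
  using indep_cut[OF \<Phi> \<Psi>, of "l - \<eta>" "lo k" "l - \<eta>"] by (simp add: Collect_conj_eq)
 also have "PP.prob ?E1 * PP.prob ?E2 <= (pr \<Phi> (l - 2 * \<eta>) + e) * (pr \<Psi> (l - 2 * \<eta>) + e)"
 proof (intro mult_mono)
  have m0: "PP.prob N = 0" using N(1) by (simp add: null_setsD1 measure_def)
  have "PP.prob ?E1 <= PP.prob ({z. l - 2 * \<eta> < \<Phi> (fld z)} \<union> (A \<union> N))"
   using \<Phi>1 N(2) s A sets_incr_fld(1)[OF \<Phi>] by (intro PP.finite_measure_mono) force+
  also have "\<dots> <= pr \<Phi> (l - 2 * \<eta>) + (PP.prob A + PP.prob N)"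
   unfolding pr_def using s A sets_incr_fld(1)[OF \<Phi>]
   by (intro order_trans[OF measure_Un_le] add_mono measure_Un_le) auto
  finally show "PP.prob ?E1 <= pr \<Phi> (l - 2 * \<eta>) + e" using PA m0 by simp
  have "PP.prob ?E2 <= PP.prob ({z. l - 2 * \<eta> < \<Psi> (fld z)} \<union> (B \<union> N))"
   using \<Psi>1 N(2) s B sets_incr_fld(1)[OF \<Psi>] by (intro PP.finite_measure_mono) force+
  also have "\<dots> <= pr \<Psi> (l - 2 * \<eta>) + (PP.prob B + PP.prob N)"
   unfolding pr_def using s B sets_incr_fld(1)[OF \<Psi>]
   by (intro order_trans[OF measure_Un_le] add_mono measure_Un_le) auto
  finally show "PP.prob ?E2 <= pr \<Psi> (l - 2 * \<eta>) + e" using PB m0 by simp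
 qed (use e0 pr_bounds in auto)
 finally show ?thesis by (simp add: e_def)
qed

lemma quasi_independence:
 assumes \<Phi>: "incr K \<Phi>" "bounded K" and \<Psi>: "incr L \<Psi>" "bounded L"
  and r: "r >= 0" and K: "!!x. x \<in> K ==> dist c x <= r" and L: "!!x. x \<in> L ==> 8 * r <= dist c x" and \<eta>: "\<eta> > 0"
 shows "pr (%g. min (\<Phi> g) (\<Psi> g)) l <=
  (pr \<Phi> (l - 2 * \<eta>) + err r / \<eta>) * (pr \<Psi> (l - 2 * \<eta>) + err r / \<eta>) + 2 * (err r / \<eta>)"
proof -
 define T where "T x = x - c" for x
 have T: "dist (T x) (T y) = dist x y" for x y by (simp add: T_def dist_norm)
 have b: "bounded (T ` M)" if "bounded M" for M
  unfolding T_def using that by (rule bounded_translation_minus)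
 have KL: "incr (K \<union> L) \<Phi>" "incr (K \<union> L) \<Psi>" "bounded (K \<union> L)"
  using incr_subset[OF \<Phi>(1)] incr_subset[OF \<Psi>(1)] \<Phi> \<Psi> by auto
 have "PP.prob {z. l < \<Phi> (fld z \<circ> T) \<and> l < \<Psi> (fld z \<circ> T)} <=
  (pr (%g. \<Phi> (g \<circ> T)) (l - 2 * \<eta>) + err r / \<eta>) * (pr (%g. \<Psi> (g \<circ> T)) (l - 2 * \<eta>) + err r / \<eta>) + 2 * (err r / \<eta>)"
  by (rule quasi_independence_centered[OF incr_compose[OF \<Phi>(1)] b[OF \<Phi>(2)] incr_compose[OF \<Psi>(1)] b[OF \<Psi>(2)] r _ _ \<eta>])
    (use K L in \<open>auto simp: T_def dist_norm norm_minus_commute\<close>)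
 moreover have "PP.prob {z. l < \<Phi> (fld z \<circ> T) \<and> l < \<Psi> (fld z \<circ> T)} = pr (%g. min (\<Phi> (g \<circ> T)) (\<Psi> (g \<circ> T))) l"
  by (simp add: pr_def)
 ultimately show ?thesis
  using pr_isometry[OF \<Phi> T] pr_isometry[OF \<Psi> T] pr_isometry[OF incr_min[OF KL(1,2)] KL(3) T] by simp
qed

section \<open>Russo-Seymour-Welsh theory\<close>

lemma pr_conn_isometry:
 assumes ne: "conn K A B ~= {}" and K: "bounded K"
  and T: "!!x y. dist (T x) (T y) = dist x y" and T': "!!x. T (T' x) = x"
 shows "pr (thr (conn (T -` K) (T -` A) (T -` B))) l = pr (thr (conn K A B)) l"
  and "conn (T -` K) (T -` A) (T -` B) ~= {}"
proof -
 have inj: "T' (T x) = x" for x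
  using T[of "T' (T x)" x] by (simp add: T')
 have d': "dist (T' x) (T' y) = dist x y" for x y using T[of "T' x" "T' y"] by (simp add: T')
 have cT: "continuous_on X T'" for X
  unfolding continuous_on_iff using d' by metis
 have cT2: "continuous_on X T" for X
  unfolding continuous_on_iff using T by metis
 have eq: "conn (T -` K) (T -` A) (T -` B) = (`) T' ` conn K A B"
 proof
  show "(`) T' ` conn K A B \<subseteq> conn (T -` K) (T -` A) (T -` B)"
  proof clarify
   fix S assume S: "S \<in> conn K A B"
   then obtain a b where "a \<in> S" "a \<in> A" "b \<in> S" "b \<in> B" by (auto simp: conn_def)
   then have "T' a \<in> T' ` S \<inter> T -` A" "T' b \<in> T' ` S \<inter> T -` B" by (auto simp: T')
   then show "T' ` S \<in> conn (T -` K) (T -` A) (T -` B)"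
    using S T' compact_continuous_image[OF cT, of S] connected_continuous_image[OF cT, of S]
    unfolding conn_def by blast
  qed
  show "conn (T -` K) (T -` A) (T -` B) \<subseteq> (`) T' ` conn K A B"
  proof
   fix S assume S: "S \<in> conn (T -` K) (T -` A) (T -` B)"
   then have "T ` S \<in> conn K A B"
    using compact_continuous_image[OF cT2, of S] connected_continuous_image[OF cT2, of S]
    unfolding conn_def by blast
   moreover have "T' ` T ` S = S" by (simp add: image_image inj)
   ultimately show "S \<in> (`) T' ` conn K A B" by (metis image_eqI)
  qed
 qed
 show "conn (T -` K) (T -` A) (T -` B) ~= {}" using ne unfolding eq by simp
 have "thr (conn (T -` K) (T -` A) (T -` B)) = (%g. thr (conn K A B) (g \<circ> T'))"
  unfolding eq by (rule ext, rule thr_image) (metis T' injI)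
 then show "pr (thr (conn (T -` K) (T -` A) (T -` B))) l = pr (thr (conn K A B)) l"
  using pr_isometry[OF incr_thr[OF fam_conn[OF ne]] K d', of l] by simp
qed

lemma dist_vec2: "dist x y = sqrt ((x $ 1 - y $ 1)\<^sup>2 + (x $ 2 - y $ 2)\<^sup>2)" for x y :: "real ^ 2"
 by (simp add: dist_vec_def L2_set_def sum_2 dist_real_def)

lemma pt_isometries:
 fixes x y :: "real ^ 2"
 shows "dist (pt (x $ 1 + u) (x $ 2 + v)) (pt (y $ 1 + u) (y $ 2 + v)) = dist x y"
 "dist (pt (- x $ 1) (x $ 2)) (pt (- y $ 1) (y $ 2)) = dist x y"
 "dist (pt (x $ 1) (- x $ 2)) (pt (y $ 1) (- y $ 2)) = dist x y"
 "dist (pt (x $ 2) (x $ 1)) (pt (y $ 2) (y $ 1)) = dist x y"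
 unfolding dist_vec2 by (simp_all add: power2_eq_square algebra_simps)

lemma pr_conn_shift:
 assumes "conn K A B ~= {}" "bounded K"
  and "K' = {x. pt (x $ 1 + u) (x $ 2 + v) \<in> K}" "A' = {x. pt (x $ 1 + u) (x $ 2 + v) \<in> A}" "B' = {x. pt (x $ 1 + u) (x $ 2 + v) \<in> B}"
 shows "pr (thr (conn K' A' B')) l = pr (thr (conn K A B)) l"
 using pr_conn_isometry(1)[OF assms(1,2) pt_isometries(1)[of _ u v], of "%x. pt (x $ 1 - u) (x $ 2 - v)" l]
 unfolding assms(3-5) by (simp add: vimage_def)

lemma pr_conn_refl1:
 assumes "conn K A B ~= {}" "bounded K"
  and "K' = {x. pt (- x $ 1) (x $ 2) \<in> K}" "A' = {x. pt (- x $ 1) (x $ 2) \<in> A}" "B' = {x. pt (- x $ 1) (x $ 2) \<in> B}"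
 shows "pr (thr (conn K' A' B')) l = pr (thr (conn K A B)) l"
 using pr_conn_isometry(1)[OF assms(1,2) pt_isometries(2), of "%x. pt (- x $ 1) (x $ 2)" l]
 unfolding assms(3-5) by (simp add: vimage_def)

lemma pr_conn_refl2:
 assumes "conn K A B ~= {}" "bounded K"
  and "K' = {x. pt (x $ 1) (- x $ 2) \<in> K}" "A' = {x. pt (x $ 1) (- x $ 2) \<in> A}" "B' = {x. pt (x $ 1) (- x $ 2) \<in> B}"
 shows "pr (thr (conn K' A' B')) l = pr (thr (conn K A B)) l"
 using pr_conn_isometry(1)[OF assms(1,2) pt_isometries(3), of "%x. pt (x $ 1) (- x $ 2)" l]
 unfolding assms(3-5) by (simp add: vimage_def)

lemma pr_conn_swap:
 assumes "conn K A B ~= {}" "bounded K"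
  and "K' = {x. pt (x $ 2) (x $ 1) \<in> K}" "A' = {x. pt (x $ 2) (x $ 1) \<in> A}" "B' = {x. pt (x $ 2) (x $ 1) \<in> B}"
 shows "pr (thr (conn K' A' B')) l = pr (thr (conn K A B)) l"
 using pr_conn_isometry(1)[OF assms(1,2) pt_isometries(4), of "%x. pt (x $ 2) (x $ 1)" l]
 unfolding assms(3-5) by (simp add: vimage_def)

lemma fkg_list:
 assumes "\<Phi>s ~= []" "!!\<Phi>. \<Phi> \<in> set \<Phi>s ==> incr K \<Phi> \<and> c <= pr \<Phi> l" "bounded K" "0 <= c"
 shows "\<exists>\<Psi>. incr K \<Psi> \<and> c ^ length \<Phi>s <= pr \<Psi> l \<and> (\<forall>g. l < \<Psi> g \<longrightarrow> (\<forall>\<Phi>\<in>set \<Phi>s. l < \<Phi> g))"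
 using assms(1,2)
proof (induction \<Phi>s rule: list_nonempty_induct)
 case (single \<Phi>)
 then show ?case by (intro exI[of _ \<Phi>]) auto
next
 case (cons \<Phi> \<Phi>s)
 then obtain \<Psi> where \<Psi>: "incr K \<Psi>" "c ^ length \<Phi>s <= pr \<Psi> l" "!!g. l < \<Psi> g ==> \<forall>\<Phi>\<in>set \<Phi>s. l < \<Phi> g"
  by auto
 have \<Phi>: "incr K \<Phi>" "c <= pr \<Phi> l" using cons.prems by auto
 have "c * c ^ length \<Phi>s <= pr \<Phi> l * pr \<Psi> l"
  using \<Phi>(2) \<Psi>(2) assms(4) pr_bounds by (intro mult_mono) auto
 also have "\<dots> <= pr (%g. min (\<Phi> g) (\<Psi> g)) l" by (rule fkg[OF \<Phi>(1) \<Psi>(1) assms(3)])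
 finally show ?case
  using \<Psi>(3) incr_min[OF \<Phi>(1) \<Psi>(1)] by (intro exI[of _ "%g. min (\<Phi> g) (\<Psi> g)"]) auto
qed

section \<open>Gluing crossings\<close>

definition fams :: "(real ^ 2) set set list => real => real => bool" where
 "fams Cs l c \<longleftrightarrow> (\<forall>\<C>\<in>set Cs. \<exists>K A B. \<C> = conn K A B \<and> conn K A B ~= {} \<and> bounded K \<and> c <= pr (thr \<C>) l)"

lemma fams_simps [simp]:
 "fams [] l c"
 "fams (conn K A B # Cs) l c \<longleftrightarrow> (\<exists>K' A' B'. conn K A B = conn K' A' B' \<and> conn K' A' B' ~= {} \<and> bounded K' \<and> c <= pr (thr (conn K A B)) l) \<and> fams Cs l c"
 by (auto simp: fams_def)

lemma fams_Cons: "conn K A B ~= {} ==> bounded K ==> c <= pr (thr (conn K A B)) l ==> fams Cs l c ==> fams (conn K A B # Cs) l c"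
 by auto

lemma fams_incr:
 assumes "fams Cs l c"
 obtains L where "bounded L" "!!\<C>. \<C> \<in> set Cs ==> incr L (thr \<C>) \<and> c <= pr (thr \<C>) l"
proof -
 have "\<forall>\<C>\<in>set Cs. \<exists>K. bounded K \<and> incr K (thr \<C>)"
  using assms incr_thr fam_conn unfolding fams_def by metis
 then obtain K where K: "!!\<C>. \<C> \<in> set Cs ==> bounded (K \<C>) \<and> incr (K \<C>) (thr \<C>)" by metis
 show ?thesis
 proof (rule that[of "\<Union>\<C>\<in>set Cs. K \<C>"])
  show "bounded (\<Union>\<C>\<in>set Cs. K \<C>)" using K by (intro bounded_UN) auto
  show "incr (\<Union>\<C>\<in>set Cs. K \<C>) (thr \<C>) \<and> c <= pr (thr \<C>) l" if "\<C> \<in> set Cs" for \<C>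
  proof
   have "K \<C> \<subseteq> (\<Union>\<C>\<in>set Cs. K \<C>)" using that by blast
   with K[OF that] show "incr (\<Union>\<C>\<in>set Cs. K \<C>) (thr \<C>)" using incr_subset by blast
   show "c <= pr (thr \<C>) l" using that assms by (auto simp: fams_def)
  qed
 qed
qed

text \<open>Turns a deterministic gluing statement into a probability bound: by the Harris
  inequality all the families have members above level \<open>l\<close> at the same time with
  probability at least the power of \<open>c\<close>, and any choice of members contains the wanted
  connection.\<close>

lemma glue_conn:
 assumes Cs: "fams Cs l c" "Cs ~= []" "0 <= c" and D: "conn K A B ~= {}" "bounded K"
  and glue: "!!f. (!!\<C>. \<C> \<in> set Cs ==> f \<C> \<in> \<C>) ==> \<exists>S\<in>conn K A B. S \<subseteq> (\<Union>\<C>\<in>set Cs. f \<C>)"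
 shows "c ^ length Cs <= pr (thr (conn K A B)) l"
proof -
 obtain L where L: "bounded L" "!!\<C>. \<C> \<in> set Cs ==> incr L (thr \<C>) \<and> c <= pr (thr \<C>) l"
  using fams_incr[OF Cs(1)] by blast
 obtain \<Psi> where \<Psi>: "incr L \<Psi>" "c ^ length (map thr Cs) <= pr \<Psi> l" "!!g. l < \<Psi> g ==> \<forall>\<Phi>\<in>set (map thr Cs). l < \<Phi> g"
  using fkg_list[of "map thr Cs" L c l] L Cs by auto
 have "pr \<Psi> l <= pr (thr (conn K A B)) l"
 proof (rule pr_mono[OF incr_thr[OF fam_conn[OF D(1)]] D(2)])
  fix z assume "l < \<Psi> (fld z)"
  then have "\<forall>\<C>\<in>set Cs. l < thr \<C> (fld z)" using \<Psi>(3) by auto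
  then have "\<forall>\<C>\<in>set Cs. \<exists>S\<in>\<C>. \<forall>x\<in>S. l < fld z x"
   using Cs(1) thr_conn_gt[OF _ _ continuous_fld] unfolding fams_def by metis
  then obtain f where f: "!!\<C>. \<C> \<in> set Cs ==> f \<C> \<in> \<C> \<and> (\<forall>x\<in>f \<C>. l < fld z x)" by metis
  then obtain S where "S \<in> conn K A B" "S \<subseteq> (\<Union>\<C>\<in>set Cs. f \<C>)" using glue[of f] by blast
  then show "l < thr (conn K A B) (fld z)"
   using f thr_conn_gt[OF D continuous_fld] by blast
 qed
 then show ?thesis using \<Psi>(2) by simp
qed

definition LR :: "real => real => real => real => (real ^ 2) set set" where
 "LR a b c d = conn (rect a b c d) {x. x $ 1 = a} {x. x $ 1 = b}"

definition TB :: "real => real => real => real => (real ^ 2) set set" where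
 "TB a b c d = conn (rect a b c d) {x. x $ 2 = c} {x. x $ 2 = d}"

definition LS :: "real => real => real => real => real => real => (real ^ 2) set set" where
 "LS a b c d h k = conn (rect a b c d) {x. x $ 1 = a} {x. x $ 1 = b \<and> h <= x $ 2 \<and> x $ 2 <= k}"

definition SL :: "real => real => real => real => real => real => (real ^ 2) set set" where
 "SL a b c d h k = conn (rect a b c d) {x. x $ 1 = b} {x. x $ 1 = a \<and> h <= x $ 2 \<and> x $ 2 <= k}"

lemma connected_rect [simp, intro]: "connected (rect a b c d)"
 by (simp add: rect_cbox convex_connected)

lemma conn_rect_ne:
 assumes "x \<in> rect a b c d" "x \<in> A" "y \<in> rect a b c d" "y \<in> B"
 shows "conn (rect a b c d) A B ~= {}"
proof -
 have "rect a b c d \<in> conn (rect a b c d) A B" using assms by (auto simp: conn_def)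
 then show ?thesis by blast
qed

lemma LR_ne: "a <= b ==> c <= d ==> LR a b c d ~= {}"
 unfolding LR_def by (rule conn_rect_ne[of "pt a c" _ _ _ _ _ "pt b c"]) (auto simp: rect_def)

lemma TB_ne: "a <= b ==> c <= d ==> TB a b c d ~= {}"
 unfolding TB_def by (rule conn_rect_ne[of "pt a c" _ _ _ _ _ "pt a d"]) (auto simp: rect_def)

lemma LS_ne: "a <= b ==> c <= h ==> h <= k ==> k <= d ==> LS a b c d h k ~= {}"
 unfolding LS_def by (rule conn_rect_ne[of "pt a c" _ _ _ _ _ "pt b h"]) (auto simp: rect_def)

lemma SL_ne: "a <= b ==> c <= h ==> h <= k ==> k <= d ==> SL a b c d h k ~= {}"
 unfolding SL_def by (rule conn_rect_ne[of "pt b c" _ _ _ _ _ "pt a h"]) (auto simp: rect_def)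

lemma incr_LR: "a <= b ==> c <= d ==> incr (rect a b c d) (thr (LR a b c d))"
 using incr_thr[OF fam_conn] LR_ne unfolding LR_def by blast

lemma incr_LS: "a <= b ==> c <= h ==> h <= k ==> k <= d ==> incr (rect a b c d) (thr (LS a b c d h k))"
 using incr_thr[OF fam_conn] LS_ne unfolding LS_def by blast

lemma pr_LR_shift:
 assumes "a <= b" "c <= d"
 shows "pr (thr (LR (a + u) (b + u) (c + v) (d + v))) l = pr (thr (LR a b c d)) l"
 unfolding LR_def by (rule pr_conn_shift[OF LR_ne[OF assms, unfolded LR_def] bounded_rect, of _ "- u" "- v"]) (auto simp: rect_def)

lemma pr_LR_congr:
 assumes "a <= b" "c <= d" "b' - a' = b - a" "d' - c' = d - c"
 shows "pr (thr (LR a' b' c' d')) l = pr (thr (LR a b c d)) l"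
proof -
 have "a + (a' - a) = a'" "b + (a' - a) = b'" "c + (c' - c) = c'" "d + (c' - c) = d'" using assms(3,4) by simp_all
 then show ?thesis using pr_LR_shift[OF assms(1,2), of "a' - a" "c' - c" l] by simp
qed

lemma pr_TB:
 assumes "a <= b" "c <= d"
 shows "pr (thr (TB a b c d)) l = pr (thr (LR c d a b)) l"
 unfolding TB_def LR_def by (rule pr_conn_swap[OF LR_ne[OF assms(2,1), unfolded LR_def] bounded_rect]) (auto simp: rect_def)

lemma pr_LS_congr:
 assumes "a <= b" "c <= h" "h <= k" "k <= d" "a' = a + u" "b' = b + u" "c' = c + v" "d' = d + v" "h' = h + v" "k' = k + v"
 shows "pr (thr (LS a' b' c' d' h' k')) l = pr (thr (LS a b c d h k)) l"
 unfolding LS_def assms(5-10)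
 by (rule pr_conn_shift[OF LS_ne[OF assms(1-4), unfolded LS_def] bounded_rect, of _ "- u" "- v"]) (auto simp: rect_def)

lemma pr_LS_refl:
 assumes "a <= b" "c <= h" "h <= k" "k <= d"
 shows "pr (thr (LS a b (- d) (- c) (- k) (- h))) l = pr (thr (LS a b c d h k)) l"
 unfolding LS_def by (rule pr_conn_refl2[OF LS_ne[OF assms, unfolded LS_def] bounded_rect]) (auto simp: rect_def)

lemma pr_SL_refl:
 assumes "a <= b" "c <= h" "h <= k" "k <= d"
 shows "pr (thr (SL (- b) (- a) c d h k)) l = pr (thr (LS a b c d h k)) l"
 unfolding LS_def SL_def by (rule pr_conn_refl1[OF LS_ne[OF assms, unfolded LS_def] bounded_rect]) (auto simp: rect_def)

lemma thr_split:
 fixes K :: "(real ^ 2) set"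
 assumes "fam K \<C>" "fam K1 \<C>1" "fam K2 \<C>2" "bounded (g ` K)" "bounded (g ` K1)" "bounded (g ` K2)"
  and "\<C> \<subseteq> \<C>1 \<union> \<C>2"
 shows "thr \<C> g <= max (thr \<C>1 g) (thr \<C>2 g)"
proof (rule dense_le)
 fix l assume "l < thr \<C> g"
 then obtain l' S where S: "l' > l" "S \<in> \<C>" "\<forall>x\<in>S. l' <= g x" using thr_gt_iff[OF assms(1,4)] by blast
 have "l' <= thr \<C>1 g \<or> l' <= thr \<C>2 g"
  using thr_ge[OF assms(2,5), of S l'] thr_ge[OF assms(3,6), of S l'] S assms(7) by blast
 then show "l <= max (thr \<C>1 g) (thr \<C>2 g)" using S(1) by auto
qed

text \<open>A connection to \<open>B\<close> ends in \<open>B1\<close> or in \<open>B2\<close>, so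
  its level is at most the larger of the two levels.\<close>

lemma square_root_split:
 assumes ne: "conn K A B ~= {}" "conn K A B1 ~= {}" "conn K A B2 ~= {}" and K: "bounded K" and B: "K \<inter> B \<subseteq> B1 \<union> B2"
 shows "(1 - pr (thr (conn K A B1)) l) * (1 - pr (thr (conn K A B2)) l) <= 1 - pr (thr (conn K A B)) l"
proof -
 note i = incr_thr[OF fam_conn[OF ne(2)]] incr_thr[OF fam_conn[OF ne(3)]]
 have "pr (thr (conn K A B)) l <= pr (%g. max (thr (conn K A B1) g) (thr (conn K A B2) g)) l"
 proof (rule pr_mono[OF incr_max[OF i] K])
  fix z assume "l < thr (conn K A B) (fld z)"
  moreover have "conn K A B \<subseteq> conn K A B1 \<union> conn K A B2"
  proof
   fix S assume S: "S \<in> conn K A B"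
   then obtain x where "x \<in> S" "x \<in> B" "x \<in> K" by (auto simp: conn_def)
   then have "S \<inter> B1 ~= {} \<or> S \<inter> B2 ~= {}" using B by blast
   then show "S \<in> conn K A B1 \<union> conn K A B2" using S by (simp add: conn_def)
  qed
  ultimately show "l < max (thr (conn K A B1) (fld z)) (thr (conn K A B2) (fld z))"
   using thr_split[OF fam_conn[OF ne(1)] fam_conn[OF ne(2)] fam_conn[OF ne(3)], of "fld z"] K by force
 qed
 then show ?thesis using pr_max_le[OF i K, of l] by simp
qed

text \<open>The event that infinitely many approximations exceed \<open>l\<close> has probability at
  least \<open>c\<close> and forces the weak inequality for the limit; absence of atoms restores the
  strict one.\<close>

lemma pr_limit:
 assumes \<Phi>: "incr K \<Phi>" "bounded K" and \<Phi>n: "!!n. incr K (\<Phi>n n)"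
  and lim: "!!z \<eta>. \<eta> > 0 ==> \<exists>N. \<forall>n\<ge>N. \<Phi>n n (fld z) <= \<Phi> (fld z) + \<eta>"
  and c: "!!n::nat. c <= pr (\<Phi>n n) l"
 shows "c <= pr \<Phi> l"
proof -
 define E where "E n = {z. l < \<Phi>n n (fld z)}" for n
 have E: "E n \<in> sets PP" for n unfolding E_def by (rule sets_incr_fld(1)[OF \<Phi>n \<Phi>(2)])
 define U where "U m = (\<Union>n\<in>{m..}. E n)" for m
 have U: "range U \<subseteq> sets PP" using E by (auto simp: U_def)
 have dec: "decseq U" unfolding U_def decseq_def
 proof (intro allI impI)
  fix m n :: nat assume "m <= n"
  then show "(\<Union>k\<in>{n..}. E k) \<subseteq> (\<Union>k\<in>{m..}. E k)" by (intro UN_mono) auto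
 qed
 have "c <= PP.prob (U m)" for m
 proof -
  have "c <= PP.prob (E m)" using c[of m] by (simp add: pr_def E_def)
  also have "\<dots> <= PP.prob (U m)" using U by (intro PP.finite_measure_mono) (auto simp: U_def)
  finally show ?thesis .
 qed
 moreover have "(%m. PP.prob (U m)) \<longlonglongrightarrow> PP.prob (\<Inter>m. U m)"
  by (rule PP.finite_Lim_measure_decseq[OF U dec])
 ultimately have "c <= PP.prob (\<Inter>m. U m)" by (meson LIMSEQ_le_const)
 also have "\<dots> <= PP.prob {z. l <= \<Phi> (fld z)}"
 proof (intro PP.finite_measure_mono subsetI)
  fix z assume z: "z \<in> (\<Inter>m. U m)"
  have "l - \<eta> <= \<Phi> (fld z)" if \<eta>: "\<eta> > 0" for \<eta>
  proof -
   obtain N where N: "!!n. n >= N ==> \<Phi>n n (fld z) <= \<Phi> (fld z) + \<eta>" using lim[OF \<eta>] by blast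
   obtain n where "n >= N" "z \<in> E n" using z by (auto simp: U_def)
   then show ?thesis using N[of n] by (simp add: E_def)
  qed
  then have "l <= \<Phi> (fld z) + \<eta>" if "\<eta> > 0" for \<eta> using that by (simp add: algebra_simps)
  then show "z \<in> {z. l <= \<Phi> (fld z)}" using field_le_epsilon[of l "\<Phi> (fld z)"] by simp
 qed (use sets_incr_fld(2)[OF \<Phi>] in auto)
 finally show ?thesis using pr_ge_eq[OF \<Phi>] by simp
qed

text \<open>A crossing that ends slightly off the target segment is prolonged along the right side
  to the nearest point of the segment; by uniform continuity this lowers the level by at most
  \<open>\<eta>\<close>.\<close>

lemma thr_LS_continuity:
 assumes ab: "a <= b" and hk: "c <= h" "h <= k" "k <= d" and hk': "!!n. c <= hn n" "!!n. hn n <= kn n" "!!n. kn n <= d"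
  and lim: "hn \<longlonglongrightarrow> h" "kn \<longlonglongrightarrow> k" and g: "continuous_on UNIV g" and \<eta>: "\<eta> > 0"
 shows "\<exists>N. \<forall>n\<ge>N. thr (LS a b c d (hn n) (kn n)) g <= thr (LS a b c d h k) g + \<eta>"
proof -
 let ?K = "rect a b c d"
 have bg: "bounded (g ` ?K)" by (intro bounded_cont_image g bounded_rect)
 have F: "fam ?K (LS a b c d h k)" using fam_conn LS_ne[OF ab hk] unfolding LS_def by blast
 have Fn: "fam ?K (LS a b c d (hn n) (kn n))" for n using fam_conn LS_ne[OF ab hk'] unfolding LS_def by blast
 have "uniformly_continuous_on ?K g"
  using g by (intro compact_uniformly_continuous) (auto intro: continuous_on_subset)
 then obtain \<delta> where \<delta>: "\<delta> > 0" "!!x y. x \<in> ?K ==> y \<in> ?K ==> dist y x < \<delta> ==> dist (g y) (g x) < \<eta>"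
  using \<eta> unfolding uniformly_continuous_on_def by metis
 have "\<forall>\<^sub>F n in sequentially. dist (hn n) h < \<delta> \<and> dist (kn n) k < \<delta>"
  using tendstoD[OF lim(1) \<delta>(1)] tendstoD[OF lim(2) \<delta>(1)] by (rule eventually_conj)
 then obtain N where N: "!!n. n >= N ==> dist (hn n) h < \<delta> \<and> dist (kn n) k < \<delta>"
  by (auto simp: eventually_sequentially)
 have "thr (LS a b c d (hn n) (kn n)) g <= thr (LS a b c d h k) g + \<eta>" if n: "n >= N" for n
 proof (rule dense_le)
  fix l assume "l < thr (LS a b c d (hn n) (kn n)) g"
  then obtain l' S where S: "l' > l" "S \<in> LS a b c d (hn n) (kn n)" "\<forall>x\<in>S. l' <= g x"
   using thr_gt_iff[OF Fn bg] by blast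
  then obtain x where x: "x \<in> S" "x $ 1 = b" "hn n <= x $ 2" "x $ 2 <= kn n" by (auto simp: LS_def conn_def)
  define t where "t = max h (min k (x $ 2))"
  have t: "h <= t" "t <= k" "\<bar>t - x $ 2\<bar> < \<delta>"
   using N[OF n] x hk \<delta>(1) by (auto simp: t_def dist_real_def max_def min_def)
  define S' where "S' = S \<union> rect b b (min t (x $ 2)) (max t (x $ 2))"
  have xK: "x \<in> ?K" using S x by (auto simp: LS_def conn_def)
  have seg: "y \<in> ?K \<and> dist y x < \<delta>" if "y \<in> rect b b (min t (x $ 2)) (max t (x $ 2))" for y
  proof -
   have y: "y $ 1 = b" "min t (x $ 2) <= y $ 2" "y $ 2 <= max t (x $ 2)" using that by (auto simp: rect_def)
   have "dist y x = \<bar>y $ 2 - x $ 2\<bar>" using y x by (simp add: dist_vec_def L2_set_def sum_2 dist_real_def)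
   then show ?thesis using y t xK hk ab by (auto simp: rect_def min_def max_def split: if_splits)
  qed
  have "x \<in> rect b b (min t (x $ 2)) (max t (x $ 2))" "pt b t \<in> rect b b (min t (x $ 2)) (max t (x $ 2))"
   using x by (auto simp: rect_def)
  then have "S' \<in> LS a b c d h k"
   using S x t seg unfolding S'_def LS_def conn_def
   by (auto intro!: connected_Un exI[of _ "pt b t"] dest: seg)
  moreover have "l' - \<eta> <= g y" if "y \<in> S'" for y
  proof (cases "y \<in> S")
   case True then show ?thesis using S(3) \<eta> by force
  next
   case False
   then have "dist (g y) (g x) < \<eta>" using that seg[of y] xK by (intro \<delta>(2)) (auto simp: S'_def)
   moreover have "l' <= g x" using S(3) x(1) by blast
   ultimately show ?thesis by (simp add: dist_real_def)
  qed
  ultimately have "l' - \<eta> <= thr (LS a b c d h k) g" by (rule thr_ge[OF F bg])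
  then show "l <= thr (LS a b c d h k) g + \<eta>" using S(1) by simp
 qed
 then show ?thesis by blast
qed

section \<open>From squares to long rectangles\<close>

definition up :: "real => real => (real ^ 2) set set" where
 "up s \<alpha> = LS 0 s (- s / 2) (s / 2) \<alpha> (s / 2)"

definition low :: "real => real => (real ^ 2) set set" where
 "low s \<alpha> = LS 0 s (- s / 2) (s / 2) 0 \<alpha>"

text \<open>The intermediate height of Tassion's proof of the box crossing property.\<close>

lemma intermediate_height:
 assumes s: "s > 0" and \<epsilon>: "0 <= \<epsilon>" "\<epsilon> < 1" and sq: "1 - \<epsilon> <= pr (thr (LR 0 s (- s / 2) (s / 2))) l"
 obtains \<alpha> where "0 <= \<alpha>" "\<alpha> <= s / 2" "1 - sqrt (sqrt \<epsilon>) <= pr (thr (up s \<alpha>)) l" "1 - sqrt (sqrt \<epsilon>) <= pr (thr (low s \<alpha>)) l"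
proof -
 \<comment> \<open>A fourth root because the square root trick is applied twice: to the two halves
   of the right side, then to the two parts of its upper half.\<close>
 define \<tau> where "\<tau> = sqrt (sqrt \<epsilon>)"
 have \<tau>: "0 <= \<tau>" "\<tau> * \<tau> = sqrt \<epsilon>" using \<epsilon> by (auto simp: \<tau>_def)
 have "sqrt \<epsilon> <= 1" using \<epsilon> by (simp add: real_le_lsqrt)
 then have "\<tau> <= 1" unfolding \<tau>_def using \<epsilon> by (simp add: real_le_lsqrt)
 then have s\<tau>: "sqrt \<epsilon> <= \<tau>" using \<tau> mult_left_mono[of \<tau> 1 \<tau>] by simp
 have eq1: "pr (thr (LS 0 s (- s / 2) (s / 2) (- s / 2) 0)) l = pr (thr (up s 0)) l"
  using pr_LS_refl[of 0 s "- s / 2" 0 "s / 2" "s / 2" l] s by (simp add: up_def)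
 have "(1 - pr (thr (up s 0)) l) * (1 - pr (thr (LS 0 s (- s / 2) (s / 2) (- s / 2) 0)) l) <= 1 - pr (thr (LR 0 s (- s / 2) (s / 2))) l"
  unfolding up_def LS_def LR_def
  by (rule square_root_split[OF _ _ _ bounded_rect]) (use s LS_ne[of 0 s "- s / 2" 0 "s / 2" "s / 2"] LS_ne[of 0 s "- s / 2" "- s / 2" 0 "s / 2"]
   LR_ne[of 0 s "- s / 2" "s / 2"] in \<open>auto simp: LS_def LR_def rect_def\<close>)
 then have "(1 - pr (thr (up s 0)) l)\<^sup>2 <= \<epsilon>" using eq1 sq by (simp add: power2_eq_square)
 then have u0: "1 - pr (thr (up s 0)) l <= sqrt \<epsilon>" by (rule real_le_rsqrt)
 have split: "(1 - pr (thr (up s \<alpha>)) l) * (1 - pr (thr (low s \<alpha>)) l) <= \<tau> * \<tau>" if "0 <= \<alpha>" "\<alpha> <= s / 2" for \<alpha>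
 proof -
  have "(1 - pr (thr (up s \<alpha>)) l) * (1 - pr (thr (low s \<alpha>)) l) <= 1 - pr (thr (up s 0)) l"
   unfolding up_def low_def LS_def
   by (rule square_root_split[OF _ _ _ bounded_rect]) (use s that LS_ne[of 0 s "- s / 2" 0 "s / 2" "s / 2"] LS_ne[of 0 s "- s / 2" \<alpha> "s / 2" "s / 2"]
    LS_ne[of 0 s "- s / 2" 0 \<alpha> "s / 2"] in \<open>auto simp: LS_def rect_def\<close>)
  then show ?thesis using u0 \<tau> by simp
 qed
 \<comment> \<open>At the supremum of this set the estimate for \<open>up\<close> follows by a limit
   from below, that for \<open>low\<close> by a limit from above.\<close>
 define A where "A = {\<alpha>. 0 <= \<alpha> \<and> \<alpha> <= s / 2 \<and> 1 - \<tau> <= pr (thr (up s \<alpha>)) l}"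
 have A0: "0 \<in> A" using u0 s\<tau> s by (simp add: A_def)
 have bdd: "bdd_above A" by (rule bdd_aboveI[of _ "s / 2"]) (simp add: A_def)
 define \<alpha> where "\<alpha> = Sup A"
 have \<alpha>: "0 <= \<alpha>" "\<alpha> <= s / 2"
 proof -
  show "0 <= \<alpha>" using cSup_upper[OF A0 bdd] by (simp add: \<alpha>_def)
  show "\<alpha> <= s / 2" unfolding \<alpha>_def
  proof (rule cSup_least)
   show "A ~= {}" using A0 by blast
  qed (simp add: A_def)
 qed
 have \<alpha>u: "a <= \<alpha>" if "a \<in> A" for a using cSup_upper[OF that bdd] by (simp add: \<alpha>_def)
 note bt = tendsto_const LIMSEQ_inverse_real_of_nat
 have goodup: "1 - \<tau> <= pr (thr (up s \<alpha>)) l"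
 proof -
  have "\<exists>a\<in>A. \<alpha> - inverse (real (Suc n)) < a" for n
   using less_cSupD[of A "\<alpha> - inverse (real (Suc n))"] A0 by (auto simp: \<alpha>_def)
  then obtain an where an: "!!n. an n \<in> A" "!!n. \<alpha> - inverse (real (Suc n)) < an n" by metis
  have "an \<longlonglongrightarrow> \<alpha>"
  proof (rule tendsto_sandwich)
   show "\<forall>\<^sub>F n in sequentially. \<alpha> - inverse (real (Suc n)) <= an n" using an(2) by (auto intro!: always_eventually less_imp_le)
   show "\<forall>\<^sub>F n in sequentially. an n <= \<alpha>" using an(1) \<alpha>u by (auto intro!: always_eventually)
   show "(%n. \<alpha> - inverse (real (Suc n))) \<longlonglongrightarrow> \<alpha>"
    using tendsto_diff[OF tendsto_const[of \<alpha>] LIMSEQ_inverse_real_of_nat] by simp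
  qed simp
  have anb: "- s / 2 <= an n" "- (s / 2) <= an n" "an n <= s / 2" "1 - \<tau> <= pr (thr (up s (an n))) l" for n
   using an(1)[of n] s by (auto simp: A_def)
  have lim: "\<exists>N. \<forall>n\<ge>N. thr (up s (an n)) (fld z) <= thr (up s \<alpha>) (fld z) + \<eta>" if "\<eta> > 0" for z \<eta>
   unfolding up_def using \<open>an \<longlonglongrightarrow> \<alpha>\<close> \<alpha> s that anb
   by (intro thr_LS_continuity continuous_fld tendsto_const) auto
  show ?thesis
   by (rule pr_limit[where \<Phi>n = "%n. thr (up s (an n))" and K = "rect 0 s (- s / 2) (s / 2)"])
     (use anb \<alpha> s lim in \<open>auto simp: up_def intro!: incr_LS\<close>)
 qed
 \<comment> \<open>Just above \<open>\<alpha>\<close> the upper part is no longer likely to be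
   reached, so by the product bound the lower one is; then the height decreases to
   \<open>\<alpha>\<close>.\<close>
 have goodlow: "1 - \<tau> <= pr (thr (low s \<alpha>)) l"
 proof (cases "\<alpha> = s / 2")
  case True
  then have "low s \<alpha> = up s 0" unfolding low_def up_def by (simp only:)
  then show ?thesis using u0 s\<tau> by simp
 next
  case False
  define an where "an n = \<alpha> + (s / 2 - \<alpha>) * inverse (real (Suc n))" for n
  have an: "\<alpha> < an n" "an n <= s / 2" for n
  proof -
   have "0 < s / 2 - \<alpha>" using False \<alpha> by simp
   then show "\<alpha> < an n" by (simp add: an_def)
   have "(s / 2 - \<alpha>) * inverse (real (Suc n)) <= (s / 2 - \<alpha>) * 1"
    using \<alpha> by (intro mult_left_mono) (auto simp: field_simps)
   then show "an n <= s / 2" by (simp add: an_def)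
  qed
  have glow: "1 - \<tau> <= pr (thr (low s (an n))) l" for n
  proof (rule ccontr)
   assume "\<not> ?thesis"
   then have 1: "\<tau> < 1 - pr (thr (low s (an n))) l" by simp
   have "an n \<notin> A" using \<alpha>u[of "an n"] an(1)[of n] by auto
   then have 2: "\<tau> < 1 - pr (thr (up s (an n))) l" using an[of n] \<alpha> by (auto simp: A_def)
   have "\<tau> * \<tau> < (1 - pr (thr (up s (an n))) l) * (1 - pr (thr (low s (an n))) l)"
    using 1 2 \<tau>(1) by (intro mult_strict_mono) auto
   then show False using split[of "an n"] an[of n] \<alpha> by auto
  qed
  have "an \<longlonglongrightarrow> \<alpha>"
   using tendsto_add[OF tendsto_const[of \<alpha>] tendsto_mult[OF tendsto_const[of "s / 2 - \<alpha>"] LIMSEQ_inverse_real_of_nat]]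
   by (simp add: an_def[abs_def])
  moreover have "0 <= an n" "an n <= s / 2" for n using an[of n] \<alpha> by auto
  ultimately have lim: "\<exists>N. \<forall>n\<ge>N. thr (low s (an n)) (fld z) <= thr (low s \<alpha>) (fld z) + \<eta>" if "\<eta> > 0" for z \<eta>
   unfolding low_def using \<alpha> s that
   by (intro thr_LS_continuity continuous_fld tendsto_const) auto
  show ?thesis
   by (rule pr_limit[where \<Phi>n = "%n. thr (low s (an n))" and K = "rect 0 s (- s / 2) (s / 2)"])
     (use \<open>!!n. 0 <= an n\<close> \<open>!!n. an n <= s / 2\<close> \<alpha> s lim glow in \<open>auto simp: low_def intro!: incr_LS\<close>)
 qed
 show ?thesis using that[OF \<alpha>] goodup goodlow by (simp add: \<tau>_def)
qed

lemma incr_conn_subset: "conn K A B ~= {} ==> K \<subseteq> L ==> incr L (thr (conn K A B))"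
 using incr_subset[OF incr_thr[OF fam_conn]] .

lemma pr_conn_mono:
 assumes "conn K A B' ~= {}" "bounded K" "B' \<subseteq> B"
 shows "pr (thr (conn K A B')) l <= pr (thr (conn K A B)) l"
proof -
 have sub: "conn K A B' \<subseteq> conn K A B" using assms(3) by (auto simp: conn_def)
 then have ne: "conn K A B ~= {}" using assms(1) by blast
 show ?thesis
 proof (rule pr_mono[OF incr_thr[OF fam_conn[OF ne]] assms(2)])
  fix z assume "l < thr (conn K A B') (fld z)"
  then show "l < thr (conn K A B) (fld z)"
   using sub thr_conn_gt[OF assms(1,2) continuous_fld] thr_conn_gt[OF ne assms(2) continuous_fld] by blast
 qed
qed

text \<open>In the square of half-side \<open>t = s / 3\<close> four crossings, ending on the
  vertical sides at height at least \<open>\<beta>\<close> or at most \<open>- \<beta>\<close>, are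
  joined by a vertical crossing into one set. A crossing of a square of side \<open>s\<close> that
  ends on the segment \<open>[- \<beta>, \<beta>]\<close> of a side must meet this set. Doing this
  from both sides crosses a rectangle of size \<open>4 * t\<close> by \<open>15 * t / 4\<close>, of
  ratio \<open>16/15\<close>.\<close>

lemma four_thirds_crossing:
 assumes s: "s > 0" and \<alpha>: "0 <= \<alpha>" "\<alpha> <= s / 2" and c: "0 <= c"
  and lw: "c <= pr (thr (low s \<alpha>)) l" and u: "c <= pr (thr (up (2 * s / 3) (\<alpha> / 2))) l"
  and sq: "c <= pr (thr (LR 0 (2 * s / 3) 0 (2 * s / 3))) l"
 shows "c ^ 7 <= pr (thr (LR (- 2 * s / 3) (2 * s / 3) (- 3 * s / 4) (s / 2))) l"
proof -
 define t where "t = s / 3"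
 \<comment> \<open>Lowering the square of side \<open>s\<close> by \<open>\<alpha> / 2\<close>
   centres its target segment \<open>[0, \<alpha>]\<close>.\<close>
 define \<beta> where "\<beta> = \<alpha> / 2"
 have t: "t > 0" "0 <= \<beta>" "\<beta> <= t" "\<beta> <= 3 * t / 4" using s \<alpha> by (auto simp: t_def \<beta>_def)
 define E where "E = LS (- 2 * t) t (- 3 * t / 2 - \<beta>) (3 * t / 2 - \<beta>) (- \<beta>) \<beta>"
 define E' where "E' = SL (- t) (2 * t) (- 3 * t / 2 - \<beta>) (3 * t / 2 - \<beta>) (- \<beta>) \<beta>"
 define X1 where "X1 = LS (- t) t (- t) t \<beta> t"
 define X2 where "X2 = LS (- t) t (- t) t (- t) (- \<beta>)"
 define X3 where "X3 = SL (- t) t (- t) t \<beta> t"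
 define X4 where "X4 = SL (- t) t (- t) t (- t) (- \<beta>)"
 define V where "V = TB (- t) t (- t) t"
 have pE: "c <= pr (thr E) l"
 proof -
  have "pr (thr E) l = pr (thr (low s \<alpha>)) l" unfolding E_def low_def
   using t \<alpha> by (intro pr_LS_congr[where u = "- 2 * t" and v = "- \<beta>"]) (auto simp: t_def \<beta>_def)
  then show ?thesis using lw by simp
 qed
 have pE': "c <= pr (thr E') l"
 proof -
  have "pr (thr E') l = pr (thr E) l" unfolding E_def E'_def
   using pr_SL_refl[of "- 2 * t" t "- 3 * t / 2 - \<beta>" "- \<beta>" \<beta> "3 * t / 2 - \<beta>" l] t by simp
  then show ?thesis using pE by simp
 qed
 have pX1: "c <= pr (thr X1) l"
 proof -
  have "pr (thr X1) l = pr (thr (up (2 * s / 3) (\<alpha> / 2))) l" unfolding X1_def up_def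
   using t by (intro pr_LS_congr[where u = "- t" and v = 0]) (auto simp: t_def \<beta>_def)
  then show ?thesis using u by simp
 qed
 have pX2: "c <= pr (thr X2) l"
  using pr_LS_refl[of "- t" t "- t" \<beta> t t l] t pX1 by (simp add: X1_def X2_def)
 have pX3: "c <= pr (thr X3) l"
  using pr_SL_refl[of "- t" t "- t" \<beta> t t l] t pX1 by (simp add: X1_def X3_def)
 have pX4: "c <= pr (thr X4) l"
  using pr_SL_refl[of "- t" t "- t" "- t" "- \<beta>" t l] t pX2 by (simp add: X2_def X4_def)
 have pV: "c <= pr (thr V) l"
  using pr_TB[of "- t" t "- t" t l] pr_LR_congr[of 0 "2 * s / 3" 0 "2 * s / 3" t "- t" t "- t" l] t sq
  by (simp add: V_def t_def)
 have tgt: "LR (- 2 * s / 3) (2 * s / 3) (- 3 * s / 4) (s / 2) = LR (- 2 * t) (2 * t) (- 9 * t / 4) (3 * t / 2)"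
  by (simp add: t_def)
 have "c ^ length [E, E', X1, X2, X3, X4, V] <= pr (thr (LR (- 2 * t) (2 * t) (- 9 * t / 4) (3 * t / 2))) l"
  unfolding LR_def
 proof (rule glue_conn[OF _ _ c])
  show "fams [E, E', X1, X2, X3, X4, V] l c"
   using pE pE' pX1 pX2 pX3 pX4 pV t
    LS_ne[of "- 2 * t" t "- 3 * t / 2 - \<beta>" "- \<beta>" \<beta> "3 * t / 2 - \<beta>"] SL_ne[of "- t" "2 * t" "- 3 * t / 2 - \<beta>" "- \<beta>" \<beta> "3 * t / 2 - \<beta>"]
    LS_ne[of "- t" t "- t" \<beta> t t] LS_ne[of "- t" t "- t" "- t" "- \<beta>" t]
    SL_ne[of "- t" t "- t" \<beta> t t] SL_ne[of "- t" t "- t" "- t" "- \<beta>" t] TB_ne[of "- t" t "- t" t]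
   unfolding E_def E'_def X1_def X2_def X3_def X4_def V_def LS_def SL_def TB_def
   by (intro fams_Cons fams_simps(1)) auto
  show "conn (rect (- 2 * t) (2 * t) (- 9 * t / 4) (3 * t / 2)) {x. x $ 1 = - 2 * t} {x. x $ 1 = 2 * t} ~= {}"
   using LR_ne[of "- 2 * t" "2 * t" "- 9 * t / 4" "3 * t / 2"] t by (simp add: LR_def)
  fix f assume "!!\<C>. \<C> \<in> set [E, E', X1, X2, X3, X4, V] ==> f \<C> \<in> \<C>"
  then have mem: "f E \<in> E" "f E' \<in> E'" "f X1 \<in> X1" "f X2 \<in> X2" "f X3 \<in> X3" "f X4 \<in> X4" "f V \<in> V" by auto
  obtain v1 v2 where v: "compact (f V)" "connected (f V)" "f V \<subseteq> rect (- t) t (- t) t" "v1 \<in> f V" "v1 $ 2 = - t" "v2 \<in> f V" "v2 $ 2 = t"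
   using mem(7) unfolding V_def TB_def conn_def by blast
  obtain a1 b1 where x1: "compact (f X1)" "connected (f X1)" "f X1 \<subseteq> rect (- t) t (- t) t" "a1 \<in> f X1" "a1 $ 1 = - t" "b1 \<in> f X1" "b1 $ 1 = t" "\<beta> <= b1 $ 2"
   using mem(3) unfolding X1_def LS_def conn_def by blast
  obtain a2 b2 where x2: "compact (f X2)" "connected (f X2)" "f X2 \<subseteq> rect (- t) t (- t) t" "a2 \<in> f X2" "a2 $ 1 = - t" "b2 \<in> f X2" "b2 $ 1 = t" "b2 $ 2 <= - \<beta>"
   using mem(4) unfolding X2_def LS_def conn_def by blast
  obtain a3 b3 where x3: "compact (f X3)" "connected (f X3)" "f X3 \<subseteq> rect (- t) t (- t) t" "a3 \<in> f X3" "a3 $ 1 = t" "b3 \<in> f X3" "b3 $ 1 = - t" "\<beta> <= b3 $ 2"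
   using mem(5) unfolding X3_def SL_def conn_def by blast
  obtain a4 b4 where x4: "compact (f X4)" "connected (f X4)" "f X4 \<subseteq> rect (- t) t (- t) t" "a4 \<in> f X4" "a4 $ 1 = t" "b4 \<in> f X4" "b4 $ 1 = - t" "b4 $ 2 <= - \<beta>"
   using mem(6) unfolding X4_def SL_def conn_def by blast
  obtain p q where e: "compact (f E)" "connected (f E)" "f E \<subseteq> rect (- 2 * t) t (- 3 * t / 2 - \<beta>) (3 * t / 2 - \<beta>)" "p \<in> f E" "p $ 1 = - 2 * t" "q \<in> f E" "q $ 1 = t" "- \<beta> <= q $ 2" "q $ 2 <= \<beta>"
   using mem(1) unfolding E_def LS_def conn_def by blast
  obtain p' q' where e': "compact (f E')" "connected (f E')" "f E' \<subseteq> rect (- t) (2 * t) (- 3 * t / 2 - \<beta>) (3 * t / 2 - \<beta>)" "p' \<in> f E'" "p' $ 1 = 2 * t" "q' \<in> f E'" "q' $ 1 = - t" "- \<beta> <= q' $ 2" "q' $ 2 <= \<beta>"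
   using mem(2) unfolding E'_def SL_def conn_def by blast
  define Y where "Y = f V \<union> f X1 \<union> f X2 \<union> f X3 \<union> f X4"
  have i1: "f X1 \<inter> f V ~= {}" by (rule rect_crossing[OF x1(1-3) v(1-3) x1(4-7) v(4-7)])
  have i2: "f X2 \<inter> f V ~= {}" by (rule rect_crossing[OF x2(1-3) v(1-3) x2(4-7) v(4-7)])
  have i3: "f X3 \<inter> f V ~= {}" by (rule rect_crossing[OF x3(1-3) v(1-3) x3(6,7,4,5) v(4-7)])
  have i4: "f X4 \<inter> f V ~= {}" by (rule rect_crossing[OF x4(1-3) v(1-3) x4(6,7,4,5) v(4-7)])
  have cY: "connected Y" unfolding Y_def
   using v(2) x1(2) x2(2) x3(2) x4(2) i1 i2 i3 i4 by (intro connected_Un) blast+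
  have kY: "compact Y" unfolding Y_def using v(1) x1(1) x2(1) x3(1) x4(1) by (intro compact_Un)
  have sY: "Y \<subseteq> rect (- t) t (- t) t" unfolding Y_def using v(3) x1(3) x2(3) x3(3) x4(3) by blast
  have mY: "b1 \<in> Y" "b2 \<in> Y" "b3 \<in> Y" "b4 \<in> Y" unfolding Y_def using x1(6) x2(6) x3(6) x4(6) by auto
  have iE: "f E \<inter> Y ~= {}"
  proof (rule arc_crossing[OF kY cY _ mY(1) x1(7,8) mY(2) x2(7,8) e(1,2) _ e(4) _ e(6-9)])
   show "- t <= x $ 1 \<and> x $ 1 <= t" if "x \<in> Y" for x using that sY by (auto simp: rect_def)
   show "x $ 1 <= t" if "x \<in> f E" for x using that e(3) by (auto simp: rect_def)
   show "p $ 1 <= - t" using e(5) t by simp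
  qed
  \<comment> \<open>\<open>arc_crossing\<close> approaches from the left, so the crossing from the
    right is treated by reflection.\<close>
  define R where "R = (%x::real^2. pt (- x $ 1) (x $ 2))"
  have cR: "continuous_on X R" for X unfolding R_def by (intro continuous_intros)
  have iE': "R ` f E' \<inter> R ` Y ~= {}"
  proof (rule arc_crossing[where a = "- t" and b = t and h = \<beta> and g = "- \<beta>"])
   show "compact (R ` Y)" "connected (R ` Y)" "compact (R ` f E')" "connected (R ` f E')"
    using kY cY e'(1,2) cR by (auto intro: compact_continuous_image connected_continuous_image)
   show "- t <= x $ 1 \<and> x $ 1 <= t" if "x \<in> R ` Y" for x using that sY by (auto simp: rect_def R_def)
   show "x $ 1 <= t" if "x \<in> R ` f E'" for x using that e'(3) by (auto simp: rect_def R_def)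
   show "R b3 \<in> R ` Y" "R b4 \<in> R ` Y" "R p' \<in> R ` f E'" "R q' \<in> R ` f E'" using mY e' by auto
  qed (use x3 x4 e' t in \<open>auto simp: R_def\<close>)
  have "R (R x) = x" for x by (simp add: R_def)
  then have "inj R" by (metis injI)
  then have iE'': "f E' \<inter> Y ~= {}" using iE' by (simp add: image_Int[symmetric])
  show "\<exists>S\<in>conn (rect (- 2 * t) (2 * t) (- 9 * t / 4) (3 * t / 2)) {x. x $ 1 = - 2 * t} {x. x $ 1 = 2 * t}.
    S \<subseteq> (\<Union>\<C>\<in>set [E, E', X1, X2, X3, X4, V]. f \<C>)"
  proof (rule bexI)
   show "f E \<union> Y \<union> f E' \<subseteq> (\<Union>\<C>\<in>set [E, E', X1, X2, X3, X4, V]. f \<C>)" by (auto simp: Y_def)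
   have "f E \<union> Y \<union> f E' \<subseteq> rect (- 2 * t) (2 * t) (- 9 * t / 4) (3 * t / 2)"
    using e(3) e'(3) sY t by (fastforce simp: rect_def)
   moreover have "connected (f E \<union> Y \<union> f E')"
    using e(2) cY e'(2) iE iE'' by (intro connected_Un) blast+
   moreover have "compact (f E \<union> Y \<union> f E')" using e(1) kY e'(1) by (intro compact_Un)
   ultimately show "f E \<union> Y \<union> f E' \<in> conn (rect (- 2 * t) (2 * t) (- 9 * t / 4) (3 * t / 2)) {x. x $ 1 = - 2 * t} {x. x $ 1 = 2 * t}"
    using e(4,5) e'(4,5) unfolding conn_def by blast
  qed
 qed auto
 then show ?thesis unfolding tgt by (simp add: numeral_eq_Suc)
qed

text \<open>Two translates of the rectangle of length \<open>L\<close> overlap in width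
  \<open>2 * L - L' \<ge> h\<close>, so a vertical crossing of a square of side \<open>h\<close> in
  the overlap meets both long crossings.\<close>

lemma extend_crossing:
 assumes h: "h > 0" "h <= L" "L <= L'" "L' <= 2 * L - h" and c: "0 <= c" "c <= 1"
  and R: "c ^ n <= pr (thr (LR 0 L 0 h)) l" and sq: "c <= pr (thr (LR 0 h 0 h)) l"
 shows "c ^ (2 * n + 1) <= pr (thr (LR 0 L' 0 h)) l"
proof -
 have sub: "bounded (rect 0 L' 0 h)" by simp
 define A where "A = LR 0 L 0 h"
 define B where "B = LR (L' - L) L' 0 h"
 define V where "V = TB (L' - L) (L' - L + h) 0 h"
 have pB: "pr (thr B) l = pr (thr A) l" unfolding A_def B_def using h by (intro pr_LR_congr) auto
 have pV: "c <= pr (thr V) l" unfolding V_def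
  using pr_TB[of "L' - L" "L' - L + h" 0 h l] pr_LR_congr[of 0 h 0 h h 0 "L' - L + h" "L' - L" l] h sq by simp
 have ne: "A ~= {}" "B ~= {}" "V ~= {}" "LR 0 L' 0 h ~= {}"
  using h LR_ne[of 0 L 0 h] LR_ne[of "L' - L" L' 0 h] TB_ne[of "L' - L" "L' - L + h" 0 h] LR_ne[of 0 L' 0 h] by (auto simp: A_def B_def V_def)
 define K where "K = rect 0 L' 0 h"
 have iA: "incr K (thr A)" "incr K (thr B)" "incr K (thr V)" "incr K (thr (LR 0 L' 0 h))"
  using ne h unfolding A_def B_def V_def LR_def TB_def K_def
  by (auto intro!: incr_conn_subset simp: rect_def)
 have bK: "bounded K" by (simp add: K_def)
 have "c ^ n * c ^ n * c <= pr (thr A) l * pr (thr B) l * pr (thr V) l"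
  using R pB pV c pr_bounds by (intro mult_mono) (auto simp: A_def)
 also have "\<dots> <= pr (%g. min (thr A g) (thr B g)) l * pr (thr V) l"
  using fkg[OF iA(1,2) bK] pr_bounds by (intro mult_right_mono) auto
 also have "\<dots> <= pr (%g. min (min (thr A g) (thr B g)) (thr V g)) l"
  by (rule fkg[OF incr_min[OF iA(1,2)] iA(3) bK])
 also have "\<dots> <= pr (thr (LR 0 L' 0 h)) l"
 proof (rule pr_mono[OF iA(4) bK])
  fix z assume "l < min (min (thr A (fld z)) (thr B (fld z))) (thr V (fld z))"
  then have "l < thr A (fld z)" "l < thr B (fld z)" "l < thr V (fld z)" by auto
  obtain S1 where S1: "S1 \<in> A" "\<forall>x\<in>S1. l < fld z x"
   using \<open>l < thr A (fld z)\<close> thr_conn_gt[OF _ bounded_rect continuous_fld] ne(1) unfolding A_def LR_def by blast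
  obtain S2 where S2: "S2 \<in> B" "\<forall>x\<in>S2. l < fld z x"
   using \<open>l < thr B (fld z)\<close> thr_conn_gt[OF _ bounded_rect continuous_fld] ne(2) unfolding B_def LR_def by blast
  obtain W where W: "W \<in> V" "\<forall>x\<in>W. l < fld z x"
   using \<open>l < thr V (fld z)\<close> thr_conn_gt[OF _ bounded_rect continuous_fld] ne(3) unfolding V_def TB_def by blast
  note S = S1 S2 W
  obtain a1 b1 where x1: "compact S1" "connected S1" "S1 \<subseteq> rect 0 L 0 h" "a1 \<in> S1" "a1 $ 1 = 0" "b1 \<in> S1" "b1 $ 1 = L"
   using S(1) unfolding A_def LR_def conn_def by blast
  obtain a2 b2 where x2: "compact S2" "connected S2" "S2 \<subseteq> rect (L' - L) L' 0 h" "a2 \<in> S2" "a2 $ 1 = L' - L" "b2 \<in> S2" "b2 $ 1 = L'"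
   using S(3) unfolding B_def LR_def conn_def by blast
  obtain v1 v2 where v: "compact W" "connected W" "W \<subseteq> rect (L' - L) (L' - L + h) 0 h" "v1 \<in> W" "v1 $ 2 = 0" "v2 \<in> W" "v2 $ 2 = h"
   using S(5) unfolding V_def TB_def conn_def by blast
  have "W \<subseteq> rect 0 L 0 h" "W \<subseteq> rect (L' - L) L' 0 h" using v(3) h by (auto simp: rect_def)
  then have i: "S1 \<inter> W ~= {}" "S2 \<inter> W ~= {}"
   using rect_crossing[OF x1(1-3) v(1,2) _ x1(4-7) v(4-7)] rect_crossing[OF x2(1-3) v(1,2) _ x2(4-7) v(4-7)] by auto
  have "connected (S1 \<union> W \<union> S2)" using x1(2) v(2) x2(2) i by (intro connected_Un) blast+
  moreover have "compact (S1 \<union> W \<union> S2)" using x1(1) v(1) x2(1) by (intro compact_Un)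
  moreover have "S1 \<union> W \<union> S2 \<subseteq> rect 0 L' 0 h" using x1(3) x2(3) v(3) h by (fastforce simp: rect_def)
  ultimately have "S1 \<union> W \<union> S2 \<in> LR 0 L' 0 h" using x1(4,5) x2(6,7) unfolding LR_def conn_def by blast
  moreover have "\<forall>x\<in>S1 \<union> W \<union> S2. l < fld z x" using S by blast
  ultimately show "l < thr (LR 0 L' 0 h) (fld z)"
   using thr_conn_gt[OF _ bounded_rect continuous_fld] ne(4) unfolding LR_def by blast
 qed
 finally have "c ^ n * c ^ n * c <= pr (thr (LR 0 L' 0 h)) l" .
 moreover have e: "c ^ (2 * n + 1) = c ^ n * c ^ n * c" by (simp add: power_add mult_2)
 ultimately show ?thesis unfolding e by blast
qed

section \<open>Annuli and arms\<close>

text \<open>Distance in the maximum norm, whose balls are squares.\<close>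

definition mx :: "real ^ 2 => real ^ 2 => real" where
 "mx c x = max \<bar>x $ 1 - c $ 1\<bar> \<bar>x $ 2 - c $ 2\<bar>"

definition arm :: "real ^ 2 => real => real => (real ^ 2) set set" where
 "arm c m R = conn {x. mx c x <= R} {x. mx c x <= m} {x. R <= mx c x}"

lemma mx_rect: "{x. mx c x <= R} = rect (c $ 1 - R) (c $ 1 + R) (c $ 2 - R) (c $ 2 + R)"
 by (auto simp: mx_def rect_def)

lemma arm_ne:
 assumes "0 <= m" "0 <= R"
 shows "arm c m R ~= {}"
 unfolding arm_def mx_rect
 by (rule conn_rect_ne[of c _ _ _ _ _ "c + pt R 0"]) (use assms in \<open>auto simp: rect_def mx_def mx_rect[symmetric]\<close>)

lemma bounded_mx [simp, intro]: "bounded {x. mx c x <= R}" "compact {x. mx c x <= R}"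
 by (simp_all add: mx_rect)

lemma incr_arm: "0 <= m ==> 0 <= R ==> incr {x. mx c x <= R} (thr (arm c m R))"
 using arm_ne unfolding arm_def by (intro incr_conn_subset) auto

text \<open>An arm ends on one of the four sides of the outer square, and the crossing of the
  rectangle along that side separates this end from the inner square. Vertical rectangles are
  reduced to horizontal ones by exchanging the coordinates.\<close>

lemma annulus_blocking:
 fixes g :: "real ^ 2 => real"
 assumes m: "m > 0" and g: "continuous_on UNIV g"
  and t: "l < thr (LR (- 7 * m) (7 * m) m (7 * m)) g" and b: "l < thr (LR (- 7 * m) (7 * m) (- 7 * m) (- m)) g"
  and r: "l < thr (TB m (7 * m) (- 7 * m) (7 * m)) g" and lf: "l < thr (TB (- 7 * m) (- m) (- 7 * m) (7 * m)) g"
 shows "thr (arm 0 m (7 * m)) (%x. - g x) <= - l"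
proof (rule ccontr)
 assume "\<not> ?thesis"
 then have "- l < thr (arm 0 m (7 * m)) (%x. - g x)" by simp
 moreover have "continuous_on UNIV (%x. - g x)" using g by (intro continuous_intros)
 moreover have "conn {x. mx 0 x <= 7 * m} {x. mx 0 x <= m} {x. 7 * m <= mx 0 x} ~= {}"
  using arm_ne[of m "7 * m" 0] m by (simp add: arm_def)
 ultimately obtain S where S: "S \<in> arm 0 m (7 * m)" "\<forall>x\<in>S. - l < - g x"
  using thr_conn_gt[OF _ bounded_mx(1), of 0 "7 * m" "{x. mx 0 x <= m}" "{x. 7 * m <= mx 0 x}" "%x. - g x" "- l"]
  unfolding arm_def by blast
 then obtain u v where uv: "compact S" "connected S" "!!x. x \<in> S ==> mx 0 x <= 7 * m" "u \<in> S" "mx 0 u <= m" "v \<in> S" "7 * m <= mx 0 v"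
  unfolding arm_def conn_def by blast
 have Sx: "- 7 * m <= x $ 1 \<and> x $ 1 <= 7 * m \<and> - 7 * m <= x $ 2 \<and> x $ 2 <= 7 * m" if "x \<in> S" for x
  using uv(3)[OF that] by (auto simp: mx_def abs_le_iff)
 have u: "- m <= u $ 1" "u $ 1 <= m" "- m <= u $ 2" "u $ 2 <= m" using uv(5) by (auto simp: mx_def abs_le_iff)
 have neq: "LR (- 7 * m) (7 * m) m (7 * m) ~= {}" "LR (- 7 * m) (7 * m) (- 7 * m) (- m) ~= {}"
  "TB m (7 * m) (- 7 * m) (7 * m) ~= {}" "TB (- 7 * m) (- m) (- 7 * m) (7 * m) ~= {}"
  using m by (simp_all add: LR_ne TB_ne)
 have disj: "P \<inter> S ~= {} ==> \<forall>x\<in>P. l < g x ==> False" for P using S(2) by force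
 consider "v $ 2 = 7 * m" | "v $ 2 = - 7 * m" | "v $ 1 = 7 * m" | "v $ 1 = - 7 * m"
  using uv(7) Sx[OF uv(6)] by (fastforce simp: mx_def max_def abs_if split: if_splits)
 then show False
 proof cases
  case 1
  obtain P where P: "P \<in> LR (- 7 * m) (7 * m) m (7 * m)" "\<forall>x\<in>P. l < g x"
   using t thr_conn_gt[OF _ bounded_rect g] neq(1) unfolding LR_def by blast
  then obtain p q where pq: "compact P" "connected P" "P \<subseteq> rect (- 7 * m) (7 * m) m (7 * m)" "p \<in> P" "p $ 1 = - 7 * m" "q \<in> P" "q $ 1 = 7 * m"
   unfolding LR_def conn_def by blast
  have "P \<inter> S ~= {}" by (rule strip_crossing[OF pq uv(1,2) _ uv(4) u(4) uv(6)]) (use Sx 1 in auto)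
  then show False using disj P(2) by blast
 next
  case 2
  obtain P where P: "P \<in> LR (- 7 * m) (7 * m) (- 7 * m) (- m)" "\<forall>x\<in>P. l < g x"
   using b thr_conn_gt[OF _ bounded_rect g] neq(2) unfolding LR_def by blast
  then obtain p q where pq: "compact P" "connected P" "P \<subseteq> rect (- 7 * m) (7 * m) (- 7 * m) (- m)" "p \<in> P" "p $ 1 = - 7 * m" "q \<in> P" "q $ 1 = 7 * m"
   unfolding LR_def conn_def by blast
  have "P \<inter> S ~= {}" by (rule strip_crossing[OF pq uv(1,2) _ uv(6) _ uv(4) u(3)]) (use Sx 2 in auto)
  then show False using disj P(2) by blast
 next
  case 3
  define w where "w = (%x::real^2. pt (x $ 2) (x $ 1))"
  have cw: "continuous_on X w" for X unfolding w_def by (intro continuous_intros)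
  have wi: "w (w x) = x" for x by (simp add: w_def)
  obtain P where P: "P \<in> TB m (7 * m) (- 7 * m) (7 * m)" "\<forall>x\<in>P. l < g x"
   using r thr_conn_gt[OF _ bounded_rect g] neq(3) unfolding TB_def by blast
  then obtain p q where pq: "compact P" "connected P" "P \<subseteq> rect m (7 * m) (- 7 * m) (7 * m)" "p \<in> P" "p $ 2 = - 7 * m" "q \<in> P" "q $ 2 = 7 * m"
   unfolding TB_def conn_def by blast
  have "w ` P \<inter> w ` S ~= {}"
  proof (rule strip_crossing[where a = "- 7 * m" and b = "7 * m" and c = m and d = "7 * m"])
   show "compact (w ` P)" "connected (w ` P)" "compact (w ` S)" "connected (w ` S)"
    using pq(1,2) uv(1,2) cw by (auto intro: compact_continuous_image connected_continuous_image)
   show "w ` P \<subseteq> rect (- 7 * m) (7 * m) m (7 * m)" using pq(3) by (auto simp: rect_def w_def)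
   show "w p \<in> w ` P" "w q \<in> w ` P" "w u \<in> w ` S" "w v \<in> w ` S" using pq uv by auto
  qed (use pq u 3 Sx in \<open>auto simp: w_def\<close>)
  then obtain x y where "x \<in> P" "y \<in> S" "w x = w y" by blast
  then have "x = y" by (metis wi)
  then have "P \<inter> S ~= {}" using \<open>x \<in> P\<close> \<open>y \<in> S\<close> by blast
  then show False using disj P(2) by blast
 next
  case 4
  define w where "w = (%x::real^2. pt (x $ 2) (x $ 1))"
  have cw: "continuous_on X w" for X unfolding w_def by (intro continuous_intros)
  have wi: "w (w x) = x" for x by (simp add: w_def)
  obtain P where P: "P \<in> TB (- 7 * m) (- m) (- 7 * m) (7 * m)" "\<forall>x\<in>P. l < g x"
   using lf thr_conn_gt[OF _ bounded_rect g] neq(4) unfolding TB_def by blast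
  then obtain p q where pq: "compact P" "connected P" "P \<subseteq> rect (- 7 * m) (- m) (- 7 * m) (7 * m)" "p \<in> P" "p $ 2 = - 7 * m" "q \<in> P" "q $ 2 = 7 * m"
   unfolding TB_def conn_def by blast
  have "w ` P \<inter> w ` S ~= {}"
  proof (rule strip_crossing[where a = "- 7 * m" and b = "7 * m" and c = "- 7 * m" and d = "- m"])
   show "compact (w ` P)" "connected (w ` P)" "compact (w ` S)" "connected (w ` S)"
    using pq(1,2) uv(1,2) cw by (auto intro: compact_continuous_image connected_continuous_image)
   show "w ` P \<subseteq> rect (- 7 * m) (7 * m) (- 7 * m) (- m)" using pq(3) by (auto simp: rect_def w_def)
   show "w p \<in> w ` P" "w q \<in> w ` P" "w v \<in> w ` S" "w u \<in> w ` S" using pq uv by auto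
  qed (use pq u 4 Sx in \<open>auto simp: w_def\<close>)
  then obtain x y where "x \<in> P" "y \<in> S" "w x = w y" by blast
  then have "x = y" by (metis wi)
  then have "P \<inter> S ~= {}" using \<open>x \<in> P\<close> \<open>y \<in> S\<close> by blast
  then show False using disj P(2) by blast
 qed
qed

text \<open>The four rectangles around the annulus of radii \<open>m\<close> and
  \<open>7 * m\<close> are \<open>14 * m\<close> by \<open>6 * m\<close> up to exchange of
  coordinates. The blocked arm belongs to \<open>- f\<close>, which has the law of
  \<open>f\<close>.\<close>

lemma annulus_arm_bound:
 assumes m: "m > 0" and c: "0 <= c" and p: "c <= pr (thr (LR 0 (14 * m) 0 (6 * m))) l"
 shows "pr (thr (arm 0 m (7 * m))) (- l) <= 1 - c ^ 4"
proof -
 define \<C>1 where "\<C>1 = LR (- 7 * m) (7 * m) m (7 * m)"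
 define \<C>2 where "\<C>2 = LR (- 7 * m) (7 * m) (- 7 * m) (- m)"
 define \<C>3 where "\<C>3 = TB m (7 * m) (- 7 * m) (7 * m)"
 define \<C>4 where "\<C>4 = TB (- 7 * m) (- m) (- 7 * m) (7 * m)"
 have q: "c <= pr (thr (LR a b c' d)) l" if "b - a = 14 * m" "d - c' = 6 * m" for a b c' d
  using p pr_LR_congr[of 0 "14 * m" 0 "6 * m" b a d c' l] that m by simp
 have cs: "c <= pr (thr \<C>1) l" "c <= pr (thr \<C>2) l" "c <= pr (thr \<C>3) l" "c <= pr (thr \<C>4) l"
  unfolding \<C>1_def \<C>2_def \<C>3_def \<C>4_def
  using q pr_TB[of m "7 * m" "- 7 * m" "7 * m" l] pr_TB[of "- 7 * m" "- m" "- 7 * m" "7 * m" l] m by auto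
 have neq: "\<C>1 ~= {}" "\<C>2 ~= {}" "\<C>3 ~= {}" "\<C>4 ~= {}"
  unfolding \<C>1_def \<C>2_def \<C>3_def \<C>4_def using m by (simp_all add: LR_ne TB_ne)
 have "fams [\<C>1, \<C>2, \<C>3, \<C>4] l c"
  using cs neq unfolding \<C>1_def \<C>2_def \<C>3_def \<C>4_def LR_def TB_def by (intro fams_Cons fams_simps(1)) auto
 then obtain L where L: "bounded L" "!!\<C>. \<C> \<in> set [\<C>1, \<C>2, \<C>3, \<C>4] ==> incr L (thr \<C>) \<and> c <= pr (thr \<C>) l"
  using fams_incr by blast
 obtain \<Psi> where \<Psi>: "incr L \<Psi>" "c ^ length (map thr [\<C>1, \<C>2, \<C>3, \<C>4]) <= pr \<Psi> l" "!!g. l < \<Psi> g ==> \<forall>\<Phi>\<in>set (map thr [\<C>1, \<C>2, \<C>3, \<C>4]). l < \<Phi> g"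
  using fkg_list[of "map thr [\<C>1, \<C>2, \<C>3, \<C>4]" L c l] L c by auto
 note ia = incr_arm[of m "7 * m" 0]
 have um: "PP.prob {z. - l < thr (arm 0 m (7 * m)) (%x. - fld z x)} = pr (thr (arm 0 m (7 * m))) (- l)"
  "(%z. thr (arm 0 m (7 * m)) (%x. - fld z x)) \<in> borel_measurable PP"
  using pr_uminus[OF ia bounded_mx(1)] m by simp_all
 note [measurable] = um(2)
 have "pr \<Psi> l <= PP.prob {z. thr (arm 0 m (7 * m)) (%x. - fld z x) <= - l}"
  unfolding pr_def
 proof (intro PP.finite_measure_mono subsetI)
  fix z assume "z \<in> {z. l < \<Psi> (fld z)}"
  then have "l < thr \<C>1 (fld z)" "l < thr \<C>2 (fld z)" "l < thr \<C>3 (fld z)" "l < thr \<C>4 (fld z)" using \<Psi>(3) by auto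
  then show "z \<in> {z. thr (arm 0 m (7 * m)) (%x. - fld z x) <= - l}"
   using annulus_blocking[OF m continuous_fld] by (simp add: \<C>1_def \<C>2_def \<C>3_def \<C>4_def)
 next
  have "{z \<in> space PP. thr (arm 0 m (7 * m)) (%x. - fld z x) <= - l} \<in> sets PP" by measurable
  then show "{z. thr (arm 0 m (7 * m)) (%x. - fld z x) <= - l} \<in> sets PP" by simp
 qed
 also have "\<dots> = 1 - pr (thr (arm 0 m (7 * m))) (- l)"
 proof -
  have "{z \<in> space PP. - l < thr (arm 0 m (7 * m)) (%x. - fld z x)} \<in> sets PP" by measurable
  from PP.prob_compl[OF this]
  have "PP.prob (space PP - {z. - l < thr (arm 0 m (7 * m)) (%x. - fld z x)}) = 1 - pr (thr (arm 0 m (7 * m))) (- l)"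
   using um(1) by simp
  moreover have "space PP - {z. - l < thr (arm 0 m (7 * m)) (%x. - fld z x)} = {z. thr (arm 0 m (7 * m)) (%x. - fld z x) <= - l}" by auto
  ultimately show ?thesis by simp
 qed
 finally show ?thesis using \<Psi>(2) by (simp add: numeral_eq_Suc)
qed

text \<open>The heights \<open>al s\<close> are at most \<open>s / 2\<close>, so along scales
  growing by the factor \<open>3/2\<close> they cannot more than double at every step. At a step
  where they do not, the hypothesis of the \<open>16/15\<close> crossing holds; extensions to ratio
  \<open>7/3\<close> then give rectangles that surround an annulus.\<close>

theorem rsw:
 assumes \<epsilon>: "0 <= \<epsilon>" "\<epsilon> < 1" and s0: "s0 > 0" and sq: "!!s. s >= s0 ==> 1 - \<epsilon> <= pr (thr (LR 0 s 0 s)) l"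
 obtains m where "m >= B" "m > 0" "pr (thr (arm 0 m (7 * m))) (- l) <= 1 - (1 - sqrt (sqrt \<epsilon>)) ^ 1020"
proof -
 define c where "c = 1 - sqrt (sqrt \<epsilon>)"
 have "sqrt \<epsilon> <= 1" using \<epsilon> by (simp add: real_le_lsqrt)
 then have c: "0 <= c" "c <= 1" unfolding c_def using \<epsilon> by (auto simp: real_le_lsqrt)
 have "\<epsilon> <= sqrt \<epsilon>" using \<epsilon> by (intro real_le_rsqrt) (simp add: power2_eq_square mult_left_le)
 also have "\<dots> <= sqrt (sqrt \<epsilon>)" using \<open>\<epsilon> <= sqrt \<epsilon>\<close> by simp
 finally have c\<epsilon>: "c <= 1 - \<epsilon>" by (simp add: c_def)
 have sqc: "c <= pr (thr (LR 0 s 0 s)) l" if "s >= s0" for s using sq[OF that] c\<epsilon> by simp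
 have "\<exists>\<alpha>. s >= s0 \<longrightarrow> 0 <= \<alpha> \<and> \<alpha> <= s / 2 \<and> c <= pr (thr (up s \<alpha>)) l \<and> c <= pr (thr (low s \<alpha>)) l" for s
 proof (cases "s >= s0")
  case True
  then have "1 - \<epsilon> <= pr (thr (LR 0 s (- s / 2) (s / 2))) l"
   using sq[OF True] pr_LR_congr[of 0 s 0 s s 0 "s / 2" "- s / 2" l] s0 by simp
  then show ?thesis using intermediate_height[of s \<epsilon> l] True s0 \<epsilon> unfolding c_def by (metis order_less_le_trans)
 qed auto
 then obtain al where al: "!!s. s >= s0 ==> 0 <= al s \<and> al s <= s / 2 \<and> c <= pr (thr (up s (al s))) l \<and> c <= pr (thr (low s (al s))) l"
  by metis
 \<comment> \<open>The inner radius will be \<open>m = 5 * S / 24\<close> for a scale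
   \<open>S \<ge> s1\<close>, so the factor 6 ensures \<open>m \<ge> B\<close>.\<close>
 define s1 where "s1 = max s0 (\<bar>B\<bar> * 6)"
 have s1: "s1 > 0" "s1 >= s0" "s1 >= 6 * B" using s0 by (auto simp: s1_def)
 define s where "s k = s1 * (3/2) ^ k" for k
 have sk: "s k >= s1" for k
 proof -
  have "1 <= (3/2 :: real) ^ k" by (rule one_le_power) simp
  then show ?thesis using s1 mult_left_mono[of 1 "(3/2)^k" s1] by (simp add: s_def)
 qed
 have sk0: "s k >= s0" "s k > 0" for k using sk[of k] s1 by linarith+
 have "\<exists>k. al (s (Suc k)) <= 2 * al (s k)"
 proof (rule ccontr)
  assume "\<not> ?thesis"
  then have gr: "2 * al (s k) < al (s (Suc k))" for k by (auto simp: not_le)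
  have pos: "al (s 1) > 0" using gr[of 0] al[OF sk0(1)[of 0]] by simp
  have ge: "2 ^ k * al (s 1) <= al (s (Suc k))" for k
  proof (induction k)
   case (Suc k)
   have "2 ^ Suc k * al (s 1) = 2 * (2 ^ k * al (s 1))" by simp
   also have "\<dots> <= 2 * al (s (Suc k))" using Suc by simp
   also have "\<dots> <= al (s (Suc (Suc k)))" using gr[of "Suc k"] by simp
   finally show ?case .
  qed simp
  have "2 ^ k * al (s 1) <= s1 * (3/2) ^ k * (3/4)" for k
   using ge[of k] al[OF sk0(1)[of "Suc k"]] by (simp add: s_def)
  then have "(4/3) ^ k * al (s 1) <= s1 * (3/4)" for k
  proof -
   have e: "(2::real) ^ k = (4/3) ^ k * (3/2) ^ k" by (simp add: power_mult_distrib[symmetric])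
   have "(3/2) ^ k * ((4/3) ^ k * al (s 1)) <= (3/2) ^ k * (s1 * (3/4))"
    using \<open>2 ^ k * al (s 1) <= s1 * (3/2) ^ k * (3/4)\<close> unfolding e by (simp add: mult_ac)
   then show ?thesis by (rule mult_left_le_imp_le) simp
  qed
  moreover obtain k where "s1 * (3/4) / al (s 1) < (4/3 :: real) ^ k" using real_arch_pow[of "4/3"] by auto
  ultimately show False using pos_divide_less_eq[OF pos, of "s1 * (3/4)" "(4/3) ^ k"] by (meson not_le)
 qed
 then obtain k where k: "al (s (Suc k)) <= 2 * al (s k)" by blast
 define S where "S = s (Suc k)"
 have S: "S > 0" "S >= s0" "2 * S / 3 = s k" using sk0[of "Suc k"] by (auto simp: S_def s_def)
 define \<alpha> where "\<alpha> = al S"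
 have \<alpha>: "0 <= \<alpha>" "\<alpha> <= S / 2" "c <= pr (thr (low S \<alpha>)) l" using al[OF S(2)] by (auto simp: \<alpha>_def)
 have u: "c <= pr (thr (up (2 * S / 3) (\<alpha> / 2))) l"
 proof -
  have "pr (thr (up (s k) (al (s k)))) l <= pr (thr (up (s k) (\<alpha> / 2))) l"
   unfolding up_def LS_def
   by (rule pr_conn_mono[OF _ bounded_rect])
     (use al[OF sk0(1)[of k]] sk0[of k] k LS_ne[of 0 "s k" "- s k / 2" "al (s k)" "s k / 2" "s k / 2"] in \<open>auto simp: LS_def \<alpha>_def S_def\<close>)
  then show ?thesis using al[OF sk0(1)[of k]] S(3) by simp
 qed
 have "c ^ 7 <= pr (thr (LR (- 2 * S / 3) (2 * S / 3) (- 3 * S / 4) (S / 2))) l"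
  using four_thirds_crossing[OF S(1) \<alpha>(1,2) c(1) \<alpha>(3) u] sqc[of "2 * S / 3"] S(3) sk0(1)[of k] by simp
 moreover define h where "h = 5 * S / 4"
 ultimately have h16: "c ^ 7 <= pr (thr (LR 0 (16/15 * h) 0 h)) l"
  using pr_LR_congr[of "- 2 * S / 3" "2 * S / 3" "- 3 * S / 4" "S / 2" "16/15 * h" 0 h 0 l] S(1) by simp
 have h: "h > 0" "h >= s0" using S(1,2) by (auto simp: h_def)
 note sqh = sqc[OF h(2)]
 \<comment> \<open>The ratio goes from \<open>16/15\<close> through \<open>17/15\<close>,
   \<open>19/15\<close>, \<open>23/15\<close> and \<open>31/15\<close> to \<open>35/15\<close>. Each
   extension sends the exponent \<open>n\<close> to \<open>2 * n + 1\<close>, so 7 becomes 255, and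
   four rectangles give \<open>4 * 255 = 1020\<close>.\<close>
 have "c ^ (2 * 7 + 1) <= pr (thr (LR 0 (17/15 * h) 0 h)) l"
  by (rule extend_crossing[OF h(1) _ _ _ c h16 sqh]) (use h(1) in auto)
 then have "c ^ (2 * (2 * 7 + 1) + 1) <= pr (thr (LR 0 (19/15 * h) 0 h)) l"
  by (rule extend_crossing[OF h(1) _ _ _ c _ sqh, rotated 3]) (use h(1) in auto)
 then have "c ^ (2 * (2 * (2 * 7 + 1) + 1) + 1) <= pr (thr (LR 0 (23/15 * h) 0 h)) l"
  by (rule extend_crossing[OF h(1) _ _ _ c _ sqh, rotated 3]) (use h(1) in auto)
 then have "c ^ (2 * (2 * (2 * (2 * 7 + 1) + 1) + 1) + 1) <= pr (thr (LR 0 (31/15 * h) 0 h)) l"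
  by (rule extend_crossing[OF h(1) _ _ _ c _ sqh, rotated 3]) (use h(1) in auto)
 then have "c ^ (2 * (2 * (2 * (2 * (2 * 7 + 1) + 1) + 1) + 1) + 1) <= pr (thr (LR 0 (7/3 * h) 0 h)) l"
  by (rule extend_crossing[OF h(1) _ _ _ c _ sqh, rotated 3]) (use h(1) in auto)
 then have p: "c ^ 255 <= pr (thr (LR 0 (7/3 * h) 0 h)) l" by simp
 define m where "m = h / 6"
 have m: "m > 0" "m >= B" "14 * m = 7/3 * h" "6 * m = h"
  using h(1) sk[of "Suc k"] s1(1,3) by (auto simp: m_def h_def S_def)
 have "pr (thr (arm 0 m (7 * m))) (- l) <= 1 - (c ^ 255) ^ 4"
  using annulus_arm_bound[OF m(1), of "c ^ 255" l] p c(1) m(3,4) by simp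
 also have "(c ^ 255) ^ 4 = c ^ 1020" by (simp add: power_mult[symmetric])
 finally show ?thesis using that m(1,2) by (simp add: c_def)
qed

section \<open>Percolation events\<close>

definition perc :: "real => (real ^ 2 => real) => bool" where
 "perc p g \<longleftrightarrow> (\<exists>S. connected S \<and> \<not> bounded S \<and> S \<subseteq> {x. - p <= g x})"

definition perc_from :: "real => real => (real ^ 2 => real) => bool" where
 "perc_from N p g \<longleftrightarrow> (\<exists>S. connected S \<and> \<not> bounded S \<and> S \<subseteq> {x. - p <= g x} \<and> S \<inter> {x. mx 0 x <= N} ~= {})"

lemma perc_from_mono: "perc_from N p g ==> N <= N' ==> perc_from N' p g"
 unfolding perc_from_def by (elim exE conjE, intro exI conjI, assumption+) force

lemma mx_le_norm: "mx c x <= dist c x"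
 using component_le_norm_cart[of "x - c" 1] component_le_norm_cart[of "x - c" 2]
 by (simp add: mx_def dist_norm norm_minus_commute)

lemma norm_le_mx: "dist c x <= 2 * mx c x"
proof -
 have "dist c x <= \<bar>(x - c) $ 1\<bar> + \<bar>(x - c) $ 2\<bar>"
  using norm_le_l1_cart[of "x - c"] by (simp add: dist_norm norm_minus_commute sum_2)
 then show ?thesis by (auto simp: mx_def max_def)
qed

lemma mx_triangle: "mx c x <= mx c y + mx y x"
 by (auto simp: mx_def max_def abs_if)

lemma mx_commute: "mx c x = mx x c"
 by (simp add: mx_def abs_minus_commute)

lemma interior_mx: "interior {x. mx c x <= R} = {x. mx c x < R}"
 unfolding mx_rect rect_cbox interior_cbox by (auto simp: mem_box_cart forall_2 mx_def)

lemma arm_sub: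
 assumes C: "closed C" "connected C" and x: "x \<in> C" "mx c x <= m" and y: "y \<in> C" "R <= mx c y" and mR: "m <= R"
 obtains S where "S \<in> arm c m R" "S \<subseteq> C"
proof -
 let ?Q = "{x. mx c x <= R}"
 have "\<not> C \<subseteq> interior ?Q" using y by (auto simp: interior_mx)
 then obtain S where S: "compact S" "connected S" "S \<subseteq> C \<inter> ?Q" "x \<in> S" "S \<inter> frontier ?Q ~= {}"
  using bumping[OF C x(1), of ?Q] x(2) mR by auto
 have "frontier ?Q \<subseteq> {x. R <= mx c x}"
  unfolding frontier_def interior_mx by auto
 then have "S \<in> arm c m R" using S x(2) unfolding arm_def conn_def by blast
 then show ?thesis using that S(3) by blast
qed

lemma arm_thr_gt:
 assumes "0 <= m" "0 <= R" "continuous_on UNIV g"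
 shows "l < thr (arm c m R) g \<longleftrightarrow> (\<exists>S\<in>arm c m R. \<forall>x\<in>S. l < g x)"
 using thr_conn_gt[OF arm_ne[OF assms(1,2), unfolded arm_def] bounded_mx(1) assms(3)] by (simp add: arm_def)

lemma arm_thr_ge:
 assumes m: "0 <= m" "m <= R" and g: "continuous_on UNIV g"
  and C: "closed C" "connected C" "x \<in> C" "mx c x <= m" "y \<in> C" "R <= mx c y" "!!x. x \<in> C ==> l <= g x"
 shows "l <= thr (arm c m R) g"
proof -
 obtain S where "S \<in> arm c m R" "S \<subseteq> C" using arm_sub[OF C(1-6) m(2)] by blast
 moreover have "fam {x. mx c x <= R} (arm c m R)" using fam_conn arm_ne m unfolding arm_def by simp
 moreover have "bounded (g ` {x. mx c x <= R})" using g by (rule bounded_cont_image) simp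
 ultimately show ?thesis using C(7) by (intro thr_ge) auto
qed

lemma arm_thr_mono:
 assumes m: "0 <= m" "m <= m'" "m' <= R" "R <= R'" and g: "continuous_on UNIV g"
 shows "thr (arm c m R') g <= thr (arm c m' R) g"
proof (rule dense_le)
 fix l assume "l < thr (arm c m R') g"
 then obtain S where S: "S \<in> arm c m R'" "\<forall>x\<in>S. l < g x" using arm_thr_gt[of m R' g l c] m g by auto
 then obtain x y where "compact S" "connected S" "x \<in> S" "mx c x <= m" "y \<in> S" "R' <= mx c y" unfolding arm_def conn_def by blast
 then show "l <= thr (arm c m' R) g"
  using S(2) m g by (intro arm_thr_ge[of m' R g S x c y l]) (auto simp: compact_imp_closed less_imp_le)
qed

lemma perc_from_closed:
 assumes "perc_from N p g" "continuous_on UNIV g"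
 obtains C where "closed C" "connected C" "\<not> bounded C" "C \<subseteq> {x. - p <= g x}" "C \<inter> {x. mx 0 x <= N} ~= {}"
proof -
 obtain S where S: "connected S" "\<not> bounded S" "S \<subseteq> {x. - p <= g x}" "S \<inter> {x. mx 0 x <= N} ~= {}"
  using assms(1) by (auto simp: perc_from_def)
 have "closed {x. - p <= g x}" using assms(2) by (intro closed_Collect_le continuous_intros)
 then show ?thesis
  using S closure_subset[of S] closure_minimal[OF S(3)] bounded_subset[of "closure S" S]
  by (intro that[of "closure S"]) (auto intro: connected_imp_connected_closure)
qed

text \<open>Left to right is boundary bumping. Conversely, if no unbounded connected set starts in
  the square \<open>B\<close>, the compact part of \<open>D\<close> seen from \<open>B\<close> is
  enclosed by a compact level set \<open>G\<close> of the distance. On \<open>G\<close> the function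
  is at most \<open>- p - \<eta>\<close> for some \<open>\<eta> > 0\<close>, whereas a long arm
  above \<open>- p - \<eta>\<close> would have to cross \<open>G\<close>.\<close>

lemma perc_from_iff:
 assumes g: "continuous_on UNIV g" and N: "N >= 0"
 shows "perc_from N p g \<longleftrightarrow> (\<forall>k::nat. - p <= thr (arm 0 N (N + real k)) g)"
proof
 assume "perc_from N p g"
 then obtain C where C: "closed C" "connected C" "\<not> bounded C" "C \<subseteq> {x. - p <= g x}" "C \<inter> {x. mx 0 x <= N} ~= {}"
  using perc_from_closed g by blast
 then obtain x where x: "x \<in> C" "mx 0 x <= N" by auto
 show "\<forall>k::nat. - p <= thr (arm 0 N (N + real k)) g"
 proof
  fix k :: nat
  obtain y where y: "y \<in> C" "N + real k <= mx 0 y"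
  proof -
   have "\<not> C \<subseteq> {x. mx 0 x <= N + real k}" using C(3) bounded_subset[OF bounded_mx(1)] by blast
   then obtain y where "y \<in> C" "\<not> mx 0 y <= N + real k" by blast
   then show ?thesis using that[of y] by simp
  qed
  show "- p <= thr (arm 0 N (N + real k)) g"
   using C(4) N by (intro arm_thr_ge[OF N _ g C(1,2) x y]) auto
 qed
next
 assume thr: "\<forall>k::nat. - p <= thr (arm 0 N (N + real k)) g"
 show "perc_from N p g"
 proof (rule ccontr)
  assume np: "\<not> perc_from N p g"
  define D where "D = {x. - p <= g x}"
  define B where "B = {x. mx 0 x <= N}"
  have D: "closed D" unfolding D_def using g by (intro closed_Collect_le continuous_intros)
  have B: "compact B" by (simp add: B_def)
  have bdd: "bounded C" if "C \<in> components D" "C \<inter> B ~= {}" for C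
   using np that in_components_connected[OF that(1)] in_components_subset[OF that(1)]
   unfolding perc_from_def D_def B_def by blast
  obtain K where K: "compact K" "K \<subseteq> D" "D \<inter> B \<subseteq> K" "closed (D - K)"
   using bounded_components_compact_clopen[OF D B] bdd by blast
  define A where "A = B \<union> K"
  have "0 \<in> B" using N by (simp add: B_def mx_def)
  then have A: "compact A" "A ~= {}" "B \<subseteq> A" using K B by (auto simp: A_def)
  have "A \<inter> (D - K) = {}" using K by (auto simp: A_def)
  then obtain d where d: "d > 0" "!!x y. x \<in> A ==> y \<in> D - K ==> d <= dist x y"
   using separate_compact_closed[OF A(1) K(4)] by blast
  define e where "e = d / 2"
  have e: "e > 0" "e < d" using d by (auto simp: e_def)
  obtain R where R: "R > 0" "A \<subseteq> ball 0 R" using A(1) compact_imp_bounded bounded_subset_ballD by blast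
  define G where "G = {x. infdist x A = e}"
  have GD: "G \<inter> D = {}"
  proof -
   have False if x: "x \<in> G" "x \<in> D" for x
   proof -
    have "infdist x A = e" using x by (simp add: G_def)
    then have "x \<notin> A" using e by (metis infdist_zero less_irrefl)
    then have "x \<in> D - K" using x by (auto simp: A_def)
    then have "d <= infdist x A" unfolding infdist_notempty[OF A(2)]
     by (intro cINF_greatest[OF A(2)]) (use d in \<open>auto simp: dist_commute\<close>)
    then show False using \<open>infdist x A = e\<close> e by simp
   qed
   then show ?thesis by blast
  qed
  have far: "norm x < R + e + 1" if "infdist x A <= e" for x
  proof -
   have "infdist x A < e + 1" using that by simp
   then obtain y where "y \<in> A" "dist x y < e + 1"
    using A(2) cInf_lessD[of "dist x ` A" "e + 1"] by (auto simp: infdist_notempty)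
   moreover have "norm y < R" using R \<open>y \<in> A\<close> by auto
   ultimately show ?thesis using norm_triangle_ineq2[of x y] by (auto simp: dist_norm)
  qed
  have "G \<subseteq> ball 0 (R + e + 1)" using far by (auto simp: G_def)
  then have "bounded G" by (rule bounded_subset[OF bounded_ball])
  moreover have "closed G" unfolding G_def by (intro closed_Collect_eq continuous_intros)
  ultimately have G: "compact G" by (simp add: compact_eq_bounded_closed)
  obtain \<eta> where \<eta>: "\<eta> > 0" "!!x. x \<in> G ==> g x <= - p - \<eta>"
  proof (cases "G = {}")
   case True then show ?thesis using that[of 1] by auto
  next
   case False
   then obtain x where x: "x \<in> G" "!!y. y \<in> G ==> g y <= g x"
    using continuous_attains_sup[OF G False, of g] continuous_on_subset[OF g] by auto
   have "g x < - p" using GD x(1) by (auto simp: D_def)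
   then show ?thesis using x by (intro that[of "- p - g x"]) auto
  qed
  obtain k :: nat where k: "R + e + 1 <= real k" using real_arch_simple by blast
  have "- p - \<eta> < thr (arm 0 N (N + real k)) g" using thr \<eta>(1) by (smt (verit))
  then obtain S where S: "S \<in> arm 0 N (N + real k)" "\<forall>x\<in>S. - p - \<eta> < g x"
   using arm_thr_gt[of N "N + real k" g "- p - \<eta>" 0] N g by auto
  then obtain a b where ab: "connected S" "a \<in> S" "mx 0 a <= N" "b \<in> S" "N + real k <= mx 0 b"
   unfolding arm_def conn_def by blast
  have a: "infdist a A = 0" using ab(3) A(3) by (auto simp: B_def)
  have b: "e < infdist b A"
  proof (rule ccontr)
   assume "\<not> e < infdist b A"
   then have "norm b < R + e + 1" using far by simp
   moreover have "mx 0 b <= norm b" using mx_le_norm[of 0 b] by simp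
   ultimately show False using ab(5) k N by simp
  qed
  have "connected ((%x. infdist x A) ` S)"
   using ab(1) by (intro connected_continuous_image continuous_intros)
  then have "e \<in> (%x. infdist x A) ` S"
   using connectedD_interval[of "(%x. infdist x A) ` S" "infdist a A" "infdist b A" e] ab a b e(1) by auto
  then obtain x where "x \<in> S" "x \<in> G" by (auto simp: G_def)
  then show False using S(2) \<eta>(2) by force
 qed
qed

lemma perc_iff: "perc p g \<longleftrightarrow> (\<exists>n::nat. perc_from (real n) p g)"
proof
 assume "perc p g"
 then obtain S where S: "connected S" "\<not> bounded S" "S \<subseteq> {x. - p <= g x}" by (auto simp: perc_def)
 then obtain x where x: "x \<in> S" by force
 obtain n :: nat where "mx 0 x <= real n" using real_arch_simple by blast
 then show "\<exists>n::nat. perc_from (real n) p g" using S x unfolding perc_from_def by blast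
qed (auto simp: perc_from_def perc_def)

text \<open>The limiting event is the weak inequality, which has the same probability by absence of
  atoms.\<close>

lemma pr_tendsto_left:
 assumes \<Phi>: "incr K \<Phi>" "bounded K" and a: "a > 0"
 shows "(%n. pr \<Phi> (l - a * inverse (real (Suc n)))) \<longlonglongrightarrow> pr \<Phi> l"
proof -
 define A where "A n = {z. l - a * inverse (real (Suc n)) < \<Phi> (fld z)}" for n
 have A: "range A \<subseteq> sets PP" using sets_incr_fld(1)[OF \<Phi>] by (auto simp: A_def)
 have dec: "decseq A"
 proof (rule decseq_SucI)
  fix n
  have "inverse (real (Suc (Suc n))) <= inverse (real (Suc n))" by (intro le_imp_inverse_le) auto
  then have "a * inverse (real (Suc (Suc n))) <= a * inverse (real (Suc n))" using a by (intro mult_left_mono) auto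
  then show "A (Suc n) \<subseteq> A n" by (auto simp: A_def)
 qed
 have "(\<Inter>n. A n) = {z. l <= \<Phi> (fld z)}"
 proof (intro equalityI subsetI)
  fix z assume z: "z \<in> (\<Inter>n. A n)"
  have "(%n. l - a * inverse (real (Suc n))) \<longlonglongrightarrow> l - a * 0"
   by (intro tendsto_intros LIMSEQ_inverse_real_of_nat)
  moreover have "l - a * inverse (real (Suc n)) <= \<Phi> (fld z)" for n using z by (auto simp: A_def less_imp_le)
  ultimately have "l - a * 0 <= \<Phi> (fld z)" using LIMSEQ_le_const2 by blast
  then show "z \<in> {z. l <= \<Phi> (fld z)}" by simp
 next
  fix z assume "z \<in> {z. l <= \<Phi> (fld z)}"
  moreover have "0 < a * inverse (real (Suc n))" for n using a by (intro mult_pos_pos) auto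
  ultimately show "z \<in> (\<Inter>n. A n)" by (auto simp: A_def intro: order_less_le_trans[rotated])
 qed
 moreover have "(%n. PP.prob (A n)) \<longlonglongrightarrow> PP.prob (\<Inter>n. A n)"
  by (rule PP.finite_Lim_measure_decseq[OF A dec])
 ultimately show ?thesis using pr_ge_eq[OF \<Phi>, of l] by (simp add: A_def[abs_def] pr_def)
qed

lemma sets_perc_from: "{z. perc_from (real n) p (fld z)} \<in> sets PP"
proof -
 have "{z. perc_from (real n) p (fld z)} = (\<Inter>k. {z. - p <= thr (arm 0 (real n) (real n + real k)) (fld z)})"
  by (auto simp: perc_from_iff[OF continuous_fld])
 also have "\<dots> \<in> sets PP"
  using sets_incr_fld(2)[OF incr_arm bounded_mx(1)] by (intro sets.countable_INT) auto
 finally show ?thesis .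
qed

lemma sets_perc: "{z. perc p (fld z)} \<in> sets PP"
proof -
 have "{z. perc p (fld z)} = (\<Union>n. {z. perc_from (real n) p (fld z)})" by (auto simp: perc_iff)
 then show ?thesis using sets_perc_from by auto
qed

lemma perc_from_tendsto:
 "(%k. pr (thr (arm 0 (real n) (real n + real k))) (- p)) \<longlonglongrightarrow> PP.prob {z. perc_from (real n) p (fld z)}"
proof -
 define A where "A k = {z. - p <= thr (arm 0 (real n) (real n + real k)) (fld z)}" for k
 have A: "range A \<subseteq> sets PP" using sets_incr_fld(2)[OF incr_arm bounded_mx(1)] by (auto simp: A_def)
 have "decseq A"
 proof (rule decseq_SucI)
  fix k
  have "thr (arm 0 (real n) (real n + real (Suc k))) (fld z) <= thr (arm 0 (real n) (real n + real k)) (fld z)" for z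
   by (rule arm_thr_mono[OF _ _ _ _ continuous_fld]) auto
  then show "A (Suc k) \<subseteq> A k" unfolding A_def by (auto intro: order_trans)
 qed
 then have "(%k. PP.prob (A k)) \<longlonglongrightarrow> PP.prob (\<Inter>k. A k)" by (rule PP.finite_Lim_measure_decseq[OF A])
 moreover have "(\<Inter>k. A k) = {z. perc_from (real n) p (fld z)}"
  by (auto simp: A_def perc_from_iff[OF continuous_fld])
 moreover have "PP.prob (A k) = pr (thr (arm 0 (real n) (real n + real k))) (- p)" for k
  unfolding A_def by (rule pr_ge_eq[OF incr_arm bounded_mx(1)]) auto
 ultimately show ?thesis by simp
qed

lemma perc_tendsto: "(%n. PP.prob {z. perc_from (real n) p (fld z)}) \<longlonglongrightarrow> PP.prob {z. perc p (fld z)}"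
proof -
 have "incseq (%n. {z. perc_from (real n) p (fld z)})"
 proof (rule incseq_SucI)
  fix n show "{z. perc_from (real n) p (fld z)} \<subseteq> {z. perc_from (real (Suc n)) p (fld z)}"
   proof clarify
   fix z assume "perc_from (real n) p (fld z)"
   then show "perc_from (real (Suc n)) p (fld z)" by (rule perc_from_mono) simp
  qed
 qed
 then have "(%n. PP.prob {z. perc_from (real n) p (fld z)}) \<longlonglongrightarrow> PP.prob (\<Union>n. {z. perc_from (real n) p (fld z)})"
  using sets_perc_from by (intro PP.finite_Lim_measure_incseq) auto
 then show ?thesis by (simp add: perc_iff Collect_ex_eq)
qed

lemma err_tendsto: "\<eta> > 0 ==> (%r::nat. err (real r) / \<eta>) \<longlonglongrightarrow> 0"
proof -
 assume "\<eta> > 0"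
 have "(%r::nat. 16 / \<eta> * inverse (exp 1) ^ r) \<longlonglongrightarrow> 16 / \<eta> * 0"
  by (intro tendsto_intros LIMSEQ_power_zero) (simp add: field_simps)
 moreover have "norm (err (real r) / \<eta>) <= 16 / \<eta> * inverse (exp 1) ^ r" for r :: nat
 proof -
  have "real r <= (real r)\<^sup>2" by (cases r) (simp_all add: power2_eq_square)
  then have "exp (- (real r)\<^sup>2) <= exp (- real r)" by simp
  also have "\<dots> = inverse (exp 1) ^ r" by (simp add: exp_minus exp_of_nat_mult[symmetric] power_inverse)
  finally show ?thesis using \<open>\<eta> > 0\<close> by (simp add: err_def divide_right_mono)
 qed
 ultimately show ?thesis
  using Lim_null_comparison[of "%r::nat. err (real r) / \<eta>" "%r. 16 / \<eta> * inverse (exp 1) ^ r" sequentially]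
  unfolding mult_zero_right eventually_sequentially by blast
qed

section \<open>Zero-one law and the level zero\<close>

text \<open>The event is approximated by one that depends on a bounded region, and a distant
  translate of the latter is nearly independent of it; this gives
  \<open>\<theta> \<le> \<theta>\<^sup>2\<close> up to small errors. The shift \<open>\<eta>\<close>
  is chosen first, by left continuity in the level; the distance follows, since
  \<open>err r / \<eta>\<close> is small only for fixed \<open>\<eta>\<close>.\<close>

lemma perc_zero_one: "PP.prob {z. perc p (fld z)} = 0 \<or> PP.prob {z. perc p (fld z)} = 1"
proof -
 define \<theta> where "\<theta> = PP.prob {z. perc p (fld z)}"
 have \<theta>: "0 <= \<theta>" "\<theta> <= 1" by (auto simp: \<theta>_def)
 have step: "\<theta> <= \<theta>\<^sup>2 + 25 * \<epsilon>" if \<epsilon>: "0 < \<epsilon>" "\<epsilon> <= 1" for \<epsilon>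
 proof -
  obtain n where n: "\<theta> - \<epsilon> < PP.prob {z. perc_from (real n) p (fld z)}"
   using order_tendstoD(1)[OF perc_tendsto[of p], of "\<theta> - \<epsilon>"] \<epsilon>(1) by (auto simp: \<theta>_def eventually_sequentially)
  define N where "N = real n"
 let ?t = "%k. thr (arm 0 N (N + real k))"
  have Nle: "PP.prob {z. perc_from N p (fld z)} <= \<theta>"
   unfolding \<theta>_def N_def by (intro PP.finite_measure_mono sets_perc) (auto simp: perc_iff)
  obtain k where k: "pr (?t k) (- p) < PP.prob {z. perc_from N p (fld z)} + \<epsilon>"
   using order_tendstoD(2)[OF perc_from_tendsto[of n p], of "PP.prob {z. perc_from N p (fld z)} + \<epsilon>"] \<epsilon>(1)
   by (auto simp: N_def eventually_sequentially)
  define R where "R = N + real k"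
  define \<Phi> where "\<Phi> = thr (arm 0 N R)"
  define K where "K = {x. mx 0 x <= R}"
  have NR: "0 <= N" "0 <= R" by (auto simp: N_def R_def)
  have \<Phi>: "incr K \<Phi>" "bounded K" using incr_arm NR by (auto simp: \<Phi>_def K_def)
  have "pr \<Phi> (- p) < \<theta> + \<epsilon>" using k Nle by (simp add: \<Phi>_def R_def)
  then obtain j where j: "pr \<Phi> (- p - 2 * inverse (real (Suc j))) < \<theta> + \<epsilon>"
   using order_tendstoD(2)[OF pr_tendsto_left[OF \<Phi>, of 2 "- p"], of "\<theta> + \<epsilon>"] by (auto simp: eventually_sequentially)
  define \<eta> where "\<eta> = inverse (real (Suc j))"
  have \<eta>: "\<eta> > 0" by (simp add: \<eta>_def)
  obtain r0 where r0: "!!r. r >= r0 ==> err (real r) / \<eta> < \<epsilon>"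
   using order_tendstoD(2)[OF err_tendsto[OF \<eta>] \<epsilon>(1)] by (auto simp: eventually_sequentially)
  obtain r1 :: nat where r1: "2 * R <= real r1" using real_arch_simple by blast
  define r where "r = real (max r0 r1)"
  have r: "0 <= r" "2 * R <= r" "err r / \<eta> < \<epsilon>" using r1 r0[of "max r0 r1"] by (auto simp: r_def)
  \<comment> \<open>A shift by \<open>9 * r\<close> puts the translate of a set of radius
    \<open>r\<close> at distance at least \<open>8 * r\<close> from the origin.\<close>
  define u where "u = pt (9 * r) 0"
  define T where "T x = x + u" for x
  have T: "dist (T x) (T y) = dist x y" for x y by (simp add: T_def)
 let ?E = "%k. {z. - p <= ?t k (fld z \<circ> T)}"
  define \<Phi>T where "\<Phi>T = (%g. \<Phi> (g \<circ> T))"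
  have \<Phi>T: "incr (T ` K) \<Phi>T" "bounded (T ` K)"
   unfolding \<Phi>T_def T_def using \<Phi> incr_compose bounded_translation_minus[of K "- u"] by auto
  have prT: "pr \<Phi>T l = pr \<Phi> l" for l unfolding \<Phi>T_def by (rule pr_isometry[OF \<Phi> T])
  have normu: "norm u = 9 * r"
  proof -
   have "norm u = sqrt ((9 * r)\<^sup>2)" using dist_vec2[of u 0] by (simp add: u_def)
   then show ?thesis using r(1) by (simp add: real_sqrt_mult)
  qed
  have KR: "norm x <= r" if "x \<in> K" for x
   using that norm_le_mx[of 0 x] r(2) by (simp add: K_def)
  have qi: "pr (%g. min (\<Phi> g) (\<Phi>T g)) (- p) <= (pr \<Phi> (- p - 2 * \<eta>) + err r / \<eta>) * (pr \<Phi>T (- p - 2 * \<eta>) + err r / \<eta>) + 2 * (err r / \<eta>)"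
  proof (rule quasi_independence[OF \<Phi> \<Phi>T r(1) _ _ \<eta>])
   show "dist 0 x <= r" if "x \<in> K" for x using KR[OF that] by simp
   show "8 * r <= dist 0 x" if "x \<in> T ` K" for x
   proof -
    obtain y where y: "y \<in> K" "x = y + u" using \<open>x \<in> T ` K\<close> by (auto simp: T_def)
    have "norm u <= norm x + norm y" using norm_triangle_ineq4[of x y] by (simp add: y(2))
    then show ?thesis using KR[OF y(1)] normu by simp
   qed
  qed
  have e0: "0 <= err r / \<eta>" using err_nonneg \<eta> by simp
  have a: "pr \<Phi> (- p - 2 * \<eta>) + err r / \<eta> <= \<theta> + 2 * \<epsilon>" using j r(3) by (simp add: \<eta>_def)
  have "(pr \<Phi> (- p - 2 * \<eta>) + err r / \<eta>) * (pr \<Phi>T (- p - 2 * \<eta>) + err r / \<eta>) <= (\<theta> + 2 * \<epsilon>) * (\<theta> + 2 * \<epsilon>)"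
   unfolding prT using a e0 pr_bounds(1)[of \<Phi>] \<theta> \<epsilon> by (intro mult_mono) (auto intro: add_nonneg_nonneg)
  then have b1: "pr (%g. min (\<Phi> g) (\<Phi>T g)) (- p) <= (\<theta> + 2 * \<epsilon>) * (\<theta> + 2 * \<epsilon>) + 2 * \<epsilon>" using qi r(3) by linarith
  let ?P = "{z. perc p (fld z)}" and ?A = "{z. perc_from N p (fld z)}" and ?B = "{z. perc_from N p (fld z \<circ> T)}"
  have cT: "continuous_on UNIV (fld z \<circ> T)" for z
   unfolding T_def by (intro continuous_on_compose continuous_intros)
  have Bk: "?B = (\<Inter>k. ?E k)"
   by (auto simp: perc_from_iff[OF cT NR(1)])
  have mT: "?E k \<in> sets PP"
   and pT: "PP.prob (?E k) = PP.prob {z. - p <= ?t k (fld z)}" for k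
  proof -
   define L where "L = {x. mx 0 x <= N + real k}"
   have i: "incr L (?t k)" "bounded L" using incr_arm NR by (auto simp: L_def)
   have bL: "bounded (T ` L)" unfolding T_def using bounded_translation_minus[of L "- u"] i(2) by simp
   note iT = incr_compose[OF i(1), of T]
   show "?E k \<in> sets PP" using sets_incr_fld(2)[OF iT bL] .
   show "PP.prob (?E k) = PP.prob {z. - p <= ?t k (fld z)}"
    using pr_ge_eq[OF iT bL] pr_ge_eq[OF i] pr_isometry[OF i T] by simp
  qed
  have Bs: "?B \<in> sets PP" unfolding Bk using mT by (intro sets.countable_INT) auto
  have dT: "decseq (%k. ?E k)"
  proof (rule decseq_SucI)
   fix k show "{z. - p <= thr (arm 0 N (N + real (Suc k))) (fld z \<circ> T)} \<subseteq> ?E k"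
   proof clarify
    fix z assume "- p <= thr (arm 0 N (N + real (Suc k))) (fld z \<circ> T)"
    also have "\<dots> <= ?t k (fld z \<circ> T)" using NR(1) by (intro arm_thr_mono cT) auto
    finally show "- p <= ?t k (fld z \<circ> T)" .
   qed
  qed
  have "(%k. PP.prob (?E k)) \<longlonglongrightarrow> PP.prob ?B"
   unfolding Bk using mT dT by (intro PP.finite_Lim_measure_decseq) auto
  moreover have "(%k. PP.prob (?E k)) \<longlonglongrightarrow> PP.prob ?A"
   unfolding pT using perc_from_tendsto[of n p] pr_ge_eq[OF incr_arm bounded_mx(1)] by (simp add: N_def)
  ultimately have PB: "PP.prob ?B = PP.prob ?A" by (rule LIMSEQ_unique)
  have As: "?A \<in> sets PP" unfolding N_def by (rule sets_perc_from)
  have AP: "?A \<subseteq> ?P" by (auto simp: perc_from_def perc_def)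
  have BP: "?B \<subseteq> ?P"
  proof
   fix z assume "z \<in> ?B"
   then obtain S where S: "connected S" "\<not> bounded S" "S \<subseteq> {x. - p <= (fld z \<circ> T) x}" by (auto simp: perc_from_def)
   have "connected (T ` S)" unfolding T_def using S(1) by (intro connected_continuous_image continuous_intros)
   moreover have "\<not> bounded (T ` S)"
   proof
    assume "bounded (T ` S)"
    then have "bounded ((%x. x - u) ` T ` S)" by (rule bounded_translation_minus)
    then show False using S(2) by (simp add: image_image T_def)
   qed
   moreover have "T ` S \<subseteq> {x. - p <= fld z x}" using S(3) by auto
   ultimately show "z \<in> ?P" unfolding perc_def by blast
  qed
  \<comment> \<open>By the choice of \<open>N\<close>, percolation that does not start in a given
    one of the two squares has probability below \<open>\<epsilon>\<close>.\<close>
  have "\<theta> <= PP.prob ((?A \<inter> ?B) \<union> ((?P - ?A) \<union> (?P - ?B)))"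
   unfolding \<theta>_def using As Bs sets_perc by (intro PP.finite_measure_mono) auto
  also have "\<dots> <= PP.prob (?A \<inter> ?B) + (PP.prob (?P - ?A) + PP.prob (?P - ?B))"
   using As Bs sets_perc by (intro order_trans[OF measure_Un_le] add_mono measure_Un_le order_refl) auto
  also have "PP.prob (?P - ?A) = \<theta> - PP.prob ?A" unfolding \<theta>_def using As sets_perc AP by (intro PP.finite_measure_Diff) auto
  also have "PP.prob (?P - ?B) = \<theta> - PP.prob ?B" unfolding \<theta>_def using Bs sets_perc BP by (intro PP.finite_measure_Diff) auto
  also have "PP.prob (?A \<inter> ?B) <= pr (%g. min (\<Phi> g) (\<Phi>T g)) (- p)"
  proof -
   have KL: "incr (K \<union> T ` K) (%g. min (\<Phi> g) (\<Phi>T g))" "bounded (K \<union> T ` K)"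
    using incr_min[OF incr_subset[OF \<Phi>(1), of "K \<union> T ` K"] incr_subset[OF \<Phi>T(1), of "K \<union> T ` K"]] \<Phi>(2) \<Phi>T(2) by auto
   have "PP.prob (?A \<inter> ?B) <= PP.prob {z. - p <= min (\<Phi> (fld z)) (\<Phi>T (fld z))}"
    using sets_incr_fld(2)[OF KL]
    by (intro PP.finite_measure_mono) (auto simp: perc_from_iff[OF cT NR(1)] perc_from_iff[OF continuous_fld NR(1)] \<Phi>_def \<Phi>T_def R_def)
   then show ?thesis using pr_ge_eq[OF KL] by simp
  qed
  finally have "\<theta> <= (\<theta> + 2 * \<epsilon>) * (\<theta> + 2 * \<epsilon>) + 2 * \<epsilon> + 2 * \<epsilon>"
   using b1 n PB unfolding N_def by linarith
  also have "\<dots> = \<theta>\<^sup>2 + (4 * \<theta> + 4 * \<epsilon> + 4) * \<epsilon>" by (simp add: power2_eq_square algebra_simps)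
  also have "\<dots> <= \<theta>\<^sup>2 + 25 * \<epsilon>" using \<theta> \<epsilon> by (intro add_left_mono mult_right_mono) auto
  finally show ?thesis .
 qed
 have "\<theta> <= \<theta>\<^sup>2"
 proof (rule field_le_epsilon)
  fix e :: real assume "e > 0"
  then have "\<theta> <= \<theta>\<^sup>2 + 25 * min 1 (e / 25)" by (intro step) auto
  also have "\<dots> <= \<theta>\<^sup>2 + e" by auto
  finally show "\<theta> <= \<theta>\<^sup>2 + e" .
 qed
 then have "\<theta> * (1 - \<theta>) <= 0" by (simp add: power2_eq_square algebra_simps)
 moreover have "0 <= \<theta> * (1 - \<theta>)" using \<theta> by simp
 ultimately show ?thesis unfolding \<theta>_def by (auto simp: mult_eq_0_iff dest: order_antisym)
qed

text \<open>Either \<open>{f \<ge> 0}\<close> crosses from left to right or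
  \<open>{f \<le> 0}\<close> crosses from bottom to top. Change of sign and exchange of coordinates
  preserve the law, so neither is more likely than the other.\<close>

lemma square_self_dual:
 assumes s: "s > 0"
 shows "1 / 2 <= pr (thr (LR 0 s 0 s)) 0"
proof -
 let ?L = "thr (LR 0 s 0 s)" and ?T = "thr (TB 0 s 0 s)" and ?K = "rect 0 s 0 s"
 have fL: "fam ?K (LR 0 s 0 s)" "fam ?K (TB 0 s 0 s)"
  using fam_conn LR_ne[of 0 s 0 s] TB_ne[of 0 s 0 s] s unfolding LR_def TB_def by auto
 note iL = incr_thr[OF fL(1)] and iT = incr_thr[OF fL(2)]
 note [measurable] = pr_uminus(2)[OF iT bounded_rect]
 have dual: "0 <= ?L (fld z) \<or> 0 <= ?T (%x. - fld z x)" for z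
 proof (cases "\<exists>C\<in>LR 0 s 0 s. \<forall>x\<in>C. 0 <= fld z x")
  case True
  then show ?thesis using thr_ge[OF fL(1), of "fld z"] by auto
 next
  case False
  have no: False if "connected C" "compact C" "C \<subseteq> rect 0 s 0 s" "!!x. x \<in> C ==> fld z x >= 0"
   "C \<inter> {x. x $ 1 = 0} ~= {}" "C \<inter> {x. x $ 1 = s} ~= {}" for C
   using False that unfolding LR_def conn_def by blast
  obtain T where T: "compact T" "connected T" "T \<subseteq> rect 0 s 0 s" "!!x. x \<in> T ==> fld z x <= 0"
   "T \<inter> {x. x $ 2 = 0} ~= {}" "T \<inter> {x. x $ 2 = s} ~= {}"
   by (rule rect_duality[OF continuous_fld s less_imp_le[OF s] no]) blast+
  then have "T \<in> TB 0 s 0 s" by (simp add: TB_def conn_def)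
  moreover have "bounded ((%x. - fld z x) ` ?K)"
   by (intro bounded_cont_image continuous_intros bounded_rect)
  ultimately show ?thesis using thr_ge[OF fL(2), of "%x. - fld z x" T 0] T(4) by auto
 qed
 \<comment> \<open>The law of \<open>- f\<close> is available for strict events, so the weak event
   at level 0 is enlarged to a strict one at a slightly negative level, which then tends to
   0.\<close>
 have "1 <= pr ?L 0 + pr ?T (0 - 1 * inverse (real (Suc n)))" for n
 proof -
  let ?e = "1 * inverse (real (Suc n))"
  have s1: "{z. 0 - ?e < ?T (%x. - fld z x)} \<in> sets PP"
  proof -
   have "{z \<in> space PP. 0 - ?e < ?T (%x. - fld z x)} \<in> sets PP" by measurable
   then show ?thesis by simp
  qed
  have "PP.prob (space PP) <= PP.prob ({z. 0 <= ?L (fld z)} \<union> {z. 0 - ?e < ?T (%x. - fld z x)})"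
  proof (intro PP.finite_measure_mono subsetI)
   fix z
   have "0 - ?e < 0" by simp
   then show "z \<in> {z. 0 <= ?L (fld z)} \<union> {z. 0 - ?e < ?T (%x. - fld z x)}"
    using dual[of z] by (elim disjE) (simp_all add: less_le_trans[of _ 0])
  qed (use sets_incr_fld(2)[OF iL bounded_rect] s1 in auto)
  also have "\<dots> <= PP.prob {z. 0 <= ?L (fld z)} + PP.prob {z. 0 - ?e < ?T (%x. - fld z x)}"
   using sets_incr_fld(2)[OF iL bounded_rect] s1 by (intro measure_Un_le) auto
  finally show ?thesis using pr_uminus(1)[OF iT bounded_rect] pr_ge_eq[OF iL bounded_rect] PP.prob_space by simp
 qed
 moreover have "(%n. pr ?L 0 + pr ?T (0 - 1 * inverse (real (Suc n)))) \<longlonglongrightarrow> pr ?L 0 + pr ?T 0"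
  by (intro tendsto_add tendsto_const pr_tendsto_left[OF iT bounded_rect]) simp
 ultimately have "1 <= pr ?L 0 + pr ?T 0" by (meson LIMSEQ_le_const)
 moreover have "pr ?T 0 = pr ?L 0" using pr_TB[of 0 s 0 s 0] s by simp
 ultimately show ?thesis by simp
qed

theorem no_percolation_at_zero: "PP.prob {z. perc 0 (fld z)} = 0"
proof -
 define c where "c = (1 - sqrt (sqrt (1 / 2 :: real))) ^ 1020"
 have "sqrt (1 / 2 :: real) < 1" by (simp add: real_sqrt_less_iff[of _ 1, simplified])
 then have c: "c > 0" unfolding c_def by simp
 have le: "PP.prob {z. perc_from (real n) 0 (fld z)} <= 1 - c" for n
 proof -
  obtain m where m: "m >= real n" "m > 0" "pr (thr (arm 0 m (7 * m))) (- 0) <= 1 - (1 - sqrt (sqrt (1/2))) ^ 1020"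
  proof (rule rsw[of "1/2" 1 0 "real n"])
   show "1 - 1 / 2 <= pr (thr (LR 0 s 0 s)) 0" if "s >= 1" for s using square_self_dual[of s] that by simp
  qed auto
  have i: "incr {x. mx 0 x <= 7 * m} (thr (arm 0 m (7 * m)))" using m by (intro incr_arm) auto
  have "PP.prob {z. perc_from (real n) 0 (fld z)} <= PP.prob {z. 0 <= thr (arm 0 m (7 * m)) (fld z)}"
  proof (intro PP.finite_measure_mono subsetI)
   fix z assume "z \<in> {z. perc_from (real n) 0 (fld z)}"
   then have "perc_from m 0 (fld z)" using perc_from_mono m(1) by blast
   then have k: "- 0 <= thr (arm 0 m (m + real k)) (fld z)" for k
    using perc_from_iff[OF continuous_fld] m(2) by auto
   obtain k where "6 * m <= real k" using real_arch_simple by blast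
   then show "z \<in> {z. 0 <= thr (arm 0 m (7 * m)) (fld z)}"
    using k[of k] arm_thr_mono[of m m "7 * m" "m + real k" "fld z" 0, OF _ _ _ _ continuous_fld] m(2) by simp
  qed (use sets_incr_fld(2)[OF i bounded_mx(1)] in auto)
  also have "\<dots> <= 1 - c" using pr_ge_eq[OF i bounded_mx(1)] m(3) by (simp add: c_def)
  finally show ?thesis .
 qed
 have "PP.prob {z. perc 0 (fld z)} <= 1 - c"
  using LIMSEQ_le_const2[OF perc_tendsto[of 0]] le by blast
 then show ?thesis using perc_zero_one[of 0] c by auto
qed

lemma surrounding_circuit:
 assumes g: "continuous_on UNIV g" and np: "\<not> perc p g" and N: "N > 0"
 obtains T where "compact T" "connected T" "!!x. x \<in> T ==> g x < - p"
  "!!S. connected S ==> S \<inter> cball 0 N ~= {} ==> \<not> bounded S ==> S \<inter> T ~= {}" "T \<inter> cball 0 N = {}"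
proof -
 have D: "closed {x. - p <= g x}" using g by (intro closed_Collect_le continuous_intros)
 have b: "bounded C" if "C \<in> components {x. - p <= g x}" for C
  using np in_components_connected[OF that] in_components_subset[OF that] unfolding perc_def by blast
 obtain T where "compact T" "connected T" "T \<inter> {x. - p <= g x} = {}" "T \<inter> cball 0 N = {}"
  "!!S. connected S ==> S \<inter> cball 0 N ~= {} ==> \<not> bounded S ==> S \<inter> T ~= {}"
  using surrounding_set[OF D b N] by metis
 then show ?thesis by (intro that[of T]) (auto simp: not_le[symmetric])
qed

section \<open>Analysis on the discrete cube\<close>

text \<open>The discrete cube over an index set is the power set: a point is the set of its coordinates
  equal to \<open>- 1\<close>.\<close>

definition sgn_at :: "'i => 'i set => real" where
 "sgn_at i X = (if i \<in> X then - 1 else 1)"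

definition avg :: "'i set => ('i set => real) => real" where
 "avg I f = (\<Sum>X\<in>Pow I. f X) / 2 ^ card I"

definition walsh :: "'i set => 'i set => real" where
 "walsh S X = (\<Prod>i\<in>S. sgn_at i X)"

definition wpoly :: "'i set => ('i set => real) => 'i set => real" where
 "wpoly I a X = (\<Sum>S\<in>Pow I. a S * walsh S X)"

text \<open>Half the jump, so that in a Walsh expansion it deletes \<open>i\<close> from the sets
  that contain it and annihilates the other terms.\<close>

definition diff_at :: "'i => ('i set => real) => 'i set => real" where
 "diff_at i f X = (f (X - {i}) - f (insert i X)) / 2"

text \<open>Expectation over a pair of uniform points whose corresponding coordinates have
  correlation \<open>r\<close>: the product is the density with respect to independent
  points.\<close>

definition noise :: "'i set => real => ('i set => 'i set => real) => real" where
 "noise I r h = avg I (%X. avg I (%Y. (\<Prod>i\<in>I. 1 + r * sgn_at i X * sgn_at i Y) * h X Y))"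

lemma sum_Pow_insert:
 assumes "finite I" "i \<notin> I"
 shows "(\<Sum>S\<in>Pow (insert i I). f S) = (\<Sum>S\<in>Pow I. f S) + (\<Sum>S\<in>Pow I. f (insert i S))"
proof -
 have "(\<Sum>S\<in>Pow (insert i I). f S) = (\<Sum>S\<in>Pow I. f S) + (\<Sum>S\<in>insert i ` Pow I. f S)"
  unfolding Pow_insert using assms by (intro sum.union_disjoint) auto
 also have "(\<Sum>S\<in>insert i ` Pow I. f S) = (\<Sum>S\<in>Pow I. f (insert i S))"
  using assms(2) by (subst sum.reindex) (auto simp: inj_on_def)
 finally show ?thesis .
qed

lemma avg_empty [simp]: "avg {} f = f {}"
 by (simp add: avg_def)

lemma avg_insert:
 assumes "finite I" "i \<notin> I"
 shows "avg (insert i I) f = avg I (%X. (f X + f (insert i X)) / 2)"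
 using assms by (simp add: avg_def sum_Pow_insert sum.distrib sum_divide_distrib[symmetric] field_simps)

lemma avg_cong: "(!!X. X \<subseteq> I ==> f X = g X) ==> avg I f = avg I g"
 by (auto simp: avg_def intro!: sum.cong)

lemma avg_mono: "(!!X. X \<subseteq> I ==> f X <= g X) ==> avg I f <= avg I g"
 by (auto simp: avg_def intro!: divide_right_mono sum_mono)

lemma avg_nonneg: "(!!X. X \<subseteq> I ==> 0 <= f X) ==> 0 <= avg I f"
 by (auto simp: avg_def intro!: divide_nonneg_nonneg sum_nonneg)

lemma avg_add: "avg I (%X. f X + g X) = avg I f + avg I g"
 by (simp add: avg_def sum.distrib add_divide_distrib)

lemma avg_cmult: "avg I (%X. c * f X) = c * avg I f"
 by (simp add: avg_def sum_distrib_left)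

lemma avg_sum: "avg I (%X. \<Sum>j\<in>J. f j X) = (\<Sum>j\<in>J. avg I (f j))"
 by (simp add: avg_def sum_divide_distrib) (rule sum.swap)

lemma avg_const: "finite I ==> avg I (%_. c) = c"
 by (simp add: avg_def card_Pow)

lemma avg_Cauchy_Schwarz: "(avg I (%X. f X * g X))\<^sup>2 <= avg I (%X. (f X)\<^sup>2) * avg I (%X. (g X)\<^sup>2)"
proof -
 have "(\<Sum>X\<in>Pow I. f X * g X)\<^sup>2 <= (\<Sum>X\<in>Pow I. (f X)\<^sup>2) * (\<Sum>X\<in>Pow I. (g X)\<^sup>2)"
  by (rule Cauchy_Schwarz_ineq_sum)
 then show ?thesis
  by (simp add: avg_def power_divide power2_eq_square[of "2 ^ card I"] divide_right_mono)
qed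

lemma walsh_insert:
 assumes "finite S" "i \<notin> S"
 shows "walsh (insert i S) X = sgn_at i X * walsh S X"
 using assms by (simp add: walsh_def)

lemma walsh_insert_point: "i \<notin> S ==> walsh S (insert i X) = walsh S X"
 unfolding walsh_def by (intro prod.cong) (auto simp: sgn_at_def)

lemma walsh_remove_point: "i \<notin> S ==> walsh S (X - {i}) = walsh S X"
 unfolding walsh_def by (intro prod.cong) (auto simp: sgn_at_def)

lemma wpoly_insert:
 assumes I: "finite I" "i \<notin> I" and X: "X \<subseteq> I"
 shows "wpoly (insert i I) a X = wpoly I a X + wpoly I (%S. a (insert i S)) X"
  "wpoly (insert i I) a (insert i X) = wpoly I a X - wpoly I (%S. a (insert i S)) X"
proof -
 have f: "finite S" "i \<notin> S" if "S \<in> Pow I" for S using that I finite_subset by auto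
 have iX: "i \<notin> X" using X I by auto
 show "wpoly (insert i I) a X = wpoly I a X + wpoly I (%S. a (insert i S)) X"
  using f iX unfolding wpoly_def sum_Pow_insert[OF I]
  by (auto simp: walsh_insert sgn_at_def intro!: sum.cong)
 have "(\<Sum>S\<in>Pow I. a (insert i S) * walsh (insert i S) (insert i X)) = - (\<Sum>S\<in>Pow I. a (insert i S) * walsh S X)"
  unfolding sum_negf[symmetric] using f
  by (intro sum.cong) (simp_all add: walsh_insert walsh_insert_point sgn_at_def)
 moreover have "(\<Sum>S\<in>Pow I. a S * walsh S (insert i X)) = (\<Sum>S\<in>Pow I. a S * walsh S X)"
  using f by (intro sum.cong) (simp_all add: walsh_insert_point)
 ultimately show "wpoly (insert i I) a (insert i X) = wpoly I a X - wpoly I (%S. a (insert i S)) X"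
  unfolding wpoly_def sum_Pow_insert[OF I] by simp
qed

lemma walsh_expansion:
 assumes "finite I"
 shows "\<exists>a. \<forall>X\<subseteq>I. f X = wpoly I a X"
 using assms
proof (induction I arbitrary: f rule: finite_induct)
 case empty
 show ?case by (intro exI[of _ "%_. f {}"]) (simp add: wpoly_def walsh_def)
next
 case (insert i I)
 obtain b where b: "!!X. X \<subseteq> I ==> (f X + f (insert i X)) / 2 = wpoly I b X"
  using insert.IH[of "%X. (f X + f (insert i X)) / 2"] by auto
 obtain c where c: "!!X. X \<subseteq> I ==> (f X - f (insert i X)) / 2 = wpoly I c X"
  using insert.IH[of "%X. (f X - f (insert i X)) / 2"] by auto
 define a where "a S = (if i \<in> S then c (S - {i}) else b S)" for S
 have ab: "wpoly I a X = wpoly I b X" "wpoly I (%S. a (insert i S)) X = wpoly I c X" for X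
 proof -
  have *: "S - {i} = S" "i \<notin> S" if "S \<in> Pow I" for S using that insert.hyps(2) by auto
  show "wpoly I a X = wpoly I b X" "wpoly I (%S. a (insert i S)) X = wpoly I c X"
   unfolding wpoly_def by (auto intro!: sum.cong simp: a_def * simp del: Pow_iff)
 qed
 have "f X = wpoly (insert i I) a X" if X: "X \<subseteq> insert i I" for X
 proof (cases "i \<in> X")
  case False
  then have "X \<subseteq> I" using X by auto
  then show ?thesis using b[of X] c[of X] by (simp add: wpoly_insert(1)[OF insert.hyps] ab field_simps)
 next
  case True
  define Y where "Y = X - {i}"
  have Y: "Y \<subseteq> I" "X = insert i Y" using X True by (auto simp: Y_def)
  then show ?thesis using b[of Y] c[of Y] by (simp add: wpoly_insert(2)[OF insert.hyps] ab field_simps)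
 qed
 then show ?case by blast
qed

lemma walsh_parseval:
 assumes "finite I"
 shows "avg I (%X. wpoly I a X * wpoly I b X) = (\<Sum>S\<in>Pow I. a S * b S)"
 using assms
proof (induction I arbitrary: a b rule: finite_induct)
 case empty
 show ?case by (simp add: wpoly_def walsh_def)
next
 case (insert i I)
 have "avg (insert i I) (%X. wpoly (insert i I) a X * wpoly (insert i I) b X)
   = avg I (%X. wpoly I a X * wpoly I b X + wpoly I (%S. a (insert i S)) X * wpoly I (%S. b (insert i S)) X)"
  unfolding avg_insert[OF insert.hyps]
  by (rule avg_cong) (simp add: wpoly_insert[OF insert.hyps] field_simps)
 then show ?case by (simp add: avg_add insert.IH sum_Pow_insert[OF insert.hyps])
qed

section \<open>Hypercontractivity and superconcentration\<close>

text \<open>Bonami's inequality by induction on the dimension. Averaging over the new sign leaves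
  \<open>u ^ 4 + 6 * r\<^sup>2 * u\<^sup>2 * v\<^sup>2 + r ^ 4 * v ^ 4\<close>. As
  \<open>3 * r\<^sup>2 = 1\<close>, the middle coefficient is 2, and Cauchy-Schwarz bounds the
  average by a perfect square.\<close>

lemma hypercontractive_4_2:
 assumes "finite I" "3 * r\<^sup>2 = 1"
 shows "avg I (%X. (wpoly I (%S. r ^ card S * a S) X) ^ 4) <= (\<Sum>S\<in>Pow I. (a S)\<^sup>2)\<^sup>2"
 using assms
proof (induction I arbitrary: a rule: finite_induct)
 case empty
 show ?case by (simp add: wpoly_def walsh_def power4_eq_xxxx power2_eq_square)
next
 case (insert i I)
 define u where "u = wpoly I (%S. r ^ card S * a S)"
 define v where "v = wpoly I (%S. r ^ card S * a (insert i S))"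
 define A where "A = (\<Sum>S\<in>Pow I. (a S)\<^sup>2)"
 define B where "B = (\<Sum>S\<in>Pow I. (a (insert i S))\<^sup>2)"
 have AB: "0 <= A" "0 <= B" by (auto simp: A_def B_def intro: sum_nonneg)
 have IH: "avg I (%X. (u X) ^ 4) <= A\<^sup>2" "avg I (%X. (v X) ^ 4) <= B\<^sup>2"
  unfolding u_def v_def A_def B_def using insert.IH[of a] insert.IH[of "%S. a (insert i S)"] insert.prems by simp_all
 have w: "wpoly I (%S. r ^ card (insert i S) * a (insert i S)) X = r * v X" for X
  unfolding v_def wpoly_def sum_distrib_left
 proof (rule sum.cong)
  fix S assume "S \<in> Pow I"
  then have "finite S" "i \<notin> S" using insert.hyps finite_subset by auto
  then show "r ^ card (insert i S) * a (insert i S) * walsh S X = r * (r ^ card S * a (insert i S) * walsh S X)" by simp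
 qed simp
 have r2: "r\<^sup>2 = 1 / 3" using insert.prems by simp
 have r4: "r ^ 4 = 1 / 9" "6 * r\<^sup>2 = 2"
  unfolding r2 using arg_cong[OF r2, of power2] by (simp_all add: power_mult[symmetric] power_divide)
 have e: "((u X + r * v X) ^ 4 + (u X - r * v X) ^ 4) / 2 = (u X) ^ 4 + 2 * ((u X)\<^sup>2 * (v X)\<^sup>2) + (v X) ^ 4 / 9" for X
 proof -
  have "((u X + r * v X) ^ 4 + (u X - r * v X) ^ 4) / 2 = (u X) ^ 4 + (6 * r\<^sup>2) * ((u X)\<^sup>2 * (v X)\<^sup>2) + r ^ 4 * (v X) ^ 4"
   by (simp add: power4_eq_xxxx power2_eq_square field_simps)
  then show ?thesis unfolding r4 by simp
 qed
 have "avg (insert i I) (%X. (wpoly (insert i I) (%S. r ^ card S * a S) X) ^ 4)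
  = avg I (%X. (u X) ^ 4 + 2 * ((u X)\<^sup>2 * (v X)\<^sup>2) + (v X) ^ 4 / 9)"
  unfolding avg_insert[OF insert.hyps]
  by (rule avg_cong) (simp add: wpoly_insert[OF insert.hyps] w u_def[symmetric] e)
 also have "\<dots> = avg I (%X. (u X) ^ 4) + 2 * avg I (%X. (u X)\<^sup>2 * (v X)\<^sup>2) + avg I (%X. (v X) ^ 4) / 9"
  using avg_cmult[of I "1/9" "%X. (v X) ^ 4"] by (simp add: avg_add avg_cmult)
 also have "\<dots> <= A\<^sup>2 + 2 * (A * B) + B\<^sup>2 / 9"
 proof -
  have "(avg I (%X. (u X)\<^sup>2 * (v X)\<^sup>2))\<^sup>2 <= avg I (%X. (u X) ^ 4) * avg I (%X. (v X) ^ 4)"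
   using avg_Cauchy_Schwarz[of I "%X. (u X)\<^sup>2" "%X. (v X)\<^sup>2"] by (simp add: power_mult[symmetric])
  also have "\<dots> <= A\<^sup>2 * B\<^sup>2" using IH by (intro mult_mono avg_nonneg) auto
  finally have "(avg I (%X. (u X)\<^sup>2 * (v X)\<^sup>2))\<^sup>2 <= (A * B)\<^sup>2" by (simp only: power_mult_distrib)
  then have "avg I (%X. (u X)\<^sup>2 * (v X)\<^sup>2) <= A * B" by (rule power2_le_imp_le) (simp add: AB)
  then show ?thesis using IH by linarith
 qed
 also have "\<dots> <= (A + B)\<^sup>2" by (simp add: power2_eq_square algebra_simps)
 also have "A + B = (\<Sum>S\<in>Pow (insert i I). (a S)\<^sup>2)" by (simp add: A_def B_def sum_Pow_insert[OF insert.hyps])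
 finally show ?case .
qed

text \<open>Diagonality of the noise operator in the Walsh basis, checked one coordinate at a
  time.\<close>

lemma noise_wpoly:
 assumes "finite I"
 shows "noise I r (%X Y. wpoly I a X * wpoly I b Y) = (\<Sum>S\<in>Pow I. r ^ card S * a S * b S)"
 using assms
proof (induction I arbitrary: a b rule: finite_induct)
 case empty
 show ?case by (simp add: noise_def wpoly_def walsh_def)
next
 case (insert i I)
 define k where "k X Y = (\<Prod>i\<in>I. 1 + r * sgn_at i X * sgn_at i Y)" for X Y
 define a' where "a' = (%S. a (insert i S))"
 define b' where "b' = (%S. b (insert i S))"
 note wi = wpoly_insert[OF insert.hyps, of _ a, folded a'_def] wpoly_insert[OF insert.hyps, of _ b, folded b'_def]
 have kk: "k (insert i X) Y = k X Y" "k X (insert i Y) = k X Y" for X Y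
  unfolding k_def using insert.hyps by (auto intro!: prod.cong simp: sgn_at_def)
 have pr: "(\<Prod>j\<in>insert i I. 1 + r * sgn_at j X * sgn_at j Y) = (1 + r * sgn_at i X * sgn_at i Y) * k X Y" for X Y
  using insert.hyps by (simp add: k_def)
 have in_avg: "avg (insert i I) (%Y. (\<Prod>j\<in>insert i I. 1 + r * sgn_at j X * sgn_at j Y) * (wpoly (insert i I) a X * wpoly (insert i I) b Y))
  = avg I (%Y. wpoly (insert i I) a X * k X Y * (wpoly I b Y + r * sgn_at i X * wpoly I b' Y))" for X
  unfolding avg_insert[OF insert.hyps] pr
 proof (rule avg_cong)
  fix Y assume "Y \<subseteq> I"
  then have "i \<notin> Y" using insert.hyps by auto
  then show "((1 + r * sgn_at i X * sgn_at i Y) * k X Y * (wpoly (insert i I) a X * wpoly (insert i I) b Y) +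
    (1 + r * sgn_at i X * sgn_at i (insert i Y)) * k X (insert i Y) * (wpoly (insert i I) a X * wpoly (insert i I) b (insert i Y))) / 2
    = wpoly (insert i I) a X * k X Y * (wpoly I b Y + r * sgn_at i X * wpoly I b' Y)"
   using \<open>Y \<subseteq> I\<close> by (simp add: wi kk sgn_at_def[of i Y] sgn_at_def[of i "insert i Y"] field_simps)
 qed
 have "noise (insert i I) r (%X Y. wpoly (insert i I) a X * wpoly (insert i I) b Y)
  = avg I (%X. avg I (%Y. k X Y * (wpoly I a X * wpoly I b Y)) + r * avg I (%Y. k X Y * (wpoly I a' X * wpoly I b' Y)))"
  unfolding noise_def in_avg unfolding avg_insert[OF insert.hyps]
 proof (rule avg_cong)
  fix X assume X: "X \<subseteq> I"
  then have iX: "i \<notin> X" using insert.hyps by auto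
  have "(avg I (%Y. wpoly (insert i I) a X * k X Y * (wpoly I b Y + r * sgn_at i X * wpoly I b' Y)) +
   avg I (%Y. wpoly (insert i I) a (insert i X) * k (insert i X) Y * (wpoly I b Y + r * sgn_at i (insert i X) * wpoly I b' Y))) / 2
   = (1/2) * avg I (%Y. wpoly (insert i I) a X * k X Y * (wpoly I b Y + r * sgn_at i X * wpoly I b' Y) +
   wpoly (insert i I) a (insert i X) * k (insert i X) Y * (wpoly I b Y + r * sgn_at i (insert i X) * wpoly I b' Y))"
   by (simp add: avg_add)
  also have "\<dots> = avg I (%Y. k X Y * (wpoly I a X * wpoly I b Y) + r * (k X Y * (wpoly I a' X * wpoly I b' Y)))"
   unfolding avg_cmult[symmetric]
   by (rule avg_cong) (use X iX in \<open>simp add: wi kk sgn_at_def[of i X] sgn_at_def[of i "insert i X"] field_simps\<close>)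
  finally show "(avg I (%Y. wpoly (insert i I) a X * k X Y * (wpoly I b Y + r * sgn_at i X * wpoly I b' Y)) +
   avg I (%Y. wpoly (insert i I) a (insert i X) * k (insert i X) Y * (wpoly I b Y + r * sgn_at i (insert i X) * wpoly I b' Y))) / 2
   = avg I (%Y. k X Y * (wpoly I a X * wpoly I b Y)) + r * avg I (%Y. k X Y * (wpoly I a' X * wpoly I b' Y))"
   by (simp add: avg_add avg_cmult)
 qed
 also have "\<dots> = noise I r (%X Y. wpoly I a X * wpoly I b Y) + r * noise I r (%X Y. wpoly I a' X * wpoly I b' Y)"
  by (simp add: noise_def k_def avg_add avg_cmult)
 also have "\<dots> = (\<Sum>S\<in>Pow I. r ^ card S * a S * b S) + r * (\<Sum>S\<in>Pow I. r ^ card S * a' S * b' S)"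
  by (simp add: insert.IH)
 also have "r * (\<Sum>S\<in>Pow I. r ^ card S * a' S * b' S) = (\<Sum>S\<in>Pow I. r ^ card (insert i S) * a (insert i S) * b (insert i S))"
  unfolding sum_distrib_left
 proof (rule sum.cong)
  fix S assume "S \<in> Pow I"
  then have "finite S" "i \<notin> S" using insert.hyps finite_subset by auto
  then show "r * (r ^ card S * a' S * b' S) = r ^ card (insert i S) * a (insert i S) * b (insert i S)" by (simp add: a'_def b'_def)
 qed simp
 finally show ?case by (simp add: sum_Pow_insert[OF insert.hyps])
qed

lemma noise_mono:
 assumes "\<bar>r\<bar> <= 1" "!!X Y. X \<subseteq> I ==> Y \<subseteq> I ==> f X Y <= g X Y"
 shows "noise I r f <= noise I r g"
 unfolding noise_def
proof (intro avg_mono mult_left_mono assms(2) prod_nonneg)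
 fix X Y i
 show "0 <= 1 + r * sgn_at i X * sgn_at i Y" using assms(1) by (auto simp: sgn_at_def)
qed

lemma noise_cong: "(!!X Y. X \<subseteq> I ==> Y \<subseteq> I ==> f X Y = g X Y) ==> noise I r f = noise I r g"
 unfolding noise_def by (intro avg_cong) simp

lemma noise_add: "noise I r (%X Y. f X Y + g X Y) = noise I r f + noise I r g"
 by (simp add: noise_def distrib_left avg_add)

lemma noise_cmult: "noise I r (%X Y. c * f X Y) = c * noise I r f"
 by (simp add: noise_def mult.left_commute[of _ c] avg_cmult)

lemma noise_sum: "noise I r (%X Y. \<Sum>j\<in>J. f j X Y) = (\<Sum>j\<in>J. noise I r (f j))"
 by (simp add: noise_def sum_distrib_left avg_sum)

lemma noise_marginal:
 assumes "finite I"
 shows "noise I r (%X Y. f X) = avg I f" "noise I r (%X Y. f Y) = avg I f"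
proof -
 obtain a where a: "!!X. X \<subseteq> I ==> f X = wpoly I a X" using walsh_expansion[OF assms, of f] by blast
 define b where "b S = (if S = {} then 1 else 0 :: real)" for S :: "'a set"
 have b: "wpoly I b X = 1" for X
 proof -
  have "wpoly I b X = (\<Sum>S\<in>Pow I. if S = {} then walsh S X else 0)" unfolding wpoly_def b_def by (intro sum.cong) auto
  then show ?thesis using assms by (simp add: sum.delta walsh_def)
 qed
 have s: "(\<Sum>S\<in>Pow I. h S * b S) = h {}" for h
 proof -
  have "(\<Sum>S\<in>Pow I. h S * b S) = (\<Sum>S\<in>Pow I. if S = {} then h S else 0)" unfolding b_def by (intro sum.cong) auto
  then show ?thesis using assms by (simp add: sum.delta)
 qed
 have av: "avg I f = a {}"
 proof -
  have "avg I f = avg I (%X. wpoly I a X * wpoly I b X)" by (rule avg_cong) (simp add: a b)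
  then show ?thesis using walsh_parseval[OF assms] s by simp
 qed
 have "noise I r (%X Y. f X) = noise I r (%X Y. wpoly I a X * wpoly I b Y)" by (rule noise_cong) (simp add: a b)
 then show "noise I r (%X Y. f X) = avg I f" using noise_wpoly[OF assms, of r a b] s[of "%S. r ^ card S * a S"] av by simp
 have "noise I r (%X Y. f Y) = noise I r (%X Y. wpoly I b X * wpoly I a Y)" by (rule noise_cong) (simp add: a b)
 then show "noise I r (%X Y. f Y) = avg I f" using noise_wpoly[OF assms, of r b a] s[of "%S. r ^ card S * a S"] av by (simp add: mult_ac)
qed

text \<open>By \<open>2 * a * b \<le> a\<^sup>2 + b\<^sup>2\<close> it suffices to pair each event
  with itself. The noise \<open>1/3\<close> is the square of the hypercontractive parameter
  \<open>1 / sqrt 3\<close>, so an event of probability \<open>p\<close> contributes at most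
  \<open>p * sqrt p\<close>, much less than \<open>p\<close> when it is rare.\<close>

lemma small_set_expansion:
 assumes I: "finite I"
 shows "noise I (1/3) (%X Y. of_bool (P X) * of_bool (Q Y)) <=
  (avg I (%X. of_bool (P X)) * sqrt (avg I (%X. of_bool (P X))) + avg I (%X. of_bool (Q X)) * sqrt (avg I (%X. of_bool (Q X)))) / 2"
proof -
 obtain a where a: "!!X. X \<subseteq> I ==> of_bool (P X) = wpoly I a X" using walsh_expansion[OF I, of "%X. of_bool (P X)"] by blast
 obtain b where b: "!!X. X \<subseteq> I ==> of_bool (Q X) = wpoly I b X" using walsh_expansion[OF I, of "%X. of_bool (Q X)"] by blast
 define W where "W c = (\<Sum>S\<in>Pow I. (1/3) ^ card S * (c S)\<^sup>2)" for c :: "'a set => real"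
 have key: "W c <= avg I (%X. of_bool (R X)) * sqrt (avg I (%X. of_bool (R X)))"
  if c: "!!X. X \<subseteq> I ==> of_bool (R X) = wpoly I c X" for R c
 proof -
  define p where "p = avg I (%X. of_bool (R X) :: real)"
  have p: "0 <= p" unfolding p_def by (rule avg_nonneg) simp
  have W0: "0 <= W c" unfolding W_def by (intro sum_nonneg mult_nonneg_nonneg) auto
  define r where "r = sqrt (1/3 :: real)"
  have r: "3 * r\<^sup>2 = 1" "r * r = 1/3" by (simp_all add: r_def)
  define g where "g = wpoly I (%S. (1/3) ^ card S * c S)"
  have ge: "g = wpoly I (%S. r ^ card S * (r ^ card S * c S))"
   unfolding g_def r(2)[symmetric] by (simp add: power_mult_distrib mult.assoc)
  have g4: "avg I (%X. (g X) ^ 4) <= (W c)\<^sup>2"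
  proof -
   have "avg I (%X. (g X) ^ 4) <= (\<Sum>S\<in>Pow I. (r ^ card S * c S)\<^sup>2)\<^sup>2" unfolding ge by (rule hypercontractive_4_2[OF I r(1)])
   also have "(\<Sum>S\<in>Pow I. (r ^ card S * c S)\<^sup>2) = W c"
    unfolding W_def r(2)[symmetric] by (simp add: power_mult_distrib power2_eq_square mult_ac)
   finally show ?thesis .
  qed
  have Wg: "W c = avg I (%X. of_bool (R X) * g X)"
  proof -
   have "avg I (%X. of_bool (R X) * g X) = avg I (%X. wpoly I c X * wpoly I (%S. (1/3) ^ card S * c S) X)"
    by (rule avg_cong) (simp add: c g_def)
   then show ?thesis by (simp add: walsh_parseval[OF I] W_def power2_eq_square mult_ac)
  qed
  \<comment> \<open>Two applications of Cauchy-Schwarz, each keeping the indicator, combine with the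
    fourth moment bound to \<open>W ^ 4 \<le> p ^ 3 * W ^ 2\<close>.\<close>
  have "(W c)\<^sup>2 <= p * avg I (%X. of_bool (R X) * (g X)\<^sup>2)"
  proof -
   have "W c = avg I (%X. of_bool (R X) * (of_bool (R X) * g X))" unfolding Wg by (rule avg_cong) simp
   then have "(W c)\<^sup>2 <= avg I (%X. (of_bool (R X))\<^sup>2) * avg I (%X. (of_bool (R X) * g X)\<^sup>2)"
    using avg_Cauchy_Schwarz[of I "%X. of_bool (R X)" "%X. of_bool (R X) * g X"] by simp
   also have "avg I (%X. (of_bool (R X))\<^sup>2) = p" unfolding p_def by (rule avg_cong) (simp add: power2_eq_square)
   also have "avg I (%X. (of_bool (R X) * g X)\<^sup>2) = avg I (%X. of_bool (R X) * (g X)\<^sup>2)"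
    by (rule avg_cong) (simp add: power2_eq_square)
   finally show ?thesis .
  qed
  moreover have "(avg I (%X. of_bool (R X) * (g X)\<^sup>2))\<^sup>2 <= p * (W c)\<^sup>2"
  proof -
   have "(avg I (%X. of_bool (R X) * (g X)\<^sup>2))\<^sup>2 <= avg I (%X. (of_bool (R X))\<^sup>2) * avg I (%X. ((g X)\<^sup>2)\<^sup>2)"
    by (rule avg_Cauchy_Schwarz)
   also have "avg I (%X. (of_bool (R X))\<^sup>2) = p" unfolding p_def by (rule avg_cong) (simp add: power2_eq_square)
   also have "p * avg I (%X. ((g X)\<^sup>2)\<^sup>2) <= p * (W c)\<^sup>2" using g4 p by (intro mult_left_mono) (simp_all add: power_mult[symmetric])
   finally show ?thesis .
  qed
  ultimately have "((W c)\<^sup>2)\<^sup>2 <= p\<^sup>2 * (p * (W c)\<^sup>2)"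
  proof -
   assume 1: "(W c)\<^sup>2 <= p * avg I (%X. of_bool (R X) * (g X)\<^sup>2)" and 2: "(avg I (%X. of_bool (R X) * (g X)\<^sup>2))\<^sup>2 <= p * (W c)\<^sup>2"
   have "((W c)\<^sup>2)\<^sup>2 <= (p * avg I (%X. of_bool (R X) * (g X)\<^sup>2))\<^sup>2" using 1 by (intro power_mono) auto
   also have "\<dots> <= p\<^sup>2 * (p * (W c)\<^sup>2)" unfolding power_mult_distrib using 2 by (intro mult_left_mono) auto
   finally show ?thesis .
  qed
  then have "(W c)\<^sup>2 * (W c)\<^sup>2 <= (p ^ 3) * (W c)\<^sup>2" by (simp add: power2_eq_square power3_eq_cube mult_ac)
  then have "(W c)\<^sup>2 <= p ^ 3" using p mult_right_le_imp_le[of "(W c)\<^sup>2" "(W c)\<^sup>2" "p ^ 3"] by (cases "W c = 0") auto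
  also have "p ^ 3 = (p * sqrt p)\<^sup>2" using p by (simp add: power_mult_distrib power3_eq_cube power2_eq_square)
  finally have "W c <= p * sqrt p" by (rule power2_le_imp_le) (simp add: p)
  then show ?thesis by (simp add: p_def)
 qed
 have "noise I (1/3) (%X Y. of_bool (P X) * of_bool (Q Y)) = noise I (1/3) (%X Y. wpoly I a X * wpoly I b Y)"
  by (rule noise_cong) (simp add: a b)
 also have "\<dots> = (\<Sum>S\<in>Pow I. (1/3) ^ card S * (a S * b S))" by (simp add: noise_wpoly[OF I] mult.assoc)
 also have "\<dots> <= (\<Sum>S\<in>Pow I. (1/3) ^ card S * (((a S)\<^sup>2 + (b S)\<^sup>2) / 2))"
 proof (intro sum_mono mult_left_mono)
  fix S show "a S * b S <= ((a S)\<^sup>2 + (b S)\<^sup>2) / 2"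
   using sum_squares_bound[of "a S" "b S"] by simp
 qed simp
 also have "\<dots> = (W a + W b) / 2"
  unfolding W_def by (simp add: distrib_left sum.distrib sum_divide_distrib[symmetric] add_divide_distrib)
 finally show ?thesis using key[OF a] key[OF b] by simp
qed

lemma diff_at_wpoly:
 assumes I: "finite I" "i \<in> I" and f: "!!X. X \<subseteq> I ==> f X = wpoly I a X" and X: "X \<subseteq> I"
 shows "diff_at i f X = wpoly I (%S. if i \<in> S then 0 else a (insert i S)) X"
proof -
 define J where "J = I - {i}"
 define Y where "Y = X - {i}"
 have J: "finite J" "i \<notin> J" "I = insert i J" and Y: "Y \<subseteq> J" "insert i X = insert i Y" using I X by (auto simp: J_def Y_def)
 let ?b = "%S. if i \<in> S then 0 else a (insert i S)"
 have "diff_at i f X = (wpoly I a Y - wpoly I a (insert i Y)) / 2"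
 proof -
  have "Y \<subseteq> I" "insert i Y \<subseteq> I" using X I(2) by (auto simp: Y_def)
  then show ?thesis unfolding diff_at_def Y(2) Y_def[symmetric] by (simp only: f)
 qed
 also have "\<dots> = wpoly J (%S. a (insert i S)) Y"
  unfolding J(3) wpoly_insert[OF J(1,2) Y(1)] by simp
 also have "\<dots> = wpoly J ?b Y" unfolding wpoly_def using J(2) by (intro sum.cong) auto
 also have "\<dots> = wpoly I ?b Y" unfolding J(3) wpoly_insert(1)[OF J(1,2) Y(1)] by (simp add: wpoly_def)
 also have "\<dots> = wpoly I ?b X" unfolding wpoly_def
 proof (rule sum.cong)
  fix S show "?b S * walsh S Y = ?b S * walsh S X" using walsh_remove_point[of i S X] by (simp add: Y_def)
 qed simp
 finally show ?thesis .
qed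

text \<open>Comparison of Walsh coefficients. Sets of size at least \<open>k\<close> are paid for by
  the energy divided by \<open>k\<close>; smaller sets by the correlated energy, whose weight
  \<open>(1/3) ^ (card S - 1)\<close> is compensated by \<open>3 ^ k\<close>.\<close>

lemma superconcentration_inequality:
 assumes I: "finite I" and k: "k > 0"
 shows "avg I (%X. (f X)\<^sup>2) - (avg I f)\<^sup>2 <= avg I (%X. \<Sum>i\<in>I. (diff_at i f X)\<^sup>2) / real k
  + 3 ^ k * noise I (1/3) (%X Y. \<Sum>i\<in>I. diff_at i f X * diff_at i f Y)"
proof -
 obtain a where a: "!!X. X \<subseteq> I ==> f X = wpoly I a X" using walsh_expansion[OF I, of f] by blast
 define b where "b i S = (if i \<in> S then 0 else a (insert i S))" for i S
 have d: "diff_at i f X = wpoly I (b i) X" if "i \<in> I" "X \<subseteq> I" for i X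
  unfolding b_def using diff_at_wpoly[OF I that(1) a that(2)] .
 have re: "(\<Sum>i\<in>I. \<Sum>S\<in>Pow I. h (card S) * (b i S)\<^sup>2) = (\<Sum>S\<in>Pow I. real (card S) * h (card S - 1) * (a S)\<^sup>2)" for h :: "nat => real"
 proof -
  have one: "(\<Sum>S\<in>Pow I. h (card S) * (b i S)\<^sup>2) = (\<Sum>S\<in>Pow I. of_bool (i \<in> S) * (h (card S - 1) * (a S)\<^sup>2))" if i: "i \<in> I" for i
  proof -
   define J where "J = I - {i}"
   have J: "finite J" "i \<notin> J" "I = insert i J" using I i by (auto simp: J_def)
   have f: "finite S" "i \<notin> S" if "S \<in> Pow J" for S using that J finite_subset by auto
   show ?thesis unfolding J(3) sum_Pow_insert[OF J(1,2)]
    using f by (simp add: b_def)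
  qed
  have "(\<Sum>i\<in>I. \<Sum>S\<in>Pow I. h (card S) * (b i S)\<^sup>2) = (\<Sum>i\<in>I. \<Sum>S\<in>Pow I. of_bool (i \<in> S) * (h (card S - 1) * (a S)\<^sup>2))"
   by (rule sum.cong[OF refl one])
  also have "\<dots> = (\<Sum>S\<in>Pow I. \<Sum>i\<in>I. of_bool (i \<in> S) * (h (card S - 1) * (a S)\<^sup>2))" by (rule sum.swap)
  also have "\<dots> = (\<Sum>S\<in>Pow I. real (card S) * h (card S - 1) * (a S)\<^sup>2)"
  proof (rule sum.cong)
   fix S assume "S \<in> Pow I"
   then have "I \<inter> S = S" by auto
   then have "(\<Sum>i\<in>I. of_bool (i \<in> S) :: real) = real (card S)" using I by simp
   then show "(\<Sum>i\<in>I. of_bool (i \<in> S) * (h (card S - 1) * (a S)\<^sup>2)) = real (card S) * h (card S - 1) * (a S)\<^sup>2"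
    by (simp add: sum_distrib_right[symmetric] del: sum_of_bool_eq)
  qed simp
  finally show ?thesis .
 qed
 have e1: "avg I (%X. \<Sum>i\<in>I. (diff_at i f X)\<^sup>2) = (\<Sum>S\<in>Pow I. real (card S) * (a S)\<^sup>2)"
 proof -
  have "avg I (%X. \<Sum>i\<in>I. (diff_at i f X)\<^sup>2) = (\<Sum>i\<in>I. avg I (%X. wpoly I (b i) X * wpoly I (b i) X))"
   unfolding avg_sum by (intro sum.cong refl avg_cong) (simp add: d power2_eq_square)
  also have "\<dots> = (\<Sum>i\<in>I. \<Sum>S\<in>Pow I. 1 * (b i S)\<^sup>2)" by (simp add: walsh_parseval[OF I] power2_eq_square)
  also have "\<dots> = (\<Sum>S\<in>Pow I. real (card S) * 1 * (a S)\<^sup>2)" by (rule re)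
  finally show ?thesis by simp
 qed
 have e2: "noise I (1/3) (%X Y. \<Sum>i\<in>I. diff_at i f X * diff_at i f Y) = (\<Sum>S\<in>Pow I. real (card S) * (1/3) ^ (card S - 1) * (a S)\<^sup>2)"
 proof -
  have "noise I (1/3) (%X Y. \<Sum>i\<in>I. diff_at i f X * diff_at i f Y) = (\<Sum>i\<in>I. noise I (1/3) (%X Y. wpoly I (b i) X * wpoly I (b i) Y))"
   unfolding noise_sum by (intro sum.cong refl noise_cong) (simp add: d)
  also have "\<dots> = (\<Sum>i\<in>I. \<Sum>S\<in>Pow I. (1/3) ^ card S * (b i S)\<^sup>2)" by (simp add: noise_wpoly[OF I] power2_eq_square mult.assoc)
  also have "\<dots> = (\<Sum>S\<in>Pow I. real (card S) * (1/3) ^ (card S - 1) * (a S)\<^sup>2)" by (rule re)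
  finally show ?thesis .
 qed
 have v: "avg I (%X. (f X)\<^sup>2) - (avg I f)\<^sup>2 = (\<Sum>S\<in>Pow I - {{}}. (a S)\<^sup>2)"
 proof -
  have "avg I (%X. (f X)\<^sup>2) = avg I (%X. wpoly I a X * wpoly I a X)" by (rule avg_cong) (simp add: a power2_eq_square)
  then have s2: "avg I (%X. (f X)\<^sup>2) = (\<Sum>S\<in>Pow I. (a S)\<^sup>2)" by (simp add: walsh_parseval[OF I] power2_eq_square)
  define c where "c S = (if S = {} then 1 else 0 :: real)" for S :: "'a set"
  have c1: "wpoly I c X = 1" for X
  proof -
   have "wpoly I c X = (\<Sum>S\<in>Pow I. if S = {} then walsh S X else 0)" unfolding wpoly_def c_def by (intro sum.cong) auto
   then show ?thesis using I by (simp add: sum.delta walsh_def)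
  qed
  have "avg I f = avg I (%X. wpoly I a X * wpoly I c X)" by (rule avg_cong) (simp add: a c1)
  also have "\<dots> = (\<Sum>S\<in>Pow I. if S = {} then a S else 0)" unfolding walsh_parseval[OF I] c_def by (intro sum.cong) auto
  also have "\<dots> = a {}" using I by (simp add: sum.delta)
  finally have "avg I f = a {}" .
  moreover have "(\<Sum>S\<in>Pow I. (a S)\<^sup>2) = (a {})\<^sup>2 + (\<Sum>S\<in>Pow I - {{}}. (a S)\<^sup>2)" using I by (intro sum.remove) auto
  ultimately show ?thesis using s2 by simp
 qed
 have "(\<Sum>S\<in>Pow I - {{}}. (a S)\<^sup>2) <= (\<Sum>S\<in>Pow I - {{}}. (real (card S) / real k + 3 ^ k * (real (card S) * (1/3) ^ (card S - 1))) * (a S)\<^sup>2)"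
 proof (rule sum_mono)
  fix S assume S: "S \<in> Pow I - {{}}"
  have cS: "card S >= 1" using S I finite_subset[of S I] by (auto simp: Suc_le_eq card_gt_0_iff)
  have "1 <= real (card S) / real k + 3 ^ k * (real (card S) * (1/3) ^ (card S - 1))"
  proof (cases "card S >= k")
   case True
   then have "1 <= real (card S) / real k" using k by simp
   then show ?thesis by (simp add: add_increasing2)
  next
   case False
   have "(3::real) ^ (card S - 1) <= 3 ^ k" using False by (intro power_increasing) auto
   then have "1 <= 3 ^ k * (1/3 :: real) ^ (card S - 1)" by (simp add: power_one_over field_simps)
   also have "\<dots> <= 3 ^ k * (real (card S) * (1/3) ^ (card S - 1))"
    using cS by (intro mult_left_mono) (auto simp: mult_le_cancel_right1)
   finally show ?thesis by (simp add: add_increasing)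
  qed
  then show "(a S)\<^sup>2 <= (real (card S) / real k + 3 ^ k * (real (card S) * (1/3) ^ (card S - 1))) * (a S)\<^sup>2"
   using mult_right_mono[of 1 _ "(a S)\<^sup>2"] by simp
 qed
 also have "\<dots> <= (\<Sum>S\<in>Pow I. (real (card S) / real k + 3 ^ k * (real (card S) * (1/3) ^ (card S - 1))) * (a S)\<^sup>2)"
  using I by (intro sum_mono2) auto
 also have "\<dots> = (\<Sum>S\<in>Pow I. real (card S) * (a S)\<^sup>2) / real k + 3 ^ k * (\<Sum>S\<in>Pow I. real (card S) * (1/3) ^ (card S - 1) * (a S)\<^sup>2)"
  by (simp add: sum.distrib distrib_right sum_divide_distrib sum_distrib_left mult.assoc)
 finally show ?thesis unfolding v e1 e2 .
qed

text \<open>In the application \<open>D i\<close> is the discrete gradient of a threshold functional, which off the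
  exceptional set \<open>Z\<close> equals the vector \<open>e\<close> attached to the vertex where the threshold is attained.\<close>

lemma selection_variance_bound:
 fixes f :: "'i set => real" and e :: "'v => 'i => real" and vs :: "'i set => 'v" and \<kappa> :: "'v => 'c"
 assumes I: "finite I" and k: "k > 0" and V: "!!X. X \<subseteq> I ==> vs X \<in> V"
  and D: "!!X i. X \<subseteq> I ==> i \<in> I ==> \<not> Z X ==> diff_at i f X = e (vs X) i"
  and L: "!!X i. X \<subseteq> I ==> i \<in> I ==> \<bar>diff_at i f X\<bar> <= L i" "(\<Sum>i\<in>I. (L i)\<^sup>2) <= \<Lambda>"
  and e1: "!!u v. u \<in> V ==> v \<in> V ==> (\<Sum>i\<in>I. e u i * e v i) <= 1"
  and e2: "!!u v. u \<in> V ==> v \<in> V ==> \<not> near (\<kappa> u) (\<kappa> v) ==> (\<Sum>i\<in>I. e u i * e v i) <= \<theta>" and \<theta>: "0 <= \<theta>"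
  and C: "finite C" "!!c c'. near c c' ==> c \<in> C \<and> c' \<in> C" "!!c. c \<in> C ==> card {c'. near c c'} <= M" "!!c. c \<in> C ==> card {c'. near c' c} <= M"
  and q0: "0 <= q" and q: "!!c. c \<in> C ==> avg I (%X. of_bool (\<kappa> (vs X) = c)) <= q"
 shows "avg I (%X. (f X)\<^sup>2) - (avg I f)\<^sup>2 <= (1 + \<Lambda> * avg I (%X. of_bool (Z X))) / real k
  + 3 ^ k * (\<theta> + real M * sqrt q + 2 * \<Lambda> * avg I (%X. of_bool (Z X)))"
proof -
 define \<delta> where "\<delta> = avg I (%X. of_bool (Z X))"
 have \<Lambda>: "0 <= \<Lambda>" using L(2) sum_nonneg[of I "%i. (L i)\<^sup>2"] by simp
 have DD: "(\<Sum>i\<in>I. diff_at i f X * diff_at i f Y) <= \<Lambda>" if "X \<subseteq> I" "Y \<subseteq> I" for X Y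
 proof -
  have "(\<Sum>i\<in>I. diff_at i f X * diff_at i f Y) <= (\<Sum>i\<in>I. (L i)\<^sup>2)"
  proof (rule sum_mono)
   fix i assume i: "i \<in> I"
   have "diff_at i f X * diff_at i f Y <= \<bar>diff_at i f X\<bar> * \<bar>diff_at i f Y\<bar>" by (metis abs_ge_self abs_mult)
   also have "\<dots> <= L i * L i" using L(1)[OF that(1) i] L(1)[OF that(2) i] by (intro mult_mono) auto
   finally show "diff_at i f X * diff_at i f Y <= (L i)\<^sup>2" by (simp add: power2_eq_square)
  qed
  then show ?thesis using L(2) by simp
 qed
 have i1: "avg I (%X. \<Sum>i\<in>I. (diff_at i f X)\<^sup>2) <= 1 + \<Lambda> * \<delta>"
 proof -
  have "avg I (%X. \<Sum>i\<in>I. (diff_at i f X)\<^sup>2) <= avg I (%X. 1 + \<Lambda> * of_bool (Z X))"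
  proof (rule avg_mono)
   fix X assume X: "X \<subseteq> I"
   show "(\<Sum>i\<in>I. (diff_at i f X)\<^sup>2) <= 1 + \<Lambda> * of_bool (Z X)"
   proof (cases "Z X")
    case True then show ?thesis using DD[OF X X] by (simp add: power2_eq_square)
   next
    case False
    then have "(\<Sum>i\<in>I. (diff_at i f X)\<^sup>2) = (\<Sum>i\<in>I. e (vs X) i * e (vs X) i)" using D[OF X] by (simp add: power2_eq_square)
    then show ?thesis using e1[OF V[OF X] V[OF X]] False by simp
   qed
  qed
  then show ?thesis using I by (simp add: avg_add avg_cmult avg_const \<delta>_def)
 qed
 have fN: "finite {c'. near c c'}" "finite {c'. near c' c}" for c using C(2) by (auto intro: finite_subset[OF _ C(1)])
 define N where "N = {cc. near (fst cc) (snd cc)}"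
 have N: "finite N" using C(2) by (intro finite_subset[of N "C \<times> C"]) (use C(1) in \<open>auto simp: N_def\<close>)
 let ?p = "%c. avg I (%X. of_bool (\<kappa> (vs X) = c) :: real)"
 have p0: "0 <= ?p c" for c by (rule avg_nonneg) simp
 have i2: "noise I (1/3) (%X Y. \<Sum>i\<in>I. diff_at i f X * diff_at i f Y) <= \<theta> + real M * sqrt q + 2 * \<Lambda> * \<delta>"
 proof -
  \<comment> \<open>Three kinds of pairs: far cells contribute at most \<open>\<theta>\<close>, near
    cells at most 1 and are recorded by indicators, exceptional points are charged the crude bound
    \<open>\<Lambda>\<close>.\<close>
  have "noise I (1/3) (%X Y. \<Sum>i\<in>I. diff_at i f X * diff_at i f Y) <=
   noise I (1/3) (%X Y. (\<theta> + (\<Sum>cc\<in>N. of_bool (\<kappa> (vs X) = fst cc) * of_bool (\<kappa> (vs Y) = snd cc))) + (\<Lambda> * of_bool (Z X) + \<Lambda> * of_bool (Z Y)))"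
  proof (rule noise_mono)
   fix X Y assume XY: "X \<subseteq> I" "Y \<subseteq> I"
   let ?s = "\<Sum>cc\<in>N. of_bool (\<kappa> (vs X) = fst cc) * of_bool (\<kappa> (vs Y) = snd cc) :: real"
   have s0: "0 <= ?s" by (intro sum_nonneg) auto
   show "(\<Sum>i\<in>I. diff_at i f X * diff_at i f Y) <= (\<theta> + ?s) + (\<Lambda> * of_bool (Z X) + \<Lambda> * of_bool (Z Y))"
   proof (cases "Z X \<or> Z Y")
    case True then show ?thesis using DD[OF XY] s0 \<theta> \<Lambda> by auto
   next
    case False
    then have eq: "(\<Sum>i\<in>I. diff_at i f X * diff_at i f Y) = (\<Sum>i\<in>I. e (vs X) i * e (vs Y) i)"
     using D XY by (intro sum.cong) auto
    show ?thesis
    proof (cases "near (\<kappa> (vs X)) (\<kappa> (vs Y))")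
     case True
     have "(1::real) = of_bool (\<kappa> (vs X) = fst (\<kappa> (vs X), \<kappa> (vs Y))) * of_bool (\<kappa> (vs Y) = snd (\<kappa> (vs X), \<kappa> (vs Y)))" by simp
     also have "\<dots> <= ?s" using N True by (intro member_le_sum) (auto simp: N_def)
     finally show ?thesis using e1[OF V[OF XY(1)] V[OF XY(2)]] eq \<theta> \<Lambda> by simp
    next
     case False
     then show ?thesis using e2[OF V[OF XY(1)] V[OF XY(2)]] eq s0 \<Lambda> by simp
    qed
   qed
  qed simp
  also have "\<dots> = \<theta> + (\<Sum>cc\<in>N. noise I (1/3) (%X Y. of_bool (\<kappa> (vs X) = fst cc) * of_bool (\<kappa> (vs Y) = snd cc))) + 2 * \<Lambda> * \<delta>"
   unfolding noise_add noise_sum noise_cmult noise_marginal[OF I] using I by (simp add: \<delta>_def avg_const)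
  also have "(\<Sum>cc\<in>N. noise I (1/3) (%X Y. of_bool (\<kappa> (vs X) = fst cc) * of_bool (\<kappa> (vs Y) = snd cc)))
    <= (\<Sum>cc\<in>N. (?p (fst cc) * sqrt q + ?p (snd cc) * sqrt q) / 2)"
  proof (rule sum_mono)
   fix cc assume cc: "cc \<in> N"
   then have "fst cc \<in> C" "snd cc \<in> C" using C(2) by (auto simp: N_def)
   then have "?p (fst cc) * sqrt (?p (fst cc)) <= ?p (fst cc) * sqrt q" "?p (snd cc) * sqrt (?p (snd cc)) <= ?p (snd cc) * sqrt q"
    using q p0 by (auto intro!: mult_left_mono)
   then show "noise I (1/3) (%X Y. of_bool (\<kappa> (vs X) = fst cc) * of_bool (\<kappa> (vs Y) = snd cc)) <= (?p (fst cc) * sqrt q + ?p (snd cc) * sqrt q) / 2"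
    by (intro order_trans[OF small_set_expansion[OF I, of "%X. \<kappa> (vs X) = fst cc" "%Y. \<kappa> (vs Y) = snd cc"]] divide_right_mono add_mono) simp_all
  qed
  \<comment> \<open>Each cell occurs in at most \<open>M\<close> near pairs on either side, and the
    cell probabilities sum to at most 1; the gain \<open>sqrt q\<close> comes from small-set
    expansion.\<close>
  also have "\<dots> <= real M * sqrt q"
  proof -
   have sp: "(\<Sum>c\<in>C. ?p c) <= 1"
   proof -
    have "(\<Sum>c\<in>C. ?p c) = avg I (%X. \<Sum>c\<in>C. of_bool (\<kappa> (vs X) = c))" by (simp add: avg_sum)
    also have "\<dots> <= avg I (%_. 1)"
    proof (rule avg_mono)
     fix X
     have "(\<Sum>c\<in>C. of_bool (\<kappa> (vs X) = c) :: real) = (\<Sum>c\<in>C. if c = \<kappa> (vs X) then 1 else 0)" by (intro sum.cong) auto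
     also have "\<dots> <= 1" using C(1) by (simp add: sum.delta)
     finally show "(\<Sum>c\<in>C. of_bool (\<kappa> (vs X) = c) :: real) <= 1" .
    qed
    finally show ?thesis using I by (simp add: avg_const)
   qed
   have cnt: "(\<Sum>cc\<in>N. ?p (g cc)) <= real M" if g: "g = fst \<or> g = snd" for g :: "'c \<times> 'c => 'c"
   proof -
    have "(\<Sum>cc\<in>N. ?p (g cc)) = (\<Sum>c\<in>C. \<Sum>cc\<in>{cc\<in>N. g cc = c}. ?p (g cc))"
     using C(1,2) N g by (intro sum.group[symmetric]) (auto simp: N_def)
    also have "\<dots> = (\<Sum>c\<in>C. real (card {cc\<in>N. g cc = c}) * ?p c)" by simp
    also have "\<dots> <= (\<Sum>c\<in>C. real M * ?p c)"
    proof (intro sum_mono mult_right_mono p0)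
     fix c assume c: "c \<in> C"
     show "real (card {cc\<in>N. g cc = c}) <= real M"
     proof (cases "g = fst")
      case True
      have "{cc\<in>N. g cc = c} = Pair c ` {c'. near c c'}" using True by (auto simp: N_def)
      then have "card {cc\<in>N. g cc = c} <= card {c'. near c c'}" using fN by (simp add: card_image_le)
      then show ?thesis using C(3)[OF c] by simp
     next
      case False
      then have "g = snd" using g by blast
      then have "{cc\<in>N. g cc = c} = (%c'. (c', c)) ` {c'. near c' c}" by (auto simp: N_def)
      then have "card {cc\<in>N. g cc = c} <= card {c'. near c' c}" using fN by (simp add: card_image_le)
      then show ?thesis using C(4)[OF c] by simp
     qed
    qed
    also have "\<dots> = real M * (\<Sum>c\<in>C. ?p c)" by (simp add: sum_distrib_left)
    also have "\<dots> <= real M" using sp by (simp add: mult_left_le)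
    finally show ?thesis .
   qed
   show ?thesis
   proof -
    have "(\<Sum>cc\<in>N. (?p (fst cc) * sqrt q + ?p (snd cc) * sqrt q) / 2) = ((\<Sum>cc\<in>N. ?p (fst cc)) + (\<Sum>cc\<in>N. ?p (snd cc))) / 2 * sqrt q"
     by (simp add: sum.distrib sum_distrib_right sum_divide_distrib[symmetric] distrib_right)
    also have "\<dots> <= real M * sqrt q"
     using cnt[of fst] cnt[of snd] q0 by (intro mult_right_mono) auto
    finally show ?thesis .
   qed
  qed
  finally show ?thesis by simp
 qed
 have "avg I (%X. (f X)\<^sup>2) - (avg I f)\<^sup>2 <= avg I (%X. \<Sum>i\<in>I. (diff_at i f X)\<^sup>2) / real k
  + 3 ^ k * noise I (1/3) (%X Y. \<Sum>i\<in>I. diff_at i f X * diff_at i f Y)"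
  by (rule superconcentration_inequality[OF I k])
 also have "\<dots> <= (1 + \<Lambda> * \<delta>) / real k + 3 ^ k * (\<theta> + real M * sqrt q + 2 * \<Lambda> * \<delta>)"
  using i1 i2 by (intro add_mono divide_right_mono mult_left_mono) auto
 finally show ?thesis unfolding \<delta>_def .
qed

section \<open>Passage from signs to Gaussian variables\<close>

text \<open>The signs of the Gaussian coordinates serve as Rademacher variables, so that the same
  probability space carries them.\<close>

definition sg :: "real => real" where
 "sg t = (if t < 0 then - 1 else 1)"

text \<open>Each Gaussian coordinate \<open>j\<close> is replaced by \<open>m\<close> signs,
  normalised as in the central limit theorem.\<close>

definition row_sum :: "nat => 'j => ('j \<times> nat) set => real" where
 "row_sum m j X = (\<Sum>l<m. sgn_at (j, l) X) / sqrt (real m)"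

lemma measurable_sg [measurable]: "sg \<in> borel_measurable borel"
 unfolding sg_def[abs_def] by measurable

lemma prob_coord_half: "PP.prob {z. z n < 0} = 1 / 2" "PP.prob {z. 0 <= z n} = 1 / 2"
proof -
 have d: "distributed N1 lborel (%x. x) std_normal_density"
  unfolding distributed_def by (auto intro!: measurable_ident_sets distr_id2)
 interpret N1: prob_space N1 by (rule prob_space_N1)
 have d': "distributed N1 lborel (%x. 0 + (- 1) * x) (normal_density (0 + (- 1) * 0) (\<bar>- 1\<bar> * 1))"
  by (rule N1.normal_density_affine[OF d]) auto
 have e: "distr N1 lborel (%x. x) = distr N1 lborel (%x. - x)"
  using distributed_distr_eq_density[OF d] distributed_distr_eq_density[OF d'] by simp
 have "measure N1 {..<0} = measure (distr N1 lborel (%x. x)) {..<0}" by (simp add: measure_distr)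
 also have "\<dots> = measure N1 {0<..}"
  unfolding e by (subst measure_distr) (auto intro!: arg_cong[of _ _ "measure N1"])
 finally have 1: "measure N1 {..<0} = measure N1 {0<..}" .
 have "AE x in N1. x ~= 0"
  using N1.distributed_AE2[OF d, of "%x. x ~= 0"] AE_lborel_singleton[of "0::real"] by (auto elim: eventually_mono)
 then have 2: "measure N1 {0::real} = 0"
  by (subst (asm) AE_iff_measurable[of "{0}"]) (auto simp: measure_def)
 have "measure N1 UNIV = measure N1 ({..<0} \<union> {0<..} \<union> {0::real})"
  by (rule arg_cong[of _ _ "measure N1"]) auto
 also have "\<dots> = measure N1 {..<0} + measure N1 {0<..} + measure N1 {0::real}"
  by (subst N1.finite_measure_Union; (subst N1.finite_measure_Union)?) auto
 finally have 3: "measure N1 {..<0} = 1 / 2" using 1 2 N1.prob_space by simp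
 have "PP.prob {z. z n < 0} = measure (distr PP borel (%z. z n)) {..<0}"
  by (subst measure_distr) (auto intro!: arg_cong[of _ _ PP.prob])
 then show h: "PP.prob {z. z n < 0} = 1 / 2" using 3 unfolding distr_coord by simp
 have "{z. z n < 0} \<in> sets PP"
 proof -
  have "{z \<in> space PP. z n < 0} \<in> sets PP" by measurable
  then show ?thesis by simp
 qed
 from PP.prob_compl[OF this] h have "PP.prob (UNIV - {z. z n < 0}) = 1 / 2" by simp
 also have "UNIV - {z. z n < (0::real)} = {z. 0 <= z n}" by auto
 finally show "PP.prob {z. 0 <= z n} = 1 / 2" .
qed

lemma indep_sg:
 assumes "inj \<iota>"
 shows "PP.indep_vars (%_. borel) (%l z. sg (z (\<iota> l))) UNIV"
proof -
 have "disjoint_family (%l. {\<iota> l})" using assms by (auto simp: disjoint_family_on_def inj_def)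
 from PP.indep_vars_restrict[OF PP_indep, of UNIV "%l. {\<iota> l}", OF _ this]
 have "PP.indep_vars (%l. PiM {\<iota> l} (%_. borel)) (%l z. restrict (%i. z i) {\<iota> l}) UNIV" by simp
 from PP.indep_vars_compose2[OF this, of "%l w. sg (w (\<iota> l))" "%_. borel"] show ?thesis by simp
qed

lemma sg_moments:
 "EE (%z. sg (z n)) = 0" "distr PP borel (%z. sg (z n)) = distr N1 borel sg"
proof -
 have m [measurable]: "{z. z n < 0} \<in> sets PP" "{z. 0 <= z n} \<in> sets PP"
 proof -
  have "{z \<in> space PP. z n < 0} \<in> sets PP" "{z \<in> space PP. 0 <= z n} \<in> sets PP" by measurable
  then show "{z. z n < 0} \<in> sets PP" "{z. 0 <= z n} \<in> sets PP" by auto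
 qed
 have "EE (%z. sg (z n)) = EE (%z. indicator {z. 0 <= z n} z - indicator {z. z n < 0} z)"
  by (rule Bochner_Integration.integral_cong) (auto simp: sg_def)
 also have "\<dots> = PP.prob {z. 0 <= z n} - PP.prob {z. z n < 0}"
  by (subst Bochner_Integration.integral_diff) (auto intro!: integrable_real_indicator simp: less_top[symmetric])
 finally show "EE (%z. sg (z n)) = 0" by (simp add: prob_coord_half)
 show "distr PP borel (%z. sg (z n)) = distr N1 borel sg"
  using distr_distr[of sg borel borel "%z. z n" PP] by (simp add: distr_coord comp_def)
qed

lemma rademacher_clt:
 assumes "inj \<iota>"
 shows "weak_conv_m (%m. distr PP borel (%z. (\<Sum>l<m. sg (z (\<iota> l))) / sqrt (real m))) N1"
proof -
 have "PP.prob UNIV = 1" using PP.prob_space by simp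
 moreover have sq: "(sg t)\<^sup>2 = 1" for t by (simp add: sg_def)
 ultimately have "weak_conv_m (%n. distr PP borel (%z. (\<Sum>l<n. sg (z (\<iota> l))) / sqrt (real n * 1\<^sup>2))) N1"
  by (intro PP.central_limit_theorem_zero_mean[OF indep_sg[OF assms]]) (simp_all add: sg_moments)
 then show ?thesis by simp
qed

text \<open>The set of negative coordinates is a uniform point of the cube, being determined by
  independent fair signs.\<close>

lemma expectation_pattern:
 assumes I: "finite I" and \<iota>: "inj_on \<iota> I"
 shows "EE (%z. h {i \<in> I. z (\<iota> i) < 0}) = avg I h"
proof -
 let ?N = "%z. {i \<in> I. z (\<iota> i) < (0::real)}"
 have B: "{z. ?N z = X} \<in> sets PP \<and> PP.prob {z. ?N z = X} = 1 / 2 ^ card I"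
  if X: "X \<in> Pow I" for X
 proof (cases "I = {}")
  case True
  have "PP.prob UNIV = 1" using PP.prob_space by simp
  with True X show ?thesis by simp
 next
  case False
  define A where "A i = (if i \<in> X then {..<0} else {0..} :: real set)" for i
  have "disjoint_family_on (%i. {\<iota> i}) I" using \<iota> by (auto simp: disjoint_family_on_def inj_on_def)
  from PP.indep_vars_restrict[OF PP_indep _ this]
  have "PP.indep_vars (%i. PiM {\<iota> i} (%_. borel)) (%i z. restrict (%i. z i) {\<iota> i}) I" by simp
  from PP.indep_vars_compose2[OF this, of "%i w. w (\<iota> i)" "%_. borel"]
  have ind: "PP.indep_vars (%_. borel) (%i z. z (\<iota> i)) I" by simp
  have eq: "{z. ?N z = X} = (\<Inter>i\<in>I. (%z. z (\<iota> i)) -` A i \<inter> space PP)"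
   using X False unfolding A_def by (auto split: if_splits)
  have s: "(%z. z (\<iota> i)) -` A i \<inter> space PP \<in> sets PP" for i by (rule measurable_sets[of _ PP borel]) (auto simp: A_def)
  have pa: "PP.prob ((%z. z (\<iota> i)) -` A i \<inter> space PP) = 1 / 2" for i
   using prob_coord_half[of "\<iota> i"] by (auto simp: A_def vimage_def)
  have "PP.prob (\<Inter>i\<in>I. (%z. z (\<iota> i)) -` A i \<inter> space PP) = 1 / 2 ^ card I"
  proof -
   have "A i \<in> sets borel" for i by (simp add: A_def)
   then have "PP.prob (\<Inter>i\<in>I. (%z. z (\<iota> i)) -` A i \<inter> space PP) = (\<Prod>i\<in>I. PP.prob ((%z. z (\<iota> i)) -` A i \<inter> space PP))"
    by (intro PP.indep_varsD_finite[OF ind False I])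
   then show ?thesis unfolding pa by (simp add: power_one_over)
  qed
  then show ?thesis unfolding eq using s I False by (auto intro!: sets.finite_INT)
 qed
 have "EE (%z. h (?N z))
   = EE (%z. \<Sum>X\<in>Pow I. h X * indicator {z. ?N z = X} z)"
 proof (rule Bochner_Integration.integral_cong)
  fix z
  have "(\<Sum>X\<in>Pow I. h X * indicator {z. ?N z = X} z) = (\<Sum>X\<in>Pow I. if X = ?N z then h X else 0)"
   by (intro sum.cong) auto
  also have "\<dots> = h (?N z)" using I by (simp add: sum.delta)
  finally show "h (?N z) = (\<Sum>X\<in>Pow I. h X * indicator {z. ?N z = X} z)" by simp
 qed simp
 also have "\<dots> = (\<Sum>X\<in>Pow I. h X * PP.prob {z. ?N z = X})"
  using B by (subst Bochner_Integration.integral_sum) (auto intro!: integrable_real_indicator simp: less_top[symmetric])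
 also have "\<dots> = avg I h" using B by (simp add: avg_def sum_divide_distrib)
 finally show ?thesis .
qed

lemma distr_PiM_maps:
 fixes \<Omega> :: "'j => 'a measure"
 assumes J: "finite J" and \<Omega>: "!!j. prob_space (\<Omega> j)" and f: "!!j. f j \<in> borel_measurable (\<Omega> j)"
 shows "distr (PiM J \<Omega>) (PiM J (%_. borel)) (%w. \<lambda>j\<in>J. f j (w j)) = PiM J (%j. distr (\<Omega> j) borel (f j))"
proof -
 note [measurable] = f
 have p: "prob_space (distr (\<Omega> j) borel (f j))" for j using \<Omega> f by (rule prob_space.prob_space_distr)
 interpret A: product_sigma_finite \<Omega> using \<Omega> by (simp add: product_sigma_finite_def prob_space_imp_sigma_finite)
 interpret B: product_sigma_finite "%j. distr (\<Omega> j) borel (f j)"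
  using p by (simp add: product_sigma_finite_def prob_space_imp_sigma_finite)
 have m: "(%w. \<lambda>j\<in>J. f j (w j)) \<in> PiM J \<Omega> \<rightarrow>\<^sub>M PiM J (%_. borel)" by measurable
 show ?thesis
 proof (rule B.PiM_eqI[OF J])
  show "sets (distr (PiM J \<Omega>) (PiM J (%_. borel)) (%w. \<lambda>j\<in>J. f j (w j))) = sets (PiM J (%j. distr (\<Omega> j) borel (f j)))"
   by (simp cong: sets_PiM_cong)
  fix S assume S: "!!i. i \<in> J ==> S i \<in> sets (distr (\<Omega> i) borel (f i))"
  have "(%w. \<lambda>j\<in>J. f j (w j)) -` Pi\<^sub>E J S \<inter> space (PiM J \<Omega>) = Pi\<^sub>E J (%j. f j -` S j \<inter> space (\<Omega> j))"
   by (auto simp: space_PiM PiE_iff extensional_def)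
  moreover have "Pi\<^sub>E J S \<in> sets (PiM J (%_. borel))" using J S by (intro sets_PiM_I_finite) auto
  ultimately show "emeasure (distr (PiM J \<Omega>) (PiM J (%_. borel)) (%w. \<lambda>j\<in>J. f j (w j))) (Pi\<^sub>E J S)
    = (\<Prod>i\<in>J. emeasure (distr (\<Omega> i) borel (f i)) (S i))"
   using S J f by (simp add: emeasure_distr[OF m] A.emeasure_PiM emeasure_distr)
 qed
qed

text \<open>Skorohod's theorem is applied to every coordinate; the product of the representing spaces then
  carries an everywhere convergent realisation of the vectors of row sums.\<close>

lemma rademacher_limit:
 fixes G :: "(nat \<times> nat => real) => real"
 assumes J: "finite J" "J ~= {}" and G: "G \<in> borel_measurable (PiM J (%_. N1))" and B: "!!w. \<bar>G w\<bar> <= B"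
  and cont: "!!w w'. (!!j. j \<in> J ==> (%m. w m j) \<longlonglongrightarrow> w' j) ==> (%m. G (w m)) \<longlonglongrightarrow> G w'"
 shows "(%m. avg (J \<times> {..<m}) (%X. G (%j. row_sum m j X))) \<longlonglongrightarrow> EE G"
  and "G \<in> borel_measurable PP"
proof -
 \<comment> \<open>Row \<open>j\<close> reads the coordinates \<open>(to_nat j, l)\<close>; distinct
   rows use disjoint blocks and are therefore independent.\<close>
 define S where "S m j z = (\<Sum>l<m. sg (z (to_nat j, l))) / sqrt (real m)" for m and j :: "nat \<times> nat" and z :: "nat \<times> nat => real"
 have [measurable]: "S m j \<in> borel_measurable PP" for m j unfolding S_def by measurable
 have sJ: "sets (PiM J (%_. N1)) = sets (PiM J (%_. borel))" by (intro sets_PiM_cong) auto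
 have Gb [measurable]: "G \<in> borel_measurable (PiM J (%_. borel))" using G measurable_cong_sets[OF sJ refl] by blast
 \<comment> \<open>Continuity along constant sequences shows that \<open>G\<close> depends on the
   coordinates in \<open>J\<close> only.\<close>
 have Gr: "G w = G w'" if "!!j. j \<in> J ==> w j = w' j" for w w'
  using cont[of "%_. w" w'] that by (simp add: LIMSEQ_const_iff)
 have "weak_conv_m (%m. distr PP borel (S m j)) N1" for j
  unfolding S_def by (rule rademacher_clt) (simp add: inj_def)
 then have "\<exists>(\<Omega> :: real measure) (Y_seq :: nat => real => real) (Y :: real => real).
  prob_space \<Omega> \<and> (\<forall>n. Y_seq n \<in> measurable \<Omega> borel) \<and> (\<forall>n. distr \<Omega> borel (Y_seq n) = distr PP borel (S n j)) \<and>
  Y \<in> measurable \<Omega> lborel \<and> distr \<Omega> borel Y = N1 \<and> (\<forall>x \<in> space \<Omega>. (%n. Y_seq n x) \<longlonglongrightarrow> Y x)" for j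
  by (intro Skorohod real_dist_normal_dist PP.real_distribution_distr) auto
 then obtain \<Omega> :: "nat \<times> nat => real measure" and Y Y' where
  \<Omega>: "!!j. prob_space (\<Omega> j)" and Y: "!!j n. Y j n \<in> borel_measurable (\<Omega> j)"
   "!!j n. distr (\<Omega> j) borel (Y j n) = distr PP borel (S n j)" "!!j. Y' j \<in> measurable (\<Omega> j) lborel"
   "!!j. distr (\<Omega> j) borel (Y' j) = N1" "!!j x. x \<in> space (\<Omega> j) ==> (%n. Y j n x) \<longlonglongrightarrow> Y' j x"
  by metis
 have Y'b: "Y' j \<in> borel_measurable (\<Omega> j)" for j using Y(3)[of j] by simp
 note [measurable] = Y(1) Y'b
 interpret \<Omega>J: prob_space "PiM J \<Omega>" by (rule prob_space_PiM) (rule \<Omega>)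
 have eqL: "avg (J \<times> {..<m}) (%X. G (%j. row_sum m j X)) = (\<integral>w. G (\<lambda>j\<in>J. Y j m (w j)) \<partial>PiM J \<Omega>)" for m
 proof -
  have "avg (J \<times> {..<m}) (%X. G (%j. row_sum m j X))
   = EE (%z. G (%j. row_sum m j {i \<in> J \<times> {..<m}. z ((%(j, l). (to_nat j, l)) i) < 0}))"
   using J(1) by (intro expectation_pattern[symmetric]) (auto simp: inj_on_def)
  also have "\<dots> = EE (%z. G (\<lambda>j\<in>J. S m j z))"
   by (intro Bochner_Integration.integral_cong Gr refl) (auto simp: row_sum_def S_def sg_def sgn_at_def intro!: sum.cong)
  also have "\<dots> = integral\<^sup>L (distr PP (PiM J (%_. borel)) (%z. \<lambda>j\<in>J. S m j z)) G"
   by (rule integral_distr[symmetric]) measurable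
  also have "distr PP (PiM J (%_. borel)) (%z. \<lambda>j\<in>J. S m j z) = PiM J (%j. distr PP borel (S m j))"
  proof (subst PP.indep_vars_iff_distr_eq_PiM'[OF J(2), symmetric])
   have "disjoint_family_on (%j. {to_nat j} \<times> {..<m}) J" by (auto simp: disjoint_family_on_def)
   from PP.indep_vars_restrict[OF PP_indep _ this]
   have i: "PP.indep_vars (%j. PiM ({to_nat j} \<times> {..<m}) (%_. borel)) (%j z. restrict (%i. z i) ({to_nat j} \<times> {..<m})) J" by simp
   have "PP.indep_vars (%_. borel) (%j z. (\<Sum>l<m. sg (restrict (%i. z i) ({to_nat j} \<times> {..<m}) (to_nat j, l))) / sqrt (real m)) J"
    by (rule PP.indep_vars_compose2[OF i, of "%j w. (\<Sum>l<m. sg (w (to_nat j, l))) / sqrt (real m)" "%_. borel"]) measurable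
   then show "PP.indep_vars (%_. borel) (S m) J"
    unfolding S_def[abs_def] by (rule PP.indep_vars_cong[THEN iffD1, rotated -1]) auto
  qed measurable
  also have "\<dots> = distr (PiM J \<Omega>) (PiM J (%_. borel)) (%w. \<lambda>j\<in>J. Y j m (w j))"
   unfolding Y(2)[symmetric] by (rule distr_PiM_maps[OF J(1) \<Omega> Y(1), symmetric])
  also have "integral\<^sup>L \<dots> G = (\<integral>w. G (\<lambda>j\<in>J. Y j m (w j)) \<partial>PiM J \<Omega>)" by (rule integral_distr) measurable
  finally show ?thesis .
 qed
 have GP: "(%z. G (restrict z J)) = G" by (intro ext Gr) simp
 show "G \<in> borel_measurable PP" using measurable_compose[OF measurable_restrict_PP G] by (simp add: GP)
 have eqR: "EE G = (\<integral>w. G (\<lambda>j\<in>J. Y' j (w j)) \<partial>PiM J \<Omega>)"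
 proof -
  have "EE G = EE (%z. G (restrict z J))" by (simp only: GP)
  also have "\<dots> = integral\<^sup>L (distr PP (PiM J (%_. N1)) (%z. restrict z J)) G"
   by (rule integral_distr[symmetric]) (use G in measurable)
  also have "distr PP (PiM J (%_. N1)) (%z. restrict z J) = PiM J (%j. distr (\<Omega> j) borel (Y' j))"
   unfolding Y(4) by (rule distr_PP_restrict[OF J(1)])
  also have "\<dots> = distr (PiM J \<Omega>) (PiM J (%_. borel)) (%w. \<lambda>j\<in>J. Y' j (w j))"
   by (rule distr_PiM_maps[OF J(1) \<Omega> Y'b, symmetric])
  also have "integral\<^sup>L \<dots> G = (\<integral>w. G (\<lambda>j\<in>J. Y' j (w j)) \<partial>PiM J \<Omega>)" by (rule integral_distr) measurable
  finally show ?thesis .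
 qed
 show "(%m. avg (J \<times> {..<m}) (%X. G (%j. row_sum m j X))) \<longlonglongrightarrow> EE G"
  unfolding eqL eqR
 proof (rule integral_dominated_convergence[where w = "%_. B"])
  show "AE w in PiM J \<Omega>. (%m. G (\<lambda>j\<in>J. Y j m (w j))) \<longlonglongrightarrow> G (\<lambda>j\<in>J. Y' j (w j))"
  proof (rule AE_I2, rule cont)
   fix w j assume "w \<in> space (PiM J \<Omega>)" "j \<in> J"
   then show "(%m. (\<lambda>j\<in>J. Y j m (w j)) j) \<longlonglongrightarrow> (\<lambda>j\<in>J. Y' j (w j)) j"
    using Y(5)[of "w j" j] by (auto simp: space_PiM)
  qed
 qed (use B in auto)
qed

section \<open>Variance of a selected affine form\<close>

text \<open>A nontrivial linear form in independent Gaussians has a normal density; a constant form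
  is nonzero by assumption.\<close>

lemma AE_affine_neq:
 assumes J: "finite J" and c: "c ~= 0 \<or> (\<exists>j\<in>J. d j ~= 0)"
 shows "AE z in PP. c + (\<Sum>j\<in>J. d j * z j) ~= (0::real)"
proof (cases "\<exists>j\<in>J. d j ~= 0")
 case False
 then show ?thesis using c by simp
next
 case True
 define I where "I = {j \<in> J. d j ~= 0}"
 have I: "finite I" "I ~= {}" using J True by (auto simp: I_def)
 have d0: "d j ~= 0" if "j \<in> I" for j using that by (simp add: I_def)
 have z: "distributed PP lborel (%z. z j) std_normal_density" for j
  unfolding distributed_def
 proof (intro conjI)
  have "distr PP lborel (%z. z j) = distr PP borel (%z. z j)" by (rule distr_cong) auto
  then show "distr PP lborel (%z. z j) = N1" by (simp add: distr_coord)
 qed simp_all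
 have dz: "distributed PP lborel (%z. d j * z j) (normal_density 0 (\<bar>d j\<bar>))" if "j \<in> I" for j
  using PP.normal_density_affine[OF z[of j], of "d j" 0] d0[OF that] by simp
 have ind: "PP.indep_vars (%_. borel) (%j z. d j * z j) I"
  by (rule PP.indep_vars_compose2[OF PP.indep_vars_subset[OF PP_indep]]) auto
 have s: "0 < \<bar>d j\<bar>" if "j \<in> I" for j using d0[OF that] by simp
 have "distributed PP lborel (%z. \<Sum>j\<in>I. d j * z j) (normal_density (\<Sum>j\<in>I. 0) (sqrt (\<Sum>j\<in>I. \<bar>d j\<bar>\<^sup>2)))"
  by (rule PP.sum_indep_normal[OF I ind s dz])
 from PP.distributed_AE2[OF this, of "%x. x ~= - c"]
 have "AE z in PP. (\<Sum>j\<in>I. d j * z j) ~= - c"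
  using AE_lborel_singleton[of "- c"] by (auto elim: eventually_mono)
 moreover have "(\<Sum>j\<in>I. d j * z j) = (\<Sum>j\<in>J. d j * z j)" for z
  using J by (intro sum.mono_neutral_left) (auto simp: I_def)
 ultimately show ?thesis by (auto elim!: eventually_mono)
qed

lemma row_sum_flip:
 assumes "l < m"
 shows "row_sum m j' (X - {(j, l)}) - row_sum m j' (insert (j, l) X) = (if j' = j then 2 / sqrt (real m) else 0)"
proof -
 have "(\<Sum>i<m. sgn_at (j', i) (X - {(j, l)})) - (\<Sum>i<m. sgn_at (j', i) (insert (j, l) X))
   = (\<Sum>i<m. if i = l then (if j' = j then 2 else 0) else 0)"
  unfolding sum_subtractf[symmetric] by (intro sum.cong) (auto simp: sgn_at_def)
 then show ?thesis using assms by (simp add: row_sum_def diff_divide_distrib[symmetric])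
qed

text \<open>At each point \<open>F\<close> takes the value of one of finitely many distinct affine
  forms. With \<open>m\<close> signs per coordinate a flip moves every form by order
  \<open>1 / sqrt m\<close>, so the selected form stays the same unless two forms nearly tie, and
  near ties become improbable as \<open>m\<close> grows. \<open>Q c\<close> is a continuous majorant
  of the event that cell \<open>c\<close> is selected, which can be carried through the
  limit.\<close>

lemma gaussian_selection_variance:
 fixes F :: "(nat \<times> nat => real) => real" and b :: "'v => real" and e :: "'v => nat \<times> nat => real" and \<kappa> :: "'v => 'c"
  and J :: "(nat \<times> nat) set" and sl :: "(nat \<times> nat => real) => 'v"
 defines "val \<equiv> %v w. b v + (\<Sum>j\<in>J. e v j * w j)"
 assumes J: "finite J" "J ~= {}" and V: "finite V" and k: "k > 0"
  and sel: "!!w. sl w \<in> V" "!!w. F w = val (sl w) w"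
  and lip: "!!w w' d. (!!v. v \<in> V ==> \<bar>val v w - val v w'\<bar> <= d) ==> \<bar>F w - F w'\<bar> <= d"
  and B: "!!w. \<bar>F w\<bar> <= B" and Fm: "F \<in> borel_measurable (PiM J (%_. N1))"
  and dist: "!!u v. u \<in> V ==> v \<in> V ==> u ~= v ==> b u ~= b v \<or> (\<exists>j\<in>J. e u j ~= e v j)"
  and e1: "!!u v. u \<in> V ==> v \<in> V ==> (\<Sum>j\<in>J. e u j * e v j) <= 1"
  and e2: "!!u v. u \<in> V ==> v \<in> V ==> \<not> near (\<kappa> u) (\<kappa> v) ==> (\<Sum>j\<in>J. e u j * e v j) <= \<theta>" and \<theta>: "0 <= \<theta>"
  and C: "finite C" "!!c c'. near c c' ==> c \<in> C \<and> c' \<in> C" "!!c. c \<in> C ==> card {c'. near c c'} <= N" "!!c. c \<in> C ==> card {c'. near c' c} <= N"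
  and Qm: "!!c. c \<in> C ==> Q c \<in> borel_measurable (PiM J (%_. N1))"
  and Q01: "!!c w. c \<in> C ==> 0 <= Q c w \<and> Q c w <= 1"
  and Qcont: "!!c w w'. c \<in> C ==> (!!j. j \<in> J ==> (%m. w m j) \<longlonglongrightarrow> w' j) ==> (%m. Q c (w m)) \<longlonglongrightarrow> Q c w'"
  and Qsel: "!!w. \<kappa> (sl w) \<in> C ==> 1 <= Q (\<kappa> (sl w)) w"
  and q: "0 <= q" "!!c. c \<in> C ==> EE (Q c) < q"
 shows "EE (%w. (F w)\<^sup>2) - (EE F)\<^sup>2 <= 1 / real k + 3 ^ k * (\<theta> + real N * sqrt q)"
proof -
 define S where "S m X j = row_sum m j X" for m j and X :: "((nat \<times> nat) \<times> nat) set"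
 define I where "I m = J \<times> {..<m}" for m :: nat
 have fI: "finite (I m)" for m using J by (simp add: I_def)
 let ?av = "%m f. avg (I m) (%X. f (S m X))"
 let ?B = "borel_measurable (PiM J (%_. N1))"
 have vcont: "(%m. val v (w m)) \<longlonglongrightarrow> val v w'" if "!!j. j \<in> J ==> (%m. w m j) \<longlonglongrightarrow> w' j" for v w w'
  unfolding val_def using that by (intro tendsto_intros) auto
 have Fcont: "(%m. F (w m)) \<longlonglongrightarrow> F w'" if w: "!!j. j \<in> J ==> (%m. w m j) \<longlonglongrightarrow> w' j" for w w'
 proof -
  have "(%m. \<Sum>v\<in>V. \<bar>val v (w m) - val v w'\<bar>) \<longlonglongrightarrow> (\<Sum>v\<in>V. \<bar>val v w' - val v w'\<bar>)"
   using vcont[OF w] by (intro tendsto_intros)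
  then have "(%m. \<Sum>v\<in>V. \<bar>val v (w m) - val v w'\<bar>) \<longlonglongrightarrow> 0" by simp
  then have "(%m. F (w m) - F w') \<longlonglongrightarrow> 0"
   by (rule Lim_null_comparison[rotated]) (auto intro!: always_eventually lip member_le_sum V)
  then show ?thesis by (simp add: LIM_zero_iff)
 qed
 have vm [measurable]: "val v \<in> ?B" for v
 proof -
  have "(%w. w j) \<in> ?B" if "j \<in> J" for j
   using measurable_component_singleton[OF that, of "%_. N1"] by (simp add: measurable_cong_sets[of _ _ N1 borel])
  then show ?thesis unfolding val_def by (intro borel_measurable_add borel_measurable_sum borel_measurable_times) auto
 qed
 note RL = rademacher_limit(1)[OF J, folded S_def I_def]
 have limF: "(%m. ?av m F) \<longlonglongrightarrow> EE F"
  using RL[OF Fm B Fcont] by (simp add: S_def[abs_def])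
 have limF2: "(%m. avg (I m) (%X. (F (S m X))\<^sup>2)) \<longlonglongrightarrow> EE (%w. (F w)\<^sup>2)"
 proof -
  have "\<bar>(F w)\<^sup>2\<bar> <= B\<^sup>2" for w using power_mono[OF B[of w], of 2] by simp
  moreover have "(%w. (F w)\<^sup>2) \<in> ?B" using Fm by measurable
  ultimately show ?thesis using RL[of "%w. (F w)\<^sup>2" "B\<^sup>2"] Fcont by (simp add: S_def[abs_def] tendsto_power)
 qed
 have evQ: "\<forall>\<^sub>F m in sequentially. \<forall>c\<in>C. ?av m (Q c) < q"
 proof (rule eventually_ball_finite[OF C(1)], rule)
  fix c assume c: "c \<in> C"
  have "\<bar>Q c w\<bar> <= 1" for w using Q01[OF c, of w] by simp
  then have "(%m. ?av m (Q c)) \<longlonglongrightarrow> EE (Q c)"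
   using RL[OF Qm[OF c] _ Qcont[OF c], of 1] by (simp add: S_def[abs_def])
  then show "\<forall>\<^sub>F m in sequentially. ?av m (Q c) < q" using q(2)[OF c] by (rule order_tendstoD)
 qed
 define L where "L j = (\<Sum>v\<in>V. \<bar>e v j\<bar>)" for j
 define \<Lambda> where "\<Lambda> = (\<Sum>j\<in>J. (L j)\<^sup>2)"
 define lam where "lam = (\<Sum>j\<in>J. L j)"
 have L0: "0 <= L j" for j unfolding L_def by (simp add: sum_nonneg)
 have eL: "\<bar>e v j\<bar> <= L j" if "v \<in> V" for v j unfolding L_def using V that by (intro member_le_sum) auto
 have Llam: "L j <= lam" if "j \<in> J" for j unfolding lam_def using J(1) that L0 by (intro member_le_sum) auto
 \<comment> \<open>A flip moves \<open>F\<close> and each of the forms by at most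
   \<open>2 * lam / sqrt m\<close>, so a change of the selected form forces a gap of at most twice
   this.\<close>
 define Z where "Z m X \<longleftrightarrow> (\<exists>u\<in>V. \<exists>v\<in>V. u ~= v \<and> \<bar>val u (S m X) - val v (S m X)\<bar> <= 4 * lam / sqrt (real m))" for m X
 let ?z = "%m. avg (I m) (%X. of_bool (Z m X))"
 have limZ: "(%m. ?z m) \<longlonglongrightarrow> 0"
 proof -
  define W where "W = {(u, v). u \<in> V \<and> v \<in> V \<and> u ~= v}"
  have W: "finite W" by (rule finite_subset[of _ "V \<times> V"]) (use V in \<open>auto simp: W_def\<close>)
  \<comment> \<open>At least 1 where \<open>\<bar>t\<bar> \<le> 1 / Suc n\<close> and 0 where
    \<open>\<bar>t\<bar> \<ge> 2 / Suc n\<close>: a continuous majorant of a near tie, so that for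
    fixed \<open>n\<close> the limit in \<open>m\<close> can be taken.\<close>
  define \<psi> where "\<psi> n t = max 0 (min 1 (2 - real (Suc n) * \<bar>t\<bar>))" for n and t :: real
  have \<psi>01: "0 <= \<psi> n t" "\<psi> n t <= 1" for n t by (auto simp: \<psi>_def)
  have \<psi>c: "(%m. \<psi> n (g m)) \<longlonglongrightarrow> \<psi> n t" if "g \<longlonglongrightarrow> t" for n t g unfolding \<psi>_def using that by (intro tendsto_intros)
  have [measurable]: "\<psi> n \<in> borel_measurable borel" for n unfolding \<psi>_def by measurable
  define T where "T n w = (\<Sum>(u, v)\<in>W. \<psi> n (val u w - val v w))" for n w
  have T0: "0 <= T n w" for n w unfolding T_def by (rule sum_nonneg) (auto simp: \<psi>01)
  have TB: "\<bar>T n w\<bar> <= real (card W)" for n w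
  proof -
   have "T n w <= (\<Sum>(u, v)\<in>W. 1)" unfolding T_def by (rule sum_mono) (auto simp: \<psi>01)
   then show ?thesis using T0[of n w] by (simp add: case_prod_beta)
  qed
  have Tm: "T n \<in> ?B" for n unfolding T_def case_prod_beta by measurable
  have Tc: "(%m. T n (w m)) \<longlonglongrightarrow> T n w'" if "!!j. j \<in> J ==> (%m. w m j) \<longlonglongrightarrow> w' j" for n w w'
   unfolding T_def case_prod_beta using vcont[OF that] by (intro tendsto_intros \<psi>c)
  have TP: "T n \<in> borel_measurable PP" for n by (rule rademacher_limit(2)[OF J Tm TB Tc])
  have "(%n. EE (T n)) \<longlonglongrightarrow> EE (%_. 0)"
  proof (rule integral_dominated_convergence[where w = "%_. real (card W)"])
   have "AE w in PP. \<forall>uv\<in>W. val (fst uv) w - val (snd uv) w ~= 0"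
   proof (rule AE_finite_allI[OF W])
    fix uv assume "uv \<in> W"
    then have "b (fst uv) - b (snd uv) ~= 0 \<or> (\<exists>j\<in>J. e (fst uv) j - e (snd uv) j ~= 0)"
     using dist[of "fst uv" "snd uv"] by (auto simp: W_def)
    from AE_affine_neq[OF J(1) this]
    show "AE w in PP. val (fst uv) w - val (snd uv) w ~= 0"
     by (rule eventually_mono) (simp add: val_def sum_subtractf algebra_simps)
   qed
   then show "AE w in PP. (%n. T n w) \<longlonglongrightarrow> 0"
   proof (rule eventually_mono)
    fix w assume w: "\<forall>uv\<in>W. val (fst uv) w - val (snd uv) w ~= 0"
    have "(%n. \<psi> n t) \<longlonglongrightarrow> 0" if t: "t ~= 0" for t
    proof (rule tendsto_eventually)
     obtain n0 :: nat where "2 / \<bar>t\<bar> <= real n0" using real_arch_simple by blast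
     then have n0: "2 <= real n0 * \<bar>t\<bar>" using t by (simp add: field_simps)
     have "\<psi> n t = 0" if "n >= n0" for n
     proof -
      have "real n0 * \<bar>t\<bar> <= real (Suc n) * \<bar>t\<bar>" using that by (intro mult_right_mono) auto
      then have "2 - real (Suc n) * \<bar>t\<bar> <= 0" using n0 by linarith
      then show ?thesis by (simp add: \<psi>_def max_def min_def)
     qed
     then show "\<forall>\<^sub>F n in sequentially. \<psi> n t = 0" by (auto simp: eventually_sequentially)
    qed
    then have "(%n. T n w) \<longlonglongrightarrow> (\<Sum>uv\<in>W. 0)" unfolding T_def case_prod_beta using w by (intro tendsto_sum) auto
    then show "(%n. T n w) \<longlonglongrightarrow> 0" by simp
   qed
  qed (use TB TP in auto)
  then have T\<epsilon>: "(%n. EE (T n)) \<longlonglongrightarrow> 0" by simp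
  show ?thesis
  proof (rule order_tendstoI)
   fix \<epsilon> :: real assume \<epsilon>: "0 < \<epsilon>"
   obtain n where n: "EE (T n) < \<epsilon>" using order_tendstoD(2)[OF T\<epsilon> \<epsilon>] by (auto simp: eventually_sequentially)
   have "(%m. ?av m (T n)) \<longlonglongrightarrow> EE (T n)"
    using RL[OF Tm TB Tc] by (simp add: S_def[abs_def])
   from order_tendstoD(2)[OF this n] have 1: "\<forall>\<^sub>F m in sequentially. ?av m (T n) < \<epsilon>" .
   have "(%m. 4 * lam / sqrt (real m)) \<longlonglongrightarrow> 0" by real_asymp
   from order_tendstoD(2)[OF this, of "inverse (real (Suc n))"]
   have 2: "\<forall>\<^sub>F m in sequentially. 4 * lam / sqrt (real m) < inverse (real (Suc n))" by simp
   from 1 2 show "\<forall>\<^sub>F m in sequentially. ?z m < \<epsilon>"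
   proof eventually_elim
    case (elim m)
    have "?z m <= ?av m (T n)"
    proof (rule avg_mono)
     fix X
     show "of_bool (Z m X) <= T n (S m X)"
     proof (cases "Z m X")
      case True
      then obtain u v where uv: "(u, v) \<in> W" "\<bar>val u (S m X) - val v (S m X)\<bar> <= 4 * lam / sqrt (real m)"
       by (auto simp: Z_def W_def)
      have "\<bar>val u (S m X) - val v (S m X)\<bar> <= inverse (real (Suc n))" using uv(2) elim(2) by linarith
      then have "real (Suc n) * \<bar>val u (S m X) - val v (S m X)\<bar> <= 1" by (simp add: field_simps)
      then have "1 <= \<psi> n (val u (S m X) - val v (S m X))" by (simp add: \<psi>_def)
      also have "\<dots> <= T n (S m X)"
       unfolding T_def using member_le_sum[OF uv(1), of "%(u, v). \<psi> n (val u (S m X) - val v (S m X))"] W by (auto simp: \<psi>01)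
      finally show ?thesis using True by simp
     qed (simp add: T0)
    qed
    then show ?case using elim(1) by simp
   qed
  next
   fix a :: real assume "a < 0"
   then show "\<forall>\<^sub>F m in sequentially. a < ?z m"
    by (intro always_eventually allI less_le_trans[OF _ avg_nonneg]) auto
  qed
 qed
 define vs where "vs m X = sl (S m X)" for m X
 have vs: "vs m X \<in> V" "F (S m X) = val (vs m X) (S m X)" for m X using sel by (auto simp: vs_def)
 have main: "avg (I m) (%X. (F (S m X))\<^sup>2) - (?av m F)\<^sup>2
   <= (1 + \<Lambda> * ?z m) / real k + 3 ^ k * (\<theta> + real N * sqrt q + 2 * \<Lambda> * ?z m)"
  if m: "m > 0" and Qm: "\<forall>c\<in>C. ?av m (Q c) < q" for m
 proof (rule selection_variance_bound[where e = "%v i. e v (fst i) / sqrt (real m)" and vs = "vs m" and V = V and \<kappa> = \<kappa> and C = C and near = near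
    and L = "%i. L (fst i) / sqrt (real m)"])
  have dv: "val v (S m (X - {(j, l)})) - val v (S m (insert (j, l) X)) = e v j * 2 / sqrt (real m)" if "j \<in> J" "l < m" for v X j l
  proof -
   have "val v (S m (X - {(j, l)})) - val v (S m (insert (j, l) X))
    = (\<Sum>j'\<in>J. e v j' * (row_sum m j' (X - {(j, l)}) - row_sum m j' (insert (j, l) X)))"
    by (simp add: val_def S_def sum_subtractf right_diff_distrib)
   also have "\<dots> = (\<Sum>j'\<in>J. if j' = j then e v j * (2 / sqrt (real m)) else 0)"
    unfolding row_sum_flip[OF that(2)] by (intro sum.cong) auto
   finally show ?thesis using J(1) that(1) by simp
  qed
  have dvL: "\<bar>val v (S m (X - {(j, l)})) - val v (S m (insert (j, l) X))\<bar> <= 2 * (L j / sqrt (real m))" if "v \<in> V" "j \<in> J" "l < m" for v X j l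
   unfolding dv[OF that(2,3)] using eL[OF that(1), of j] m by (simp add: abs_mult field_simps)
  have dF: "\<bar>F (S m (X - {(j, l)})) - F (S m (insert (j, l) X))\<bar> <= 2 * (L j / sqrt (real m))" if "j \<in> J" "l < m" for X j l
   by (rule lip) (use dvL that in auto)
  show "\<bar>diff_at i (%X. F (S m X)) X\<bar> <= L (fst i) / sqrt (real m)" if XI: "X \<subseteq> I m" "i \<in> I m" for X i
  proof -
   obtain j l where i: "i = (j, l)" "j \<in> J" "l < m" using XI by (auto simp: I_def)
   show ?thesis using dF[OF i(2,3), of X] by (simp add: diff_at_def i(1) mult.commute)
  qed
  show "diff_at i (%X. F (S m X)) X = e (vs m X) (fst i) / sqrt (real m)" if XI: "X \<subseteq> I m" "i \<in> I m" and nZ: "\<not> Z m X" for X i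
  proof -
   obtain j l where i: "i = (j, l)" "j \<in> J" "l < m" using XI by (auto simp: I_def)
   \<comment> \<open>The form selected after the flip is so close at \<open>X\<close> to the one
     selected before that they coincide, as \<open>X\<close> is not a near tie.\<close>
   have same: "F (S m X') = val (vs m X) (S m X')" if X': "X' = X - {i} \<or> X' = insert i X" for X'
   proof -
    have X: "X = X - {i} \<or> X = insert i X" by auto
    have "L j / sqrt (real m) <= lam / sqrt (real m)" using Llam[OF i(2)] by (intro divide_right_mono) auto
    note l2 = this L0[of j]
    have cv: "\<bar>val v (S m X) - val v (S m X')\<bar> <= 2 * (lam / sqrt (real m))" if "v \<in> V" for v
    proof -
     have "\<bar>val v (S m (X - {i})) - val v (S m (insert i X))\<bar> <= 2 * (lam / sqrt (real m))"
      using dvL[OF that i(2,3), of X] l2(1) unfolding i(1) by linarith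
     moreover have "S m X = S m (X - {i}) \<or> S m X = S m (insert i X)" "S m X' = S m (X - {i}) \<or> S m X' = S m (insert i X)"
      using X X' by metis+
     moreover have "0 <= lam / sqrt (real m)" using l2 by (intro order_trans[OF _ l2(1)] divide_nonneg_nonneg) auto
     ultimately show ?thesis by (elim disjE) (simp_all add: abs_minus_commute)
    qed
    have "\<bar>F (S m X) - F (S m X')\<bar> <= 2 * (lam / sqrt (real m))" by (rule lip) (rule cv)
    moreover have "\<bar>val (vs m X') (S m X) - val (vs m X') (S m X')\<bar> <= 2 * (lam / sqrt (real m))" by (rule cv) (rule vs)
    ultimately have "\<bar>val (vs m X') (S m X) - val (vs m X) (S m X)\<bar> <= 4 * lam / sqrt (real m)"
     unfolding vs(2) by linarith
    then have "vs m X' = vs m X" using nZ vs(1) unfolding Z_def by blast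
    then show ?thesis using vs(2)[of m X'] by simp
   qed
   show ?thesis
    using same[of "X - {i}"] same[of "insert i X"] dv[OF i(2,3), of "vs m X" X] by (simp add: diff_at_def i(1))
  qed
  have sI: "(\<Sum>i\<in>I m. g (fst i) / sqrt (real m) * (h (fst i) / sqrt (real m))) = (\<Sum>j\<in>J. g j * h j)" for g h :: "nat \<times> nat => real"
  proof -
   have "(\<Sum>i\<in>I m. g (fst i) / sqrt (real m) * (h (fst i) / sqrt (real m))) = (\<Sum>j\<in>J. \<Sum>l<m. g j * h j / real m)"
    unfolding I_def sum.cartesian_product by (intro sum.cong) (auto simp: case_prod_beta)
   also have "\<dots> = (\<Sum>j\<in>J. g j * h j)" using m by simp
   finally show ?thesis .
  qed
  show "(\<Sum>i\<in>I m. (L (fst i) / sqrt (real m))\<^sup>2) <= \<Lambda>" using sI[of L L] by (simp add: power2_eq_square \<Lambda>_def)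
  show "(\<Sum>i\<in>I m. e u (fst i) / sqrt (real m) * (e v (fst i) / sqrt (real m))) <= 1" if "u \<in> V" "v \<in> V" for u v
   unfolding sI by (rule e1[OF that])
  show "(\<Sum>i\<in>I m. e u (fst i) / sqrt (real m) * (e v (fst i) / sqrt (real m))) <= \<theta>" if "u \<in> V" "v \<in> V" "\<not> near (\<kappa> u) (\<kappa> v)" for u v
   unfolding sI by (rule e2[OF that])
  show "avg (I m) (%X. of_bool (\<kappa> (vs m X) = c)) <= q" if c: "c \<in> C" for c
  proof -
   have "avg (I m) (%X. of_bool (\<kappa> (vs m X) = c)) <= ?av m (Q c)"
    using Qsel[of "S m _"] Q01[OF c] c by (intro avg_mono) (auto simp: vs_def)
   then show ?thesis using Qm c by fastforce
  qed
 qed (use fI k vs \<theta> C q in auto)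
 have rhs: "(%m. (1 + \<Lambda> * ?z m) / real k + 3 ^ k * (\<theta> + real N * sqrt q + 2 * \<Lambda> * ?z m))
   \<longlonglongrightarrow> (1 + \<Lambda> * 0) / real k + 3 ^ k * (\<theta> + real N * sqrt q + 2 * \<Lambda> * 0)"
  by (intro tendsto_intros limZ) (use k in auto)
 have lhs: "(%m. avg (I m) (%X. (F (S m X))\<^sup>2) - (?av m F)\<^sup>2)
   \<longlonglongrightarrow> EE (%w. (F w)\<^sup>2) - (EE F)\<^sup>2"
  by (intro tendsto_intros limF limF2)
 have "EE (%w. (F w)\<^sup>2) - (EE F)\<^sup>2 <= (1 + \<Lambda> * 0) / real k + 3 ^ k * (\<theta> + real N * sqrt q + 2 * \<Lambda> * 0)"
 proof (rule tendsto_le[OF _ rhs lhs])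
  show "\<forall>\<^sub>F m in sequentially. avg (I m) (%X. (F (S m X))\<^sup>2) - (?av m F)\<^sup>2
   <= (1 + \<Lambda> * ?z m) / real k + 3 ^ k * (\<theta> + real N * sqrt q + 2 * \<Lambda> * ?z m)"
   using evQ eventually_gt_at_top[of 0] by eventually_elim (rule main)
 qed simp
 then show ?thesis by simp
qed

section \<open>Sharpness of the crossing threshold\<close>

definition gr :: "nat => real ^ 2 => real ^ 2" where
 "gr j x = gpt j (gidx j x)"

text \<open>With finitely many values both the maximum over members and the minimum on a member are
  attained; \<open>x\<close> is the point at which the threshold is decided.\<close>

lemma thr_attained:
 fixes g :: "'a => real"
 assumes fam: "fam K \<C>" and fin: "finite (g ` K)"
 obtains S x where "S \<in> \<C>" "x \<in> S" "g x = thr \<C> g" "!!y. y \<in> S ==> thr \<C> g <= g y"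
proof -
 have SK: "S ~= {}" "S \<subseteq> K" "finite (g ` S)" if "S \<in> \<C>" for S
  using fam that finite_subset[OF image_mono fin] by (auto simp: fam_def)
 have "(%S. Min (g ` S)) ` \<C> \<subseteq> g ` K"
 proof clarify
  fix S assume S: "S \<in> \<C>"
  then have "Min (g ` S) \<in> g ` S" using SK[OF S] by (intro Min_in) auto
  then show "Min (g ` S) \<in> g ` K" using image_mono[OF SK(2)[OF S], of g] by blast
 qed
 then have f: "finite ((%S. Min (g ` S)) ` \<C>)" using fin finite_subset by blast
 have ne: "(%S. Min (g ` S)) ` \<C> ~= {}" using fam by (auto simp: fam_def)
 obtain S where S: "S \<in> \<C>" "Max ((%S. Min (g ` S)) ` \<C>) = Min (g ` S)" using Max_in[OF f ne] by auto
 have b: "bounded (g ` K)" using fin by (rule finite_imp_bounded)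
 have "Min (g ` S) <= thr \<C> g" by (rule thr_ge[OF fam b S(1)]) (use SK[OF S(1)] in auto)
 moreover have "\<not> Min (g ` S) < thr \<C> g"
 proof
  assume "Min (g ` S) < thr \<C> g"
  then obtain l T where T: "l > Min (g ` S)" "T \<in> \<C>" "\<forall>x\<in>T. l <= g x" using thr_gt_iff[OF fam b] by blast
  have "l <= Min (g ` T)" using SK[OF T(2)] T(3) by (intro Min.boundedI) auto
  also have "\<dots> <= Min (g ` S)" unfolding S(2)[symmetric] using f T(2) by (intro Max_ge) auto
  finally show False using T(1) by simp
 qed
 ultimately have eq: "Min (g ` S) = thr \<C> g" by simp
 moreover have "Min (g ` S) \<in> g ` S" using SK[OF S(1)] by (intro Min_in) auto
 ultimately obtain x where x: "x \<in> S" "g x = thr \<C> g" by auto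
 have "thr \<C> g <= g y" if "y \<in> S" for y unfolding eq[symmetric] using SK[OF S(1)] that by (intro Min_le) auto
 with S(1) x that show ?thesis by blast
qed

lemma finite_gr: "bounded K ==> finite ((g \<circ> gr j) ` K)"
proof -
 assume "bounded K"
 then have "finite ((%v. g (gpt j v)) ` gidx j ` K)" using finite_grid_index by blast
 then show ?thesis by (simp add: image_image gr_def comp_def)
qed

lemma bounded_gr: "bounded K ==> bounded (gr j ` K)"
 using finite_gr[of K "%x. x" j] by (auto simp: comp_def intro: finite_imp_bounded)

lemma gr_limits:
 assumes \<Phi>: "incr K \<Phi>" "bounded K" and h: "continuous_on UNIV h" "!!t. \<bar>h t\<bar> <= (B::real)"
 shows "(%N. EE (%z. h (\<Phi> (lin (lo N) z \<circ> gr j)))) \<longlonglongrightarrow> EE (%z. h (\<Phi> (fld z \<circ> gr j)))"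
  and "(%j. EE (%z. h (\<Phi> (fld z \<circ> gr j)))) \<longlonglongrightarrow> EE (%z. h (\<Phi> (fld z)))"
proof -
 have hm [measurable]: "h \<in> borel_measurable borel" using h(1) by (rule borel_measurable_continuous_onI)
 note i = incr_compose[OF \<Phi>(1), of "gr j" for j] and b = bounded_gr[OF \<Phi>(2)]
 have [measurable]: "(%z. \<Phi> (lin J z \<circ> gr j)) \<in> borel_measurable PP" "(%z. \<Phi> (fld z \<circ> gr j)) \<in> borel_measurable PP"
  "(%z. \<Phi> (fld z)) \<in> borel_measurable PP" for j J
  using measurable_incr_lin[OF i b] measurable_incr_fld[OF i b] measurable_incr_fld[OF \<Phi>] by auto
 have hc: "(%m. h (g m)) \<longlonglongrightarrow> h t" if "g \<longlonglongrightarrow> t" for g t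
  using continuous_on_tendsto_compose[OF h(1) that] by simp
 show "(%N. EE (%z. h (\<Phi> (lin (lo N) z \<circ> gr j)))) \<longlonglongrightarrow> EE (%z. h (\<Phi> (fld z \<circ> gr j)))"
 proof (rule integral_dominated_convergence[where w = "%_. B"])
  show "AE z in PP. (%N. h (\<Phi> (lin (lo N) z \<circ> gr j))) \<longlonglongrightarrow> h (\<Phi> (fld z \<circ> gr j))"
   using AE_good by (rule eventually_mono) (rule hc[OF incr_lin_tendsto[OF i b]])
 qed (use h(2) in auto)
 show "(%j. EE (%z. h (\<Phi> (fld z \<circ> gr j)))) \<longlonglongrightarrow> EE (%z. h (\<Phi> (fld z)))"
 proof (rule integral_dominated_convergence[where w = "%_. B"])
  show "AE z in PP. (%j. h (\<Phi> (fld z \<circ> gr j))) \<longlonglongrightarrow> h (\<Phi> (fld z))"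
   using incr_grid_tendsto[OF \<Phi> continuous_fld] by (intro AE_I2 hc) (simp add: comp_def gr_def)
 qed (use h(2) in auto)
qed

text \<open>The mode of degree 0 is positive, so the modes of degree at most 1 determine both
  coordinates; hence the condition \<open>N >= 2\<close>.\<close>

lemma basis_injective:
 assumes "N >= 2" "x ~= y"
 obtains n where "n \<in> lo N" "basis n x ~= basis n y"
proof -
 have "\<exists>n\<in>{(0, 0), (1, 0), (0, 1)}. basis n x ~= basis n y"
 proof (rule ccontr)
  assume "\<not> ?thesis"
  then have "x $ 1 = y $ 1" "x $ 2 = y $ 2" by (auto simp: basis_def)
  then show False using assms(2) by (simp add: vec2_eq_iff)
 qed
 moreover have "{(0, 0), (1, 0), (0, 1)} \<subseteq> lo N" using assms(1) by (auto simp: lo_def)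
 ultimately show ?thesis using that by blast
qed

section \<open>Variance of the crossing level\<close>

definition ctr :: "int \<times> int => real ^ 2" where
 "ctr c = pt (real_of_int (fst c)) (real_of_int (snd c))"

definition cells :: "real => (int \<times> int) set" where
 "cells s = {0..\<lfloor>s\<rfloor>} \<times> {0..\<lfloor>s\<rfloor>}"

text \<open>\<open>None\<close> is the cell of the clamped values. It is near no cell, so their zero
  gradient always falls under the far case.\<close>

definition near :: "real => nat => (int \<times> int) option => (int \<times> int) option => bool" where
 "near s r c c' \<longleftrightarrow> (\<exists>a\<in>cells s. \<exists>a'\<in>cells s. c = Some a \<and> c' = Some a' \<and> \<bar>fst a - fst a'\<bar> <= int r \<and> \<bar>snd a - snd a'\<bar> <= int r)"

lemma card_near: "card {c'. near s r c c'} <= (2 * r + 1)\<^sup>2" "card {c'. near s r c' c} <= (2 * r + 1)\<^sup>2"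
proof -
 show 1: "card {c'. near s r c c'} <= (2 * r + 1)\<^sup>2" for c
 proof (cases c)
  case None
  then show ?thesis by (simp add: near_def)
 next
  case (Some a)
  let ?N = "{fst a - int r..fst a + int r} \<times> {snd a - int r..snd a + int r}"
  have "{c'. near s r c c'} \<subseteq> Some ` ?N" using Some by (auto simp: near_def abs_le_iff intro!: imageI)
  then have "card {c'. near s r c c'} <= card (Some ` ?N)" by (intro card_mono) auto
  also have "\<dots> = card ?N" by (intro card_image) auto
  also have "\<dots> = (2 * r + 1)\<^sup>2" by (simp add: card_cartesian_product power2_eq_square nat_add_distrib nat_mult_distrib)
  finally show ?thesis .
 qed
 have "near s r c' c = near s r c c'" for c' by (auto simp: near_def abs_minus_commute)
 then show "card {c'. near s r c' c} <= (2 * r + 1)\<^sup>2" using 1[of c] by simp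
qed

lemma norm_coord2: "\<bar>x $ 1 - y $ 1\<bar> <= norm (x - y)" "\<bar>x $ 2 - y $ 2\<bar> <= norm (x - y :: real ^ 2)"
 using component_le_norm_cart[of "x - y"] by auto

lemma gpt_inj: "gpt j u = gpt j v ==> u = v"
 by (auto simp: gpt_def vec2_eq_iff prod_eq_iff)

text \<open>Clamping to \<open>[- p, 0]\<close> keeps the functional bounded. Strictly inside this
  range the level is the field value at a grid vertex of an optimal crossing, near which an arm of
  radius \<open>s / 2\<close> starts at a level above \<open>- p\<close>; hence each cell is
  selected with small probability.\<close>

lemma rounded_crossing_variance:
 fixes p q s \<eta> :: real and j N k m0 r :: nat
 defines "F \<equiv> %z. max (- p) (min 0 (thr (LR 0 s 0 s) (lin (lo N) z \<circ> gr j)))"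
 assumes s: "s >= 4" and j: "j >= 1" and N: "N >= 2" and p: "p > 0" and k: "k > 0" and m0: "m0 > 0" and \<eta>: "0 <= \<eta>" and q0: "0 <= q"
  and ker: "!!u v. u \<in> gidx j ` rect 0 s 0 s ==> v \<in> gidx j ` rect 0 s 0 s ==>
   (\<Sum>n\<in>lo N. basis n (gpt j u) * basis n (gpt j v)) <= exp (- (1 / 2) * (norm (gpt j u - gpt j v))\<^sup>2) + \<eta>"
  and q: "!!c. c \<in> cells s ==> EE (%z. ramp m0 (- p - 1 / real m0) (thr (arm (ctr c) 2 (s / 2)) (lin (lo N) z \<circ> gr j))) < q"
 shows "EE (%z. (F z)\<^sup>2) - (EE F)\<^sup>2
  <= 1 / real k + 3 ^ k * ((exp (- (1 / 2) * (real r)\<^sup>2) + \<eta>) + real ((2 * r + 1)\<^sup>2) * sqrt q)"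
proof -
 let ?R = "rect 0 s 0 s"
 let ?g = "%w. lin (lo N) w \<circ> gr j"
 let ?A = "%c. thr (arm c 2 (s / 2))"
 define G where "G = gidx j ` ?R"
 have G: "finite G" unfolding G_def by (rule finite_grid_index) simp
 define V where "V = Inl ` G \<union> range (Inr :: bool => (int \<times> int) + bool)"
 define b :: "(int \<times> int) + bool => real" where "b v = (case v of Inl _ => 0 | Inr t => if t then 0 else - p)" for v
 define e :: "(int \<times> int) + bool => nat \<times> nat => real" where
  "e v n = (case v of Inl a => basis n (gpt j a) | Inr _ => 0)" for v n
 define \<kappa> :: "(int \<times> int) + bool => (int \<times> int) option" where
  "\<kappa> v = (case v of Inl a => Some (\<lfloor>gpt j a $ 1\<rfloor>, \<lfloor>gpt j a $ 2\<rfloor>) | Inr _ => None)" for v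
 \<comment> \<open>The level is lowered by \<open>1 / m0\<close> so that the ramp of slope
   \<open>m0\<close> has already reached 1 at \<open>- p\<close>.\<close>
 define Q where "Q c z = ramp m0 (- p - 1 / real m0) (?A (ctr (the c)) (?g z))"
  for c :: "(int \<times> int) option" and z
 define val where "val v w = b v + (\<Sum>n\<in>lo N. e v n * w n)" for v w
 have val: "val (Inl a) w = lin (lo N) w (gpt j a)" "val (Inr t) w = (if t then 0 else - p)" for a t w
  by (simp_all add: val_def b_def e_def lin_def mult.commute)
 have J: "finite (lo N)" "lo N ~= {}" using finite_lo N by (auto simp: lo_def intro!: exI[of _ 0])
 have fLR: "fam ?R (LR 0 s 0 s)" using fam_conn LR_ne[of 0 s 0 s] s unfolding LR_def by simp
 have iLR: "incr ?R (thr (LR 0 s 0 s))" using s by (intro incr_LR) auto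
 have iA: "incr {x. mx c x <= s / 2} (?A c)" for c using s by (intro incr_arm) auto
 have bR: "bounded ?R" by simp
 have bgr: "bounded ((g \<circ> gr j) ` K)" if "bounded K" for g :: "real ^ 2 => real" and K
  using finite_gr[OF that] by (rule finite_imp_bounded)
 have gcoord: "0 <= gpt j a $ i \<and> gpt j a $ i <= s" if aG: "a \<in> G" for a i
 proof -
  obtain x where x: "x \<in> ?R" "a = gidx j x" using aG by (auto simp: G_def)
  have le: "0 <= real_of_int \<lfloor>t * real (Suc j)\<rfloor> / real (Suc j) \<and> real_of_int \<lfloor>t * real (Suc j)\<rfloor> / real (Suc j) <= s" if "0 <= t" "t <= s" for t
  proof -
   have "real_of_int \<lfloor>t * real (Suc j)\<rfloor> / real (Suc j) <= t" by (subst pos_divide_le_eq) auto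
   moreover have "0 <= \<lfloor>t * real (Suc j)\<rfloor>" using that by simp
   ultimately show ?thesis using that by auto
  qed
  have "i = 1 \<or> i = 2" using exhaust_2 by blast
  then show ?thesis using x le[of "x $ 1"] le[of "x $ 2"] by (auto simp: gpt_def gidx_def rect_def)
 qed
 have ex: "\<exists>v. v \<in> V \<and> F w = val v w \<and> (\<kappa> v \<in> Some ` cells s \<longrightarrow> 1 <= Q (\<kappa> v) w)" for w
 proof -
  define t where "t = thr (LR 0 s 0 s) (?g w)"
  obtain S x where S: "S \<in> LR 0 s 0 s" "x \<in> S" "(?g w) x = t" "!!y. y \<in> S ==> t <= (?g w) y"
   using thr_attained[OF fLR finite_gr[OF bR], of "lin (lo N) w" j] unfolding t_def by blast
  show ?thesis
  proof (cases "t <= - p \<or> 0 <= t")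
   case True
   then have "F w = val (Inr (0 <= t)) w" using p by (auto simp: F_def t_def[symmetric] val)
   then show ?thesis by (intro exI[of _ "Inr (0 <= t)"]) (auto simp: V_def \<kappa>_def)
  next
   case False
   define a where "a = gidx j x"
   have xR: "x \<in> ?R" using S(1,2) by (auto simp: LR_def conn_def)
   have aG: "a \<in> G" using xR by (simp add: G_def a_def)
   have Fa: "F w = val (Inl a) w" using False S(3) by (simp add: F_def t_def[symmetric] val a_def gr_def)
   define c where "c = ctr (the (\<kappa> (Inl a)))"
   have "mx c (gpt j a) <= 1"
   proof -
    have "\<bar>u - real_of_int \<lfloor>u\<rfloor>\<bar> <= 1" for u :: real using floor_correct[of u] by linarith
    then show ?thesis by (simp add: c_def \<kappa>_def ctr_def mx_def)
   qed
   moreover have "mx (gpt j a) x <= 1"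
   proof -
    have "dist (gpt j a) x <= 2 / real (Suc j)" using grid_dist[of j x] by (simp add: dist_norm a_def)
    also have "\<dots> <= 1" using j by (simp add: field_simps)
    finally show ?thesis using mx_le_norm[of "gpt j a" x] by linarith
   qed
   \<comment> \<open>At most 1 from the corner of the unit cell to the grid vertex and at most 1
     from there to the point that was rounded: this is why the arms start from radius 2.\<close>
   ultimately have cx: "mx c x <= 2" using mx_triangle[of c x "gpt j a"] by linarith
   obtain y1 y2 where y: "y1 \<in> S" "y1 $ 1 = 0" "y2 \<in> S" "y2 $ 1 = s" using S(1) by (auto simp: LR_def conn_def)
   \<comment> \<open>The two ends of the crossing are at horizontal distance \<open>s\<close>, so
     one of them is at least \<open>s / 2\<close> away from the centre.\<close>
   have "s / 2 <= \<bar>y1 $ 1 - c $ 1\<bar> \<or> s / 2 <= \<bar>y2 $ 1 - c $ 1\<bar>" unfolding y by linarith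
   then obtain y where y: "y \<in> S" "s / 2 <= mx c y" using y(1,3) unfolding mx_def by (meson max.coboundedI1)
   have "closed S" "connected S" using S(1) by (auto simp: LR_def conn_def compact_imp_closed)
   then obtain S' where S': "S' \<in> arm c 2 (s / 2)" "S' \<subseteq> S" using arm_sub[OF _ _ S(2) cx y] s by auto
   have fA: "fam {x. mx c x <= s / 2} (arm c 2 (s / 2))" using fam_conn[OF arm_ne[of 2 "s / 2" c, unfolded arm_def]] s by (simp only: arm_def)
   have "t <= ?A c (?g w)" by (rule thr_ge[OF fA bgr[OF bounded_mx(1)] S'(1)]) (use S' S(4) in auto)
   then have "- p <= ?A c (?g w)" using False by linarith
   then have "0 <= real m0 * (?A c (?g w) + p)" by (intro mult_nonneg_nonneg) auto
   moreover have "real m0 * (?A c (?g w) - (- p - 1 / real m0)) = real m0 * (?A c (?g w) + p) + 1"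
    using m0 by (simp add: field_simps)
   ultimately have "1 <= real m0 * (?A c (?g w) - (- p - 1 / real m0))" by linarith
   then have "1 <= Q (\<kappa> (Inl a)) w" by (simp add: Q_def ramp_def c_def)
   then show ?thesis using aG Fa by (intro exI[of _ "Inl a"]) (auto simp: V_def)
  qed
 qed
 then obtain sl where sl: "!!w. sl w \<in> V" "!!w. F w = val (sl w) w" "!!w. \<kappa> (sl w) \<in> Some ` cells s ==> 1 <= Q (\<kappa> (sl w)) w"
  by metis
 have clamp: "\<bar>max (- p) (min 0 t) - max (- p) (min 0 t')\<bar> <= \<bar>t - t'\<bar>" for t t' :: real by linarith
 have cellV: "(\<lfloor>gpt j a $ 1\<rfloor>, \<lfloor>gpt j a $ 2\<rfloor>) \<in> cells s" if "a \<in> G" for a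
  using gcoord[OF that, of 1] gcoord[OF that, of 2] by (auto simp: cells_def floor_mono)
 have mA: "(%z. \<Phi> (?g z)) \<in> borel_measurable (PiM (lo N) (%_. N1))" if "incr K \<Phi>" "bounded K" for K \<Phi>
  using measurable_incr_lin_PiM[OF incr_compose[OF that(1)] bounded_gr[OF that(2)]] .
 show ?thesis
 proof (rule gaussian_selection_variance[where e = e and b = b and J = "lo N" and V = V and \<kappa> = \<kappa> and sl = sl and Q = Q and C = "Some ` cells s"
   and near = "near s r" and B = p])
  show "sl w \<in> V" "F w = b (sl w) + (\<Sum>j\<in>lo N. e (sl w) j * w j)" for w using sl by (auto simp: val_def)
  show "1 <= Q (\<kappa> (sl w)) w" if "\<kappa> (sl w) \<in> Some ` cells s" for w using sl(3)[OF that] .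
  show "\<bar>F w - F w'\<bar> <= d" if d: "!!v. v \<in> V ==> \<bar>b v + (\<Sum>j\<in>lo N. e v j * w j) - (b v + (\<Sum>j\<in>lo N. e v j * w' j))\<bar> <= d" for w w' d
  proof -
   have dv: "\<bar>val v w - val v w'\<bar> <= d" if "v \<in> V" for v using d[OF that] by (simp add: val_def)
   have "\<bar>thr (LR 0 s 0 s) (?g w) - thr (LR 0 s 0 s) (?g w')\<bar> <= d"
   proof (rule incr_abs[OF iLR bgr[OF bR] bgr[OF bR]])
    fix x assume "x \<in> ?R"
    then have "Inl (gidx j x) \<in> V" by (simp add: V_def G_def)
    from dv[OF this] show "\<bar>(?g w) x - (?g w') x\<bar> <= d" by (simp add: val gr_def)
   qed
   then show ?thesis unfolding F_def using clamp by (rule order_trans[rotated])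
  qed
  show "\<bar>F w\<bar> <= p" for w unfolding F_def using p by linarith
  show "F \<in> borel_measurable (PiM (lo N) (%_. N1))" unfolding F_def using mA[OF iLR bR] by measurable
  show "b u ~= b v \<or> (\<exists>n\<in>lo N. e u n ~= e v n)" if uv: "u \<in> V" "v \<in> V" "u ~= v" for u v
  proof -
   have 0: "(0, 0) \<in> lo N" "basis (0, 0) x ~= 0" for x using N by (auto simp: lo_def basis_def)
   have 2: "\<exists>n\<in>lo N. basis n (gpt j a) ~= basis n (gpt j a')" if "a ~= a'" for a a'
    using basis_injective[OF N, of "gpt j a" "gpt j a'"] gpt_inj that by metis
   show ?thesis
   proof (cases u; cases v)
    fix a a' assume "u = Inl a" "v = Inl a'" then show ?thesis using 2[of a a'] uv(3) by (auto simp: e_def)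
   next
    fix a t assume "u = Inl a" "v = Inr t" then show ?thesis using 0 by (auto simp: e_def)
   next
    fix a t assume "u = Inr t" "v = Inl a" then show ?thesis using 0 by (force simp: e_def)
   next
    fix t t' assume "u = Inr t" "v = Inr t'" then show ?thesis using uv(3) p by (cases t; cases t') (auto simp: b_def)
   qed
  qed
  \<comment> \<open>The truncated variance at a point is a partial sum of the kernel on the
    diagonal, where its sum is 1.\<close>
  have sqb: "(\<Sum>n\<in>lo N. (basis n x)\<^sup>2) <= 1" for x
   using has_sum_imp_summable[OF kernel_has_sum[of x x]] infsumI[OF kernel_has_sum[of x x]]
    finite_sum_le_infsum[of "%n. basis n x * basis n x" UNIV "lo N"] J(1) by (simp add: power2_eq_square)
  show "(\<Sum>n\<in>lo N. e u n * e v n) <= 1" for u v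
  proof -
   have sq: "(\<Sum>n\<in>lo N. (e u n)\<^sup>2) <= 1" for u using sqb by (cases u) (auto simp: e_def)
   have "(\<Sum>n\<in>lo N. e u n * e v n) <= (\<Sum>n\<in>lo N. ((e u n)\<^sup>2 + (e v n)\<^sup>2) / 2)"
   proof (rule sum_mono)
    fix n show "e u n * e v n <= ((e u n)\<^sup>2 + (e v n)\<^sup>2) / 2"
     using sum_squares_bound[of "e u n" "e v n"] by (simp add: field_simps)
   qed
   also have "\<dots> = ((\<Sum>n\<in>lo N. (e u n)\<^sup>2) + (\<Sum>n\<in>lo N. (e v n)\<^sup>2)) / 2" by (simp add: sum.distrib sum_divide_distrib[symmetric])
   also have "\<dots> <= 1" using sq[of u] sq[of v] by simp
   finally show ?thesis .
  qed
  show "(\<Sum>n\<in>lo N. e u n * e v n) <= exp (- (1 / 2) * (real r)\<^sup>2) + \<eta>" if uv: "u \<in> V" "v \<in> V" "\<not> near s r (\<kappa> u) (\<kappa> v)" for u v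
  proof (cases "\<exists>a a'. u = Inl a \<and> v = Inl a'")
   case False
   then have "(\<Sum>n\<in>lo N. e u n * e v n) = 0" by (cases u; cases v) (auto simp: e_def)
   then show ?thesis using \<eta> by (simp add: add_nonneg_nonneg)
  next
   case True
   then obtain a a' where a: "u = Inl a" "v = Inl a'" by blast
   then have aG: "a \<in> G" "a' \<in> G" using uv by (auto simp: V_def)
   let ?x = "gpt j a" and ?y = "gpt j a'"
   \<comment> \<open>Integer parts that differ by more than \<open>r\<close> belong to numbers that
     differ by at least \<open>r\<close>.\<close>
   have "\<bar>\<lfloor>?x $ 1\<rfloor> - \<lfloor>?y $ 1\<rfloor>\<bar> > int r \<or> \<bar>\<lfloor>?x $ 2\<rfloor> - \<lfloor>?y $ 2\<rfloor>\<bar> > int r"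
    using uv(3) cellV[OF aG(1)] cellV[OF aG(2)] unfolding near_def a \<kappa>_def by fastforce
   then have "real r <= \<bar>?x $ 1 - ?y $ 1\<bar> \<or> real r <= \<bar>?x $ 2 - ?y $ 2\<bar>" by linarith
   then have "real r <= norm (?x - ?y)" using norm_coord2[of ?x ?y] by linarith
   then have "(real r)\<^sup>2 <= (norm (?x - ?y))\<^sup>2" by (intro power_mono) auto
   then have "exp (- (1 / 2) * (norm (?x - ?y))\<^sup>2) <= exp (- (1 / 2) * (real r)\<^sup>2)" by simp
   then have "(\<Sum>n\<in>lo N. basis n ?x * basis n ?y) <= exp (- (1 / 2) * (real r)\<^sup>2) + \<eta>"
    using ker[of a a'] aG unfolding G_def by (meson add_right_mono order_trans)
   then show ?thesis by (simp add: a e_def)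
  qed
  show "c \<in> Some ` cells s \<and> c' \<in> Some ` cells s" if "near s r c c'" for c c' using that by (auto simp: near_def)
  show "Q c \<in> borel_measurable (PiM (lo N) (%_. N1))" for c
   unfolding Q_def using mA[OF iA bounded_mx(1)] by measurable
  show "0 <= Q c w \<and> Q c w <= 1" for c w by (simp add: Q_def ramp_bounds)
  show "(%m. Q c (w m)) \<longlonglongrightarrow> Q c w'" if w: "!!n. n \<in> lo N ==> (%m. w m n) \<longlonglongrightarrow> w' n" for c w w'
  proof -
   let ?c = "ctr (the c)"
   let ?K = "{x. mx ?c x <= s / 2}"
   define H where "H = gidx j ` ?K"
   have H: "finite H" unfolding H_def by (rule finite_grid_index) (rule bounded_mx(1))
   let ?d = "%m. \<Sum>a\<in>H. \<bar>lin (lo N) (w m) (gpt j a) - lin (lo N) w' (gpt j a)\<bar>"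
   have "?d \<longlonglongrightarrow> (\<Sum>a\<in>H. \<bar>lin (lo N) w' (gpt j a) - lin (lo N) w' (gpt j a)\<bar>)"
    unfolding lin_def using w by (intro tendsto_intros) auto
   then have d0: "?d \<longlonglongrightarrow> 0" by simp
   have dm: "\<bar>?A ?c (?g (w m)) - ?A ?c (?g w')\<bar> <= ?d m" for m
   proof (rule incr_abs[OF iA bgr[OF bounded_mx(1)] bgr[OF bounded_mx(1)]])
    fix x assume "x \<in> ?K"
    then show "\<bar>(?g (w m)) x - (?g w') x\<bar> <= ?d m"
     using member_le_sum[of "gidx j x" H "%a. \<bar>lin (lo N) (w m) (gpt j a) - lin (lo N) w' (gpt j a)\<bar>"] H
     by (auto simp: H_def gr_def)
   qed
   have "(%m. ?A ?c (?g (w m)) - ?A ?c (?g w')) \<longlonglongrightarrow> 0"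
    by (rule Lim_null_comparison[OF always_eventually[OF allI] d0]) (simp only: real_norm_def dm)
   then have "(%m. ?A ?c (?g (w m))) \<longlonglongrightarrow> ?A ?c (?g w')"
    by (simp add: LIM_zero_iff)
   from continuous_on_tendsto_compose[OF continuous_ramp[of UNIV] this] show ?thesis by (simp add: Q_def)
  qed
  show "EE (Q c) < q" if "c \<in> Some ` cells s" for c using q that by (auto simp: Q_def[abs_def])
  show "0 <= exp (- (1 / 2) * (real r)\<^sup>2) + \<eta>" using \<eta> by (simp add: add_nonneg_nonneg)
 qed (use J G k q0 card_near in \<open>auto simp: V_def cells_def\<close>)
qed

lemma pr_arm_center:
 assumes "0 <= m" "0 <= R"
 shows "pr (thr (arm c m R)) l = pr (thr (arm 0 m R)) l"
 unfolding arm_def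
 by (rule pr_conn_shift[where u = "- c $ 1" and v = "- c $ 2", OF arm_ne[OF assms, of 0, unfolded arm_def] bounded_mx(1)])
  (auto simp: mx_def)

text \<open>Limit of the bounds for rounded truncations: the truncation is removed on a fixed grid,
  then the grid is refined. The error \<open>\<eta>\<close> of the truncated kernel contributes
  \<open>3 ^ k * \<eta> = d\<close>, which is arbitrary.\<close>

lemma crossing_variance:
 fixes p q s :: real and k m0 r :: nat
 defines "F \<equiv> %z. max (- p) (min 0 (thr (LR 0 s 0 s) (fld z)))"
 assumes s: "s >= 4" and p: "p > 0" and k: "k > 0" and m0: "m0 > 0"
  and q: "pr (thr (arm 0 2 (s / 2))) (- p - 1 / real m0) < q"
 shows "EE (%z. (F z)\<^sup>2) - (EE F)\<^sup>2
  <= 1 / real k + 3 ^ k * (exp (- (1 / 2) * (real r)\<^sup>2) + real ((2 * r + 1)\<^sup>2) * sqrt q)"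
proof (rule field_le_epsilon)
 fix d :: real assume d: "0 < d"
 define \<eta> where "\<eta> = d / 3 ^ k"
 have \<eta>: "\<eta> > 0" "3 ^ k * \<eta> = d" using d by (auto simp: \<eta>_def)
 have q0: "0 <= q" using q pr_bounds(1) by (meson less_eq_real_def order_le_less_trans)
 define B where "B = 1 / real k + 3 ^ k * ((exp (- (1 / 2) * (real r)\<^sup>2) + \<eta>) + real ((2 * r + 1)\<^sup>2) * sqrt q)"
 let ?R = "rect 0 s 0 s"
 let ?L = "thr (LR 0 s 0 s)"
 let ?A = "%c. thr (arm c 2 (s / 2))"
 have iLR: "incr ?R (?L)" using s by (intro incr_LR) auto
 have iA: "incr {x. mx c x <= s / 2} (?A c)" for c using s by (intro incr_arm) auto
 let ?h = "%t. max (- p) (min 0 t)"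
 have h: "continuous_on UNIV ?h" "\<bar>?h t\<bar> <= p" "continuous_on UNIV (%t. (?h t)\<^sup>2)" "\<bar>(?h t)\<^sup>2\<bar> <= p\<^sup>2" for t
 proof -
  show "continuous_on UNIV ?h" "continuous_on UNIV (%t. (?h t)\<^sup>2)" by (intro continuous_intros)+
  show 1: "\<bar>?h t\<bar> <= p" using p by linarith
  show "\<bar>(?h t)\<^sup>2\<bar> <= p\<^sup>2" using power_mono[OF 1, of 2] by simp
 qed
 let ?\<rho> = "ramp m0 (- p - 1 / real m0)"
 have fc: "finite (cells s)" by (simp add: cells_def)
 have "\<forall>\<^sub>F j in sequentially. \<forall>c\<in>cells s. EE (%z. ?\<rho> (?A (ctr c) (fld z \<circ> gr j))) < q"
 proof (rule eventually_ball_finite[OF fc], rule)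
  fix c assume "c \<in> cells s"
  note [measurable] = measurable_incr_fld[OF iA bounded_mx(1), of "ctr c"]
  have "EE (%z. ?\<rho> (?A (ctr c) (fld z)))
   <= EE (indicator {z. - p - 1 / real m0 < ?A (ctr c) (fld z)})"
   using sets_incr_fld(1)[OF iA bounded_mx(1)]
   by (intro integral_mono PP.integrable_const_bound[where B = 1] integrable_real_indicator)
    (auto simp: ramp_bounds indicator_def less_top[symmetric], auto simp: ramp_def not_less mult_nonneg_nonpos)
  also have "\<dots> = pr (?A (ctr c)) (- p - 1 / real m0)"
   using sets_incr_fld(1)[OF iA bounded_mx(1)] by (simp add: pr_def)
  also have "\<dots> < q" using pr_arm_center[of 2 "s / 2" "ctr c"] q s by simp
  finally show "\<forall>\<^sub>F j in sequentially. EE (%z. ?\<rho> (?A (ctr c) (fld z \<circ> gr j))) < q"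
   by (rule order_tendstoD(2)[OF gr_limits(2)[OF iA bounded_mx(1) continuous_ramp ramp_bounds(3)]])
 qed
 then have jb: "\<forall>\<^sub>F j in sequentially. EE (%z. (?h (?L (fld z \<circ> gr j)))\<^sup>2)
   - (EE (%z. ?h (?L (fld z \<circ> gr j))))\<^sup>2 <= B"
  using eventually_ge_at_top[of 1]
 proof eventually_elim
  case (elim j)
  let ?G = "gidx j ` ?R"
  have G: "finite ?G" by (rule finite_grid_index) simp
  have e1: "\<forall>\<^sub>F N in sequentially. \<forall>c\<in>cells s. EE (%z. ?\<rho> (?A (ctr c) (lin (lo N) z \<circ> gr j))) < q"
   using elim(1) by (intro eventually_ball_finite[OF fc] ballI order_tendstoD(2)[OF gr_limits(1)[OF iA bounded_mx(1) continuous_ramp ramp_bounds(3)]]) auto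
  have e2: "\<forall>\<^sub>F N in sequentially. \<forall>u\<in>?G. \<forall>v\<in>?G. (\<Sum>n\<in>lo N. basis n (gpt j u) * basis n (gpt j v))
    <= exp (- (1 / 2) * (norm (gpt j u - gpt j v))\<^sup>2) + \<eta>"
  proof (intro eventually_ball_finite[OF G] ballI)
   fix u v
   have "(%N. \<Sum>n\<in>lo N. basis n (gpt j u) * basis n (gpt j v)) \<longlonglongrightarrow> exp (- (1 / 2) * (norm (gpt j u - gpt j v))\<^sup>2)"
    using kernel_has_sum[of "gpt j u" "gpt j v"] unfolding has_sum_def by (rule filterlim_compose[OF _ filterlim_lo])
   from order_tendstoD(2)[OF this, of "exp (- (1 / 2) * (norm (gpt j u - gpt j v))\<^sup>2) + \<eta>"] \<eta>(1)
   show "\<forall>\<^sub>F N in sequentially. (\<Sum>n\<in>lo N. basis n (gpt j u) * basis n (gpt j v)) <= exp (- (1 / 2) * (norm (gpt j u - gpt j v))\<^sup>2) + \<eta>"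
    by (auto elim: eventually_mono)
  qed
  have "\<forall>\<^sub>F N in sequentially. EE (%z. (?h (?L (lin (lo N) z \<circ> gr j)))\<^sup>2)
   - (EE (%z. ?h (?L (lin (lo N) z \<circ> gr j))))\<^sup>2 <= B"
   using e1 e2 eventually_ge_at_top[of 2]
  proof eventually_elim
   case (elim N)
   show ?case unfolding B_def by (rule rounded_crossing_variance[where ?m0.0 = m0 and q = q and \<eta> = \<eta>]) (use s p k m0 \<eta>(1) q0 elim \<open>1 <= j\<close> in auto)
  qed
  then show ?case
   by (intro tendsto_upperbound[OF tendsto_diff[OF gr_limits(1)[OF iLR bounded_rect h(3,4)] tendsto_power[OF gr_limits(1)[OF iLR bounded_rect h(1,2)]]]]) auto
 qed
 have "EE (%z. (F z)\<^sup>2) - (EE F)\<^sup>2 <= B" unfolding F_def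
  by (rule tendsto_upperbound[OF tendsto_diff[OF gr_limits(2)[OF iLR bounded_rect h(3,4)] tendsto_power[OF gr_limits(2)[OF iLR bounded_rect h(1,2)]]] jb]) simp
 also have "B = 1 / real k + 3 ^ k * (exp (- (1 / 2) * (real r)\<^sup>2) + real ((2 * r + 1)\<^sup>2) * sqrt q) + d"
  unfolding B_def \<eta>(2)[symmetric] by (simp only: distrib_left add_ac)
 finally show "EE (%z. (F z)\<^sup>2) - (EE F)\<^sup>2
  <= 1 / real k + 3 ^ k * (exp (- (1 / 2) * (real r)\<^sup>2) + real ((2 * r + 1)\<^sup>2) * sqrt q) + d" .
qed

text \<open>If the square were crossed at level \<open>- p\<close> with probability below
  \<open>1 - \<epsilon>\<close>, the clamped level would equal \<open>- p\<close> with probability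
  at least \<open>\<epsilon>'\<close>, and 0 with probability at least \<open>1/2\<close> by
  self-duality. Its variance would then be at least \<open>\<epsilon>' * p\<^sup>2 / 4\<close>,
  against the variance bound at large scales.\<close>

lemma sharp_crossing:
 assumes p0: "PP.prob {z. perc p0 (fld z)} = 0" and p: "0 < p" "p < p0" and \<epsilon>: "\<epsilon> > 0"
 obtains s0 where "s0 > 0" "!!s. s >= s0 ==> 1 - \<epsilon> <= pr (thr (LR 0 s 0 s)) (- p)"
proof -
 define \<epsilon>' where "\<epsilon>' = min \<epsilon> (1 / 2)"
 have \<epsilon>': "0 < \<epsilon>'" "\<epsilon>' <= 1 / 2" "\<epsilon>' <= \<epsilon>" using \<epsilon> by (auto simp: \<epsilon>'_def)
 define D where "D = \<epsilon>' * p\<^sup>2 / 4"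
 have D: "D > 0" using \<epsilon>' p by (simp add: D_def)
 \<comment> \<open>The order of choice matters: \<open>k\<close>, then \<open>r\<close> for this
   \<open>k\<close>, then \<open>q\<close> for both, and finally the scale at which arms at level
   \<open>- p0\<close> have probability below \<open>q\<close>. The gap \<open>p0 - p\<close> pays
   for \<open>1 / m0\<close>.\<close>
 obtain k :: nat where k: "k > 0" "1 / real k < D / 3"
  using reals_Archimedean[of "D / 3"] D by (auto simp: inverse_eq_divide intro: that[of "Suc _"])
 have "(%r::nat. 3 ^ k * exp (- (1 / 2) * (real r)\<^sup>2)) \<longlonglongrightarrow> 0" by real_asymp
 from order_tendstoD(2)[OF this, of "D / 3"] D obtain r :: nat where r: "3 ^ k * exp (- (1 / 2) * (real r)\<^sup>2) < D / 3"
  by (auto simp: eventually_sequentially)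
 define A where "A = 3 ^ k * real ((2 * r + 1)\<^sup>2)"
 have A: "A > 0" by (simp add: A_def)
 define q where "q = (D / (6 * A))\<^sup>2"
 have "sqrt q = D / (6 * A)" using A D by (simp add: q_def)
 then have q: "q > 0" "A * sqrt q < D / 3" using A D by (auto simp: q_def field_simps)
 obtain m0 :: nat where m0: "m0 > 0" "1 / real m0 < p0 - p"
  using reals_Archimedean[of "p0 - p"] p by (auto simp: inverse_eq_divide intro: that[of "Suc _"])
 have "PP.prob {z. perc_from (real 2) p0 (fld z)} <= PP.prob {z. perc p0 (fld z)}"
  using sets_perc by (intro PP.finite_measure_mono) (auto simp: perc_from_def perc_def)
 then have z: "PP.prob {z. perc_from (real 2) p0 (fld z)} = 0" using p0 by (simp add: measure_le_0_iff)
 from order_tendstoD(2)[OF perc_from_tendsto[of 2 p0, unfolded z] q(1)]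
 obtain K where K: "pr (thr (arm 0 2 (2 + real K))) (- p0) < q" by (auto simp: eventually_sequentially)
 define s0 where "s0 = 4 + 2 * real K"
 have "1 - \<epsilon> <= pr (thr (LR 0 s 0 s)) (- p)" if s: "s >= s0" for s
 proof (rule ccontr)
  assume neg: "\<not> ?thesis"
  let ?L = "thr (LR 0 s 0 s)"
  have s4: "s >= 4" "s > 0" "2 + real K <= s / 2" using s by (auto simp: s0_def)
  have iLR: "incr (rect 0 s 0 s) ?L" using s4 by (intro incr_LR) auto
  note [measurable] = measurable_incr_fld[OF iLR bounded_rect]
  define F where "F z = max (- p) (min 0 (?L (fld z)))" for z
  have [measurable]: "F \<in> borel_measurable PP" unfolding F_def[abs_def] by measurable
  have FB: "- p <= F z \<and> F z <= 0" for z using p by (auto simp: F_def)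
  define \<mu> where "\<mu> = EE F"
  have iF [simp]: "integrable PP F"
  proof (rule PP.integrable_const_bound[where B = p])
   show "AE z in PP. norm (F z) <= p" using FB p by (intro AE_I2) (auto simp: abs_le_iff minus_le_iff intro: order_trans[of _ 0])
  qed simp
  have iF2 [simp]: "integrable PP (%z. (F z)\<^sup>2)"
  proof (rule PP.integrable_const_bound[where B = "p\<^sup>2"])
   have "\<bar>F z\<bar> <= p" for z using FB[of z] p by linarith
   then have "\<bar>F z\<bar>\<^sup>2 <= p\<^sup>2" for z by (intro power_mono) auto
   then show "AE z in PP. norm ((F z)\<^sup>2) <= p\<^sup>2" by simp
  qed simp
  have var: "EE (%z. (F z - \<mu>)\<^sup>2) = EE (%z. (F z)\<^sup>2) - \<mu>\<^sup>2"
  proof -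
   have U: "PP.prob UNIV = 1" using PP.prob_space by simp
   have "EE (%z. (F z - \<mu>)\<^sup>2) = EE (%z. (F z)\<^sup>2 - (2 * \<mu>) * F z + \<mu>\<^sup>2)"
    by (simp add: power2_diff algebra_simps)
   also have "\<dots> = EE (%z. (F z)\<^sup>2) - (2 * \<mu>) * \<mu> + \<mu>\<^sup>2" by (simp add: U \<mu>_def)
   finally show ?thesis by (simp add: power2_eq_square)
  qed
  have iv: "integrable PP (%z. (F z - \<mu>)\<^sup>2)" by (simp add: power2_diff)
  have low: "p\<^sup>2 / 4 * PP.prob E <= EE (%z. (F z - \<mu>)\<^sup>2)"
   if E: "E \<in> sets PP" "!!z. z \<in> E ==> p / 2 <= \<bar>F z - \<mu>\<bar>" for E
  proof -
   have "p\<^sup>2 / 4 * PP.prob E = EE (%z. p\<^sup>2 / 4 * indicator E z)" using E(1) by simp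
   also have "\<dots> <= EE (%z. (F z - \<mu>)\<^sup>2)"
   proof (intro integral_mono iv integrable_mult_right integrable_real_indicator E(1))
    fix z
    show "p\<^sup>2 / 4 * indicator E z <= (F z - \<mu>)\<^sup>2"
    proof (cases "z \<in> E")
     case True
     then show ?thesis using power_mono[OF E(2)[OF True], of 2] p by (simp add: power_divide)
    qed simp
   qed (simp add: less_top[symmetric])
   finally show ?thesis .
  qed
  \<comment> \<open>The mean is at distance at least \<open>p / 2\<close> from one of the extreme
    values 0 and \<open>- p\<close>, each of which is taken with probability at least
    \<open>\<epsilon>'\<close>.\<close>
  have "D <= EE (%z. (F z - \<mu>)\<^sup>2)"
  proof (cases "\<mu> <= - p / 2")
   case True
   let ?E = "{z. 0 < ?L (fld z)}"
   have "p\<^sup>2 / 4 * PP.prob ?E <= EE (%z. (F z - \<mu>)\<^sup>2)"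
    by (rule low) (use sets_incr_fld(1)[OF iLR bounded_rect] True p in \<open>auto simp: F_def\<close>)
   moreover have "\<epsilon>' <= PP.prob ?E" using square_self_dual[OF s4(2)] \<epsilon>' by (simp add: pr_def)
   then have "p\<^sup>2 / 4 * \<epsilon>' <= p\<^sup>2 / 4 * PP.prob ?E" by (intro mult_left_mono) auto
   ultimately show ?thesis by (simp add: D_def mult.commute)
  next
   case False
   let ?E = "{z. ?L (fld z) <= - p}"
   have "{z \<in> space PP. ?L (fld z) <= - p} \<in> sets PP" by measurable
   then have "p\<^sup>2 / 4 * PP.prob ?E <= EE (%z. (F z - \<mu>)\<^sup>2)"
    by (intro low) (use False p in \<open>auto simp: F_def\<close>)
   moreover have "\<epsilon>' <= PP.prob ?E" using pr_not_gt[OF iLR bounded_rect] neg \<epsilon>' by simp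
   then have "p\<^sup>2 / 4 * \<epsilon>' <= p\<^sup>2 / 4 * PP.prob ?E" by (intro mult_left_mono) auto
   ultimately show ?thesis by (simp add: D_def mult.commute)
  qed
  also note var
  also have "EE (%z. (F z)\<^sup>2) - \<mu>\<^sup>2 <= 1 / real k + 3 ^ k * (exp (- (1 / 2) * (real r)\<^sup>2) + real ((2 * r + 1)\<^sup>2) * sqrt q)"
   unfolding \<mu>_def F_def[abs_def]
  proof (rule crossing_variance[OF s4(1) p(1) k(1) m0(1)])
   have iA: "incr {x. mx 0 x <= R} (thr (arm 0 2 R))" if "R >= 0" for R using that by (intro incr_arm) auto
   have "pr (thr (arm 0 2 (s / 2))) (- p - 1 / real m0) <= pr (thr (arm 0 2 (2 + real K))) (- p0)"
   proof (rule pr_mono[OF iA bounded_mx(1)])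
    fix z assume "- p - 1 / real m0 < thr (arm 0 2 (s / 2)) (fld z)"
    also have "\<dots> <= thr (arm 0 2 (2 + real K)) (fld z)" using s4 by (intro arm_thr_mono continuous_fld) auto
    finally show "- p0 < thr (arm 0 2 (2 + real K)) (fld z)" using m0 by linarith
   qed simp
   then show "pr (thr (arm 0 2 (s / 2))) (- p - 1 / real m0) < q" using K by simp
  qed
  also have "\<dots> = 1 / real k + 3 ^ k * exp (- (1 / 2) * (real r)\<^sup>2) + A * sqrt q" by (simp add: A_def distrib_left mult.assoc)
  also have "\<dots> < D" using k r q by linarith
  finally show False by simp
 qed
 then show ?thesis using that[of s0] by (simp add: s0_def)
qed

section \<open>Renormalization\<close>

text \<open>Centres of the squares of radius \<open>m\<close> that tile the plane.\<close>

definition lat :: "real => int \<times> int => real ^ 2" where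
 "lat m a = pt (2 * m * real_of_int (fst a)) (2 * m * real_of_int (snd a))"

lemma lattice_round:
 fixes t m L :: real
 assumes m: "m > 0" and t: "\<bar>t\<bar> <= (2 * real n - 1) * m"
 obtains i where "\<bar>t - 2 * m * real_of_int i\<bar> <= m" "\<bar>i\<bar> <= int n"
proof -
 define i where "i = round (t / (2 * m))"
 have 1: "\<bar>t / (2 * m) - real_of_int i\<bar> <= 1 / 2"
  using of_int_round_abs_le[of "t / (2 * m)"] by (simp add: i_def abs_minus_commute)
 have "\<bar>t - 2 * m * real_of_int i\<bar> = 2 * m * \<bar>t / (2 * m) - real_of_int i\<bar>"
  using m by (simp add: abs_mult[symmetric] field_simps flip: abs_of_pos[of "2 * m"])
 then have d: "\<bar>t - 2 * m * real_of_int i\<bar> <= m" using mult_left_mono[OF 1, of "2 * m"] m by simp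
 have "2 * m * real_of_int \<bar>i\<bar> = \<bar>2 * m * real_of_int i\<bar>" using m by (simp add: abs_mult)
 also have "\<dots> <= (2 * m) * real n" using d t by (simp add: algebra_simps)
 finally have "\<bar>i\<bar> <= int n" using m by (simp add: mult_le_cancel_left)
 with d show ?thesis by (rule that)
qed

text \<open>As \<open>147 = 7 * 21 = 2 * 74 - 1\<close>, these squares of radius \<open>m\<close>
  cover the square of radius \<open>147 * m\<close>; there are \<open>149 ^ 4\<close> pairs of
  them.\<close>

definition win :: "(int \<times> int) set" where
 "win = {-74..74} \<times> {-74..74}"

lemma finite_win: "finite win" "card (win \<times> win) = 149 ^ 4"
 by (simp_all add: win_def card_cartesian_product)

lemma lattice_cover:
 assumes m: "m > 0" and x: "mx 0 x <= 147 * m"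
 obtains a where "a \<in> win" "mx (lat m a) x <= m"
proof -
 have "\<bar>x $ 1\<bar> <= (2 * real 74 - 1) * m" "\<bar>x $ 2\<bar> <= (2 * real 74 - 1) * m" using x by (auto simp: mx_def)
 then obtain i j where "\<bar>x $ 1 - 2 * m * real_of_int i\<bar> <= m" "\<bar>i\<bar> <= int 74" "\<bar>x $ 2 - 2 * m * real_of_int j\<bar> <= m" "\<bar>j\<bar> <= int 74"
  using lattice_round[OF m] by metis
 then show ?thesis by (intro that[of "(i, j)"]) (auto simp: win_def lat_def mx_def)
qed

text \<open>An arm from radius \<open>21 * m\<close> to \<open>147 * m\<close> contains two arms of
  scale \<open>m\<close>, one around each end. The ends are \<open>126 * m\<close> apart, so the
  lattice centres are at least \<open>124 * m\<close> apart and the second arm is at least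
  \<open>117 * m\<close> from the first centre; quasi-independence with radius \<open>14 * m\<close>
  asks for \<open>112 * m\<close>. The factor 21 provides this margin.\<close>

lemma arm_renormalization:
 assumes m: "m > 0" and \<eta>: "\<eta> > 0"
 defines "e \<equiv> err (14 * m) / \<eta>"
 shows "pr (thr (arm 0 (21 * m) (7 * (21 * m)))) (l + 2 * \<eta>) <= 149 ^ 4 * ((pr (thr (arm 0 m (7 * m))) l + e)\<^sup>2 + 2 * e)"
proof -
 let ?l = "l + 2 * \<eta>" and ?\<delta> = "pr (thr (arm 0 m (7 * m))) l"
 let ?A = "%c. thr (arm c m (7 * m))"
 have iA: "incr {x. mx c x <= 7 * m} (?A c)" for c using m by (intro incr_arm) auto
 define W where "W = {ab \<in> win \<times> win. 117 * m <= mx (lat m (fst ab)) (lat m (snd ab)) - 7 * m}"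
 have W: "finite W" "card W <= 149 ^ 4"
  using finite_win finite_subset[of W "win \<times> win"] card_mono[of "win \<times> win" W] by (auto simp: W_def)
 have i2: "incr ({x. mx c x <= 7 * m} \<union> {x. mx c' x <= 7 * m}) (%g. min (?A c g) (?A c' g))" for c c'
  using incr_min[OF incr_subset[OF iA] incr_subset[OF iA]] by blast
 have b2: "bounded ({x. mx c x <= 7 * m} \<union> {x. mx c' x <= 7 * m})" for c c'
  unfolding bounded_Un using bounded_mx(1) by blast
 have s2: "{z. ?l < min (?A c (fld z)) (?A c' (fld z))} \<in> sets PP" for c c' by (rule sets_incr_fld(1)[OF i2 b2])
 have "pr (thr (arm 0 (21 * m) (7 * (21 * m)))) ?l
   <= PP.prob (\<Union>ab\<in>W. {z. ?l < min (?A (lat m (fst ab)) (fld z)) (?A (lat m (snd ab)) (fld z))})"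
  unfolding pr_def
 proof (intro PP.finite_measure_mono sets.finite_UN W(1) s2 subsetI)
  fix z assume "z \<in> {z. ?l < thr (arm 0 (21 * m) (7 * (21 * m))) (fld z)}"
  then obtain S where S: "S \<in> arm 0 (21 * m) (7 * (21 * m))" "\<forall>x\<in>S. ?l < fld z x"
   using arm_thr_gt[OF _ _ continuous_fld] m by auto
  then have Sc: "compact S" "connected S" "S \<subseteq> {x. mx 0 x <= 147 * m}" "S \<inter> {x. mx 0 x <= 21 * m} ~= {}" "S \<inter> {x. 147 * m <= mx 0 x} ~= {}"
   unfolding arm_def conn_def by simp_all
  then obtain x y where "x \<in> S" "mx 0 x <= 21 * m" "y \<in> S" "147 * m <= mx 0 y" by blast
  moreover have "mx 0 y <= 147 * m" using Sc(3) \<open>y \<in> S\<close> by blast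
  ultimately have xy: "compact S" "connected S" "x \<in> S" "mx 0 x <= 21 * m" "y \<in> S" "147 * m <= mx 0 y" "mx 0 y <= 147 * m"
   using Sc by simp_all
  obtain a where a: "a \<in> win" "mx (lat m a) x <= m" using lattice_cover[OF m, of x] xy(4) m by auto
  obtain b where b: "b \<in> win" "mx (lat m b) y <= m" using lattice_cover[OF m, of y] xy(7) by auto
  have d1: "126 * m <= mx x y" using mx_triangle[of 0 y x] xy(4,6) by linarith
  have d2: "mx x y <= mx (lat m a) x + mx (lat m a) y" using mx_triangle[of x y "lat m a"] by (simp add: mx_commute)
  have d3: "mx (lat m a) y <= mx (lat m a) (lat m b) + mx (lat m b) y" by (rule mx_triangle)
  have d4: "mx x y <= mx (lat m b) x + mx (lat m b) y" using mx_triangle[of x y "lat m b"] by (simp add: mx_commute)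
  have ab: "(a, b) \<in> W" using a b d1 d2 d3 m by (auto simp: W_def)
  have far: "7 * m <= mx (lat m a) y" "7 * m <= mx (lat m b) x" using a b d1 d2 d4 m by linarith+
  have gt: "?l < ?A c (fld z)" if uv: "u \<in> S" "mx c u <= m" "v \<in> S" "7 * m <= mx c v" for c u v
  proof -
   obtain S' where "S' \<in> arm c m (7 * m)" "S' \<subseteq> S" using arm_sub[OF compact_imp_closed[OF xy(1)] xy(2) uv] m by auto
   then show ?thesis using arm_thr_gt[OF _ _ continuous_fld] S(2) m by (meson less_eq_real_def mult_nonneg_nonneg subsetD zero_le_numeral)
  qed
  show "z \<in> (\<Union>ab\<in>W. {z. ?l < min (?A (lat m (fst ab)) (fld z)) (?A (lat m (snd ab)) (fld z))})"
   using gt[OF xy(3) a(2) xy(5) far(1)] gt[OF xy(5) b(2) xy(3) far(2)] ab by force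
 qed
 also have "\<dots> <= (\<Sum>ab\<in>W. PP.prob {z. ?l < min (?A (lat m (fst ab)) (fld z)) (?A (lat m (snd ab)) (fld z))})"
  using s2 by (intro PP.finite_measure_subadditive_finite W(1)) blast
 also have "\<dots> <= (\<Sum>ab\<in>W. (?\<delta> + e)\<^sup>2 + 2 * e)"
 proof (rule sum_mono)
  fix ab assume ab: "ab \<in> W"
  let ?c = "lat m (fst ab)" and ?c' = "lat m (snd ab)"
  have "pr (%g. min (?A ?c g) (?A ?c' g)) ?l <= (pr (?A ?c) (?l - 2 * \<eta>) + err (14 * m) / \<eta>) * (pr (?A ?c') (?l - 2 * \<eta>) + err (14 * m) / \<eta>) + 2 * (err (14 * m) / \<eta>)"
  proof (rule quasi_independence[OF iA bounded_mx(1) iA bounded_mx(1) _ _ _ \<eta>])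
   show "dist ?c x <= 14 * m" if "x \<in> {x. mx ?c x <= 7 * m}" for x using that norm_le_mx[of ?c x] by simp
   show "8 * (14 * m) <= dist ?c x" if "x \<in> {x. mx ?c' x <= 7 * m}" for x
   proof -
    have "mx ?c ?c' <= mx ?c x + mx x ?c'" by (rule mx_triangle)
    moreover have "117 * m <= mx ?c ?c' - 7 * m" "mx ?c' x <= 7 * m" using that ab by (auto simp: W_def)
    ultimately show ?thesis using mx_le_norm[of ?c x] mx_commute[of x ?c'] m by linarith
   qed
  qed (use m in auto)
  moreover have "pr (?A ?c) l = ?\<delta>" "pr (?A ?c') l = ?\<delta>" using m by (intro pr_arm_center; simp)+
  ultimately have "pr (%g. min (?A ?c g) (?A ?c' g)) ?l <= (?\<delta> + e)\<^sup>2 + 2 * e"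
   by (simp add: e_def power2_eq_square)
  then show "PP.prob {z. ?l < min (?A ?c (fld z)) (?A ?c' (fld z))} <= (?\<delta> + e)\<^sup>2 + 2 * e"
   by (simp only: pr_def)
 qed
 also have "\<dots> = real (card W) * ((?\<delta> + e)\<^sup>2 + 2 * e)" by simp
 also have "\<dots> <= 149 ^ 4 * ((?\<delta> + e)\<^sup>2 + 2 * e)"
 proof (rule mult_right_mono)
  show "real (card W) <= 149 ^ 4" using W(2) by (simp flip: of_nat_power_eq_of_nat_cancel_iff)
  show "0 <= (?\<delta> + e)\<^sup>2 + 2 * e" using err_nonneg[of "14 * m"] \<eta> by (simp add: e_def add_nonneg_nonneg)
 qed
 finally show ?thesis .
qed

text \<open>With \<open>t\<close> the bound at step \<open>j\<close>, the renormalization inequality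
  gives at most \<open>149 ^ 4 * 6 * t\<^sup>2\<close>, which is at most \<open>t / 2\<close> since
  \<open>12 * 149 ^ 4 * t \<le> 1\<close>. Meanwhile the levels rise from \<open>p / 2\<close> and
  stay below \<open>p\<close>.\<close>

lemma arm_bootstrap:
 assumes p: "p > 0" and \<tau>: "0 < \<tau>" "12 * 149 ^ 4 * \<tau> <= 1" and m: "1 <= m" "1 / (p * \<tau>\<^sup>2) <= m"
  and start: "pr (thr (arm 0 m (7 * m))) (p / 2) <= \<tau>"
 shows "pr (thr (arm 0 (21 ^ j * m) (7 * (21 ^ j * m)))) (p - p / 2 / 2 ^ j) <= \<tau> / 2 ^ j"
proof (induction j)
 case 0
 then show ?case using start by simp
next
 case (Suc j)
 define M where "M = 21 ^ j * m"
 \<comment> \<open>Twice this shift is the rise of the level from step \<open>j\<close> to step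
   \<open>j + 1\<close>.\<close>
 define \<eta> where "\<eta> = p / 8 / 2 ^ j"
 define e where "e = err (14 * M) / \<eta>"
 define t where "t = \<tau> / 2 ^ j"
 define \<delta> where "\<delta> = pr (thr (arm 0 M (7 * M))) (p - p / 2 / 2 ^ j)"
 have M: "M > 0" using m by (simp add: M_def)
 have \<eta>: "\<eta> > 0" using p by (simp add: \<eta>_def)
 have t: "0 < t" "12 * 149 ^ 4 * t <= 1" "t <= 1"
 proof -
  show t0: "0 < t" using \<tau> by (simp add: t_def)
  have "t <= \<tau>" using \<tau> by (simp add: t_def divide_le_eq mult_le_cancel_left1)
  then show "12 * 149 ^ 4 * t <= 1" using \<tau> mult_left_mono[of t \<tau> "12 * 149 ^ 4"] by simp
  then show "t <= 1" using t0 by simp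
 qed
 have \<delta>: "0 <= \<delta>" "\<delta> <= t" using Suc.IH pr_bounds(1) by (auto simp: \<delta>_def M_def t_def)
 have e: "0 <= e" "e <= t\<^sup>2"
 proof -
  show "0 <= e" using err_nonneg \<eta> by (simp add: e_def)
  \<comment> \<open>The bound \<open>x \<le> exp x\<close> is enough here: the square of the scale
    gains a factor \<open>21\<^sup>2\<close> per step, while \<open>t\<^sup>2\<close> and
    \<open>\<eta>\<close> together lose only 8.\<close>
  have "(14 * M)\<^sup>2 <= exp ((14 * M)\<^sup>2)" using exp_ge_add_one_self[of "(14 * M)\<^sup>2"] by linarith
  then have "inverse (exp ((14 * M)\<^sup>2)) <= inverse ((14 * M)\<^sup>2)" by (rule le_imp_inverse_le) (use M in simp)
  then have "exp (- (14 * M)\<^sup>2) <= 1 / (14 * M)\<^sup>2" by (simp only: exp_minus inverse_eq_divide)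
  then have "err (14 * M) <= 16 / (14 * M)\<^sup>2" by (simp add: err_def)
  also have "\<dots> = 16 / 196 / ((21 ^ j)\<^sup>2 * m\<^sup>2)" by (simp add: M_def power_mult_distrib)
  also have "\<dots> <= 1 / 8 / (8 ^ j * m\<^sup>2)"
  proof -
   have "(8::real) ^ j <= (21\<^sup>2) ^ j" by (intro power_mono) auto
   also have "\<dots> = ((21::real) ^ j)\<^sup>2" by (simp only: power_mult[symmetric] mult.commute)
   finally have "(8::real) ^ j * m\<^sup>2 <= (21 ^ j)\<^sup>2 * m\<^sup>2" by (intro mult_right_mono) auto
   moreover have "0 < (8::real) ^ j * m\<^sup>2" using m by simp
   ultimately show ?thesis by - (rule frac_le; simp)
  qed
  finally have "e <= 1 / 8 / (8 ^ j * m\<^sup>2) / \<eta>" unfolding e_def by (rule divide_right_mono) (use \<eta> in simp)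
  also have "\<dots> = 1 / (p * m\<^sup>2) / (4 ^ j)"
  proof -
   have "(8::real) ^ j = 4 ^ j * 2 ^ j" by (simp flip: power_mult_distrib)
   then show ?thesis using p m by (simp add: \<eta>_def field_simps)
  qed
  also have "\<dots> <= \<tau>\<^sup>2 / 4 ^ j"
  proof (rule divide_right_mono)
   have "1 <= (p * \<tau>\<^sup>2) * m" using m(2) p \<tau> by (simp add: field_simps)
   also have "\<dots> <= (p * \<tau>\<^sup>2) * m\<^sup>2" using m(1) p \<tau> by (intro mult_left_mono) (auto simp: power2_eq_square)
   finally show "1 / (p * m\<^sup>2) <= \<tau>\<^sup>2" using p m by (simp add: field_simps)
  qed simp
  also have "\<dots> = t\<^sup>2"
  proof -
   have "(4::real) ^ j = (2 ^ j)\<^sup>2" by (simp add: power2_eq_square flip: power_mult_distrib)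
   then show ?thesis by (simp add: t_def power_divide)
  qed
  finally show "e <= t\<^sup>2" .
 qed
 have "p - p / 2 / 2 ^ Suc j = (p - p / 2 / 2 ^ j) + 2 * \<eta>" by (simp add: \<eta>_def field_simps)
 then have "pr (thr (arm 0 (21 ^ Suc j * m) (7 * (21 ^ Suc j * m)))) (p - p / 2 / 2 ^ Suc j)
  = pr (thr (arm 0 (21 * M) (7 * (21 * M)))) ((p - p / 2 / 2 ^ j) + 2 * \<eta>)" by (simp only: M_def power_Suc mult.assoc)
 also have "\<dots> <= 149 ^ 4 * ((\<delta> + e)\<^sup>2 + 2 * e)"
  unfolding \<delta>_def e_def by (rule arm_renormalization[OF M \<eta>])
 also have "\<dots> <= 149 ^ 4 * ((2 * t)\<^sup>2 + 2 * t\<^sup>2)"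
 proof (intro mult_left_mono add_mono power_mono)
  have "t\<^sup>2 <= t" using t by (simp add: power2_eq_square mult_left_le)
  then show "\<delta> + e <= 2 * t" using \<delta> e by linarith
 qed (use \<delta> e in auto)
 also have "\<dots> = (12 * 149 ^ 4 * t) * (t / 2)" by (simp add: power2_eq_square)
 also have "\<dots> <= 1 * (t / 2)" using t by (intro mult_right_mono) auto
 finally show ?case by (simp add: t_def)
qed

section \<open>Percolation at positive levels\<close>

text \<open>The half axis is an unbounded connected set that starts in the ball.\<close>

lemma axis_hit:
 assumes T: "compact T" "T \<inter> cball 0 N = {}" and N: "N > 0"
  and meet: "!!S. connected S ==> S \<inter> cball 0 N ~= {} ==> \<not> bounded S ==> S \<inter> T ~= {}" and \<sigma>: "\<bar>\<sigma>\<bar> = 1"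
 obtains t where "t > N" "pt (\<sigma> * t) 0 \<in> T"
proof -
 let ?f = "%t. pt (\<sigma> * t) 0"
 let ?S = "?f ` {0..}"
 have "connected ?S" by (intro connected_continuous_image continuous_intros continuous_on_pt) auto
 moreover have "?f 0 \<in> ?S \<inter> cball 0 N"
 proof -
  have "?f 0 = 0" by (simp add: vec2_eq_iff)
  moreover have "?f 0 \<in> ?S" by (rule imageI) simp
  ultimately show ?thesis using N by simp
 qed
 moreover have nf: "norm (?f t) = \<bar>t\<bar>" for t
 proof -
  have "norm (?f t) = sqrt ((\<sigma> * t)\<^sup>2)" using dist_vec2[of "?f t" 0] by simp
  then show ?thesis using \<sigma> by (simp add: abs_mult)
 qed
 have "\<not> bounded ?S"
 proof
  assume "bounded ?S"
  then obtain B where "\<forall>x\<in>?S. norm x <= B" by (auto simp: bounded_iff)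
  moreover have "?f (\<bar>B\<bar> + 1) \<in> ?S" by (rule imageI) simp
  ultimately have "norm (?f (\<bar>B\<bar> + 1)) <= B" by blast
  then show False unfolding nf by linarith
 qed
 ultimately have "?S \<inter> T ~= {}" using meet by blast
 then obtain t where t: "t >= 0" "?f t \<in> T" by auto
 then have "\<not> norm (?f t) <= N" using T(2) by auto
 then show ?thesis using that[of t] t nf by auto
qed

text \<open>A dual circuit around the ball meets the positive and the negative half axis. Seen from
  a lattice point near the hit on the positive half axis, it contains an arm of the scale of that
  hit. The union of these arm events over all scales and lattice points has probability below 1,
  while the absence of percolation has probability 1 by assumption.\<close>

theorem percolation_positive_level:
 assumes p: "p > 0"
 shows "PP.prob {z. perc p (fld z)} = 1"
proof (rule ccontr)
 assume "PP.prob {z. perc p (fld z)} ~= 1"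
 then have null: "PP.prob {z. perc p (fld z)} = 0" using perc_zero_one by blast
 define \<tau> :: real where "\<tau> = 1 / (12 * 149 ^ 4)"
 have \<tau>: "0 < \<tau>" "12 * 149 ^ 4 * \<tau> <= 1" by (auto simp: \<tau>_def)
 \<comment> \<open>Chosen so that \<open>(1 - sqrt (sqrt \<epsilon>)) ^ 1020\<close> is at least
   \<open>1 - \<tau>\<close> by Bernoulli's inequality.\<close>
 define \<epsilon> where "\<epsilon> = (\<tau> / 1020) ^ 4"
 have ss: "sqrt (sqrt \<epsilon>) = \<tau> / 1020"
 proof -
  have e4: "\<epsilon> = ((\<tau> / 1020)\<^sup>2)\<^sup>2" unfolding \<epsilon>_def power_mult[symmetric] by simp
  have "sqrt \<epsilon> = \<bar>(\<tau> / 1020)\<^sup>2\<bar>" unfolding e4 by (rule real_sqrt_abs)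
  then have "sqrt (sqrt \<epsilon>) = sqrt ((\<tau> / 1020)\<^sup>2)" by simp
  also have "\<dots> = \<bar>\<tau> / 1020\<bar>" by (rule real_sqrt_abs)
  finally show ?thesis using \<tau> by simp
 qed
 have \<epsilon>: "0 < \<epsilon>" "\<epsilon> < 1"
 proof -
  show "0 < \<epsilon>" by (simp add: \<epsilon>_def \<tau>_def)
  have "\<epsilon> <= (\<tau> / 1020) ^ 1" unfolding \<epsilon>_def by (rule power_decreasing) (auto simp: \<tau>_def)
  then show "\<epsilon> < 1" by (simp add: \<tau>_def)
 qed
 obtain s0 where s0: "s0 > 0" "!!s. s >= s0 ==> 1 - \<epsilon> <= pr (thr (LR 0 s 0 s)) (- (p / 2))"
  using sharp_crossing[OF null _ _ \<epsilon>(1), of "p / 2"] p by auto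
 obtain m where m: "m >= max 1 (1 / (p * \<tau>\<^sup>2))" "m > 0" "pr (thr (arm 0 m (7 * m))) (- (- (p / 2))) <= 1 - (1 - sqrt (sqrt \<epsilon>)) ^ 1020"
  using rsw[OF _ \<epsilon>(2) s0] \<epsilon>(1) by (metis less_eq_real_def)
 have "1 - \<tau> <= (1 - \<tau> / 1020) ^ 1020"
  using Bernoulli_inequality[of "- \<tau> / 1020" 1020] \<tau> by simp
 then have start: "pr (thr (arm 0 m (7 * m))) (p / 2) <= \<tau>" using m(3) unfolding ss by simp
 have m1: "1 <= m" "1 / (p * \<tau>\<^sup>2) <= m" using m(1) by auto
 note boot = arm_bootstrap[OF p \<tau> m1 start]
 define M where "M j = 21 ^ j * m" for j :: nat
 have M: "M j > 0" "M (Suc j) = 21 * M j" for j using m(2) by (auto simp: M_def)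
 define q where "q j = p - p / 2 / 2 ^ j" for j :: nat
 have qp: "q j < p" for j using p by (simp add: q_def)
 define A where "A j i = {z. q j < thr (arm (pt (2 * M j * real i) 0) (M j) (7 * M j)) (%x. - fld z x)}" for j i :: nat
 have iA: "incr {x. mx c x <= 7 * M j} (thr (arm c (M j) (7 * M j)))" for c j using M(1)[of j] by (intro incr_arm) auto
 have A: "A j i \<in> sets PP" "PP.prob (A j i) <= \<tau> / 2 ^ j" for j i
 proof -
  note [measurable] = pr_uminus(2)[OF iA bounded_mx(1)]
  have "{z \<in> space PP. q j < thr (arm (pt (2 * M j * real i) 0) (M j) (7 * M j)) (%x. - fld z x)} \<in> sets PP" by measurable
  then show "A j i \<in> sets PP" by (simp add: A_def)
  have "PP.prob (A j i) = pr (thr (arm 0 (M j) (7 * M j))) (q j)"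
   unfolding A_def pr_uminus(1)[OF iA bounded_mx(1)] using M(1)[of j] by (intro pr_arm_center) auto
  then show "PP.prob (A j i) <= \<tau> / 2 ^ j" using boot[of j] by (simp add: M_def q_def)
 qed
 \<comment> \<open>The hit lies below \<open>168 * M j\<close>, in reach of the lattice points with
   index at most 85, because \<open>2 * 85 - 1 = 169\<close>.\<close>
 define B where "B j = (\<Union>i\<le>85. A j i)" for j
 have B: "B j \<in> sets PP" for j unfolding B_def using A(1) by blast
 have PB: "PP.prob (B j) <= 86 * \<tau> * (1 / 2) ^ j" for j
 proof -
  have "PP.prob (B j) <= (\<Sum>i\<le>85. PP.prob (A j i))"
   unfolding B_def by (intro PP.finite_measure_subadditive_finite) (use A(1) in auto)
  also have "\<dots> <= (\<Sum>i\<le>85::nat. \<tau> / 2 ^ j)" by (intro sum_mono A(2))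
  finally show ?thesis by (simp add: power_one_over)
 qed
 have sg: "summable (%j. 86 * \<tau> * (1 / 2 :: real) ^ j)" by (intro summable_mult summable_geometric) simp
 have sB: "summable (%j. PP.prob (B j))" by (rule summable_comparison_test'[OF sg]) (use PB in simp)
 have "PP.prob (\<Union>j. B j) <= (\<Sum>j. PP.prob (B j))" using B sB by (intro PP.finite_measure_subadditive_countably) auto
 also have "\<dots> <= (\<Sum>j. 86 * \<tau> * (1 / 2) ^ j)" by (rule suminf_le[OF PB sB sg])
 also have "\<dots> = 86 * \<tau> * 2" by (subst suminf_mult) (auto simp: suminf_geometric)
 also have "\<dots> < 1" by (simp add: \<tau>_def)
 finally have lt: "PP.prob (\<Union>j. B j) < 1" .
 have "{z. \<not> perc p (fld z)} \<subseteq> (\<Union>j. B j)"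
 proof clarify
  fix z assume np: "\<not> perc p (fld z)"
  have N: "8 * M 0 > 0" using M(1)[of 0] by simp
  obtain T where T: "compact T" "connected T" "!!x. x \<in> T ==> fld z x < - p"
   "!!S. connected S ==> S \<inter> cball 0 (8 * M 0) ~= {} ==> \<not> bounded S ==> S \<inter> T ~= {}" "T \<inter> cball 0 (8 * M 0) = {}"
   using surrounding_circuit[OF continuous_fld np N] by metis
  obtain t where t: "t > 8 * M 0" "pt (1 * t) 0 \<in> T" using axis_hit[OF T(1,5) N T(4), of 1] by auto
  obtain t' where t': "t' > 8 * M 0" "pt (- 1 * t') 0 \<in> T" using axis_hit[OF T(1,5) N T(4), of "- 1"] by auto
  have "\<exists>n. t < 8 * M n"
  proof -
   obtain n where "t / (8 * m) < 21 ^ n" using real_arch_pow[of 21 "t / (8 * m)"] by auto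
   then show ?thesis using m(2) by (intro exI[of _ n]) (simp add: M_def field_simps)
  qed
  then obtain n where n: "t < 8 * M n" "!!k. k < n ==> \<not> t < 8 * M k" using exists_least_iff[of "%n. t < 8 * M n"] by auto
  then obtain j where j: "n = Suc j" using t(1) by (cases n) auto
  have tj: "8 * M j <= t" "t < 168 * M j" using n[unfolded j] M(2)[of j] by (force simp: not_less)+
  have "\<bar>t\<bar> <= (2 * real 85 - 1) * M j" using tj M(1)[of j] by simp
  then obtain i where i: "\<bar>t - 2 * M j * real_of_int i\<bar> <= M j" "\<bar>i\<bar> <= int 85" using lattice_round[OF M(1)] by blast
  have "0 <= i"
  proof (rule ccontr)
   assume "\<not> 0 <= i"
   then have "2 * M j * real_of_int i <= 0" using M(1)[of j] by (intro mult_nonneg_nonpos) auto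
   then show False using i(1) tj M(1)[of j] by linarith
  qed
  then have ni: "real_of_int i = real (nat i)" "nat i <= 85" using i(2) by auto
  let ?c = "pt (2 * M j * real (nat i)) 0"
  have x: "mx ?c (pt (1 * t) 0) <= M j" using i(1) M(1)[of j] by (simp add: mx_def ni)
  \<comment> \<open>The lattice point has abscissa at least \<open>t - M j \<ge> 7 * M j\<close>,
    and the circuit also meets the negative half axis.\<close>
  have y: "7 * M j <= mx ?c (pt (- 1 * t') 0)"
  proof -
   have "7 * M j <= 2 * M j * real (nat i)" using i(1) tj unfolding ni by linarith
   then show ?thesis using t' M(1)[of 0] by (simp add: mx_def)
  qed
  have Tp: "p <= - fld z x" if "x \<in> T" for x using T(3)[OF that] by linarith
  have "p <= thr (arm ?c (M j) (7 * M j)) (%x. - fld z x)"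
   using M(1)[of j] by (intro arm_thr_ge[OF _ _ _ compact_imp_closed[OF T(1)] T(2) t(2) x t'(2) y Tp] continuous_intros continuous_fld) auto
  then have "z \<in> A j (nat i)" using qp[of j] by (simp add: A_def)
  then show "z \<in> (\<Union>j. B j)" using ni(2) by (auto simp: B_def)
 qed
 then have "PP.prob {z. \<not> perc p (fld z)} <= PP.prob (\<Union>j. B j)" using B by (intro PP.finite_measure_mono) auto
 moreover have "PP.prob {z. \<not> perc p (fld z)} = 1"
 proof -
  have "{z. \<not> perc p (fld z)} = space PP - {z. perc p (fld z)}" by auto
  then show ?thesis using PP.prob_compl[OF sets_perc, of p] null by simp
 qed
 ultimately show False using lt by simp
qed

section \<open>Existence and uniqueness of the unbounded component\<close>

lemma unbounded_components_iff: "unbounded_components (excursion_set g p) ~= {} \<longleftrightarrow> perc p g"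
proof
 assume "unbounded_components (excursion_set g p) ~= {}"
 then obtain C where C: "C \<in> components {x. - p <= g x}" "\<not> bounded C"
  by (auto simp: unbounded_components_def excursion_set_def vimage_def)
 then show "perc p g" unfolding perc_def using in_components_connected in_components_subset by blast
next
 assume "perc p g"
 then obtain S where S: "connected S" "\<not> bounded S" "S \<subseteq> excursion_set g p"
  by (auto simp: perc_def excursion_set_def)
 then obtain x where x: "x \<in> S" by force
 let ?C = "connected_component_set (excursion_set g p) x"
 have "S \<subseteq> ?C" using x S by (intro connected_component_maximal)
 then have "\<not> bounded ?C" using S(2) bounded_subset by blast
 moreover have "?C \<in> components (excursion_set g p)" using x S(3) by (auto simp: components_def)
 ultimately show "unbounded_components (excursion_set g p) ~= {}" by (auto simp: unbounded_components_def)
qed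

lemma unbounded_components_unique:
 assumes g: "continuous_on UNIV g" and p: "p > 0" and np: "\<not> perc (- p / 2) (%x. - g x)"
  and C: "C \<in> unbounded_components (excursion_set g p)" "C' \<in> unbounded_components (excursion_set g p)"
 shows "C = C'"
proof -
 let ?D = "excursion_set g p"
 have cc: "C \<in> components ?D" "\<not> bounded C" "C' \<in> components ?D" "\<not> bounded C'"
  using C by (auto simp: unbounded_components_def)
 obtain x y where xy: "x \<in> C" "y \<in> C'" using in_components_nonempty cc(1,3) by blast
 define N where "N = max 1 (max (norm x) (norm y))"
 have gc: "continuous_on UNIV (%x. - g x)" using g by (intro continuous_intros)
 have N: "N > 0" by (simp add: N_def)
 obtain T where T: "compact T" "connected T" "!!x. x \<in> T ==> - g x < - (- p / 2)"
  "!!S. connected S ==> S \<inter> cball 0 N ~= {} ==> \<not> bounded S ==> S \<inter> T ~= {}"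
  using surrounding_circuit[OF gc np N] by metis
 have "x \<in> cball 0 N" "y \<in> cball 0 N" by (auto simp: N_def)
 then have meet: "C \<inter> T ~= {}" "C' \<inter> T ~= {}"
  using T(4)[of C] T(4)[of C'] xy cc in_components_connected by blast+
 have "T \<subseteq> ?D"
 proof
  fix x assume "x \<in> T"
  then show "x \<in> ?D" using T(3)[of x] p by (auto simp: excursion_set_def)
 qed
 then have "T \<subseteq> C" "T \<subseteq> C'" using components_maximal[OF cc(1) T(2)] components_maximal[OF cc(3) T(2)] meet by auto
 then have "C \<inter> C' ~= {}" using meet by blast
 then show ?thesis using components_eq[OF cc(1,3)] by blast
qed

text \<open>Percolation of \<open>- f\<close> above \<open>p / 2\<close> makes the levels of all its
  arms strictly positive. That event is expressed by threshold functionals of \<open>- f\<close>,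
  whose laws are those of \<open>f\<close>, and so it is compared with percolation of
  \<open>f\<close> at level 0.\<close>

lemma AE_no_dual_percolation:
 assumes p: "p > 0"
 shows "AE z in PP. \<not> perc (- p / 2) (%x. - fld z x)"
proof -
 have "AE z in PP. \<not> perc_from (real n) (- p / 2) (%x. - fld z x)" for n
 proof -
  let ?A = "%k. {z. 0 < thr (arm 0 (real n) (real n + real k)) (%x. - fld z x)}"
  have iA: "incr {x. mx 0 x <= real n + real k} (thr (arm 0 (real n) (real n + real k)))" for k by (intro incr_arm) auto
  have A: "?A k \<in> sets PP" for k
  proof -
   note [measurable] = pr_uminus(2)[OF iA bounded_mx(1)]
   have "{z \<in> space PP. 0 < thr (arm 0 (real n) (real n + real k)) (%x. - fld z x)} \<in> sets PP" by measurable
   then show ?thesis by simp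
  qed
  have AI: "(\<Inter>k. ?A k) \<in> sets PP" using A by (intro sets.countable_INT) auto
  have "PP.prob (\<Inter>k. ?A k) <= pr (thr (arm 0 (real n) (real n + real k))) (- 0)" for k
   unfolding minus_zero pr_uminus(1)[OF iA bounded_mx(1), symmetric] using A by (intro PP.finite_measure_mono) auto
  then have "PP.prob (\<Inter>k. ?A k) <= PP.prob {z. perc_from (real n) 0 (fld z)}"
   by (intro tendsto_lowerbound[OF perc_from_tendsto]) auto
  also have "\<dots> <= PP.prob {z. perc 0 (fld z)}"
   using sets_perc[of 0] by (intro PP.finite_measure_mono) (auto simp: perc_from_def perc_def)
  finally have "PP.prob (\<Inter>k. ?A k) = 0" by (simp add: no_percolation_at_zero measure_le_0_iff)
  then have null: "(\<Inter>k. ?A k) \<in> null_sets PP" using AI by (auto simp: null_sets_def PP.emeasure_eq_measure)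
  have c: "continuous_on UNIV (%x. - fld z x)" for z by (intro continuous_intros continuous_fld)
  have sub: "{z \<in> space PP. \<not> \<not> perc_from (real n) (- p / 2) (%x. - fld z x)} \<subseteq> (\<Inter>k. ?A k)"
  proof (intro subsetI INT_I CollectI)
   fix z k assume "z \<in> {z \<in> space PP. \<not> \<not> perc_from (real n) (- p / 2) (%x. - fld z x)}"
   then have "- (- p / 2) <= thr (arm 0 (real n) (real n + real k)) (%x. - fld z x)"
    using perc_from_iff[OF c, of "real n"] by simp
   then show "0 < thr (arm 0 (real n) (real n + real k)) (%x. - fld z x)" using p by linarith
  qed
  show ?thesis by (rule AE_I'[OF null sub])
 qed
 then show ?thesis by (simp add: perc_iff AE_all_countable)
qed

lemma bargmann_fock_eq_fld:
 assumes "good (%(i, j). a i j \<omega>)"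
 shows "bargmann_fock a \<omega> = fld (%(i, j). a i j \<omega>)"
proof
 fix x
 have "fld (%(i, j). a i j \<omega>) x = (\<Sum>\<^sub>\<infinity>n. exp (- (1 / 2) * (norm x)\<^sup>2) *
   (%(i, j). a i j \<omega> * ((x $ 1) ^ i * (x $ 2) ^ j / sqrt (fact i * fact j))) n)"
  unfolding fld_def basis_def using assms by (simp, intro infsum_cong) (auto simp: case_prod_beta)
 then show "bargmann_fock a \<omega> x = fld (%(i, j). a i j \<omega>) x"
  unfolding bargmann_fock_def by (simp only: infsum_cmult_right')
qed

text \<open>Independence and the normal marginals identify the joint law of the coefficients, so
  almost sure statements and probabilities transfer from the canonical product space.\<close>

lemma coefficients_distr:
 assumes M: "prob_space M" and ind: "prob_space.indep_vars M (%_. borel) (%(i, j). a i j) UNIV"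
  and d: "!!i j. distributed M lborel (a i j) (normal_density 0 1)"
 shows "(%\<omega> (i, j). a i j \<omega>) \<in> M \<rightarrow>\<^sub>M PP" "distr M PP (%\<omega> (i, j). a i j \<omega>) = PP"
proof -
 interpret prob_space M by fact
 let ?X = "%(i, j). a i j"
 have X: "?X n \<in> borel_measurable M" for n
  using distributed_measurable[OF d, of "fst n" "snd n"] by (simp add: case_prod_beta)
 have DX: "distr M borel (?X n) = N1" for n
 proof -
  have "distr M borel (?X n) = distr M lborel (a (fst n) (snd n))" by (rule distr_cong) (auto simp: case_prod_beta)
  then show ?thesis using distributed_distr_eq_density[OF d] by simp
 qed
 have eq: "(%\<omega> (i, j). a i j \<omega>) = (%\<omega>. \<lambda>n\<in>UNIV. ?X n \<omega>)" by (auto simp: fun_eq_iff)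
 show m: "(%\<omega> (i, j). a i j \<omega>) \<in> M \<rightarrow>\<^sub>M PP"
  unfolding eq measurable_cong_sets[OF refl sets_PP] using X by (intro measurable_restrict)
 have "distr M PP (%\<omega> (i, j). a i j \<omega>) = distr M (PiM UNIV (%_. borel)) (%\<omega>. \<lambda>n\<in>UNIV. ?X n \<omega>)"
  unfolding eq by (rule distr_cong) (simp_all add: sets_PP)
 also have "\<dots> = PiM UNIV (%n. distr M borel (?X n))"
  using ind indep_vars_iff_distr_eq_PiM'[where I = UNIV and M' = "%_. borel" and X = ?X] X by simp
 finally show "distr M PP (%\<omega> (i, j). a i j \<omega>) = PP" unfolding DX PP_def .
qed

theorem theorem1p3:
  fixes M :: "'w measure"
    and a :: "nat \<Rightarrow> nat \<Rightarrow> 'w \<Rightarrow> real"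
    and p :: real
  assumes "prob_space M"
    and "prob_space.indep_vars M (\<lambda>_. borel) (\<lambda>(i, j). a i j) UNIV"
    and "\<And>i j. distributed M lborel (a i j) (normal_density 0 1)"
  defines "D \<equiv> \<lambda>\<omega>. excursion_set (bargmann_fock a \<omega>) p"
  shows "{\<omega> \<in> space M. unbounded_components (D \<omega>) \<noteq> {}} \<in> sets (completion M) \<and>
         measure (completion M) {\<omega> \<in> space M. unbounded_components (D \<omega>) \<noteq> {}}
           = (if p > 0 then 1 else 0) \<and>
         (AE \<omega> in M. \<forall>C\<in>unbounded_components (D \<omega>).
            \<forall>C'\<in>unbounded_components (D \<omega>). C = C')"
proof -
 interpret prob_space M by fact
 define Z where "Z = (%\<omega> (i, j). a i j \<omega>)"
 note Z = coefficients_distr[OF assms(1-3), folded Z_def]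
 have AEZ: "AE \<omega> in M. P (Z \<omega>)" if "AE z in PP. P z" for P
  using AE_distrD[OF Z(1), of P] that unfolding Z(2) by simp
 have D: "unbounded_components (D \<omega>) ~= {} \<longleftrightarrow> perc p (fld (Z \<omega>))"
  "D \<omega> = excursion_set (fld (Z \<omega>)) p" if "good (Z \<omega>)" for \<omega>
 proof -
  have "bargmann_fock a \<omega> = fld (Z \<omega>)" using bargmann_fock_eq_fld[of a \<omega>] that by (simp add: Z_def)
  then show "D \<omega> = excursion_set (fld (Z \<omega>)) p" by (simp add: D_def)
  then show "unbounded_components (D \<omega>) ~= {} \<longleftrightarrow> perc p (fld (Z \<omega>))" by (simp add: unbounded_components_iff)
 qed
 define v :: real where "v = (if p > 0 then 1 else 0)"
 have pv: "PP.prob {z. perc p (fld z)} = v"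
 proof (cases "p > 0")
  case True
  then show ?thesis using percolation_positive_level[OF True] by (simp add: v_def)
 next
  case False
  then have "{x. - p <= g x} \<subseteq> {x. - 0 <= g x}" for g :: "real ^ 2 => real" by auto
  then have "perc 0 g" if "perc p g" for g using that unfolding perc_def by (meson order_trans)
  then have "PP.prob {z. perc p (fld z)} <= PP.prob {z. perc 0 (fld z)}"
   using sets_perc by (intro PP.finite_measure_mono) auto
  then show ?thesis using False by (simp add: no_percolation_at_zero v_def measure_le_0_iff)
 qed
 let ?E = "{\<omega> \<in> space M. unbounded_components (D \<omega>) ~= {}}"
 let ?F = "Z -` {z. perc p (fld z)} \<inter> space M"
 let ?G = "Z -` {z. good z} \<inter> space M"
 have F: "?F \<in> sets M" and G: "?G \<in> sets M"
  using measurable_sets[OF Z(1) sets_perc] measurable_sets[OF Z(1) sets_good(1)] by blast+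
 have PF: "prob ?F = v"
  using measure_distr[OF Z(1), of "{z. perc p (fld z)}"] sets_perc pv unfolding Z(2) by simp
 have AEG: "AE \<omega> in M. good (Z \<omega>)" by (rule AEZ[OF AE_good])
 have "{\<omega> \<in> space M. \<not> good (Z \<omega>)} = space M - ?G" by auto
 then have null: "space M - ?G \<in> null_sets M"
  using AE_iff_null[of M "%\<omega>. good (Z \<omega>)"] AEG G by auto
 \<comment> \<open>The event agrees on \<open>?G\<close> with the measurable set \<open>?F\<close>;
   on the null remainder, where the series may diverge, its measurability is not known, hence the
   completion.\<close>
 have Es: "?E \<in> sets (completion M)"
  by (rule sets_completionI[of _ "?F \<inter> ?G" "?E - ?G" "space M - ?G"]) (use D(1) null F G in auto)
 have "measure (completion M) ?E = measure (completion M) ?F"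
 proof (rule measure_eq_AE)
  show "AE \<omega> in completion M. (\<omega> \<in> ?E) = (\<omega> \<in> ?F)"
   by (rule AE_completion, rule AE_mp[OF AEG]) (auto intro!: AE_I2 simp: D(1))
 qed (use Es F in auto)
 then have "measure (completion M) ?E = v" using F PF by (simp add: measure_completion)
 moreover have "AE \<omega> in M. \<forall>C\<in>unbounded_components (D \<omega>). \<forall>C'\<in>unbounded_components (D \<omega>). C = C'"
 proof (cases "p > 0")
  case True
  show ?thesis
   using AEG AEZ[OF AE_no_dual_percolation[OF True]]
  proof eventually_elim
   case (elim \<omega>)
   show ?case unfolding D(2)[OF elim(1)] using unbounded_components_unique[OF continuous_fld True elim(2)] by blast
  qed
 next
  case False
  have "AE z in PP. \<not> perc p (fld z)"
   using pv False sets_perc by (intro AE_I[of _ _ "{z. perc p (fld z)}"]) (auto simp: v_def PP.emeasure_eq_measure)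
  from AEG AEZ[OF this] show ?thesis by eventually_elim (use D(1) in blast)
 qed
 ultimately show ?thesis using Es by (simp add: v_def)
qed

end
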